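(* Let $(M,m,u)$ be a naturally Frobenius map monoidale in a monoidal bicategory $\mathcal B$, and let $(a,(\mu,\eta),(\delta,\varepsilon),\sigma)$ be a Hopf monoid in the duoidal category $(\mathcal B(M,M),\bullet,\circ)$. The following assertions are equivalent. (i) $(a,\delta,\varepsilon)$ is a coseparable comonoid in $(\mathcal B(M,M),\circ,i)$. (ii) There exists a normalized left cointegral $a\circ j\to j$. (iii) There exists a normalized right cointegral $j\circ a\to j$. (iv) The forgetful functor $\mathcal B(M,M)^{a\circ-\circ j}\to\mathcal B(M,M)^{-\circ j}$ is separable. (v) The forgetful functor $\mathcal B(M,M)^{j\circ-\circ a}\to\mathcal B(M,M)^{j\circ-}$ is separable. (vi) The forgetful functor $\mathcal B(M,M)^{a\circ-\circ j}\to\mathcal B(M,M)^{-\circ j}$ reflects split monomorphisms. (vii) The forgetful functor $\mathcal B(M,M)^{j\circ-\circ a}\to\mathcal B(M,M)^{j\circ-}$ reflects split monomorphisms.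
   Context: Conventions. $\mathcal B$ is a monoidal bicategory, treated (by coherence) as a Gray monoid; its monoidal product is denoted by juxtaposition, its unit by $I$, and horizontal composition by $g.f$ (first $f$, then $g$). Identity 1-cells are denoted $1$. Coherence isomorphisms, including interchange and associativity/unitality isomorphisms, are denoted $\cong$ or suppressed. Composition of morphisms (2-cells) in hom categories is written $\beta\cdot\alpha$ (first $\alpha$). Naturally Frobenius map monoidale. A monoidale is a pseudo-monoid $(M,m:MM\to M,u:I\to M)$ in $\mathcal B$. It is a map monoidale if $m,u$ have right adjoints $m^*,u^*$, with units $\eta_m:1\to m^*.m$, $\eta_u:1\to u^*.u$ and counits $\varepsilon_m:m.m^*\to 1$, $\varepsilon_u:u.u^*\to1$. Then $(M,m^*,u^* )$ is a pseudo-comonoid via mates; in particular $(u^*1).m^*\cong 1\cong(1u^* ).m^*$. It is naturally Frobenius if the 2-cells $\pi:(m1).(1m^* )\xrightarrow{\eta_m} m^*.m.(m1).(1m^* )\cong m^*.m.(1m).(1m^* )\xrightarrow{1\varepsilon_m} m^*.m$ and $\pi':(1m).(m^*1)\xrightarrow{\eta_m} m^*.m.(1m).(m^*1)\cong m^*.m.(m1).(m^*1)\xrightarrow{\varepsilon_m1} m^*.m$ are invertible. Duoidal structure on $\mathcal B(M,M)$. For $f,g:M\to M$: $f\circ g:=g.f$ with unit $i:=1_M$; $f\bullet g:=m.(fg).m^*$ with unit $j:=u.u^*$. Structure morphisms: $\xi_0=\varepsilon_m:i\bullet i\to i$; $\xi^0_0=\varepsilon_u:j\to i$; $\xi^0=u.\eta_u.u^*:j\to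 j\circ j$; and $\xi:(a\circ b)\bullet(c\circ d)\cong m.(bd).(ac).m^*\to m.(bd).m^*.m.(ac).m^*=(a\bullet c)\circ(b\bullet d)$ obtained by inserting $\eta_m$. Monoidal coherence isomorphisms of $\circ$ and $\bullet$ are suppressed. Thus $(j,\xi^0,\xi^0_0)$ is a $\circ$-comonoid. Bimonoid. An object $a$ with a $\bullet$-monoid structure $\mu:a\bullet a\to a$, $\eta:j\to a$ and a $\circ$-comonoid structure $\delta:a\to a\circ a$, $\varepsilon:a\to i$ such that $\delta\cdot\mu=(\mu\circ\mu)\cdot\xi\cdot(\delta\bullet\delta)$, $\varepsilon\cdot\mu=\xi_0\cdot(\varepsilon\bullet\varepsilon)$, $\delta\cdot\eta=(\eta\circ\eta)\cdot\xi^0$, $\varepsilon\cdot\eta=\xi^0_0$. Hopf monoid. For $b:M\to M$ put $b^-:=(u^*1).(m1).(1b1).(1m^* ).(1u)$. Let $\alpha: u^*1\xrightarrow{\eta_m}(u^*1).m^*.m\cong m$ and $\beta:1u\xrightarrow{\eta_m} m^*.m.(1u)\cong m^*$. For $b,c:M\to M$ let $\varphi_{b,c}: b\circ c^-\cong (u^*1).(m1).(bc1).(1m^* ).(1u)\xrightarrow{\beta}(u^*1).(m1).(bc1).(1m^* ).m^*\cong(u^*1).(m1).(bc1).(m^*1).m^*\cong[(b\bullet c)\circ j]\bullet i$, $\psi_{b,c}: b^-\circ c\cong (u^*1).(m1).(1bc).(1m^* ).(1u)\xrightarrow{\alpha} m.(m1).(1bc).(1m^* ).(1u)\cong m.(1m).(1bc).(1m^*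 ).(1u)\cong i\bullet[j\circ(b\bullet c)]$. A Hopf monoid in $\mathcal B(M,M)$ is a bimonoid $a$ (equivalently, a monoidal comonad on $M$) with a morphism $\sigma:a\to a^-$ (the antipode) such that $[(\mu\circ1)\bullet1]\cdot\varphi_{a,a}\cdot(1\circ\sigma)\cdot\delta=[((\eta\circ1)\cdot\xi^0)\bullet1]\cdot\varepsilon: a\to(a\circ j)\bullet i$ and $[1\bullet(1\circ\mu)]\cdot\psi_{a,a}\cdot(\sigma\circ1)\cdot\delta=[1\bullet(1\circ\eta)\cdot\xi^0]\cdot\varepsilon:a\to i\bullet(j\circ a)$, where $i=j\bullet i=i\bullet j$. Coseparable comonoid. A comonoid $(a,\delta,\varepsilon)$ in a monoidal category is coseparable if $\delta$ admits a retraction that is a morphism of $a$-bicomodules. Cointegrals. A left cointegral is a left $a$-comodule and right $j$-comodule morphism $\theta:a\circ j\to j$: $(1\circ\theta)\cdot(\delta\circ1)=(\eta\circ1)\cdot\xi^0\cdot\theta$ and $(\theta\circ1)\cdot(1\circ\xi^0)=\xi^0\cdot\theta$. It is normalized if $\theta\cdot(\eta\circ1)\cdot\xi^0=1_j$. A right cointegral is a right $a$-comodule and left $j$-comodule morphism $\theta:j\circ a\to j$: $(\theta\circ1)\cdot(1\circ\delta)=(1\circ\eta)\cdot\xi^0\cdot\theta$ and $(1\circ\theta)\cdot(\xi^0\circ1)=\xi^0\cdot\theta$. It is normalized if $\theta\cdot(1\circ\eta)\cdot\xi^0=1_j$. Comodule categories. $\mathcal B(M,M)^{j\circ-}$ and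 $\mathcal B(M,M)^{-\circ j}$ are the categories of left, respectively right, comodules of the $\circ$-comonoid $j$ (Eilenberg–Moore coalgebras of the comonads $j\circ-$, $-\circ j$). $\mathcal B(M,M)^{a\circ-\circ j}$ is the category of (left $a$, right $j$)-bicomodules and $\mathcal B(M,M)^{j\circ-\circ a}$ that of (left $j$, right $a$)-bicomodules. The forgetful functors forget the $a$-coaction. Functors. A functor $F:\mathsf X\to\mathsf Y$ is separable if the natural transformation $\mathsf X(-,-)\to\mathsf Y(F-,F-)$, $f\mapsto Ff$, has a natural retraction. $F$ reflects split monomorphisms if $f$ is a split monomorphism whenever $Ff$ is. *)

theory Defs
  imports Main
begin

section \<open>Strict 2-categories\<close>

text \<open>
  \<open>g \<odot> f\<close> is composition of 1-cells (first \<open>f\<close>), \<open>\<beta> \<cdot> \<alpha>\<close> vertical composition (first \<open>\<alpha>\<close>) and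
  \<open>\<beta> \<star> \<alpha>\<close> horizontal composition of 2-cells, in the same order as \<open>\<odot>\<close>.
\<close>

record ('o, 'a, 'c) two_cat =
  cells0 :: "'o set"
  cells1 :: "'a set"
  cells2 :: "'c set"
  src1 :: "'a \<Rightarrow> 'o"
  trg1 :: "'a \<Rightarrow> 'o"
  src2 :: "'c \<Rightarrow> 'a"
  trg2 :: "'c \<Rightarrow> 'a"
  id1 :: "'o \<Rightarrow> 'a" ("\<one>\<^sub>1\<index>")
  id2 :: "'a \<Rightarrow> 'c" ("\<one>\<^sub>2\<index>")
  comp1 :: "'a \<Rightarrow> 'a \<Rightarrow> 'a" (infixr "\<odot>\<index>" 75)
  vcomp :: "'c \<Rightarrow> 'c \<Rightarrow> 'c" (infixr "\<cdot>\<index>" 65)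
  hcomp :: "'c \<Rightarrow> 'c \<Rightarrow> 'c" (infixr "\<star>\<index>" 74)

definition hom1 :: "('o, 'a, 'c, 'x) two_cat_scheme \<Rightarrow> 'o \<Rightarrow> 'o \<Rightarrow> 'a set" where
  "hom1 B X Y = {f \<in> cells1 B. src1 B f = X \<and> trg1 B f = Y}"

definition hom2 :: "('o, 'a, 'c, 'x) two_cat_scheme \<Rightarrow> 'a \<Rightarrow> 'a \<Rightarrow> 'c set" where
  "hom2 B f g = {\<alpha> \<in> cells2 B. src2 B \<alpha> = f \<and> trg2 B \<alpha> = g}"

definition whisker_left :: "('o, 'a, 'c, 'x) two_cat_scheme \<Rightarrow> 'a \<Rightarrow> 'c \<Rightarrow> 'c"
    (infixr "\<rhd>\<index>" 72) where
  "g \<rhd>\<^bsub>B\<^esub> \<alpha> = \<one>\<^sub>2\<^bsub>B\<^esub> g \<star>\<^bsub>B\<^esub> \<alpha>"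

definition whisker_right :: "('o, 'a, 'c, 'x) two_cat_scheme \<Rightarrow> 'c \<Rightarrow> 'a \<Rightarrow> 'c"
    (infixl "\<lhd>\<index>" 73) where
  "\<alpha> \<lhd>\<^bsub>B\<^esub> f = \<alpha> \<star>\<^bsub>B\<^esub> \<one>\<^sub>2\<^bsub>B\<^esub> f"

locale two_category =
  fixes B :: "('o, 'a, 'c, 'x) two_cat_scheme" (structure)
  assumes cells1_ends: "f \<in> cells1 B \<Longrightarrow> src1 B f \<in> cells0 B \<and> trg1 B f \<in> cells0 B"
    and id1_hom: "X \<in> cells0 B \<Longrightarrow> \<one>\<^sub>1 X \<in> hom1 B X X"
    and comp1_hom: "\<lbrakk>f \<in> hom1 B X Y; g \<in> hom1 B Y Z\<rbrakk> \<Longrightarrow> g \<odot> f \<in> hom1 B X Z"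
    and comp1_assoc: "\<lbrakk>f \<in> hom1 B X Y; g \<in> hom1 B Y Z; h \<in> hom1 B Z W\<rbrakk>
      \<Longrightarrow> (h \<odot> g) \<odot> f = h \<odot> (g \<odot> f)"
    and comp1_id_left: "f \<in> hom1 B X Y \<Longrightarrow> \<one>\<^sub>1 Y \<odot> f = f"
    and comp1_id_right: "f \<in> hom1 B X Y \<Longrightarrow> f \<odot> \<one>\<^sub>1 X = f"
    and cells2_ends: "\<alpha> \<in> cells2 B \<Longrightarrow> src2 B \<alpha> \<in> cells1 B \<and> trg2 B \<alpha> \<in> cells1 B"
    and cells2_parallel: "\<alpha> \<in> cells2 B \<Longrightarrow>
      src1 B (src2 B \<alpha>) = src1 B (trg2 B \<alpha>) \<and> trg1 B (src2 B \<alpha>) = trg1 B (trg2 B \<alpha>)"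
    and id2_hom: "f \<in> cells1 B \<Longrightarrow> \<one>\<^sub>2 f \<in> hom2 B f f"
    and vcomp_hom: "\<lbrakk>\<alpha> \<in> hom2 B f g; \<beta> \<in> hom2 B g h\<rbrakk> \<Longrightarrow> \<beta> \<cdot> \<alpha> \<in> hom2 B f h"
    and vcomp_assoc: "\<lbrakk>\<alpha> \<in> hom2 B f g; \<beta> \<in> hom2 B g h; \<gamma> \<in> hom2 B h k\<rbrakk>
      \<Longrightarrow> (\<gamma> \<cdot> \<beta>) \<cdot> \<alpha> = \<gamma> \<cdot> (\<beta> \<cdot> \<alpha>)"
    and vcomp_id_left: "\<alpha> \<in> hom2 B f g \<Longrightarrow> \<one>\<^sub>2 g \<cdot> \<alpha> = \<alpha>"
    and vcomp_id_right: "\<alpha> \<in> hom2 B f g \<Longrightarrow> \<alpha> \<cdot> \<one>\<^sub>2 f = \<alpha>"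
    and hcomp_hom: "\<lbrakk>\<alpha> \<in> hom2 B f f'; \<beta> \<in> hom2 B g g'; f \<in> hom1 B X Y; g \<in> hom1 B Y Z\<rbrakk>
      \<Longrightarrow> \<beta> \<star> \<alpha> \<in> hom2 B (g \<odot> f) (g' \<odot> f')"
    and hcomp_assoc: "\<lbrakk>\<alpha> \<in> hom2 B f f'; \<beta> \<in> hom2 B g g'; \<gamma> \<in> hom2 B h h';
        f \<in> hom1 B X Y; g \<in> hom1 B Y Z; h \<in> hom1 B Z W\<rbrakk>
      \<Longrightarrow> (\<gamma> \<star> \<beta>) \<star> \<alpha> = \<gamma> \<star> (\<beta> \<star> \<alpha>)"
    and hcomp_id_left: "\<lbrakk>\<alpha> \<in> hom2 B f f'; f \<in> hom1 B X Y\<rbrakk> \<Longrightarrow> \<one>\<^sub>2 (\<one>\<^sub>1 Y) \<star> \<alpha> = \<alpha>"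
    and hcomp_id_right: "\<lbrakk>\<alpha> \<in> hom2 B f f'; f \<in> hom1 B X Y\<rbrakk> \<Longrightarrow> \<alpha> \<star> \<one>\<^sub>2 (\<one>\<^sub>1 X) = \<alpha>"
    and hcomp_id2: "\<lbrakk>f \<in> hom1 B X Y; g \<in> hom1 B Y Z\<rbrakk> \<Longrightarrow> \<one>\<^sub>2 g \<star> \<one>\<^sub>2 f = \<one>\<^sub>2 (g \<odot> f)"
    and interchange: "\<lbrakk>\<alpha> \<in> hom2 B f f'; \<alpha>' \<in> hom2 B f' f''; \<beta> \<in> hom2 B g g'; \<beta>' \<in> hom2 B g' g'';
        f \<in> hom1 B X Y; g \<in> hom1 B Y Z\<rbrakk>
      \<Longrightarrow> (\<beta>' \<cdot> \<beta>) \<star> (\<alpha>' \<cdot> \<alpha>) = (\<beta>' \<star> \<alpha>') \<cdot> (\<beta> \<star> \<alpha>)"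

context
  fixes B :: "('o, 'a, 'c, 'x) two_cat_scheme" (structure)
begin

definition inverse2 :: "'c \<Rightarrow> 'c \<Rightarrow> bool" where
  "inverse2 \<alpha> \<beta> \<longleftrightarrow> \<alpha> \<in> cells2 B \<and> \<beta> \<in> hom2 B (trg2 B \<alpha>) (src2 B \<alpha>) \<and>
     \<beta> \<cdot> \<alpha> = \<one>\<^sub>2 (src2 B \<alpha>) \<and> \<alpha> \<cdot> \<beta> = \<one>\<^sub>2 (trg2 B \<alpha>)"

definition invertible2 :: "'c \<Rightarrow> bool" where
  "invertible2 \<alpha> \<longleftrightarrow> (\<exists>\<beta>. inverse2 \<alpha> \<beta>)"

definition inv2 :: "'c \<Rightarrow> 'c" where
  "inv2 \<alpha> = (THE \<beta>. inverse2 \<alpha> \<beta>)"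

definition strict_endo_2_functor :: "('o \<Rightarrow> 'o) \<Rightarrow> ('a \<Rightarrow> 'a) \<Rightarrow> ('c \<Rightarrow> 'c) \<Rightarrow> bool" where
  "strict_endo_2_functor F0 F1 F2 \<longleftrightarrow>
     (\<forall>X \<in> cells0 B. F0 X \<in> cells0 B \<and> F1 (\<one>\<^sub>1 X) = \<one>\<^sub>1 (F0 X)) \<and>
     (\<forall>f \<in> cells1 B. F1 f \<in> hom1 B (F0 (src1 B f)) (F0 (trg1 B f)) \<and> F2 (\<one>\<^sub>2 f) = \<one>\<^sub>2 (F1 f)) \<and>
     (\<forall>f \<in> cells1 B. \<forall>g \<in> cells1 B. trg1 B f = src1 B g \<longrightarrow> F1 (g \<odot> f) = F1 g \<odot> F1 f) \<and>
     (\<forall>\<alpha> \<in> cells2 B. F2 \<alpha> \<in> hom2 B (F1 (src2 B \<alpha>)) (F1 (trg2 B \<alpha>))) \<and>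
     (\<forall>\<alpha> \<in> cells2 B. \<forall>\<beta> \<in> cells2 B. trg2 B \<alpha> = src2 B \<beta> \<longrightarrow> F2 (\<beta> \<cdot> \<alpha>) = F2 \<beta> \<cdot> F2 \<alpha>) \<and>
     (\<forall>\<alpha> \<in> cells2 B. \<forall>\<beta> \<in> cells2 B. trg1 B (src2 B \<alpha>) = src1 B (src2 B \<beta>) \<longrightarrow>
        F2 (\<beta> \<star> \<alpha>) = F2 \<beta> \<star> F2 \<alpha>)"

text \<open>\<open>adjunction f r \<eta> \<epsilon>\<close>: \<open>r\<close> is right adjoint to \<open>f\<close>, with unit \<open>\<eta>\<close> and counit \<open>\<epsilon>\<close>.\<close>

definition adjunction :: "'a \<Rightarrow> 'a \<Rightarrow> 'c \<Rightarrow> 'c \<Rightarrow> bool" where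
  "adjunction f r \<eta> \<epsilon> \<longleftrightarrow>
     f \<in> cells1 B \<and> r \<in> hom1 B (trg1 B f) (src1 B f) \<and>
     \<eta> \<in> hom2 B (\<one>\<^sub>1 (src1 B f)) (r \<odot> f) \<and> \<epsilon> \<in> hom2 B (f \<odot> r) (\<one>\<^sub>1 (trg1 B f)) \<and>
     (\<epsilon> \<lhd> f) \<cdot> (f \<rhd> \<eta>) = \<one>\<^sub>2 f \<and> (r \<rhd> \<epsilon>) \<cdot> (\<eta> \<lhd> r) = \<one>\<^sub>2 r"

text \<open>Unit and counit of the composite of the adjunctions \<open>f \<stileturn> r\<close> and \<open>g \<stileturn> s\<close>, with right adjoint \<open>r \<odot> s\<close>
  to \<open>g \<odot> f\<close>.\<close>

definition comp_unit :: "'a \<Rightarrow> 'a \<Rightarrow> 'c \<Rightarrow> 'c \<Rightarrow> 'c" where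
  "comp_unit f r \<eta>f \<eta>g = (r \<rhd> \<eta>g \<lhd> f) \<cdot> \<eta>f"

definition comp_counit :: "'a \<Rightarrow> 'a \<Rightarrow> 'c \<Rightarrow> 'c \<Rightarrow> 'c" where
  "comp_counit g s \<epsilon>f \<epsilon>g = \<epsilon>g \<cdot> (g \<rhd> \<epsilon>f \<lhd> s)"

text \<open>For \<open>f \<stileturn> r\<close> with unit \<open>\<eta>\<close> and \<open>f' \<stileturn> r'\<close> with counit \<open>\<epsilon>'\<close>, the mate of \<open>\<theta> : f \<Rightarrow> f'\<close>
  is a 2-cell \<open>r' \<Rightarrow> r\<close>.\<close>

definition mate :: "'a \<Rightarrow> 'c \<Rightarrow> 'a \<Rightarrow> 'c \<Rightarrow> 'c \<Rightarrow> 'c" where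
  "mate r \<eta> r' \<epsilon>' \<theta> = (r \<rhd> \<epsilon>') \<cdot> (r \<rhd> \<theta> \<lhd> r') \<cdot> (\<eta> \<lhd> r')"

end


section \<open>Gray monoids\<close>

text \<open>
  A monoid in the monoidal category of 2-categories and strict 2-functors with the Gray tensor
  product, that is, a one-object Gray-category: strict 2-functors \<open>X \<ltimes> -\<close> and \<open>- \<rtimes> Y\<close> that agree
  on objects, together with invertible interchange 2-cells
  \<open>\<Sigma> f g : (f \<rtimes> Y') \<odot> (X \<ltimes> g) \<Rightarrow> (X' \<ltimes> g) \<odot> (f \<rtimes> Y)\<close> for \<open>f : X \<rightarrow> X'\<close> and \<open>g : Y \<rightarrow> Y'\<close>.
\<close>

record ('o, 'a, 'c) gray_mon = "('o, 'a, 'c) two_cat" +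
  tunit :: "'o" ("\<I>\<index>")
  tens0 :: "'o \<Rightarrow> 'o \<Rightarrow> 'o" (infixr "\<otimes>\<^sub>0\<index>" 80)
  ltens1 :: "'o \<Rightarrow> 'a \<Rightarrow> 'a" (infixr "\<ltimes>\<^sub>1\<index>" 79)
  rtens1 :: "'a \<Rightarrow> 'o \<Rightarrow> 'a" (infixl "\<rtimes>\<^sub>1\<index>" 79)
  ltens2 :: "'o \<Rightarrow> 'c \<Rightarrow> 'c" (infixr "\<ltimes>\<^sub>2\<index>" 79)
  rtens2 :: "'c \<Rightarrow> 'o \<Rightarrow> 'c" (infixl "\<rtimes>\<^sub>2\<index>" 79)
  interchanger :: "'a \<Rightarrow> 'a \<Rightarrow> 'c" ("\<Sigma>\<index>")

locale gray_monoid = two_category B for B :: "('o, 'a, 'c, 'x) gray_mon_scheme" (structure) +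
  assumes tunit_obj: "\<I> \<in> cells0 B"
    and ltens_2_functor: "X \<in> cells0 B \<Longrightarrow>
      strict_endo_2_functor B (\<lambda>Y. X \<otimes>\<^sub>0 Y) (\<lambda>f. X \<ltimes>\<^sub>1 f) (\<lambda>\<alpha>. X \<ltimes>\<^sub>2 \<alpha>)"
    and rtens_2_functor: "X \<in> cells0 B \<Longrightarrow>
      strict_endo_2_functor B (\<lambda>Y. Y \<otimes>\<^sub>0 X) (\<lambda>f. f \<rtimes>\<^sub>1 X) (\<lambda>\<alpha>. \<alpha> \<rtimes>\<^sub>2 X)"
    and tens0_unit: "X \<in> cells0 B \<Longrightarrow> \<I> \<otimes>\<^sub>0 X = X \<and> X \<otimes>\<^sub>0 \<I> = X"
    and tens1_unit: "f \<in> cells1 B \<Longrightarrow> \<I> \<ltimes>\<^sub>1 f = f \<and> f \<rtimes>\<^sub>1 \<I> = f"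
    and tens2_unit: "\<alpha> \<in> cells2 B \<Longrightarrow> \<I> \<ltimes>\<^sub>2 \<alpha> = \<alpha> \<and> \<alpha> \<rtimes>\<^sub>2 \<I> = \<alpha>"
    and tens0_assoc: "\<lbrakk>X \<in> cells0 B; Y \<in> cells0 B; Z \<in> cells0 B\<rbrakk>
      \<Longrightarrow> (X \<otimes>\<^sub>0 Y) \<otimes>\<^sub>0 Z = X \<otimes>\<^sub>0 (Y \<otimes>\<^sub>0 Z)"
    and tens1_assoc: "\<lbrakk>X \<in> cells0 B; Y \<in> cells0 B; f \<in> cells1 B\<rbrakk> \<Longrightarrow>
      (X \<otimes>\<^sub>0 Y) \<ltimes>\<^sub>1 f = X \<ltimes>\<^sub>1 (Y \<ltimes>\<^sub>1 f) \<and>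
      (X \<ltimes>\<^sub>1 f) \<rtimes>\<^sub>1 Y = X \<ltimes>\<^sub>1 (f \<rtimes>\<^sub>1 Y) \<and>
      (f \<rtimes>\<^sub>1 X) \<rtimes>\<^sub>1 Y = f \<rtimes>\<^sub>1 (X \<otimes>\<^sub>0 Y)"
    and tens2_assoc: "\<lbrakk>X \<in> cells0 B; Y \<in> cells0 B; \<alpha> \<in> cells2 B\<rbrakk> \<Longrightarrow>
      (X \<otimes>\<^sub>0 Y) \<ltimes>\<^sub>2 \<alpha> = X \<ltimes>\<^sub>2 (Y \<ltimes>\<^sub>2 \<alpha>) \<and>
      (X \<ltimes>\<^sub>2 \<alpha>) \<rtimes>\<^sub>2 Y = X \<ltimes>\<^sub>2 (\<alpha> \<rtimes>\<^sub>2 Y) \<and>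
      (\<alpha> \<rtimes>\<^sub>2 X) \<rtimes>\<^sub>2 Y = \<alpha> \<rtimes>\<^sub>2 (X \<otimes>\<^sub>0 Y)"
    and interchanger_hom: "\<lbrakk>f \<in> hom1 B X X'; g \<in> hom1 B Y Y'\<rbrakk> \<Longrightarrow>
      \<Sigma> f g \<in> hom2 B ((f \<rtimes>\<^sub>1 Y') \<odot> (X \<ltimes>\<^sub>1 g)) ((X' \<ltimes>\<^sub>1 g) \<odot> (f \<rtimes>\<^sub>1 Y))"
    and interchanger_invertible: "\<lbrakk>f \<in> cells1 B; g \<in> cells1 B\<rbrakk> \<Longrightarrow> invertible2 B (\<Sigma> f g)"
    and interchanger_natural: "\<lbrakk>f \<in> hom1 B X X'; g \<in> hom1 B Y Y'; \<alpha> \<in> hom2 B f f'; \<beta> \<in> hom2 B g g'\<rbrakk>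
      \<Longrightarrow> \<Sigma> f' g' \<cdot> ((\<alpha> \<rtimes>\<^sub>2 Y') \<star> (X \<ltimes>\<^sub>2 \<beta>)) = ((X' \<ltimes>\<^sub>2 \<beta>) \<star> (\<alpha> \<rtimes>\<^sub>2 Y)) \<cdot> \<Sigma> f g"
    and interchanger_id_left: "\<lbrakk>X \<in> cells0 B; g \<in> cells1 B\<rbrakk> \<Longrightarrow> \<Sigma> (\<one>\<^sub>1 X) g = \<one>\<^sub>2 (X \<ltimes>\<^sub>1 g)"
    and interchanger_id_right: "\<lbrakk>f \<in> cells1 B; Y \<in> cells0 B\<rbrakk> \<Longrightarrow> \<Sigma> f (\<one>\<^sub>1 Y) = \<one>\<^sub>2 (f \<rtimes>\<^sub>1 Y)"
    and interchanger_comp_left: "\<lbrakk>f \<in> hom1 B X X'; f' \<in> hom1 B X' X''; g \<in> hom1 B Y Y'\<rbrakk>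
      \<Longrightarrow> \<Sigma> (f' \<odot> f) g = (\<Sigma> f' g \<lhd> (f \<rtimes>\<^sub>1 Y)) \<cdot> ((f' \<rtimes>\<^sub>1 Y') \<rhd> \<Sigma> f g)"
    and interchanger_comp_right: "\<lbrakk>f \<in> hom1 B X X'; g \<in> hom1 B Y Y'; g' \<in> hom1 B Y' Y''\<rbrakk>
      \<Longrightarrow> \<Sigma> f (g' \<odot> g) = ((X' \<ltimes>\<^sub>1 g') \<rhd> \<Sigma> f g) \<cdot> (\<Sigma> f g' \<lhd> (X \<ltimes>\<^sub>1 g))"
    and interchanger_tens: "\<lbrakk>X \<in> cells0 B; f \<in> cells1 B; g \<in> cells1 B\<rbrakk> \<Longrightarrow>
      \<Sigma> (X \<ltimes>\<^sub>1 f) g = X \<ltimes>\<^sub>2 \<Sigma> f g \<and>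
      \<Sigma> (f \<rtimes>\<^sub>1 X) g = \<Sigma> f (X \<ltimes>\<^sub>1 g) \<and>
      \<Sigma> f (g \<rtimes>\<^sub>1 X) = \<Sigma> f g \<rtimes>\<^sub>2 X"

text \<open>Of the two isomorphic choices for the product of 1-cells, this fixes
  \<open>f g = (f 1).(1 g)\<close>; it is strictly associative and unital.\<close>

definition tens1 :: "('o, 'a, 'c, 'x) gray_mon_scheme \<Rightarrow> 'a \<Rightarrow> 'a \<Rightarrow> 'a" (infixr "\<otimes>\<^sub>1\<index>" 78) where
  "f \<otimes>\<^sub>1\<^bsub>B\<^esub> g = (f \<rtimes>\<^sub>1\<^bsub>B\<^esub> trg1 B g) \<odot>\<^bsub>B\<^esub> (src1 B f \<ltimes>\<^sub>1\<^bsub>B\<^esub> g)"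

definition tens2 :: "('o, 'a, 'c, 'x) gray_mon_scheme \<Rightarrow> 'c \<Rightarrow> 'c \<Rightarrow> 'c" (infixr "\<otimes>\<^sub>2\<index>" 78) where
  "\<alpha> \<otimes>\<^sub>2\<^bsub>B\<^esub> \<beta> = (\<alpha> \<rtimes>\<^sub>2\<^bsub>B\<^esub> trg1 B (src2 B \<beta>)) \<star>\<^bsub>B\<^esub> (src1 B (src2 B \<alpha>) \<ltimes>\<^sub>2\<^bsub>B\<^esub> \<beta>)"


section \<open>Map monoidales\<close>

text \<open>A Gray monoid together with a distinguished object \<open>\<M>\<close> carrying the data of a map
  monoidale; \<open>\<m>\<^sup>r\<close> and \<open>\<u>\<^sup>r\<close> are the right adjoints.\<close>

record ('o, 'a, 'c) map_mon = "('o, 'a, 'c) gray_mon" +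
  carr :: "'o" ("\<M>\<index>")
  mul :: "'a" ("\<m>\<index>")
  unt :: "'a" ("\<u>\<index>")
  asc :: "'c"
  lun :: "'c"
  run :: "'c"
  mul_r :: "'a" ("\<m>\<^sup>r\<index>")
  unt_r :: "'a" ("\<u>\<^sup>r\<index>")
  eta_m :: "'c" ("\<eta>\<^sub>m\<index>")
  eps_m :: "'c" ("\<epsilon>\<^sub>m\<index>")
  eta_u :: "'c" ("\<eta>\<^sub>u\<index>")
  eps_u :: "'c" ("\<epsilon>\<^sub>u\<index>")

locale map_monoidale = gray_monoid B for B :: "('o, 'a, 'c, 'x) map_mon_scheme" (structure) +
  assumes carr_obj: "\<M> \<in> cells0 B"
    and mul_hom: "\<m> \<in> hom1 B (\<M> \<otimes>\<^sub>0 \<M>) \<M>"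
    and unt_hom: "\<u> \<in> hom1 B \<I> \<M>"
    and asc_hom: "asc B \<in> hom2 B (\<m> \<odot> (\<m> \<rtimes>\<^sub>1 \<M>)) (\<m> \<odot> (\<M> \<ltimes>\<^sub>1 \<m>))"
    and lun_hom: "lun B \<in> hom2 B (\<m> \<odot> (\<u> \<rtimes>\<^sub>1 \<M>)) (\<one>\<^sub>1 \<M>)"
    and run_hom: "run B \<in> hom2 B (\<m> \<odot> (\<M> \<ltimes>\<^sub>1 \<u>)) (\<one>\<^sub>1 \<M>)"
    and asc_invertible: "invertible2 B (asc B)"
    and lun_invertible: "invertible2 B (lun B)"
    and run_invertible: "invertible2 B (run B)"
    and pentagon:
      "(asc B \<lhd> (\<M> \<ltimes>\<^sub>1 \<M> \<ltimes>\<^sub>1 \<m>)) \<cdot> (\<m> \<rhd> inv2 B (\<Sigma> \<m> \<m>)) \<cdot> (asc B \<lhd> (\<m> \<rtimes>\<^sub>1 \<M> \<rtimes>\<^sub>1 \<M>))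
       = (\<m> \<rhd> (\<M> \<ltimes>\<^sub>2 asc B)) \<cdot> (asc B \<lhd> (\<M> \<ltimes>\<^sub>1 (\<m> \<rtimes>\<^sub>1 \<M>))) \<cdot> (\<m> \<rhd> (asc B \<rtimes>\<^sub>2 \<M>))"
    and triangle:
      "(\<m> \<rhd> (\<M> \<ltimes>\<^sub>2 lun B)) \<cdot> (asc B \<lhd> (\<M> \<ltimes>\<^sub>1 (\<u> \<rtimes>\<^sub>1 \<M>))) = \<m> \<rhd> (run B \<rtimes>\<^sub>2 \<M>)"
    and mul_adjunction: "adjunction B \<m> \<m>\<^sup>r \<eta>\<^sub>m \<epsilon>\<^sub>m"
    and unt_adjunction: "adjunction B \<u> \<u>\<^sup>r \<eta>\<^sub>u \<epsilon>\<^sub>u"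

context
  fixes B :: "('o, 'a, 'c, 'x) map_mon_scheme" (structure)
begin

text \<open>The structure 2-cells of the pseudo-comonoid \<open>(M, m\<^sup>r, u\<^sup>r)\<close>, as mates of \<open>asc\<close>, \<open>lun\<close> and \<open>run\<close>:
  \<open>co_asc : (1 m\<^sup>r).m\<^sup>r \<Rightarrow> (m\<^sup>r 1).m\<^sup>r\<close>, \<open>co_lun : 1 \<Rightarrow> (u\<^sup>r 1).m\<^sup>r\<close> and \<open>co_run : 1 \<Rightarrow> (1 u\<^sup>r).m\<^sup>r\<close>.\<close>

definition co_asc :: 'c where
  "co_asc =
     mate B
       ((\<m>\<^sup>r \<rtimes>\<^sub>1 \<M>) \<odot> \<m>\<^sup>r) (comp_unit B (\<m> \<rtimes>\<^sub>1 \<M>) (\<m>\<^sup>r \<rtimes>\<^sub>1 \<M>) (\<eta>\<^sub>m \<rtimes>\<^sub>2 \<M>) \<eta>\<^sub>m)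
       ((\<M> \<ltimes>\<^sub>1 \<m>\<^sup>r) \<odot> \<m>\<^sup>r) (comp_counit B \<m> \<m>\<^sup>r (\<M> \<ltimes>\<^sub>2 \<epsilon>\<^sub>m) \<epsilon>\<^sub>m)
       (asc B)"

definition co_lun :: 'c where
  "co_lun =
     mate B
       ((\<u>\<^sup>r \<rtimes>\<^sub>1 \<M>) \<odot> \<m>\<^sup>r) (comp_unit B (\<u> \<rtimes>\<^sub>1 \<M>) (\<u>\<^sup>r \<rtimes>\<^sub>1 \<M>) (\<eta>\<^sub>u \<rtimes>\<^sub>2 \<M>) \<eta>\<^sub>m)
       (\<one>\<^sub>1 \<M>) (\<one>\<^sub>2 (\<one>\<^sub>1 \<M>))
       (lun B)"

definition co_run :: 'c where
  "co_run =
     mate B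
       ((\<M> \<ltimes>\<^sub>1 \<u>\<^sup>r) \<odot> \<m>\<^sup>r) (comp_unit B (\<M> \<ltimes>\<^sub>1 \<u>) (\<M> \<ltimes>\<^sub>1 \<u>\<^sup>r) (\<M> \<ltimes>\<^sub>2 \<eta>\<^sub>u) \<eta>\<^sub>m)
       (\<one>\<^sub>1 \<M>) (\<one>\<^sub>2 (\<one>\<^sub>1 \<M>))
       (run B)"

definition frob_left :: 'c where
  "frob_left =
     (\<m>\<^sup>r \<rhd> \<m> \<rhd> (\<M> \<ltimes>\<^sub>2 \<epsilon>\<^sub>m)) \<cdot>
     (\<m>\<^sup>r \<rhd> asc B \<lhd> (\<M> \<ltimes>\<^sub>1 \<m>\<^sup>r)) \<cdot>
     (\<eta>\<^sub>m \<lhd> ((\<m> \<rtimes>\<^sub>1 \<M>) \<odot> (\<M> \<ltimes>\<^sub>1 \<m>\<^sup>r)))"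

definition frob_right :: 'c where
  "frob_right =
     (\<m>\<^sup>r \<rhd> \<m> \<rhd> (\<epsilon>\<^sub>m \<rtimes>\<^sub>2 \<M>)) \<cdot>
     (\<m>\<^sup>r \<rhd> inv2 B (asc B) \<lhd> (\<m>\<^sup>r \<rtimes>\<^sub>1 \<M>)) \<cdot>
     (\<eta>\<^sub>m \<lhd> ((\<M> \<ltimes>\<^sub>1 \<m>) \<odot> (\<m>\<^sup>r \<rtimes>\<^sub>1 \<M>)))"

definition naturally_frobenius :: bool where
  "naturally_frobenius \<longleftrightarrow> invertible2 B frob_left \<and> invertible2 B frob_right"


section \<open>The duoidal category of endo-1-cells\<close>

definition cprod1 :: "'a \<Rightarrow> 'a \<Rightarrow> 'a" (infixr "\<circ>\<^sub>1" 76) where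
  "f \<circ>\<^sub>1 g = g \<odot> f"

definition cprod2 :: "'c \<Rightarrow> 'c \<Rightarrow> 'c" (infixr "\<circ>\<^sub>2" 76) where
  "\<alpha> \<circ>\<^sub>2 \<beta> = \<beta> \<star> \<alpha>"

definition cunit :: 'a ("\<i>") where
  "\<i> = \<one>\<^sub>1 \<M>"

definition bprod1 :: "'a \<Rightarrow> 'a \<Rightarrow> 'a" (infixr "\<bullet>\<^sub>1" 77) where
  "f \<bullet>\<^sub>1 g = \<m> \<odot> (f \<otimes>\<^sub>1 g) \<odot> \<m>\<^sup>r"

definition bprod2 :: "'c \<Rightarrow> 'c \<Rightarrow> 'c" (infixr "\<bullet>\<^sub>2" 77) where
  "\<alpha> \<bullet>\<^sub>2 \<beta> = \<m> \<rhd> (\<alpha> \<otimes>\<^sub>2 \<beta>) \<lhd> \<m>\<^sup>r"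

definition bunit :: 'a ("\<j>") where
  "\<j> = \<u> \<odot> \<u>\<^sup>r"

text \<open>The associator \<open>(f \<bullet> g) \<bullet> h \<Rightarrow> f \<bullet> (g \<bullet> h)\<close> passes through \<open>m.(m 1).(f g h).(m\<^sup>r 1).m\<^sup>r\<close> and
  \<open>m.(1 m).(f g h).(1 m\<^sup>r).m\<^sup>r\<close>; the unitors are \<open>j \<bullet> f \<Rightarrow> f\<close> and \<open>f \<bullet> j \<Rightarrow> f\<close>.\<close>

definition b_assoc :: "'a \<Rightarrow> 'a \<Rightarrow> 'a \<Rightarrow> 'c" where
  "b_assoc f g h =
     (\<m> \<rhd> inv2 B (\<Sigma> f \<m>) \<lhd> ((\<M> \<ltimes>\<^sub>1 (g \<otimes>\<^sub>1 h)) \<odot> (\<M> \<ltimes>\<^sub>1 \<m>\<^sup>r) \<odot> \<m>\<^sup>r)) \<cdot>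
     (asc B \<star> \<one>\<^sub>2 (f \<otimes>\<^sub>1 g \<otimes>\<^sub>1 h) \<star> inv2 B co_asc) \<cdot>
     ((\<m> \<odot> (\<m> \<rtimes>\<^sub>1 \<M>) \<odot> ((f \<otimes>\<^sub>1 g) \<rtimes>\<^sub>1 \<M>)) \<rhd> \<Sigma> \<m>\<^sup>r h \<lhd> \<m>\<^sup>r)"

definition b_lunit :: "'a \<Rightarrow> 'c" where
  "b_lunit f =
     (lun B \<star> \<one>\<^sub>2 f \<star> inv2 B co_lun) \<cdot> ((\<m> \<odot> (\<u> \<rtimes>\<^sub>1 \<M>)) \<rhd> \<Sigma> \<u>\<^sup>r f \<lhd> \<m>\<^sup>r)"

definition b_runit :: "'a \<Rightarrow> 'c" where
  "b_runit f =
     (run B \<star> \<one>\<^sub>2 f \<star> inv2 B co_run) \<cdot> (\<m> \<rhd> \<Sigma> f \<u> \<lhd> ((\<M> \<ltimes>\<^sub>1 \<u>\<^sup>r) \<odot> \<m>\<^sup>r))"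

text \<open>The structure 2-cells \<open>\<xi>\<^sub>0 : i \<bullet> i \<Rightarrow> i\<close>, \<open>\<xi>\<^sup>0\<^sub>0 : j \<Rightarrow> i\<close>, \<open>\<xi>\<^sup>0 : j \<Rightarrow> j \<circ> j\<close> and
  \<open>\<xi> a b c d : (a \<circ> b) \<bullet> (c \<circ> d) \<Rightarrow> (a \<bullet> c) \<circ> (b \<bullet> d)\<close>.\<close>

definition xi_mul :: 'c where
  "xi_mul = \<epsilon>\<^sub>m"

definition xi_counit :: 'c where
  "xi_counit = \<epsilon>\<^sub>u"

definition xi_comul :: 'c where
  "xi_comul = \<u> \<rhd> \<eta>\<^sub>u \<lhd> \<u>\<^sup>r"

definition xi :: "'a \<Rightarrow> 'a \<Rightarrow> 'a \<Rightarrow> 'a \<Rightarrow> 'c" where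
  "xi a b c d =
     ((\<m> \<odot> (b \<otimes>\<^sub>1 d)) \<rhd> \<eta>\<^sub>m \<lhd> ((a \<otimes>\<^sub>1 c) \<odot> \<m>\<^sup>r)) \<cdot>
     ((\<m> \<odot> (b \<rtimes>\<^sub>1 \<M>)) \<rhd> \<Sigma> a d \<lhd> ((\<M> \<ltimes>\<^sub>1 c) \<odot> \<m>\<^sup>r))"


section \<open>Comonoids and comodules for the product \<open>\<circ>\<close>\<close>

definition c_comonoid :: "'a \<Rightarrow> 'c \<Rightarrow> 'c \<Rightarrow> bool" where
  "c_comonoid c d e \<longleftrightarrow>
     c \<in> hom1 B \<M> \<M> \<and> d \<in> hom2 B c (c \<circ>\<^sub>1 c) \<and> e \<in> hom2 B c \<i> \<and>
     (d \<circ>\<^sub>2 \<one>\<^sub>2 c) \<cdot> d = (\<one>\<^sub>2 c \<circ>\<^sub>2 d) \<cdot> d \<and>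
     (e \<circ>\<^sub>2 \<one>\<^sub>2 c) \<cdot> d = \<one>\<^sub>2 c \<and> (\<one>\<^sub>2 c \<circ>\<^sub>2 e) \<cdot> d = \<one>\<^sub>2 c"

definition left_comodule :: "'a \<Rightarrow> 'c \<Rightarrow> 'c \<Rightarrow> 'a \<Rightarrow> 'c \<Rightarrow> bool" where
  "left_comodule c d e x l \<longleftrightarrow>
     x \<in> hom1 B \<M> \<M> \<and> l \<in> hom2 B x (c \<circ>\<^sub>1 x) \<and>
     (d \<circ>\<^sub>2 \<one>\<^sub>2 x) \<cdot> l = (\<one>\<^sub>2 c \<circ>\<^sub>2 l) \<cdot> l \<and> (e \<circ>\<^sub>2 \<one>\<^sub>2 x) \<cdot> l = \<one>\<^sub>2 x"

definition right_comodule :: "'a \<Rightarrow> 'c \<Rightarrow> 'c \<Rightarrow> 'a \<Rightarrow> 'c \<Rightarrow> bool" where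
  "right_comodule c d e x r \<longleftrightarrow>
     x \<in> hom1 B \<M> \<M> \<and> r \<in> hom2 B x (x \<circ>\<^sub>1 c) \<and>
     (\<one>\<^sub>2 x \<circ>\<^sub>2 d) \<cdot> r = (r \<circ>\<^sub>2 \<one>\<^sub>2 c) \<cdot> r \<and> (\<one>\<^sub>2 x \<circ>\<^sub>2 e) \<cdot> r = \<one>\<^sub>2 x"

definition bicomodule ::
    "'a \<Rightarrow> 'c \<Rightarrow> 'c \<Rightarrow> 'a \<Rightarrow> 'c \<Rightarrow> 'c \<Rightarrow> 'a \<Rightarrow> 'c \<Rightarrow> 'c \<Rightarrow> bool" where
  "bicomodule c d e c' d' e' x l r \<longleftrightarrow>
     left_comodule c d e x l \<and> right_comodule c' d' e' x r \<and>
     (l \<circ>\<^sub>2 \<one>\<^sub>2 c') \<cdot> r = (\<one>\<^sub>2 c \<circ>\<^sub>2 r) \<cdot> l"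

definition left_comodule_map :: "'a \<Rightarrow> 'a \<Rightarrow> 'c \<Rightarrow> 'a \<Rightarrow> 'c \<Rightarrow> 'c \<Rightarrow> bool" where
  "left_comodule_map c x l x' l' \<theta> \<longleftrightarrow> \<theta> \<in> hom2 B x x' \<and> (\<one>\<^sub>2 c \<circ>\<^sub>2 \<theta>) \<cdot> l = l' \<cdot> \<theta>"

definition right_comodule_map :: "'a \<Rightarrow> 'a \<Rightarrow> 'c \<Rightarrow> 'a \<Rightarrow> 'c \<Rightarrow> 'c \<Rightarrow> bool" where
  "right_comodule_map c x r x' r' \<theta> \<longleftrightarrow> \<theta> \<in> hom2 B x x' \<and> (\<theta> \<circ>\<^sub>2 \<one>\<^sub>2 c) \<cdot> r = r' \<cdot> \<theta>"

definition coseparable :: "'a \<Rightarrow> 'c \<Rightarrow> bool" where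
  "coseparable c d \<longleftrightarrow>
     (\<exists>\<rho>. left_comodule_map c (c \<circ>\<^sub>1 c) (d \<circ>\<^sub>2 \<one>\<^sub>2 c) c d \<rho> \<and>
          right_comodule_map c (c \<circ>\<^sub>1 c) (\<one>\<^sub>2 c \<circ>\<^sub>2 d) c d \<rho> \<and> \<rho> \<cdot> d = \<one>\<^sub>2 c)"


section \<open>Bimonoids and Hopf monoids\<close>

definition b_monoid :: "'a \<Rightarrow> 'c \<Rightarrow> 'c \<Rightarrow> bool" where
  "b_monoid a \<mu> \<eta> \<longleftrightarrow>
     a \<in> hom1 B \<M> \<M> \<and> \<mu> \<in> hom2 B (a \<bullet>\<^sub>1 a) a \<and> \<eta> \<in> hom2 B \<j> a \<and>
     \<mu> \<cdot> (\<mu> \<bullet>\<^sub>2 \<one>\<^sub>2 a) = \<mu> \<cdot> (\<one>\<^sub>2 a \<bullet>\<^sub>2 \<mu>) \<cdot> b_assoc a a a \<and>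
     \<mu> \<cdot> (\<eta> \<bullet>\<^sub>2 \<one>\<^sub>2 a) = b_lunit a \<and> \<mu> \<cdot> (\<one>\<^sub>2 a \<bullet>\<^sub>2 \<eta>) = b_runit a"

definition bimonoid :: "'a \<Rightarrow> 'c \<Rightarrow> 'c \<Rightarrow> 'c \<Rightarrow> 'c \<Rightarrow> bool" where
  "bimonoid a \<mu> \<eta> \<delta> \<epsilon> \<longleftrightarrow>
     b_monoid a \<mu> \<eta> \<and> c_comonoid a \<delta> \<epsilon> \<and>
     \<delta> \<cdot> \<mu> = (\<mu> \<circ>\<^sub>2 \<mu>) \<cdot> xi a a a a \<cdot> (\<delta> \<bullet>\<^sub>2 \<delta>) \<and>
     \<epsilon> \<cdot> \<mu> = xi_mul \<cdot> (\<epsilon> \<bullet>\<^sub>2 \<epsilon>) \<and>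
     \<delta> \<cdot> \<eta> = (\<eta> \<circ>\<^sub>2 \<eta>) \<cdot> xi_comul \<and>
     \<epsilon> \<cdot> \<eta> = xi_counit"

definition antipode_target :: "'a \<Rightarrow> 'a" ("_\<^sup>-" [1000] 999) where
  "b\<^sup>- = (\<u>\<^sup>r \<rtimes>\<^sub>1 \<M>) \<odot> (\<m> \<rtimes>\<^sub>1 \<M>) \<odot> (\<M> \<ltimes>\<^sub>1 (b \<rtimes>\<^sub>1 \<M>)) \<odot> (\<M> \<ltimes>\<^sub>1 \<m>\<^sup>r) \<odot> (\<M> \<ltimes>\<^sub>1 \<u>)"

definition unit_to_mul :: 'c where
  "unit_to_mul = (inv2 B co_lun \<lhd> \<m>) \<cdot> ((\<u>\<^sup>r \<rtimes>\<^sub>1 \<M>) \<rhd> \<eta>\<^sub>m)"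

definition unit_to_comul :: 'c where
  "unit_to_comul = (\<m>\<^sup>r \<rhd> run B) \<cdot> (\<eta>\<^sub>m \<lhd> (\<M> \<ltimes>\<^sub>1 \<u>))"

text \<open>
  The 2-cells \<open>\<phi>\<^sub>b\<^sub>c : b \<circ> c\<^sup>- \<Rightarrow> ((b \<bullet> c) \<circ> j) \<bullet> i\<close> and \<open>\<psi>\<^sub>b\<^sub>c : b\<^sup>- \<circ> c \<Rightarrow> i \<bullet> (j \<circ> (b \<bullet> c))\<close>, with the
  suppressed isomorphisms made explicit. The first factor to be applied moves \<open>b\<close> past the part
  \<open>X = (c 1).m\<^sup>r.u : I \<rightarrow> MM\<close> of \<open>c\<^sup>-\<close> (respectively \<open>c\<close> past the part \<open>Y = u\<^sup>r.m.(1 b) : MM \<rightarrow> I\<close> of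
  \<open>b\<^sup>-\<close>); the second one is \<open>\<beta>\<close> (respectively \<open>\<alpha>\<close>).
\<close>

definition phi :: "'a \<Rightarrow> 'a \<Rightarrow> 'c" where
  "phi b c =
     (inv2 B (lun B) \<lhd> ((\<u>\<^sup>r \<rtimes>\<^sub>1 \<M>) \<odot> (\<m> \<rtimes>\<^sub>1 \<M>) \<odot> (b \<otimes>\<^sub>1 c \<rtimes>\<^sub>1 \<M>) \<odot> (\<m>\<^sup>r \<rtimes>\<^sub>1 \<M>) \<odot> \<m>\<^sup>r)) \<cdot>
     (((\<u>\<^sup>r \<rtimes>\<^sub>1 \<M>) \<odot> (\<m> \<rtimes>\<^sub>1 \<M>) \<odot> (b \<otimes>\<^sub>1 c \<rtimes>\<^sub>1 \<M>)) \<rhd> co_asc) \<cdot>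
     (((\<u>\<^sup>r \<rtimes>\<^sub>1 \<M>) \<odot> (\<m> \<rtimes>\<^sub>1 \<M>) \<odot> (b \<otimes>\<^sub>1 c \<rtimes>\<^sub>1 \<M>) \<odot> (\<M> \<ltimes>\<^sub>1 \<m>\<^sup>r)) \<rhd> unit_to_comul) \<cdot>
     (((\<u>\<^sup>r \<rtimes>\<^sub>1 \<M>) \<odot> (\<m> \<rtimes>\<^sub>1 \<M>)) \<rhd> inv2 B (\<Sigma> b ((c \<rtimes>\<^sub>1 \<M>) \<odot> \<m>\<^sup>r \<odot> \<u>)))"

definition psi :: "'a \<Rightarrow> 'a \<Rightarrow> 'c" where
  "psi b c =
     ((\<m> \<odot> (\<M> \<ltimes>\<^sub>1 \<m>) \<odot> (\<M> \<ltimes>\<^sub>1 b \<otimes>\<^sub>1 c) \<odot> (\<M> \<ltimes>\<^sub>1 \<m>\<^sup>r) \<odot> (\<M> \<ltimes>\<^sub>1 \<u>)) \<rhd> co_run) \<cdot>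
     (asc B \<lhd> ((\<M> \<ltimes>\<^sub>1 b \<otimes>\<^sub>1 c) \<odot> (\<M> \<ltimes>\<^sub>1 \<m>\<^sup>r) \<odot> (\<M> \<ltimes>\<^sub>1 \<u>))) \<cdot>
     (unit_to_mul \<lhd> ((\<m> \<rtimes>\<^sub>1 \<M>) \<odot> (\<M> \<ltimes>\<^sub>1 b \<otimes>\<^sub>1 c) \<odot> (\<M> \<ltimes>\<^sub>1 \<m>\<^sup>r) \<odot> (\<M> \<ltimes>\<^sub>1 \<u>))) \<cdot>
     (inv2 B (\<Sigma> (\<u>\<^sup>r \<odot> \<m> \<odot> (\<M> \<ltimes>\<^sub>1 b)) c) \<lhd> ((\<M> \<ltimes>\<^sub>1 \<m>\<^sup>r) \<odot> (\<M> \<ltimes>\<^sub>1 \<u>)))"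

text \<open>The suppressed identifications \<open>i = j \<bullet> i = i \<bullet> j\<close> are the inverse unitors at \<open>i\<close>.\<close>

definition hopf_monoid :: "'a \<Rightarrow> 'c \<Rightarrow> 'c \<Rightarrow> 'c \<Rightarrow> 'c \<Rightarrow> 'c \<Rightarrow> bool" where
  "hopf_monoid a \<mu> \<eta> \<delta> \<epsilon> \<sigma> \<longleftrightarrow>
     bimonoid a \<mu> \<eta> \<delta> \<epsilon> \<and> \<sigma> \<in> hom2 B a (a\<^sup>-) \<and>
     ((\<mu> \<circ>\<^sub>2 \<one>\<^sub>2 \<j>) \<bullet>\<^sub>2 \<one>\<^sub>2 \<i>) \<cdot> phi a a \<cdot> (\<one>\<^sub>2 a \<circ>\<^sub>2 \<sigma>) \<cdot> \<delta>
       = (((\<eta> \<circ>\<^sub>2 \<one>\<^sub>2 \<j>) \<cdot> xi_comul) \<bullet>\<^sub>2 \<one>\<^sub>2 \<i>) \<cdot> inv2 B (b_lunit \<i>) \<cdot> \<epsilon> \<and>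
     (\<one>\<^sub>2 \<i> \<bullet>\<^sub>2 (\<one>\<^sub>2 \<j> \<circ>\<^sub>2 \<mu>)) \<cdot> psi a a \<cdot> (\<sigma> \<circ>\<^sub>2 \<one>\<^sub>2 a) \<cdot> \<delta>
       = (\<one>\<^sub>2 \<i> \<bullet>\<^sub>2 ((\<one>\<^sub>2 \<j> \<circ>\<^sub>2 \<eta>) \<cdot> xi_comul)) \<cdot> inv2 B (b_runit \<i>) \<cdot> \<epsilon>"


section \<open>Cointegrals\<close>

definition left_cointegral :: "'a \<Rightarrow> 'c \<Rightarrow> 'c \<Rightarrow> 'c \<Rightarrow> bool" where
  "left_cointegral a \<eta> \<delta> \<theta> \<longleftrightarrow>
     left_comodule_map a (a \<circ>\<^sub>1 \<j>) (\<delta> \<circ>\<^sub>2 \<one>\<^sub>2 \<j>) \<j> ((\<eta> \<circ>\<^sub>2 \<one>\<^sub>2 \<j>) \<cdot> xi_comul) \<theta> \<and>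
     right_comodule_map \<j> (a \<circ>\<^sub>1 \<j>) (\<one>\<^sub>2 a \<circ>\<^sub>2 xi_comul) \<j> xi_comul \<theta>"

definition normalized_left_cointegral :: "'a \<Rightarrow> 'c \<Rightarrow> 'c \<Rightarrow> 'c \<Rightarrow> bool" where
  "normalized_left_cointegral a \<eta> \<delta> \<theta> \<longleftrightarrow>
     left_cointegral a \<eta> \<delta> \<theta> \<and> \<theta> \<cdot> (\<eta> \<circ>\<^sub>2 \<one>\<^sub>2 \<j>) \<cdot> xi_comul = \<one>\<^sub>2 \<j>"

definition right_cointegral :: "'a \<Rightarrow> 'c \<Rightarrow> 'c \<Rightarrow> 'c \<Rightarrow> bool" where
  "right_cointegral a \<eta> \<delta> \<theta> \<longleftrightarrow>
     right_comodule_map a (\<j> \<circ>\<^sub>1 a) (\<one>\<^sub>2 \<j> \<circ>\<^sub>2 \<delta>) \<j> ((\<one>\<^sub>2 \<j> \<circ>\<^sub>2 \<eta>) \<cdot> xi_comul) \<theta> \<and>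
     left_comodule_map \<j> (\<j> \<circ>\<^sub>1 a) (xi_comul \<circ>\<^sub>2 \<one>\<^sub>2 a) \<j> xi_comul \<theta>"

definition normalized_right_cointegral :: "'a \<Rightarrow> 'c \<Rightarrow> 'c \<Rightarrow> 'c \<Rightarrow> bool" where
  "normalized_right_cointegral a \<eta> \<delta> \<theta> \<longleftrightarrow>
     right_cointegral a \<eta> \<delta> \<theta> \<and> \<theta> \<cdot> (\<one>\<^sub>2 \<j> \<circ>\<^sub>2 \<eta>) \<cdot> xi_comul = \<one>\<^sub>2 \<j>"

end


section \<open>Separable functors and reflection of split monomorphisms\<close>

record ('x, 'm) cat =
  obs :: "'x set"
  arrs :: "'x \<Rightarrow> 'x \<Rightarrow> 'm set"
  compose :: "'m \<Rightarrow> 'm \<Rightarrow> 'm"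
  ident :: "'x \<Rightarrow> 'm"

text \<open>A functor is given by its object map \<open>F\<close> and its morphism map \<open>F'\<close>.\<close>

definition separable_functor ::
    "('x, 'm) cat \<Rightarrow> ('y, 'n) cat \<Rightarrow> ('x \<Rightarrow> 'y) \<Rightarrow> ('m \<Rightarrow> 'n) \<Rightarrow> bool" where
  "separable_functor C D F F' \<longleftrightarrow>
     (\<exists>P. (\<forall>x \<in> obs C. \<forall>y \<in> obs C. \<forall>h \<in> arrs D (F x) (F y). P x y h \<in> arrs C x y) \<and>
          (\<forall>x \<in> obs C. \<forall>y \<in> obs C. \<forall>x' \<in> obs C. \<forall>y' \<in> obs C.
             \<forall>f \<in> arrs C x' x. \<forall>h \<in> arrs D (F x) (F y). \<forall>g \<in> arrs C y y'.
               P x' y' (compose D (F' g) (compose D h (F' f))) = compose C g (compose C (P x y h) f)) \<and>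
          (\<forall>x \<in> obs C. \<forall>y \<in> obs C. \<forall>f \<in> arrs C x y. P x y (F' f) = f))"

definition split_mono :: "('x, 'm) cat \<Rightarrow> 'x \<Rightarrow> 'x \<Rightarrow> 'm \<Rightarrow> bool" where
  "split_mono C x y f \<longleftrightarrow> f \<in> arrs C x y \<and> (\<exists>g \<in> arrs C y x. compose C g f = ident C x)"

definition reflects_split_monos ::
    "('x, 'm) cat \<Rightarrow> ('y, 'n) cat \<Rightarrow> ('x \<Rightarrow> 'y) \<Rightarrow> ('m \<Rightarrow> 'n) \<Rightarrow> bool" where
  "reflects_split_monos C D F F' \<longleftrightarrow>
     (\<forall>x \<in> obs C. \<forall>y \<in> obs C. \<forall>f \<in> arrs C x y.
        split_mono D (F x) (F y) (F' f) \<longrightarrow> split_mono C x y f)"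


section \<open>Comodule categories\<close>

context
  fixes B :: "('o, 'a, 'c, 'x) map_mon_scheme" (structure)
begin

definition left_comodule_cat :: "'a \<Rightarrow> 'c \<Rightarrow> 'c \<Rightarrow> ('a \<times> 'c, 'c) cat" where
  "left_comodule_cat c d e =
     \<lparr>obs = {(x, l). left_comodule B c d e x l},
      arrs = (\<lambda>(x, l) (x', l'). {\<theta>. left_comodule_map B c x l x' l' \<theta>}),
      compose = (\<cdot>),
      ident = (\<lambda>(x, l). \<one>\<^sub>2 x)\<rparr>"

definition right_comodule_cat :: "'a \<Rightarrow> 'c \<Rightarrow> 'c \<Rightarrow> ('a \<times> 'c, 'c) cat" where
  "right_comodule_cat c d e =
     \<lparr>obs = {(x, r). right_comodule B c d e x r},
      arrs = (\<lambda>(x, r) (x', r'). {\<theta>. right_comodule_map B c x r x' r' \<theta>}),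
      compose = (\<cdot>),
      ident = (\<lambda>(x, r). \<one>\<^sub>2 x)\<rparr>"

definition bicomodule_cat ::
    "'a \<Rightarrow> 'c \<Rightarrow> 'c \<Rightarrow> 'a \<Rightarrow> 'c \<Rightarrow> 'c \<Rightarrow> ('a \<times> 'c \<times> 'c, 'c) cat" where
  "bicomodule_cat c d e c' d' e' =
     \<lparr>obs = {(x, l, r). bicomodule B c d e c' d' e' x l r},
      arrs = (\<lambda>(x, l, r) (x', l', r').
        {\<theta>. left_comodule_map B c x l x' l' \<theta> \<and> right_comodule_map B c' x r x' r' \<theta>}),
      compose = (\<cdot>),
      ident = (\<lambda>(x, l, r). \<one>\<^sub>2 x)\<rparr>"

definition aj_bicomodules :: "'a \<Rightarrow> 'c \<Rightarrow> 'c \<Rightarrow> ('a \<times> 'c \<times> 'c, 'c) cat" where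
  "aj_bicomodules a \<delta> \<epsilon> = bicomodule_cat a \<delta> \<epsilon> (bunit B) (xi_comul B) (xi_counit B)"

definition ja_bicomodules :: "'a \<Rightarrow> 'c \<Rightarrow> 'c \<Rightarrow> ('a \<times> 'c \<times> 'c, 'c) cat" where
  "ja_bicomodules a \<delta> \<epsilon> = bicomodule_cat (bunit B) (xi_comul B) (xi_counit B) a \<delta> \<epsilon>"

definition right_j_comodules :: "('a \<times> 'c, 'c) cat" where
  "right_j_comodules = right_comodule_cat (bunit B) (xi_comul B) (xi_counit B)"

definition left_j_comodules :: "('a \<times> 'c, 'c) cat" where
  "left_j_comodules = left_comodule_cat (bunit B) (xi_comul B) (xi_counit B)"

end

definition forget_left :: "'a \<times> 'c \<times> 'c \<Rightarrow> 'a \<times> 'c" where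
  "forget_left = (\<lambda>(x, l, r). (x, r))"

definition forget_right :: "'a \<times> 'c \<times> 'c \<Rightarrow> 'a \<times> 'c" where
  "forget_right = (\<lambda>(x, l, r). (x, l))"

end

theory Submission
  imports Defs
begin

text \<open>
  The implications (i) \<open>\<Rightarrow>\<close> (iv) \<open>\<Rightarrow>\<close> (vi) \<open>\<Rightarrow>\<close> (ii) are formal: a morphism over \<open>j\<close> between bicomodules is made
  \<open>a\<close>-colinear by averaging with a colinear retraction of \<open>\<delta>\<close>, a separable functor reflects split
  monomorphisms, and \<open>(\<eta> \<circ> 1) \<cdot> \<xi>\<^sup>0 : j \<rightarrow> a \<circ> j\<close> is a bicomodule morphism which is split over \<open>j\<close> by \<open>\<epsilon> \<circ> 1\<close>
  and whose bicomodule retractions are the normalized left cointegrals.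

  For (ii) \<open>\<Rightarrow>\<close> (i), let \<open>\<tau> : u\<^sup>r.a \<Rightarrow> u\<^sup>r\<close> be the transpose of the cointegral. In the notation of Hopf algebras
  the retraction is \<open>\<rho> (x \<otimes> y) = \<tau> (x S(y\<^sub>1)) y\<^sub>2\<close>. The antipode axiom and normalization give \<open>\<rho> \<cdot> \<delta> = 1\<close>, and
  colinearity in \<open>y\<close> is coassociativity. Colinearity in \<open>x\<close> may be checked after composition with
  \<open>\<gamma> : x \<otimes> y \<mapsto> x y\<^sub>1 \<otimes> y\<^sub>2\<close>, which is split by \<open>x \<otimes> y \<mapsto> x S(y\<^sub>1) \<otimes> y\<^sub>2\<close>; there it reduces to the colinearity of
  \<open>\<theta>\<close>, because \<open>\<rho> \<gamma> (x \<otimes> y) = \<tau> (x) y\<close>.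

  These calculations are large pastings of interchangers and coherence 2-cells. They are carried out on
  syntactic diagrams, by explicit rewriting certificates whose evaluation is a proof. The statements
  about right cointegrals come from the same certificates, reflected.
\<close>

section \<open>Calculus in a Gray monoid\<close>

text \<open>The antipode lands in \<open>a^-\<close>, not in \<open>a\<close>, and no formula for
  the comultiplication of \<open>S(y)\<close> is at hand, so left colinearity of
  \<open>\<rho>\<close> cannot be checked by expanding its definition. Composition with
  \<open>\<gamma>\<close> removes the antipode before \<open>\<delta>\<close> is applied: what is
  left uses only that \<open>\<delta>\<close> is multiplicative and that
  \<open>x1 \<tau>(x2) = \<tau>(x) 1\<close>.

  The element notation hides where the factors live. The element \<open>x S(y)\<close> belongs to
  \<open>(u^r 1).(a 1).m^r\<close>, which is \<open>(a \<circ> j) \<bullet> i\<close> up to a unit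
  isomorphism, and the product by \<open>y\<close> takes this 1-cell as its left factor. Hence even
  \<open>(x y) S(z) = x (y S(z))\<close> needs the coassociator, the unit laws and many crossings.

  In a Gray monoid all laws for 1-cells are strict except interchange. Boundaries can therefore be
  compared as lists, and interchangers are the only coherence cells of the ambient structure that a
  diagram must record. Reflected equations are derived in the same Gray monoid from reflected
  axioms, so that no opposite structure has to be formed.\<close>

context two_category
begin

text \<open>\<open>hom2\<close> records only the boundary 1-cells, while every law for
  \<open>\<star>\<close> also asks for 0-cells. With all four in one predicate, typing facts can be
  chained.\<close>

definition in2 :: "'c \<Rightarrow> 'a \<Rightarrow> 'a \<Rightarrow> 'o \<Rightarrow> 'o \<Rightarrow> bool" where
  "in2 \<alpha> f g X Y \<longleftrightarrow> \<alpha> \<in> hom2 B f g \<and> f \<in> hom1 B X Y \<and> g \<in> hom1 B X Y"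

lemma hom1_cells0:
  assumes "f \<in> hom1 B X Y"
  shows "f \<in> cells1 B" "src1 B f = X" "trg1 B f = Y" "X \<in> cells0 B" "Y \<in> cells0 B"
  using assms cells1_ends[of f] by (auto simp: hom1_def)

lemma in2I: "\<alpha> \<in> hom2 B f g \<Longrightarrow> f \<in> hom1 B X Y \<Longrightarrow> in2 \<alpha> f g X Y"
  using cells2_ends[of \<alpha>] cells2_parallel[of \<alpha>] by (auto simp: in2_def hom2_def hom1_def)

lemma in2D:
  assumes "in2 \<alpha> f g X Y"
  shows "\<alpha> \<in> hom2 B f g" "f \<in> hom1 B X Y" "g \<in> hom1 B X Y"
  using assms by (auto simp: in2_def)

lemma in2_cells:
  assumes "in2 \<alpha> f g X Y"
  shows "\<alpha> \<in> cells2 B" "src2 B \<alpha> = f" "trg2 B \<alpha> = g"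
  using assms by (auto simp: in2_def hom2_def)

lemma in2_id: "f \<in> hom1 B X Y \<Longrightarrow> in2 (\<one>\<^sub>2 f) f f X Y"
  by (rule in2I) (auto simp: hom1_def id2_hom)

lemma in2_vcomp: "in2 \<alpha> f g X Y \<Longrightarrow> in2 \<beta> g h X Y \<Longrightarrow> in2 (\<beta> \<cdot> \<alpha>) f h X Y"
  by (auto simp: in2_def vcomp_hom)

lemma in2_hcomp: "in2 \<alpha> f f' X Y \<Longrightarrow> in2 \<beta> g g' Y Z \<Longrightarrow> in2 (\<beta> \<star> \<alpha>) (g \<odot> f) (g' \<odot> f') X Z"
  by (auto simp: in2_def hcomp_hom comp1_hom)

lemma v_assoc:
  "in2 \<alpha> f g X Y \<Longrightarrow> in2 \<beta> g h X Y \<Longrightarrow> in2 \<gamma> h k X Y \<Longrightarrow> (\<gamma> \<cdot> \<beta>) \<cdot> \<alpha> = \<gamma> \<cdot> (\<beta> \<cdot> \<alpha>)"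
  by (auto simp: in2_def intro: vcomp_assoc)

lemma v_id: "in2 \<alpha> f g X Y \<Longrightarrow> \<one>\<^sub>2 g \<cdot> \<alpha> = \<alpha>" "in2 \<alpha> f g X Y \<Longrightarrow> \<alpha> \<cdot> \<one>\<^sub>2 f = \<alpha>"
  by (auto simp: in2_def vcomp_id_left vcomp_id_right)

lemma h_assoc:
  "in2 \<alpha> f f' X Y \<Longrightarrow> in2 \<beta> g g' Y Z \<Longrightarrow> in2 \<gamma> h h' Z W \<Longrightarrow> (\<gamma> \<star> \<beta>) \<star> \<alpha> = \<gamma> \<star> (\<beta> \<star> \<alpha>)"
  by (auto simp: in2_def intro: hcomp_assoc)

lemma h_id: "in2 \<alpha> f g X Y \<Longrightarrow> \<one>\<^sub>2 (\<one>\<^sub>1 Y) \<star> \<alpha> = \<alpha>" "in2 \<alpha> f g X Y \<Longrightarrow> \<alpha> \<star> \<one>\<^sub>2 (\<one>\<^sub>1 X) = \<alpha>"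
  by (auto simp: in2_def intro: hcomp_id_left hcomp_id_right)

lemma vh_interchange:
  "in2 \<alpha> f f' X Y \<Longrightarrow> in2 \<alpha>' f' f'' X Y \<Longrightarrow> in2 \<beta> g g' Y Z \<Longrightarrow> in2 \<beta>' g' g'' Y Z \<Longrightarrow>
    (\<beta>' \<star> \<alpha>') \<cdot> (\<beta> \<star> \<alpha>) = (\<beta>' \<cdot> \<beta>) \<star> (\<alpha>' \<cdot> \<alpha>)"
  by (rule interchange[symmetric]) (auto simp: in2_def)

text \<open>Middle-four interchange with identities inserted. The two orders are what lets slices at
  different places of a path commute.\<close>

lemma hcomp_split:
  assumes "in2 \<alpha> f f' X Y" "in2 \<beta> g g' Y Z"
  shows "\<beta> \<star> \<alpha> = (\<beta> \<star> \<one>\<^sub>2 f') \<cdot> (\<one>\<^sub>2 g \<star> \<alpha>)" "\<beta> \<star> \<alpha> = (\<one>\<^sub>2 g' \<star> \<alpha>) \<cdot> (\<beta> \<star> \<one>\<^sub>2 f)"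
proof -
  note i = in2_id[OF in2D(2)[OF assms(1)]] in2_id[OF in2D(3)[OF assms(1)]]
    in2_id[OF in2D(2)[OF assms(2)]] in2_id[OF in2D(3)[OF assms(2)]]
  show "\<beta> \<star> \<alpha> = (\<beta> \<star> \<one>\<^sub>2 f') \<cdot> (\<one>\<^sub>2 g \<star> \<alpha>)"
    using vh_interchange[OF assms(1) i(2) i(3) assms(2)] v_id[OF assms(1)] v_id[OF assms(2)] by simp
  show "\<beta> \<star> \<alpha> = (\<one>\<^sub>2 g' \<star> \<alpha>) \<cdot> (\<beta> \<star> \<one>\<^sub>2 f)"
    using vh_interchange[OF i(1) assms(1) assms(2) i(4)] v_id[OF assms(1)] v_id[OF assms(2)] by simp
qed

lemma in2_inverse2:
  assumes "inverse2 B \<alpha> \<beta>" "in2 \<alpha> f g X Y"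
  shows "in2 \<beta> g f X Y" "\<beta> \<cdot> \<alpha> = \<one>\<^sub>2 f" "\<alpha> \<cdot> \<beta> = \<one>\<^sub>2 g"
  using assms in2_cells[OF assms(2)] by (auto simp: inverse2_def in2_def)

lemma inverse2_unique:
  assumes "in2 \<alpha> f g X Y" "inverse2 B \<alpha> \<beta>" "inverse2 B \<alpha> \<beta>'"
  shows "\<beta> = \<beta>'"
proof -
  note b = in2_inverse2[OF assms(2,1)] and b' = in2_inverse2[OF assms(3,1)]
  have "\<beta> = (\<beta>' \<cdot> \<alpha>) \<cdot> \<beta>" using b b' v_id[OF b(1)] by simp
  also have "\<dots> = \<beta>' \<cdot> (\<alpha> \<cdot> \<beta>)" by (rule v_assoc[OF b(1) assms(1) b'(1)])
  finally show ?thesis using b v_id[OF b'(1)] by simp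
qed

text \<open>\<open>inv2\<close> is a definite description; uniqueness of inverses allows it to be
  computed from any two-sided inverse.\<close>

lemma inv2_eqI:
  assumes "in2 \<alpha> f g X Y" "in2 \<beta> g f X Y" "\<beta> \<cdot> \<alpha> = \<one>\<^sub>2 f" "\<alpha> \<cdot> \<beta> = \<one>\<^sub>2 g"
  shows "inv2 B \<alpha> = \<beta>"
proof -
  have "inverse2 B \<alpha> \<beta>" using assms in2_cells[OF assms(1)] by (auto simp: inverse2_def in2_def)
  then show ?thesis unfolding inv2_def using inverse2_unique[OF assms(1)] by blast
qed

lemma inv2_inverse:
  assumes "invertible2 B \<alpha>" "in2 \<alpha> f g X Y"
  shows "in2 (inv2 B \<alpha>) g f X Y" "inv2 B \<alpha> \<cdot> \<alpha> = \<one>\<^sub>2 f" "\<alpha> \<cdot> inv2 B \<alpha> = \<one>\<^sub>2 g"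
proof -
  obtain \<beta> where b: "inverse2 B \<alpha> \<beta>" using assms by (auto simp: invertible2_def)
  note i = in2_inverse2[OF b assms(2)]
  have "inv2 B \<alpha> = \<beta>" by (rule inv2_eqI[OF assms(2) i])
  then show "in2 (inv2 B \<alpha>) g f X Y" "inv2 B \<alpha> \<cdot> \<alpha> = \<one>\<^sub>2 f" "\<alpha> \<cdot> inv2 B \<alpha> = \<one>\<^sub>2 g" using i by auto
qed

end

section \<open>Functoriality of the two tensor actions\<close>

context gray_monoid
begin

lemma tens0_obj: "X \<in> cells0 B \<Longrightarrow> Y \<in> cells0 B \<Longrightarrow> X \<otimes>\<^sub>0 Y \<in> cells0 B"
  using ltens_2_functor[of X] by (auto simp: strict_endo_2_functor_def)

lemma ltens1_hom: "Z \<in> cells0 B \<Longrightarrow> f \<in> hom1 B X Y \<Longrightarrow> Z \<ltimes>\<^sub>1 f \<in> hom1 B (Z \<otimes>\<^sub>0 X) (Z \<otimes>\<^sub>0 Y)"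
  using ltens_2_functor[of Z] by (auto simp: strict_endo_2_functor_def hom1_def)

lemma rtens1_hom: "Z \<in> cells0 B \<Longrightarrow> f \<in> hom1 B X Y \<Longrightarrow> f \<rtimes>\<^sub>1 Z \<in> hom1 B (X \<otimes>\<^sub>0 Z) (Y \<otimes>\<^sub>0 Z)"
  using rtens_2_functor[of Z] by (auto simp: strict_endo_2_functor_def hom1_def)

lemma tens1_id:
  assumes "Z \<in> cells0 B" "X \<in> cells0 B"
  shows "Z \<ltimes>\<^sub>1 \<one>\<^sub>1 X = \<one>\<^sub>1 (Z \<otimes>\<^sub>0 X)" "\<one>\<^sub>1 X \<rtimes>\<^sub>1 Z = \<one>\<^sub>1 (X \<otimes>\<^sub>0 Z)"
  using assms ltens_2_functor[of Z] rtens_2_functor[of Z] by (auto simp: strict_endo_2_functor_def)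

lemma tens1_comp:
  assumes "Z \<in> cells0 B" "f \<in> hom1 B X Y" "g \<in> hom1 B Y W"
  shows "Z \<ltimes>\<^sub>1 (g \<odot> f) = (Z \<ltimes>\<^sub>1 g) \<odot> (Z \<ltimes>\<^sub>1 f)" "(g \<odot> f) \<rtimes>\<^sub>1 Z = (g \<rtimes>\<^sub>1 Z) \<odot> (f \<rtimes>\<^sub>1 Z)"
  using assms ltens_2_functor[of Z] rtens_2_functor[of Z]
  by (auto simp: strict_endo_2_functor_def hom1_def)

lemma in2_ltens:
  assumes "Z \<in> cells0 B" "in2 \<alpha> f g X Y"
  shows "in2 (Z \<ltimes>\<^sub>2 \<alpha>) (Z \<ltimes>\<^sub>1 f) (Z \<ltimes>\<^sub>1 g) (Z \<otimes>\<^sub>0 X) (Z \<otimes>\<^sub>0 Y)"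
  using assms ltens_2_functor[of Z] ltens1_hom[of Z]
  by (auto simp: strict_endo_2_functor_def in2_def hom2_def)

lemma in2_rtens:
  assumes "Z \<in> cells0 B" "in2 \<alpha> f g X Y"
  shows "in2 (\<alpha> \<rtimes>\<^sub>2 Z) (f \<rtimes>\<^sub>1 Z) (g \<rtimes>\<^sub>1 Z) (X \<otimes>\<^sub>0 Z) (Y \<otimes>\<^sub>0 Z)"
  using assms rtens_2_functor[of Z] rtens1_hom[of Z]
  by (auto simp: strict_endo_2_functor_def in2_def hom2_def)

lemma tens2_id:
  assumes "Z \<in> cells0 B" "f \<in> cells1 B"
  shows "Z \<ltimes>\<^sub>2 \<one>\<^sub>2 f = \<one>\<^sub>2 (Z \<ltimes>\<^sub>1 f)" "\<one>\<^sub>2 f \<rtimes>\<^sub>2 Z = \<one>\<^sub>2 (f \<rtimes>\<^sub>1 Z)"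
  using assms ltens_2_functor[of Z] rtens_2_functor[of Z] by (auto simp: strict_endo_2_functor_def)

lemma tens2_vcomp:
  assumes "Z \<in> cells0 B" "in2 \<alpha> f g X Y" "in2 \<beta> g h X Y"
  shows "Z \<ltimes>\<^sub>2 (\<beta> \<cdot> \<alpha>) = (Z \<ltimes>\<^sub>2 \<beta>) \<cdot> (Z \<ltimes>\<^sub>2 \<alpha>)" "(\<beta> \<cdot> \<alpha>) \<rtimes>\<^sub>2 Z = (\<beta> \<rtimes>\<^sub>2 Z) \<cdot> (\<alpha> \<rtimes>\<^sub>2 Z)"
  using assms ltens_2_functor[of Z] rtens_2_functor[of Z]
  by (auto simp: strict_endo_2_functor_def in2_def hom2_def)

lemma tens2_hcomp:
  assumes "Z \<in> cells0 B" "in2 \<alpha> f f' X Y" "in2 \<beta> g g' Y W"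
  shows "Z \<ltimes>\<^sub>2 (\<beta> \<star> \<alpha>) = (Z \<ltimes>\<^sub>2 \<beta>) \<star> (Z \<ltimes>\<^sub>2 \<alpha>)" "(\<beta> \<star> \<alpha>) \<rtimes>\<^sub>2 Z = (\<beta> \<rtimes>\<^sub>2 Z) \<star> (\<alpha> \<rtimes>\<^sub>2 Z)"
  using assms ltens_2_functor[of Z] rtens_2_functor[of Z]
  by (auto simp: strict_endo_2_functor_def in2_def hom2_def hom1_def)

end

section \<open>Diagrams\<close>

text \<open>
  A layer \<open>(l, g, r)\<close> stands for the 1-cell \<open>M\<^sup>l g M\<^sup>r\<close>, and a path is a composite of layers, the one applied
  last coming first. A slice \<open>(i, l, x, r)\<close> applies \<open>M\<^sup>l x M\<^sup>r\<close> to the layers from position \<open>i\<close> on, and a list of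
  slices is a vertical composite, the one applied first coming first. The generators \<open>gn\<close> and \<open>gv\<close> are \<open>m\<^sup>r\<close>
  and \<open>u\<^sup>r\<close>, \<open>Cas\<close>, \<open>Cl\<close> and \<open>Cr\<close> are \<open>co_asc\<close>, \<open>co_lun\<close> and \<open>co_run\<close>, a final \<open>I\<close> marks an inverse, and \<open>Sw f k g\<close> and
  \<open>Si f k g\<close> are the interchanger of \<open>f\<close> and \<open>M\<^sup>k g\<close> and its inverse. \<open>Theta : a \<circ> j \<Rightarrow> j\<close> and \<open>RTheta : j \<circ> a \<Rightarrow> j\<close>
  are the places for a left and for a right cointegral.
\<close>

datatype gen1 = ga | gm | gu | gn | gv

fun dom_g :: "gen1 \<Rightarrow> nat" where
  "dom_g ga = 1" | "dom_g gm = 2" | "dom_g gu = 0" | "dom_g gn = 1" | "dom_g gv = 1"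

fun cod_g :: "gen1 \<Rightarrow> nat" where
  "cod_g ga = 1" | "cod_g gm = 1" | "cod_g gu = 1" | "cod_g gn = 2" | "cod_g gv = 0"

type_synonym layer = "nat \<times> gen1 \<times> nat"
type_synonym path = "layer list"

definition shift :: "nat \<Rightarrow> nat \<Rightarrow> path \<Rightarrow> path" where
  "shift l r = map (\<lambda>(l', g, r'). (l + l', g, r' + r))"

datatype gen2 = Asc | AscI | Lun | LunI | Run | RunI | Cas | CasI | Cl | ClI | Cr | CrI
  | EtaM | EpsM | EtaU | EpsU | Mul | One | Del | Eps | Sig | Theta | RTheta

datatype cell = Gen gen2 | Sw gen1 nat gen1 | Si gen1 nat gen1

fun gsrc :: "gen2 \<Rightarrow> path" where
  "gsrc Asc = [(0,gm,0),(0,gm,1)]" | "gsrc AscI = [(0,gm,0),(1,gm,0)]"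
| "gsrc Lun = [(0,gm,0),(0,gu,1)]" | "gsrc LunI = []"
| "gsrc Run = [(0,gm,0),(1,gu,0)]" | "gsrc RunI = []"
| "gsrc Cas = [(1,gn,0),(0,gn,0)]" | "gsrc CasI = [(0,gn,1),(0,gn,0)]"
| "gsrc Cl = []" | "gsrc ClI = [(0,gv,1),(0,gn,0)]"
| "gsrc Cr = []" | "gsrc CrI = [(1,gv,0),(0,gn,0)]"
| "gsrc EtaM = []" | "gsrc EpsM = [(0,gm,0),(0,gn,0)]"
| "gsrc EtaU = []" | "gsrc EpsU = [(0,gu,0),(0,gv,0)]"
| "gsrc Mul = [(0,gm,0),(0,ga,1),(1,ga,0),(0,gn,0)]"
| "gsrc One = [(0,gu,0),(0,gv,0)]"
| "gsrc Del = [(0,ga,0)]" | "gsrc Eps = [(0,ga,0)]" | "gsrc Sig = [(0,ga,0)]"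
| "gsrc Theta = [(0,gu,0),(0,gv,0),(0,ga,0)]" | "gsrc RTheta = [(0,ga,0),(0,gu,0),(0,gv,0)]"

fun gtrg :: "gen2 \<Rightarrow> path" where
  "gtrg Asc = [(0,gm,0),(1,gm,0)]" | "gtrg AscI = [(0,gm,0),(0,gm,1)]"
| "gtrg Lun = []" | "gtrg LunI = [(0,gm,0),(0,gu,1)]"
| "gtrg Run = []" | "gtrg RunI = [(0,gm,0),(1,gu,0)]"
| "gtrg Cas = [(0,gn,1),(0,gn,0)]" | "gtrg CasI = [(1,gn,0),(0,gn,0)]"
| "gtrg Cl = [(0,gv,1),(0,gn,0)]" | "gtrg ClI = []"
| "gtrg Cr = [(1,gv,0),(0,gn,0)]" | "gtrg CrI = []"
| "gtrg EtaM = [(0,gn,0),(0,gm,0)]" | "gtrg EpsM = []"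
| "gtrg EtaU = [(0,gv,0),(0,gu,0)]" | "gtrg EpsU = []"
| "gtrg Mul = [(0,ga,0)]" | "gtrg One = [(0,ga,0)]"
| "gtrg Del = [(0,ga,0),(0,ga,0)]" | "gtrg Eps = []"
| "gtrg Sig = [(0,gv,1),(0,gm,1),(1,ga,1),(1,gn,0),(1,gu,0)]"
| "gtrg Theta = [(0,gu,0),(0,gv,0)]" | "gtrg RTheta = [(0,gu,0),(0,gv,0)]"

text \<open>An empty boundary path, such as the source of \<open>EtaM\<close>, does not reveal the
  power of \<open>\<M>\<close> on which it is an identity, so that power is recorded
  separately.\<close>

fun gdom :: "gen2 \<Rightarrow> nat" where
  "gdom Asc = 3" | "gdom AscI = 3" | "gdom EtaM = 2" | "gdom EtaU = 0" | "gdom _ = 1"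

fun gcod :: "gen2 \<Rightarrow> nat" where
  "gcod Cas = 3" | "gcod CasI = 3" | "gcod EtaM = 2" | "gcod EtaU = 0" | "gcod _ = 1"

fun csrc :: "cell \<Rightarrow> path" where
  "csrc (Gen h) = gsrc h"
| "csrc (Sw f k g) = [(0, f, k + cod_g g), (dom_g f + k, g, 0)]"
| "csrc (Si f k g) = [(cod_g f + k, g, 0), (0, f, k + dom_g g)]"

fun ctrg :: "cell \<Rightarrow> path" where
  "ctrg (Gen h) = gtrg h"
| "ctrg (Sw f k g) = [(cod_g f + k, g, 0), (0, f, k + dom_g g)]"
| "ctrg (Si f k g) = [(0, f, k + cod_g g), (dom_g f + k, g, 0)]"

fun cdom :: "cell \<Rightarrow> nat" where
  "cdom (Gen h) = gdom h" | "cdom (Sw f k g) = dom_g f + k + dom_g g" | "cdom (Si f k g) = dom_g f + k + dom_g g"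

fun ccod :: "cell \<Rightarrow> nat" where
  "ccod (Gen h) = gcod h" | "ccod (Sw f k g) = cod_g f + k + cod_g g" | "ccod (Si f k g) = cod_g f + k + cod_g g"

fun cd :: "nat \<Rightarrow> path \<Rightarrow> nat" where
  "cd n [] = n" | "cd n ((l, g, r) # p) = l + cod_g g + r"

fun wf_path :: "nat \<Rightarrow> path \<Rightarrow> bool" where
  "wf_path n [] \<longleftrightarrow> True" | "wf_path n ((l, g, r) # p) \<longleftrightarrow> cd n p = l + dom_g g + r \<and> wf_path n p"

type_synonym slice = "nat \<times> nat \<times> cell \<times> nat"

text \<open>The test on \<open>cd\<close> has content only when \<open>csrc x\<close> is empty: then
  no layer is matched, and the number of strands at position \<open>i\<close> must be checked
  directly.\<close>

fun app :: "nat \<Rightarrow> path \<Rightarrow> slice \<Rightarrow> path option" where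
  "app n p (i, l, x, r) =
    (if i \<le> length p \<and> take (length (csrc x)) (drop i p) = shift l r (csrc x) \<and>
        cd n (drop i p) = l + ccod x + r
     then Some (take i p @ shift l r (ctrg x) @ drop (length (csrc x)) (drop i p)) else None)"

fun run :: "nat \<Rightarrow> path \<Rightarrow> slice list \<Rightarrow> path option" where
  "run n p [] = Some p"
| "run n p (s # S) = (case app n p s of None \<Rightarrow> None | Some q \<Rightarrow> run n q S)"

definition shs :: "nat \<Rightarrow> nat \<Rightarrow> nat \<Rightarrow> slice list \<Rightarrow> slice list" where
  "shs j l r = map (\<lambda>(i, l', x, r'). (i + j, l + l', x, r' + r))"

text \<open>Meant for interchangers only. The value at \<open>Gen h\<close> is a filler, excluded by
  \<open>is_swap\<close> wherever an inverse is claimed.\<close>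

fun cinv :: "cell \<Rightarrow> cell" where
  "cinv (Sw f k g) = Si f k g" | "cinv (Si f k g) = Sw f k g" | "cinv (Gen h) = Gen h"

definition invs :: "slice list \<Rightarrow> slice list" where
  "invs S = rev (map (\<lambda>(i, l, x, r). (i, l, cinv x, r)) S)"

fun swaps1 :: "layer \<Rightarrow> path \<Rightarrow> slice list" where
  "swaps1 x [] = []"
| "swaps1 (l, f, r) ((l', g, r') # q) = (0, l, Sw f (r + l') g, r') # shs 1 0 0 (swaps1 (l, f, r) q)"

text \<open>The interchanger of two paths, expanded as \<open>interchanger_comp_left\<close> and
  \<open>interchanger_comp_right\<close> prescribe: the layers of \<open>p\<close> cross
  \<open>q\<close> one after the other, beginning with the one applied first.\<close>

fun swaps :: "path \<Rightarrow> path \<Rightarrow> slice list" where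
  "swaps [] q = []" | "swaps (x # p) q = shs 1 0 0 (swaps p q) @ swaps1 x q"

lemma shift_simps [simp]:
  "shift l r [] = []" "shift l r ((l', g, r') # p) = (l + l', g, r' + r) # shift l r p"
  "shift l r (p @ q) = shift l r p @ shift l r q" "length (shift l r p) = length p"
  "shift l r p = [] \<longleftrightarrow> p = []"
  by (auto simp: shift_def)

lemma shift_shift [simp]: "shift l r (shift l' r' p) = shift (l + l') (r' + r) p"
  by (auto simp: shift_def)

lemma shift_0 [simp]: "shift 0 0 p = p"
  by (induction p) (auto simp: shift_def)

lemma shs_simps [simp]:
  "shs j l r [] = []" "shs j l r ((i, l', x, r') # S) = (i + j, l + l', x, r' + r) # shs j l r S"
  "shs j l r (S @ T) = shs j l r S @ shs j l r T"
  by (auto simp: shs_def)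

lemma shs_shs [simp]: "shs j l r (shs j' l' r' S) = shs (j' + j) (l + l') (r' + r) S"
  by (auto simp: shs_def)

lemma shs_0 [simp]: "shs 0 0 0 S = S"
  by (induction S) (auto simp: shs_def)

lemma wf_append: "wf_path n (p @ q) \<longleftrightarrow> wf_path n q \<and> wf_path (cd n q) p"
proof -
  have "cd n (p @ q) = cd (cd n q) p" for p by (cases p) auto
  then show ?thesis by (induction p) auto
qed

lemma cd_append [simp]: "cd n (p @ q) = cd (cd n q) p"
  by (cases p) auto

lemma cd_shift [simp]: "cd (l + n + r) (shift l r p) = l + cd n p + r"
  by (cases p) auto

lemma wf_shift: "wf_path n p \<Longrightarrow> wf_path (l + n + r) (shift l r p)"
proof (induction p)
  case (Cons x p)
  then show ?case using cd_shift[of l n r p] by (cases x) (simp del: cd_shift)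
qed simp

lemma wf_unique: "wf_path a p \<Longrightarrow> wf_path b p \<Longrightarrow> p \<noteq> [] \<Longrightarrow> a = b"
proof (induction p)
  case (Cons x p)
  then show ?case by (cases x; cases "p = []") auto
qed simp

lemma cell_wf:
  "wf_path (cdom x) (csrc x)" "wf_path (cdom x) (ctrg x)" "cd (cdom x) (csrc x) = ccod x" "cd (cdom x) (ctrg x) = ccod x"
proof -
  have "wf_path (gdom h) (gsrc h) \<and> wf_path (gdom h) (gtrg h) \<and> cd (gdom h) (gsrc h) = gcod h \<and> cd (gdom h) (gtrg h) = gcod h"
    for h by (cases h) auto
  then show "wf_path (cdom x) (csrc x)" "wf_path (cdom x) (ctrg x)" "cd (cdom x) (csrc x) = ccod x" "cd (cdom x) (ctrg x) = ccod x"
    by (cases x; auto)+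
qed

text \<open>Turns a successful test into context, redex and context with matching powers of
  \<open>\<M>\<close>; arguments about a single slice start from this splitting.\<close>

lemma appE:
  assumes "app n p (i, l, x, r) = Some p'" "wf_path n p"
  obtains p1 p2 where "p = p1 @ shift l r (csrc x) @ p2" "p' = p1 @ shift l r (ctrg x) @ p2" "i = length p1"
    "cd n p2 = l + cdom x + r" "wf_path n p2" "wf_path (l + ccod x + r) p1"
proof -
  let ?k = "length (csrc x)"
  define p1 p2 where "p1 = take i p" and "p2 = drop ?k (drop i p)"
  have 1: "i \<le> length p" "take ?k (drop i p) = shift l r (csrc x)" "cd n (drop i p) = l + ccod x + r"
    and p': "p' = p1 @ shift l r (ctrg x) @ p2"
    using assms(1) unfolding p1_def p2_def by (auto split: if_splits simp del: drop_drop)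
  have d: "drop i p = shift l r (csrc x) @ p2" using append_take_drop_id[of ?k "drop i p"] 1 unfolding p2_def by simp
  then have p: "p = p1 @ shift l r (csrc x) @ p2" using append_take_drop_id[of i p] unfolding p1_def by simp
  have i: "i = length p1" using 1 by (simp add: p1_def)
  have w: "wf_path n p2" "wf_path (cd n p2) (shift l r (csrc x))" "wf_path (cd n (drop i p)) p1"
    using assms(2) unfolding p by (auto simp: wf_append d i)
  \<comment> \<open>A nonempty source path determines its source power by itself; for an empty one
    the value comes from the last test of \<open>app\<close>.\<close>
  have c: "cd n p2 = l + cdom x + r"
  proof (cases "csrc x = []")
    case True
    then show ?thesis using 1(3) d cell_wf(3)[of x] by simp
  next
    case False
    then show ?thesis using wf_unique[OF w(2) wf_shift[OF cell_wf(1)[of x]]] by simp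
  qed
  show thesis using that[OF p p' i c w(1)] w(3) 1(3) by simp
qed

lemma appI:
  assumes "wf_path n p2" "cd n p2 = l + cdom x + r"
  shows "app n (p1 @ shift l r (csrc x) @ p2) (length p1, l, x, r) = Some (p1 @ shift l r (ctrg x) @ p2)"
  using assms cell_wf(3)[of x] by simp

lemma app_wf:
  assumes "app n p s = Some p'" "wf_path n p"
  shows "wf_path n p'" "cd n p' = cd n p"
proof -
  obtain i l x r where s: "s = (i, l, x, r)" by (cases s)
  from assms[unfolded s] obtain p1 p2 where a: "p = p1 @ shift l r (csrc x) @ p2" "p' = p1 @ shift l r (ctrg x) @ p2"
    "cd n p2 = l + cdom x + r" "wf_path n p2" "wf_path (l + ccod x + r) p1" by (rule appE)
  show "wf_path n p'" "cd n p' = cd n p"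
    using a wf_shift[OF cell_wf(2)[of x], of l r] cell_wf[of x] by (auto simp: wf_append)
qed

lemma run_wf:
  assumes "run n p S = Some q" "wf_path n p"
  shows "wf_path n q" "cd n q = cd n p"
  using assms by (induction S arbitrary: p) (auto split: option.splits simp: app_wf)

lemma run_append: "run n p (S @ T) = (case run n p S of None \<Rightarrow> None | Some q \<Rightarrow> run n q T)"
  by (induction S arbitrary: p) (auto split: option.splits)

section \<open>Interpretation of diagrams as 2-cells of a Gray monoid\<close>

primrec tpow :: "('o, 'a, 'c, 'x) gray_mon_scheme \<Rightarrow> 'o \<Rightarrow> nat \<Rightarrow> 'o" where
  "tpow B X 0 = tunit B"
| "tpow B X (Suc n) = tens0 B X (tpow B X n)"

text \<open>Only the generating 1-cells are required to be typed. Boundaries of generating 2-cells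
  are demanded later, one generator at a time, by \<open>adm\<close>.\<close>

locale diagrams = gray_monoid B for B :: "('o, 'a, 'c, 'x) gray_mon_scheme" (structure) +
  fixes X :: 'o and v1 :: "gen1 \<Rightarrow> 'a" and v2 :: "gen2 \<Rightarrow> 'c"
  assumes X_obj: "X \<in> cells0 B"
    and v1_hom: "v1 g \<in> hom1 B (tpow B X (dom_g g)) (tpow B X (cod_g g))"
begin

abbreviation P :: "nat \<Rightarrow> 'o" where "P \<equiv> tpow B X"

lemma P_obj [simp]: "P n \<in> cells0 B"
  by (induction n) (auto simp: tunit_obj X_obj tens0_obj)

lemma P_add: "P (m + n) = P m \<otimes>\<^sub>0 P n"
  by (induction m) (auto simp: tens0_unit tens0_assoc X_obj)

definition wk1 :: "nat \<Rightarrow> nat \<Rightarrow> 'a \<Rightarrow> 'a" where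
  "wk1 l r f = P l \<ltimes>\<^sub>1 (f \<rtimes>\<^sub>1 P r)"

definition wk2 :: "nat \<Rightarrow> nat \<Rightarrow> 'c \<Rightarrow> 'c" where
  "wk2 l r \<alpha> = P l \<ltimes>\<^sub>2 (\<alpha> \<rtimes>\<^sub>2 P r)"

lemma wk1_hom: "f \<in> hom1 B (P m) (P n) \<Longrightarrow> wk1 l r f \<in> hom1 B (P (l + m + r)) (P (l + n + r))"
  unfolding wk1_def P_add by (simp add: tens0_assoc ltens1_hom rtens1_hom)

lemma wk1_wk1: "f \<in> hom1 B (P m) (P n) \<Longrightarrow> wk1 l r (wk1 l' r' f) = wk1 (l + l') (r' + r) f"
  using rtens1_hom[of "P r'" f "P m" "P n"] ltens1_hom[of "P l'"] hom1_cells0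
  unfolding wk1_def P_add
  by (metis P_obj ltens1_hom rtens1_hom tens1_assoc)

lemma wk1_id: "wk1 l r (\<one>\<^sub>1 (P n)) = \<one>\<^sub>1 (P (l + n + r))"
  unfolding wk1_def P_add by (simp add: tens1_id tens0_obj tens0_assoc)

lemma wk1_comp:
  "f \<in> hom1 B (P m) (P n) \<Longrightarrow> g \<in> hom1 B (P n) (P k) \<Longrightarrow> wk1 l r (g \<odot> f) = wk1 l r g \<odot> wk1 l r f"
  unfolding wk1_def
  by (simp add: tens1_comp(2)[where X = "P m" and Y = "P n" and W = "P k"]
      tens1_comp(1)[where X = "P m \<otimes>\<^sub>0 P r" and Y = "P n \<otimes>\<^sub>0 P r" and W = "P k \<otimes>\<^sub>0 P r"] rtens1_hom)

lemma wk1_0: "f \<in> hom1 B Y Z \<Longrightarrow> wk1 0 0 f = f"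
  unfolding wk1_def by (simp add: tens1_unit hom1_cells0)

lemma wk2_in2:
  "in2 \<alpha> f g (P m) (P n) \<Longrightarrow> in2 (wk2 l r \<alpha>) (wk1 l r f) (wk1 l r g) (P (l + m + r)) (P (l + n + r))"
  unfolding wk1_def wk2_def P_add by (simp add: tens0_assoc in2_ltens in2_rtens)

lemma wk2_wk2:
  assumes "in2 \<alpha> f g (P m) (P n)"
  shows "wk2 l r (wk2 l' r' \<alpha>) = wk2 (l + l') (r' + r) \<alpha>"
proof -
  note i1 = in2_rtens[OF P_obj assms, of r']
  note i2 = in2_rtens[OF P_obj i1, of r]
  show ?thesis
    unfolding wk2_def P_add
    using tens2_assoc[OF P_obj P_obj in2_cells(1)[OF assms], of r' r]
      tens2_assoc[OF P_obj P_obj in2_cells(1)[OF i1], of l' r]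
      tens2_assoc[OF P_obj P_obj in2_cells(1)[OF i2], of l l'] by simp
qed

lemma wk2_id: "f \<in> hom1 B (P m) (P n) \<Longrightarrow> wk2 l r (\<one>\<^sub>2 f) = \<one>\<^sub>2 (wk1 l r f)"
  unfolding wk1_def wk2_def using rtens1_hom[of "P r" f "P m" "P n"] by (simp add: tens2_id hom1_cells0)

lemma wk2_vcomp:
  assumes "in2 \<alpha> f g (P m) (P n)" "in2 \<beta> g h (P m) (P n)"
  shows "wk2 l r (\<beta> \<cdot> \<alpha>) = wk2 l r \<beta> \<cdot> wk2 l r \<alpha>"
  unfolding wk2_def
  by (simp add: tens2_vcomp(2)[OF P_obj assms] tens2_vcomp(1)[OF P_obj in2_rtens[OF P_obj assms(1)] in2_rtens[OF P_obj assms(2)]])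

lemma wk2_hcomp:
  assumes "in2 \<alpha> f f' (P m) (P n)" "in2 \<beta> g g' (P n) (P k)"
  shows "wk2 l r (\<beta> \<star> \<alpha>) = wk2 l r \<beta> \<star> wk2 l r \<alpha>"
  unfolding wk2_def
  by (simp add: tens2_hcomp(2)[OF P_obj assms] tens2_hcomp(1)[OF P_obj in2_rtens[OF P_obj assms(1)] in2_rtens[OF P_obj assms(2)]])

lemma wk2_0: "in2 \<alpha> f g Y Z \<Longrightarrow> wk2 0 0 \<alpha> = \<alpha>"
  unfolding wk2_def by (simp add: tens2_unit in2_cells)

fun lay :: "layer \<Rightarrow> 'a" where
  "lay (l, g, r) = wk1 l r (v1 g)"

fun pth :: "nat \<Rightarrow> path \<Rightarrow> 'a" where
  "pth n [] = \<one>\<^sub>1 (P n)"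
| "pth n (x # p) = lay x \<odot> pth n p"

lemma lay_hom: "lay (l, g, r) \<in> hom1 B (P (l + dom_g g + r)) (P (l + cod_g g + r))"
  by (simp add: wk1_hom v1_hom)

lemma pth_hom: "wf_path n p \<Longrightarrow> pth n p \<in> hom1 B (P n) (P (cd n p))"
proof (induction p)
  case (Cons x p)
  obtain l g r where x: "x = (l, g, r)" by (cases x)
  from Cons x comp1_hom[OF _ lay_hom[of l g r], of "pth n p" "P n"] show ?case by simp
qed (simp add: id1_hom)

lemma pth_append:
  "wf_path n (p @ q) \<Longrightarrow> pth n (p @ q) = pth (cd n q) p \<odot> pth n q"
proof (induction p)
  case Nil
  then show ?case using comp1_id_left[OF pth_hom[of n q]] by simp
next
  case (Cons x p)
  obtain l g r where x: "x = (l, g, r)" by (cases x)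
  have w: "wf_path n q" "wf_path (cd n q) p" "cd (cd n q) p = l + dom_g g + r"
    using Cons.prems x by (auto simp: wf_append)
  have "pth n ((x # p) @ q) = lay x \<odot> (pth (cd n q) p \<odot> pth n q)" using Cons x w by (simp add: wf_append)
  also have "\<dots> = (lay x \<odot> pth (cd n q) p) \<odot> pth n q"
    using comp1_assoc[OF pth_hom[OF w(1)] pth_hom[OF w(2)], of "lay x"] lay_hom[of l g r] w x by simp
  finally show ?case by simp
qed

lemma pth_shift: "wf_path n p \<Longrightarrow> pth (l + n + r) (shift l r p) = wk1 l r (pth n p)"
proof (induction p)
  case Nil
  then show ?case by (simp add: wk1_id)
next
  case (Cons x p)
  obtain l' g r' where x: "x = (l', g, r')" by (cases x)
  have w: "wf_path n p" "cd n p = l' + dom_g g + r'" using Cons.prems x by auto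
  have "wk1 l r (lay x \<odot> pth n p) = wk1 l r (lay x) \<odot> wk1 l r (pth n p)"
    using wk1_comp[OF pth_hom[OF w(1)], of "lay x"] lay_hom[of l' g r'] w x by simp
  then show ?case using Cons x w by (simp add: wk1_wk1[OF v1_hom])
qed

fun cv :: "cell \<Rightarrow> 'c" where
  "cv (Gen h) = v2 h"
| "cv (Sw f k g) = \<Sigma> (v1 f) (P k \<ltimes>\<^sub>1 v1 g)"
| "cv (Si f k g) = inv2 B (\<Sigma> (v1 f) (P k \<ltimes>\<^sub>1 v1 g))"

fun adm :: "cell \<Rightarrow> bool" where
  "adm (Gen h) \<longleftrightarrow> v2 h \<in> hom2 B (pth (gdom h) (gsrc h)) (pth (gdom h) (gtrg h))"
| "adm (Sw f k g) \<longleftrightarrow> True"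
| "adm (Si f k g) \<longleftrightarrow> True"

lemma Pk_hom: "P k \<ltimes>\<^sub>1 v1 g \<in> hom1 B (P (k + dom_g g)) (P (k + cod_g g))"
  by (simp add: P_add ltens1_hom v1_hom)

text \<open>The layers of a crossing carry idle strands, whereas the interchanger acts on whole
  1-cells; strict associativity and unitality of the tensor actions identify the two
  boundaries.\<close>

lemma Sw_in2:
  "in2 (cv (Sw f k g)) (pth (cdom (Sw f k g)) (csrc (Sw f k g))) (pth (cdom (Sw f k g)) (ctrg (Sw f k g)))
    (P (cdom (Sw f k g))) (P (ccod (Sw f k g)))"
proof -
  have a: "wk1 (dom_g f + k) 0 (v1 g) = P (dom_g f) \<ltimes>\<^sub>1 (P k \<ltimes>\<^sub>1 v1 g)"
    "wk1 (cod_g f + k) 0 (v1 g) = P (cod_g f) \<ltimes>\<^sub>1 (P k \<ltimes>\<^sub>1 v1 g)"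
    unfolding wk1_def by (simp_all add: P_add tens1_unit tens1_assoc hom1_cells0[OF v1_hom])
  have b: "wk1 0 r (v1 f) = v1 f \<rtimes>\<^sub>1 P r" for r
    using hom1_cells0[OF rtens1_hom[OF P_obj v1_hom]] unfolding wk1_def by (simp add: tens1_unit)
  have h: "pth n [(l, x, r), (l', y, r')] = lay (l, x, r) \<odot> lay (l', y, r')" if "n = l' + dom_g y + r'" for n l x r l' y r'
    using comp1_id_right[OF lay_hom[of l' y r']] that by simp
  have s: "\<Sigma> (v1 f) (P k \<ltimes>\<^sub>1 v1 g) \<in> hom2 B (pth (cdom (Sw f k g)) (csrc (Sw f k g))) (pth (cdom (Sw f k g)) (ctrg (Sw f k g)))"
    using interchanger_hom[OF v1_hom[of f] Pk_hom[of k g]] by (simp add: h a b del: pth.simps)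
  show ?thesis
    using in2I[OF s pth_hom] cell_wf(1,3)[of "Sw f k g"] by (simp add: add.assoc)
qed

lemma cell_in2:
  assumes "adm x"
  shows "in2 (cv x) (pth (cdom x) (csrc x)) (pth (cdom x) (ctrg x)) (P (cdom x)) (P (ccod x))"
proof (cases x)
  case (Gen h)
  then show ?thesis using in2I[of "v2 h" _ _ "P (gdom h)"] pth_hom[of "gdom h" "gsrc h"] cell_wf(1,3)[of x] assms by simp
next
  case (Sw f k g)
  then show ?thesis using Sw_in2 by blast
next
  case (Si f k g)
  show ?thesis using inv2_inverse(1)[OF interchanger_invertible Sw_in2[of f k g, simplified cv.simps]]
    unfolding Si by (simp add: hom1_cells0[OF v1_hom] hom1_cells0[OF Pk_hom])
qed

lemma Si_inverse:
  "cv (Si f k g) \<cdot> cv (Sw f k g) = \<one>\<^sub>2 (pth (cdom (Sw f k g)) (csrc (Sw f k g)))"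
  "cv (Sw f k g) \<cdot> cv (Si f k g) = \<one>\<^sub>2 (pth (cdom (Sw f k g)) (ctrg (Sw f k g)))"
  using inv2_inverse(2,3)[OF interchanger_invertible Sw_in2[of f k g, simplified cv.simps]]
  by (simp_all add: hom1_cells0[OF v1_hom] hom1_cells0[OF Pk_hom])

fun sv :: "nat \<Rightarrow> path \<Rightarrow> slice \<Rightarrow> 'c" where
  "sv n p (i, l, x, r) =
    \<one>\<^sub>2 (pth (l + ccod x + r) (take i p)) \<star> (wk2 l r (cv x) \<star> \<one>\<^sub>2 (pth n (drop (i + length (csrc x)) p)))"

text \<open>Whenever \<open>run\<close> succeeds on the diagram, \<open>the\<close> is applied only
  to values of the form \<open>Some q\<close>.\<close>

fun sem :: "nat \<Rightarrow> path \<Rightarrow> slice list \<Rightarrow> 'c" where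
  "sem n p [] = \<one>\<^sub>2 (pth n p)"
| "sem n p (s # S) = sem n (the (app n p s)) S \<cdot> sv n p s"

definition adms :: "slice list \<Rightarrow> bool" where
  "adms S \<longleftrightarrow> list_all (\<lambda>(i, l, x, r). adm x) S"

lemma adms_simps [simp]:
  "adms []" "adms ((i, l, x, r) # S) \<longleftrightarrow> adm x \<and> adms S" "adms (S @ T) \<longleftrightarrow> adms S \<and> adms T"
  "adms (shs j l r S) \<longleftrightarrow> adms S"
proof -
  show "adms (shs j l r S) \<longleftrightarrow> adms S" unfolding adms_def by (induction S) auto
qed (simp_all add: adms_def)

lemma cell_wk_in2:
  assumes "adm x"
  shows "in2 (wk2 l r (cv x)) (pth (l + cdom x + r) (shift l r (csrc x))) (pth (l + cdom x + r) (shift l r (ctrg x)))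
    (P (l + cdom x + r)) (P (l + ccod x + r))"
  using wk2_in2[OF cell_in2[OF assms]] by (simp add: pth_shift cell_wf)

lemma pth_mid:
  assumes "cd n p2 = l + cdom x + r" "wf_path n p2" "wf_path (l + ccod x + r) p1"
  shows "pth n (p1 @ shift l r (csrc x) @ p2) = pth (l + ccod x + r) p1 \<odot> (pth (l + cdom x + r) (shift l r (csrc x)) \<odot> pth n p2)"
    "pth n (p1 @ shift l r (ctrg x) @ p2) = pth (l + ccod x + r) p1 \<odot> (pth (l + cdom x + r) (shift l r (ctrg x)) \<odot> pth n p2)"
  using assms wf_shift[OF cell_wf(1)[of x], of l r] wf_shift[OF cell_wf(2)[of x], of l r]
  by (simp_all add: pth_append wf_append cell_wf)

lemma sv_eq:
  "sv n (p1 @ shift l r (csrc x) @ p2) (length p1, l, x, r) =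
    \<one>\<^sub>2 (pth (l + ccod x + r) p1) \<star> (wk2 l r (cv x) \<star> \<one>\<^sub>2 (pth n p2))"
  by simp

lemma sv_in2:
  assumes "app n p (i, l, x, r) = Some p'" "wf_path n p" "adm x"
  shows "in2 (sv n p (i, l, x, r)) (pth n p) (pth n p') (P n) (P (cd n p))"
proof -
  from assms(1,2) obtain p1 p2 where a: "p = p1 @ shift l r (csrc x) @ p2" "p' = p1 @ shift l r (ctrg x) @ p2"
    "i = length p1" "cd n p2 = l + cdom x + r" "wf_path n p2" "wf_path (l + ccod x + r) p1" by (rule appE)
  have h: "pth n p2 \<in> hom1 B (P n) (P (l + cdom x + r))" using pth_hom[OF a(5)] a by simp
  have h1: "pth (l + ccod x + r) p1 \<in> hom1 B (P (l + ccod x + r)) (P (cd n p))"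
    using pth_hom[OF a(6)] a by (simp add: cell_wf)
  show ?thesis unfolding a(3) unfolding a(1,2) sv_eq pth_mid[OF a(4-6)]
    using in2_hcomp[OF in2_hcomp[OF in2_id[OF h] cell_wk_in2[OF assms(3)]] in2_id[OF h1]] a(1) by simp
qed

lemma sem_in2:
  assumes "run n p S = Some q" "wf_path n p" "adms S"
  shows "in2 (sem n p S) (pth n p) (pth n q) (P n) (P (cd n p))"
  using assms
proof (induction S arbitrary: p)
  case Nil
  then show ?case using in2_id[OF pth_hom] by simp
next
  case (Cons s S)
  obtain i l x r where s: "s = (i, l, x, r)" by (cases s)
  from Cons.prems obtain p' where p': "app n p s = Some p'" "run n p' S = Some q" by (auto split: option.splits)
  note w = app_wf[OF p'(1) Cons.prems(2)]
  have "in2 (sem n p' S) (pth n p') (pth n q) (P n) (P (cd n p))"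
    using Cons.IH[OF p'(2) w(1)] w Cons.prems s by simp
  from in2_vcomp[OF sv_in2[OF p'(1)[unfolded s] Cons.prems(2)] this] show ?case using p' Cons.prems s by simp
qed

lemma sem_append:
  assumes "run n p S = Some q" "run n q T = Some q'" "wf_path n p" "adms S" "adms T"
  shows "sem n p (S @ T) = sem n q T \<cdot> sem n p S"
  using assms
proof (induction S arbitrary: p)
  case Nil
  then show ?case using v_id(2)[OF sem_in2[of n q T q']] by simp
next
  case (Cons s S)
  obtain i l x r where s: "s = (i, l, x, r)" by (cases s)
  from Cons.prems obtain p' where p': "app n p s = Some p'" "run n p' S = Some q" by (auto split: option.splits)
  note w = app_wf[OF p'(1) Cons.prems(3)]
  have adm: "adm x" "adms S" using Cons.prems s by auto
  note i1 = sv_in2[OF p'(1)[unfolded s] Cons.prems(3) adm(1)]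
  note i2 = sem_in2[OF p'(2) w(1) adm(2)]
  have wq: "wf_path n q" "cd n q = cd n p" using run_wf[OF p'(2) w(1)] w by auto
  note i3 = sem_in2[OF Cons.prems(2) wq(1) Cons.prems(5)]
  have "sem n p ((s # S) @ T) = (sem n q T \<cdot> sem n p' S) \<cdot> sv n p s"
    using Cons.IH[OF p'(2) Cons.prems(2) w(1) adm(2) Cons.prems(5)] p' by simp
  also have "\<dots> = sem n q T \<cdot> (sem n p' S \<cdot> sv n p s)"
    using v_assoc[OF i1 i2[unfolded w(2)] i3[unfolded wq(2)]] s by simp
  finally show ?case using p' by simp
qed

lemma ctx_vcomp:
  assumes "f \<in> hom1 B Y Z" "g \<in> hom1 B W V" "in2 \<alpha> a b V Y" "in2 \<beta> b c V Y"
  shows "\<one>\<^sub>2 f \<star> ((\<beta> \<cdot> \<alpha>) \<star> \<one>\<^sub>2 g) = (\<one>\<^sub>2 f \<star> (\<beta> \<star> \<one>\<^sub>2 g)) \<cdot> (\<one>\<^sub>2 f \<star> (\<alpha> \<star> \<one>\<^sub>2 g))"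
proof -
  note g = in2_id[OF assms(2)] and f = in2_id[OF assms(1)]
  have "(\<beta> \<cdot> \<alpha>) \<star> \<one>\<^sub>2 g = (\<beta> \<star> \<one>\<^sub>2 g) \<cdot> (\<alpha> \<star> \<one>\<^sub>2 g)"
    using vh_interchange[OF g g assms(3,4)] v_id(1)[OF g] by simp
  then show ?thesis
    using vh_interchange[OF in2_hcomp[OF g assms(3)] in2_hcomp[OF g assms(4)] f f] v_id(1)[OF f] by simp
qed

lemma id_ctx:
  assumes "f \<in> hom1 B Y Z" "g \<in> hom1 B W V" "a \<in> hom1 B V Y"
  shows "\<one>\<^sub>2 f \<star> (\<one>\<^sub>2 a \<star> \<one>\<^sub>2 g) = \<one>\<^sub>2 (f \<odot> (a \<odot> g))"
  using assms by (simp add: hcomp_id2[OF assms(2,3)] hcomp_id2[OF comp1_hom[OF assms(2,3)] assms(1)])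

lemma ctx_ctx:
  assumes "f \<in> hom1 B Y Z" "g \<in> hom1 B W V" "f' \<in> hom1 B Y' Y" "g' \<in> hom1 B V V'" "in2 \<alpha> a b V' Y'"
  shows "\<one>\<^sub>2 f \<star> ((\<one>\<^sub>2 f' \<star> (\<alpha> \<star> \<one>\<^sub>2 g')) \<star> \<one>\<^sub>2 g) = \<one>\<^sub>2 (f \<odot> f') \<star> (\<alpha> \<star> \<one>\<^sub>2 (g' \<odot> g))"
proof -
  note i = in2_id[OF assms(1)] in2_id[OF assms(2)] in2_id[OF assms(3)] in2_id[OF assms(4)]
  have "(\<one>\<^sub>2 f' \<star> (\<alpha> \<star> \<one>\<^sub>2 g')) \<star> \<one>\<^sub>2 g = \<one>\<^sub>2 f' \<star> (\<alpha> \<star> \<one>\<^sub>2 (g' \<odot> g))"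
    using h_assoc[OF i(2) in2_hcomp[OF i(4) assms(5)] i(3)] h_assoc[OF i(2,4) assms(5)] hcomp_id2[OF assms(2,4)] by simp
  then show ?thesis
    using h_assoc[OF in2_hcomp[OF in2_hcomp[OF i(2,4)] assms(5)] i(3,1)] hcomp_id2[OF assms(3,1)] hcomp_id2[OF assms(2,4)]
    by simp
qed

text \<open>Whiskering a slice only lengthens its context: by strict functoriality the inner and
  outer contexts compose to segments of the larger path.\<close>

lemma wk_ctx:
  assumes "wf_path n0 (a1 @ shift l' r' (csrc x) @ a2)" "cd n0 a2 = l' + cdom x + r'" "adm x"
    "wf_path n p2" "cd n p2 = l + n0 + r" "wf_path (l + cd n0 (a1 @ shift l' r' (csrc x) @ a2) + r) p1"
  shows "sv n (p1 @ shift l r (a1 @ shift l' r' (csrc x) @ a2) @ p2) (length p1 + length a1, l + l', x, r' + r) =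
    \<one>\<^sub>2 (pth (l + cd n0 (a1 @ shift l' r' (csrc x) @ a2) + r) p1) \<star>
      (wk2 l r (sv n0 (a1 @ shift l' r' (csrc x) @ a2) (length a1, l', x, r')) \<star> \<one>\<^sub>2 (pth n p2))"
proof -
  let ?d = "l' + ccod x + r'"
  have w: "wf_path n0 a2" "wf_path ?d a1" using assms(1,2) by (auto simp: wf_append cell_wf)
  have c: "cd n0 (a1 @ shift l' r' (csrc x) @ a2) = cd ?d a1" using assms(2) by (simp add: cell_wf)
  have wp1: "wf_path (l + cd ?d a1 + r) p1" using assms(6) c by simp
  have h1: "pth ?d a1 \<in> hom1 B (P ?d) (P (cd ?d a1))" by (rule pth_hom[OF w(2)])
  have h2: "pth n0 a2 \<in> hom1 B (P n0) (P (l' + cdom x + r'))" using pth_hom[OF w(1)] assms(2) by simp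
  have h3: "pth (l + cd ?d a1 + r) p1 \<in> hom1 B (P (l + cd ?d a1 + r)) (P (cd (l + cd ?d a1 + r) p1))"
    by (rule pth_hom[OF wp1])
  have h4: "pth n p2 \<in> hom1 B (P n) (P (l + n0 + r))" using pth_hom[OF assms(4)] assms(5) by simp
  note ix = cell_wk_in2[OF assms(3), of l' r']
  have e1: "pth (l + ?d + r) (p1 @ shift l r a1) = pth (l + cd ?d a1 + r) p1 \<odot> wk1 l r (pth ?d a1)"
    using pth_append[of "l + ?d + r" p1 "shift l r a1"] wp1 w wf_shift[OF w(2), of l r]
    by (simp add: wf_append pth_shift)
  have e2: "pth n (shift l r a2 @ p2) = wk1 l r (pth n0 a2) \<odot> pth n p2"
    using pth_append[of n "shift l r a2" p2] w wf_shift[OF w(1), of l r] assms by (simp add: wf_append pth_shift)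
  have "wk2 l r (sv n0 (a1 @ shift l' r' (csrc x) @ a2) (length a1, l', x, r'))
      = \<one>\<^sub>2 (wk1 l r (pth ?d a1)) \<star> (wk2 (l + l') (r' + r) (cv x) \<star> \<one>\<^sub>2 (wk1 l r (pth n0 a2)))"
    unfolding sv_eq
    using wk2_hcomp[OF in2_hcomp[OF in2_id[OF h2] ix] in2_id[OF h1]] wk2_hcomp[OF in2_id[OF h2] ix]
    by (simp add: wk2_id[OF h1] wk2_id[OF h2] wk2_wk2[OF cell_in2[OF assms(3)]])
  moreover have "sv n (p1 @ shift l r (a1 @ shift l' r' (csrc x) @ a2) @ p2) (length p1 + length a1, l + l', x, r' + r) =
    \<one>\<^sub>2 (pth (l + ?d + r) (p1 @ shift l r a1)) \<star> (wk2 (l + l') (r' + r) (cv x) \<star> \<one>\<^sub>2 (pth n (shift l r a2 @ p2)))"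
    using sv_eq[of n "p1 @ shift l r a1" "l + l'" "r' + r" x "shift l r a2 @ p2"] by (simp add: add.assoc)
  ultimately show ?thesis
    unfolding e1 e2 c
    using ctx_ctx[OF h3 h4 wk1_hom[OF h1] wk1_hom[OF h2], of "wk2 (l + l') (r' + r) (cv x)"]
      wk2_in2[OF ix, of l r] by (simp add: wk2_wk2[OF cell_in2[OF assms(3)]])
qed

text \<open>This makes local rewriting legitimate: an equation between diagrams can be inserted at
  any place of a larger diagram by renumbering its slices.\<close>

lemma whisker:
  assumes "run n0 p0 S = Some q0" "wf_path n0 p0" "wf_path n p2" "cd n p2 = l + n0 + r"
    "wf_path (l + cd n0 p0 + r) p1"
  shows "run n (p1 @ shift l r p0 @ p2) (shs (length p1) l r S) = Some (p1 @ shift l r q0 @ p2)"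
    and "adms S \<Longrightarrow> sem n (p1 @ shift l r p0 @ p2) (shs (length p1) l r S) =
      \<one>\<^sub>2 (pth (l + cd n0 p0 + r) p1) \<star> (wk2 l r (sem n0 p0 S) \<star> \<one>\<^sub>2 (pth n p2))"
proof -
  have "run n (p1 @ shift l r p0 @ p2) (shs (length p1) l r S) = Some (p1 @ shift l r q0 @ p2) \<and>
    (adms S \<longrightarrow> sem n (p1 @ shift l r p0 @ p2) (shs (length p1) l r S) =
      \<one>\<^sub>2 (pth (l + cd n0 p0 + r) p1) \<star> (wk2 l r (sem n0 p0 S) \<star> \<one>\<^sub>2 (pth n p2)))"
    using assms
  proof (induction S arbitrary: p0)
    case Nil
    have h1: "pth (l + cd n0 p0 + r) p1 \<in> hom1 B (P (l + cd n0 p0 + r)) (P (cd (l + cd n0 p0 + r) p1))"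
      by (rule pth_hom[OF Nil(5)])
    have h2: "pth n p2 \<in> hom1 B (P n) (P (l + n0 + r))" using pth_hom[OF Nil(3)] Nil(4) by simp
    note h3 = wk1_hom[OF pth_hom[OF Nil(2)], of l r]
    have q: "q0 = p0" using Nil(1) by simp
    have "sem n (p1 @ shift l r p0 @ p2) [] = \<one>\<^sub>2 (pth (l + cd n0 p0 + r) p1 \<odot> (wk1 l r (pth n0 p0) \<odot> pth n p2))"
      using Nil(2-5) by (simp add: pth_append wf_append wf_shift pth_shift)
    then show ?case using id_ctx[OF h1 h2 h3] unfolding q by (simp add: wk2_id[OF pth_hom[OF Nil(2)]])
  next
    case (Cons s S)
    obtain i l' x r' where s: "s = (i, l', x, r')" by (cases s)
    from Cons.prems obtain p' where p': "app n0 p0 s = Some p'" "run n0 p' S = Some q0" by (auto split: option.splits)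
    note w = app_wf[OF p'(1) Cons.prems(2)]
    from p'(1)[unfolded s] Cons.prems(2) obtain a1 a2 where a: "p0 = a1 @ shift l' r' (csrc x) @ a2" "p' = a1 @ shift l' r' (ctrg x) @ a2"
      "i = length a1" "cd n0 a2 = l' + cdom x + r'" "wf_path n0 a2" "wf_path (l' + ccod x + r') a1" by (rule appE)
    have IH: "run n (p1 @ shift l r p' @ p2) (shs (length p1) l r S) = Some (p1 @ shift l r q0 @ p2)"
      "adms S \<Longrightarrow> sem n (p1 @ shift l r p' @ p2) (shs (length p1) l r S) =
      \<one>\<^sub>2 (pth (l + cd n0 p' + r) p1) \<star> (wk2 l r (sem n0 p' S) \<star> \<one>\<^sub>2 (pth n p2))"
      using Cons.IH[OF p'(2) w(1) Cons.prems(3,4)] Cons.prems(5) w(2) by auto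
    have wf2: "wf_path n (shift l r a2 @ p2)" "cd n (shift l r a2 @ p2) = (l + l') + cdom x + (r' + r)"
      using wf_shift[OF a(5), of l r] Cons.prems(3,4) a(4) by (auto simp: wf_append)
    have ap: "app n (p1 @ shift l r p0 @ p2) (i + length p1, l + l', x, r' + r) = Some (p1 @ shift l r p' @ p2)"
      using appI[OF wf2, of "p1 @ shift l r a1"] unfolding a by (simp add: add.commute)
    show ?case
    proof (intro conjI impI)
      show "run n (p1 @ shift l r p0 @ p2) (shs (length p1) l r (s # S)) = Some (p1 @ shift l r q0 @ p2)"
        using ap IH(1) s by (simp del: app.simps)
      assume adm: "adms (s # S)"
      then have "adm x" "adms S" using s by auto
      have v: "sv n (p1 @ shift l r p0 @ p2) (i + length p1, l + l', x, r' + r) =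
          \<one>\<^sub>2 (pth (l + cd n0 p0 + r) p1) \<star> (wk2 l r (sv n0 p0 s) \<star> \<one>\<^sub>2 (pth n p2))"
        using wk_ctx[of n0 a1 l' r' x a2 n p2 l r p1] Cons.prems a s \<open>adm x\<close> by (simp add: add.commute del: sv.simps)
      note h1 = pth_hom[OF Cons.prems(5)]
      have h2: "pth n p2 \<in> hom1 B (P n) (P (l + n0 + r))" using pth_hom[OF Cons.prems(3)] Cons.prems(4) by simp
      have i1: "in2 (sv n0 p0 s) (pth n0 p0) (pth n0 p') (P n0) (P (cd n0 p0))"
        using sv_in2[OF p'(1)[unfolded s] Cons.prems(2) \<open>adm x\<close>] s by simp
      have i2: "in2 (sem n0 p' S) (pth n0 p') (pth n0 q0) (P n0) (P (cd n0 p0))"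
        using sem_in2[OF p'(2) w(1) \<open>adms S\<close>] w by simp
      show "sem n (p1 @ shift l r p0 @ p2) (shs (length p1) l r (s # S)) =
        \<one>\<^sub>2 (pth (l + cd n0 p0 + r) p1) \<star> (wk2 l r (sem n0 p0 (s # S)) \<star> \<one>\<^sub>2 (pth n p2))"
        using ap IH(2)[OF \<open>adms S\<close>] v s p'(1) w(2) ctx_vcomp[OF h1 h2 wk2_in2[OF i1] wk2_in2[OF i2]]
        by (simp add: wk2_vcomp[OF i1[unfolded s] i2] del: app.simps sv.simps)
    qed
  qed
  then show "run n (p1 @ shift l r p0 @ p2) (shs (length p1) l r S) = Some (p1 @ shift l r q0 @ p2)"
    and "adms S \<Longrightarrow> sem n (p1 @ shift l r p0 @ p2) (shs (length p1) l r S) =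
      \<one>\<^sub>2 (pth (l + cd n0 p0 + r) p1) \<star> (wk2 l r (sem n0 p0 S) \<star> \<one>\<^sub>2 (pth n p2))" by auto
qed

end

type_synonym rule = "nat \<times> path \<times> slice list \<times> slice list"

section \<open>Interchangers of composite paths\<close>

context diagrams
begin

lemma pth_single: "n = l + dom_g g + r \<Longrightarrow> pth n [(l, g, r)] = lay (l, g, r)"
  using comp1_id_right[OF lay_hom[of l g r]] by simp

lemma wk1_left: "f \<in> hom1 B Y Z \<Longrightarrow> wk1 l 0 f = P l \<ltimes>\<^sub>1 f"
  unfolding wk1_def by (simp add: tens1_unit hom1_cells0)

lemma wk1_right: "f \<in> hom1 B Y Z \<Longrightarrow> wk1 0 r f = f \<rtimes>\<^sub>1 P r"
  using hom1_cells0(1)[OF rtens1_hom[OF P_obj, of f Y Z r]] unfolding wk1_def by (simp add: tens1_unit)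

lemma wk2_left: "in2 \<alpha> f g Y Z \<Longrightarrow> wk2 l 0 \<alpha> = P l \<ltimes>\<^sub>2 \<alpha>"
  unfolding wk2_def by (simp add: tens2_unit in2_cells)

lemma wk2_right: "in2 \<alpha> f g Y Z \<Longrightarrow> wk2 0 r \<alpha> = \<alpha> \<rtimes>\<^sub>2 P r"
  using in2_cells(1)[OF in2_rtens[OF P_obj, of \<alpha> f g Y Z r]] unfolding wk2_def by (simp add: tens2_unit)

text \<open>Two parts of \<open>interchanger_tens\<close> take the outer strands \<open>l\<close>
  and \<open>r'\<close> out of the interchanger, and the third passes the strands between the two
  cells from one argument to the other. This is the origin of the gap \<open>k\<close> in
  \<open>Sw f k g\<close>.\<close>

lemma interchanger_wk:
  "wk2 l r' (\<Sigma> (v1 f) (P (r + l') \<ltimes>\<^sub>1 v1 g)) = \<Sigma> (lay (l, f, r)) (lay (l', g, r'))"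
proof -
  note f = hom1_cells0(1)[OF v1_hom[of f]] hom1_cells0(1)[OF rtens1_hom[OF P_obj v1_hom], of f r]
  note g = hom1_cells0(1)[OF v1_hom[of g]] hom1_cells0(1)[OF rtens1_hom[OF P_obj v1_hom], of g r']
    hom1_cells0(1)[OF Pk_hom, of "r + l'" g] hom1_cells0(1)[OF lay_hom, of l' g r']
  have "\<Sigma> (v1 f) (P (r + l') \<ltimes>\<^sub>1 v1 g) \<rtimes>\<^sub>2 P r' = \<Sigma> (v1 f) (P (r + l') \<ltimes>\<^sub>1 (v1 g \<rtimes>\<^sub>1 P r'))"
    using interchanger_tens[OF P_obj f(1) g(3), of r'] tens1_assoc[OF P_obj P_obj g(1), of "r + l'" r'] by simp
  also have "\<dots> = \<Sigma> (v1 f) (P r \<ltimes>\<^sub>1 lay (l', g, r'))"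
    using tens1_assoc[OF P_obj P_obj g(2), of r l'] by (simp add: P_add wk1_def)
  also have "\<dots> = \<Sigma> (v1 f \<rtimes>\<^sub>1 P r) (lay (l', g, r'))" using interchanger_tens[OF P_obj f(1) g(4), of r] by simp
  finally show ?thesis using interchanger_tens[OF P_obj f(2) g(4), of l] by (simp add: wk2_def wk1_def)
qed

lemma swaps1_sem:
  assumes "wf_path b q"
  shows "run (l + dom_g f + r + b) ((l, f, r + cd b q) # shift (l + dom_g f + r) 0 q) (swaps1 (l, f, r) q) =
      Some (shift (l + cod_g f + r) 0 q @ [(l, f, r + b)]) \<and>
    sem (l + dom_g f + r + b) ((l, f, r + cd b q) # shift (l + dom_g f + r) 0 q) (swaps1 (l, f, r) q) =
      \<Sigma> (lay (l, f, r)) (pth b q)"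
  using assms
proof (induction q)
  case Nil
  have "pth (l + dom_g f + r + b) [(l, f, r + b)] = lay (l, f, r) \<rtimes>\<^sub>1 P b"
    using pth_single[of "l + dom_g f + r + b" l f "r + b"] wk1_wk1[OF v1_hom, of 0 b l r f] wk1_right[OF lay_hom[of l f r], of b]
    by (simp add: add.assoc)
  then show ?case using interchanger_id_right[OF hom1_cells0(1)[OF lay_hom[of l f r]] P_obj, of b] by simp
next
  case (Cons y q)
  obtain l' g r' where y: "y = (l', g, r')" by (cases y)
  let ?a = "l + dom_g f + r" and ?c = "l + cod_g f + r"
  have w: "wf_path b q" "cd b q = l' + dom_g g + r'" using Cons.prems y by auto
  let ?p = "(l, f, r + cd b q) # shift ?a 0 q"
  let ?p1 = "[(?c + l', g, r')]"
  note IH = Cons.IH[OF w(1)]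
  have wq: "wf_path (?a + b) (shift ?a 0 q)" "cd (?a + b) (shift ?a 0 q) = ?a + cd b q"
    using wf_shift[OF w(1), of ?a 0] cd_shift[of ?a b 0 q] by (simp_all del: cd_shift)
  have wp: "wf_path (?a + b) ?p" using wq w by simp
  have ap: "app (?a + b) ((l, f, r + cd b (y # q)) # shift ?a 0 (y # q)) (0, l, Sw f (r + l') g, r') = Some (?p1 @ ?p)"
    using appI[of "?a + b" "shift ?a 0 q" l "Sw f (r + l') g" r' "[]"] wq w y by (simp add: ac_simps del: app.simps)
  have w1: "wf_path (0 + cd (?a + b) ?p + 0) ?p1" using w y by simp
  note wh = whisker[of "?a + b" ?p "swaps1 (l, f, r) q" _ "?a + b" "[]" 0 0 ?p1, OF IH[THEN conjunct1] wp _ _ w1, simplified]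
  have r: "run (?a + b) ((l, f, r + cd b (y # q)) # shift ?a 0 (y # q)) (swaps1 (l, f, r) (y # q)) =
      Some (shift ?c 0 (y # q) @ [(l, f, r + b)])"
    using ap wh(1) y by (simp del: app.simps)
  have h: "lay (l, f, r) \<in> hom1 B (P ?a) (P ?c)" "pth b q \<in> hom1 B (P b) (P (l' + dom_g g + r'))"
    "lay (l', g, r') \<in> hom1 B (P (l' + dom_g g + r')) (P (l' + cod_g g + r'))"
    using lay_hom pth_hom[OF w(1)] w by (auto simp del: lay.simps)
  have ad: "adms (swaps1 (l, f, r) q')" for q'
    by (induction q') (auto split: prod.splits)
  have i: "in2 (\<Sigma> (lay (l, f, r)) (pth b q)) (pth (?a + b) ?p) (pth (?a + b) (shift ?c 0 q @ [(l, f, r + b)])) (P (?a + b)) (P (cd (?a + b) ?p))"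
    using sem_in2[OF IH[THEN conjunct1] wp ad] IH by simp
  have s1: "sem (?a + b) (?p1 @ ?p) (shs 1 0 0 (swaps1 (l, f, r) q)) = \<one>\<^sub>2 (P ?c \<ltimes>\<^sub>1 lay (l', g, r')) \<star> \<Sigma> (lay (l, f, r)) (pth b q)"
  proof -
    have "pth (?c + cd b q) ?p1 = P ?c \<ltimes>\<^sub>1 lay (l', g, r')"
      using pth_single[of "?c + cd b q" "?c + l'" g r'] wk1_wk1[OF v1_hom, of ?c 0 l' r' g] wk1_left[OF lay_hom[of l' g r'], of ?c] w
      by simp
    then have "wk1 (?c + l') r' (v1 g) \<odot> \<one>\<^sub>1 (P (l + cod_g f + (r + cd b q))) = P ?c \<ltimes>\<^sub>1 lay (l', g, r')"
      by (simp add: add.assoc del: lay.simps) (simp add: add.assoc)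
    then show ?thesis using wh(2)[OF ad] IH h_id(2)[OF i] wk2_0[OF i] by (simp add: w(2) del: lay.simps)
  qed
  have s2: "sv (?a + b) ((l, f, r + cd b (y # q)) # shift ?a 0 (y # q)) (0, l, Sw f (r + l') g, r') =
      \<Sigma> (lay (l, f, r)) (lay (l', g, r')) \<star> \<one>\<^sub>2 (P ?a \<ltimes>\<^sub>1 pth b q)"
  proof -
    have sg: "\<Sigma> (lay (l, f, r)) (lay (l', g, r')) \<in> hom2 B ((lay (l, f, r) \<rtimes>\<^sub>1 P (l' + cod_g g + r')) \<odot> (P ?a \<ltimes>\<^sub>1 lay (l', g, r')))
        ((P ?c \<ltimes>\<^sub>1 lay (l', g, r')) \<odot> (lay (l, f, r) \<rtimes>\<^sub>1 P (l' + dom_g g + r')))" by (rule interchanger_hom[OF h(1,3)])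
    have dom: "(lay (l, f, r) \<rtimes>\<^sub>1 P (l' + cod_g g + r')) \<odot> (P ?a \<ltimes>\<^sub>1 lay (l', g, r')) \<in> hom1 B (P ?a \<otimes>\<^sub>0 P (l' + dom_g g + r')) (P ?c \<otimes>\<^sub>0 P (l' + cod_g g + r'))"
      by (rule comp1_hom[OF ltens1_hom[OF P_obj h(3)] rtens1_hom[OF P_obj h(1)]])
    note i2 = in2I[OF sg dom]
    have n: "P ?c \<otimes>\<^sub>0 P (l' + cod_g g + r') = P (l + ccod (Sw f (r + l') g) + r')" by (simp add: P_add[symmetric] ac_simps)
    have q: "pth (?a + b) (shift ?a 0 q) = P ?a \<ltimes>\<^sub>1 pth b q" using pth_shift[OF w(1), of ?a 0] wk1_left[OF h(2)] by simp
    have h2: "P ?a \<ltimes>\<^sub>1 pth b q \<in> hom1 B (P ?a \<otimes>\<^sub>0 P b) (P ?a \<otimes>\<^sub>0 P (l' + dom_g g + r'))" by (rule ltens1_hom[OF P_obj h(2)])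
    show ?thesis using h_id(1)[OF in2_hcomp[OF in2_id[OF h2] i2]] unfolding n
      by (simp add: y q interchanger_wk del: lay.simps)
  qed
  have "sem (?a + b) ((l, f, r + cd b (y # q)) # shift ?a 0 (y # q)) (swaps1 (l, f, r) (y # q)) =
      (\<one>\<^sub>2 (P ?c \<ltimes>\<^sub>1 lay (l', g, r')) \<star> \<Sigma> (lay (l, f, r)) (pth b q)) \<cdot> (\<Sigma> (lay (l, f, r)) (lay (l', g, r')) \<star> \<one>\<^sub>2 (P ?a \<ltimes>\<^sub>1 pth b q))"
    using s1 s2 ap y by (simp del: app.simps sv.simps lay.simps)
  also have "\<dots> = \<Sigma> (lay (l, f, r)) (pth b (y # q))"
    using interchanger_comp_right[OF h] y by (simp add: whisker_left_def whisker_right_def del: lay.simps)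
  finally show ?case using r by simp
qed

lemma adms_swaps1: "adms (swaps1 x q)"
  by (cases x) (induction q; auto split: prod.splits)

lemma adms_swaps: "adms (swaps p q)"
  by (induction p) (auto simp: adms_swaps1)

text \<open>Inductions on \<open>q\<close> and then on \<open>p\<close> follow the two composition
  axioms, so a list of elementary crossings denotes one interchanger of composites, and naturality
  can be used for whole paths at once.\<close>

lemma swaps_sem:
  assumes "wf_path a p" "wf_path b q"
  shows "run (a + b) (shift 0 (cd b q) p @ shift a 0 q) (swaps p q) = Some (shift (cd a p) 0 q @ shift 0 b p) \<and>
    sem (a + b) (shift 0 (cd b q) p @ shift a 0 q) (swaps p q) = \<Sigma> (pth a p) (pth b q)"
  using assms(1)
proof (induction p)
  case Nil
  show ?case using interchanger_id_left[OF P_obj, of "pth b q" a] hom1_cells0[OF pth_hom[OF assms(2)]]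
      pth_shift[OF assms(2), of a 0] wk1_left[OF pth_hom[OF assms(2)]] by simp
next
  case (Cons x p)
  obtain l f r where x: "x = (l, f, r)" by (cases x)
  let ?c = "cd b q"
  have w: "wf_path a p" "cd a p = l + dom_g f + r" using Cons.prems x by auto
  note IH = Cons.IH[OF w(1)]
  note s1 = swaps1_sem[OF assms(2), of l f r]
  let ?p = "shift 0 ?c p @ shift a 0 q" and ?q = "shift (cd a p) 0 q @ shift 0 b p"
  have cq: "cd (a + b) (shift a 0 q) = a + ?c" using cd_shift[of a b 0 q] by (simp del: cd_shift)
  have cp: "cd (0 + a + ?c) (shift 0 ?c p) = cd a p + ?c" using cd_shift[of 0 a ?c p] by (simp del: cd_shift)
  have cp2: "cd (a + b) (shift 0 b p) = cd a p + b" using cd_shift[of 0 a b p] by (simp del: cd_shift)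
  have wp: "wf_path (a + b) ?p" "cd (a + b) ?p = cd a p + ?c"
    using wf_shift[OF assms(2), of a 0] wf_shift[OF w(1), of 0 ?c] cq cp by (simp_all add: wf_append)
  have wp2: "wf_path (a + b) (shift 0 b p)" using wf_shift[OF w(1), of 0 b] by simp
  have w1: "wf_path (0 + cd (a + b) ?p + 0) [(l, f, r + ?c)]" using w wp by simp
  note wh1 = whisker[of "a + b" ?p "swaps p q" _ "a + b" "[]" 0 0 "[(l, f, r + ?c)]", OF IH[THEN conjunct1] wp(1) _ _ w1, simplified]
  let ?a = "l + dom_g f + r" and ?d = "l + cod_g f + r"
  let ?t = "(l, f, r + ?c) # shift ?a 0 q"
  have cq': "cd (?a + b) (shift ?a 0 q) = ?a + ?c" using cd_shift[of ?a b 0 q] by (simp del: cd_shift)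
  have wt: "wf_path (?a + b) ?t" using wf_shift[OF assms(2), of ?a 0] cq' by simp
  note wh2 = whisker[of "?a + b" ?t "swaps1 (l, f, r) q" _ "a + b" "shift 0 b p" 0 0 "[]", OF s1[THEN conjunct1] wt wp2 _ , simplified, OF cp2[unfolded w(2)]]
  have r1: "run (a + b) (shift 0 ?c (x # p) @ shift a 0 q) (shs 1 0 0 (swaps p q)) = Some ((l, f, r + ?c) # ?q)"
    using wh1(1) x by simp
  have e: "(l, f, r + ?c) # ?q = ?t @ shift 0 b p" using w by simp
  have r2: "run (a + b) ((l, f, r + ?c) # ?q) (swaps1 x q) = Some (shift (cd a (x # p)) 0 q @ shift 0 b (x # p))"
    using wh2(1) w x by simp
  have wf: "wf_path (a + b) (shift 0 ?c (x # p) @ shift a 0 q)" using wp w x by simp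
  have hx: "lay (l, f, r) \<in> hom1 B (P ?a) (P ?d)" and hp: "pth a p \<in> hom1 B (P a) (P ?a)" and hq: "pth b q \<in> hom1 B (P b) (P ?c)"
    using lay_hom pth_hom[OF w(1)] pth_hom[OF assms(2)] w by (auto simp del: lay.simps)
  have i1: "in2 (\<Sigma> (pth a p) (pth b q)) (pth (a + b) ?p) (pth (a + b) ?q) (P (a + b)) (P (cd (a + b) ?p))"
    using sem_in2[OF IH[THEN conjunct1] wp(1) adms_swaps] IH by simp
  have i2: "in2 (\<Sigma> (lay (l, f, r)) (pth b q)) (pth (?a + b) ?t) (pth (?a + b) (shift ?d 0 q @ [(l, f, r + b)])) (P (?a + b)) (P (cd (?a + b) ?t))"
    using sem_in2[OF s1[THEN conjunct1] wt adms_swaps1] s1 by simp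
  have l1: "pth (cd a p + ?c) [(l, f, r + ?c)] = lay (l, f, r) \<rtimes>\<^sub>1 P ?c"
    using pth_single[of "cd a p + ?c" l f "r + ?c"] wk1_wk1[OF v1_hom, of 0 ?c l r f] wk1_right[OF lay_hom[of l f r], of ?c] w by simp
  have l2: "pth (a + b) (shift 0 b p) = pth a p \<rtimes>\<^sub>1 P b" using pth_shift[OF w(1), of 0 b] wk1_right[OF hp] by simp
  have S1: "sem (a + b) (shift 0 ?c (x # p) @ shift a 0 q) (shs 1 0 0 (swaps p q)) = \<one>\<^sub>2 (lay (l, f, r) \<rtimes>\<^sub>1 P ?c) \<star> \<Sigma> (pth a p) (pth b q)"
    using wh1(2)[OF adms_swaps] IH h_id(2)[OF i1] wk2_0[OF i1] wp(2) x l1 by simp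
  have h3: "pth a p \<rtimes>\<^sub>1 P b \<in> hom1 B (P (a + b)) (P (?a + b))" using rtens1_hom[OF P_obj hp, of b] by (simp add: P_add)
  have S2: "sem (a + b) ((l, f, r + ?c) # ?q) (swaps1 x q) = \<Sigma> (lay (l, f, r)) (pth b q) \<star> \<one>\<^sub>2 (pth a p \<rtimes>\<^sub>1 P b)"
    using wh2(2)[OF adms_swaps1] s1 wk2_0[OF i2] h_id(1)[OF in2_hcomp[OF in2_id[OF h3] i2]] x w l2
    by (simp add: add.assoc del: lay.simps)
  have "sem (a + b) (shift 0 ?c (x # p) @ shift a 0 q) (swaps (x # p) q) =
      (\<Sigma> (lay (l, f, r)) (pth b q) \<star> \<one>\<^sub>2 (pth a p \<rtimes>\<^sub>1 P b)) \<cdot> (\<one>\<^sub>2 (lay (l, f, r) \<rtimes>\<^sub>1 P ?c) \<star> \<Sigma> (pth a p) (pth b q))"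
    using sem_append[OF r1 r2 wf] S1 S2 by (simp add: adms_swaps adms_swaps1)
  also have "\<dots> = \<Sigma> (pth a (x # p)) (pth b q)"
    using interchanger_comp_left[OF hp hx hq] x by (simp add: whisker_left_def whisker_right_def del: lay.simps)
  finally show ?case using r1 r2 by (simp add: run_append)
qed

end

section \<open>Sound equations between diagrams\<close>

context diagrams
begin

text \<open>
  The interpretation of a generating 2-cell need not have the type of the generator, and equations
  between ill-typed diagrams are vacuous: \<open>Theta\<close> and \<open>RTheta\<close> will both be interpreted by \<open>\<theta>\<close>.
\<close>

fun sound :: "rule \<Rightarrow> bool" where
  "sound (n, p, S, T) \<longleftrightarrow> wf_path n p \<and> (\<exists>q. run n p S = Some q \<and> run n p T = Some q) \<and>
    (adms S \<longleftrightarrow> adms T) \<and> (adms S \<longrightarrow> sem n p S = sem n p T)"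

lemma sound_sym: "sound (n, p, S, T) \<Longrightarrow> sound (n, p, T, S)"
  by auto

lemma sound_trans: "sound (n, p, S, T) \<Longrightarrow> sound (n, p, T, U) \<Longrightarrow> sound (n, p, S, U)"
  by auto

lemma sound_prepend:
  assumes "sound (n, q, S, T)" "run n p U = Some q" "wf_path n p"
  shows "sound (n, p, U @ S, U @ T)"
proof -
  obtain q' where "run n q S = Some q'" "run n q T = Some q'" using assms(1) by auto
  then show ?thesis using assms by (auto simp: run_append sem_append[OF assms(2) _ assms(3)])
qed

lemma sound_append:
  assumes "sound (n, p, S, T)" "run n p S = Some q" "run n q V = Some q'"
  shows "sound (n, p, S @ V, T @ V)"
proof -
  have t: "run n p T = Some q" "wf_path n p" using assms(1,2) by auto
  then show ?thesis
    using assms by (auto simp: run_append sem_append[OF assms(2,3) t(2)] sem_append[OF t(1) assms(3) t(2)])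
qed

lemma sound_whisker:
  assumes "sound (n0, p0, S, T)" "wf_path n p2" "cd n p2 = l + n0 + r" "wf_path (l + cd n0 p0 + r) p1"
  shows "sound (n, p1 @ shift l r p0 @ p2, shs (length p1) l r S, shs (length p1) l r T)"
proof -
  from assms(1) obtain q where q: "run n0 p0 S = Some q" "run n0 p0 T = Some q" "wf_path n0 p0" by auto
  have "wf_path n (p1 @ shift l r p0 @ p2)"
    using assms(2-4) wf_shift[OF q(3), of l r] by (simp add: wf_append)
  then show ?thesis
    using assms(1) whisker[OF q(1) q(3) assms(2-4)] whisker[OF q(2) q(3) assms(2-4)] by auto
qed

text \<open>Disjoint segments of a path commute by the interchange law of the 2-category alone: they
  are composed, not tensored, so no \<open>\<Sigma>\<close> appears. The slice at the later position
  is renumbered by the change of length that the other one causes.\<close>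

lemma sound_exchange_aux:
  assumes "wf_path n p3" "cd n p3 = l2 + cdom y + r2" "wf_path (l2 + ccod y + r2) p2"
    "cd (l2 + ccod y + r2) p2 = l + cdom x + r" "wf_path (l + ccod x + r) p1"
  shows "sound (n, p1 @ shift l r (csrc x) @ p2 @ shift l2 r2 (csrc y) @ p3,
    [(length p1, l, x, r), (length p1 + length (ctrg x) + length p2, l2, y, r2)],
    [(length p1 + length (csrc x) + length p2, l2, y, r2), (length p1, l, x, r)])"
proof -
  let ?s1 = "shift l r (csrc x)" and ?t1 = "shift l r (ctrg x)"
  let ?s2 = "shift l2 r2 (csrc y)" and ?t2 = "shift l2 r2 (ctrg y)"
  let ?c1 = "l + ccod x + r" and ?d1 = "l + cdom x + r" and ?c2 = "l2 + ccod y + r2" and ?d2 = "l2 + cdom y + r2"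
  have ws: "wf_path ?d1 ?s1" "wf_path ?d1 ?t1" "cd ?d1 ?s1 = ?c1" "cd ?d1 ?t1 = ?c1"
    "wf_path ?d2 ?s2" "wf_path ?d2 ?t2" "cd ?d2 ?s2 = ?c2" "cd ?d2 ?t2 = ?c2"
    using wf_shift[OF cell_wf(1)] wf_shift[OF cell_wf(2)] by (simp_all add: cell_wf)
  have w: "wf_path n (p2 @ ?s2 @ p3)" "wf_path n (p2 @ ?t2 @ p3)"
    "cd n (p2 @ ?s2 @ p3) = ?d1" "cd n (p2 @ ?t2 @ p3) = ?d1"
    using assms ws by (simp_all add: wf_append)
  have wf: "wf_path n (p1 @ ?s1 @ p2 @ ?s2 @ p3)" using assms w ws by (simp add: wf_append)
  have a1: "app n (p1 @ ?s1 @ p2 @ ?s2 @ p3) (length p1, l, x, r) = Some (p1 @ ?t1 @ p2 @ ?s2 @ p3)"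
    "app n (p1 @ ?s1 @ p2 @ ?t2 @ p3) (length p1, l, x, r) = Some (p1 @ ?t1 @ p2 @ ?t2 @ p3)"
    using appI[OF w(1,3)] appI[OF w(2,4)] by blast+
  have a2: "app n (p1 @ ?t1 @ p2 @ ?s2 @ p3) (length p1 + length (ctrg x) + length p2, l2, y, r2) = Some (p1 @ ?t1 @ p2 @ ?t2 @ p3)"
    "app n (p1 @ ?s1 @ p2 @ ?s2 @ p3) (length p1 + length (csrc x) + length p2, l2, y, r2) = Some (p1 @ ?s1 @ p2 @ ?t2 @ p3)"
    using appI[OF assms(1,2), of "p1 @ ?t1 @ p2"] appI[OF assms(1,2), of "p1 @ ?s1 @ p2"] by (simp_all add: add.assoc del: app.simps)
  have r: "\<exists>q. run n (p1 @ ?s1 @ p2 @ ?s2 @ p3) [(length p1, l, x, r), (length p1 + length (ctrg x) + length p2, l2, y, r2)] = Some q \<and>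
    run n (p1 @ ?s1 @ p2 @ ?s2 @ p3) [(length p1 + length (csrc x) + length p2, l2, y, r2), (length p1, l, x, r)] = Some q"
    using a1 a2 by (simp del: app.simps)
  have s: "sem n (p1 @ ?s1 @ p2 @ ?s2 @ p3) [(length p1, l, x, r), (length p1 + length (ctrg x) + length p2, l2, y, r2)] =
    sem n (p1 @ ?s1 @ p2 @ ?s2 @ p3) [(length p1 + length (csrc x) + length p2, l2, y, r2), (length p1, l, x, r)]"
    if adm: "adm x" "adm y"
  proof -
    note i1 = cell_wk_in2[OF adm(1), of l r] and i2 = cell_wk_in2[OF adm(2), of l2 r2]
    note h1 = pth_hom[OF assms(5)]
    have h2: "pth ?c2 p2 \<in> hom1 B (P ?c2) (P ?d1)" using pth_hom[OF assms(3)] assms(4) by simp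
    have h3: "pth n p3 \<in> hom1 B (P n) (P ?d2)" using pth_hom[OF assms(1)] assms(2) by simp
    let ?G = "\<one>\<^sub>2 (pth ?c2 p2) \<star> (wk2 l2 r2 (cv y) \<star> \<one>\<^sub>2 (pth n p3))"
    note iG0 = in2_hcomp[OF in2_id[OF h3] i2]
    note iG1 = in2_hcomp[OF iG0 in2_id[OF h2]]
    have iG: "in2 ?G (pth n (p2 @ ?s2 @ p3)) (pth n (p2 @ ?t2 @ p3)) (P n) (P ?d1)"
      using iG1 pth_mid[OF assms(2,1,3)] by simp
    note hs = in2D(2)[OF i1] and ht = in2D(3)[OF i1]
    have v1: "sv n (p1 @ ?s1 @ p2 @ ?s2 @ p3) (length p1, l, x, r) = \<one>\<^sub>2 (pth ?c1 p1) \<star> (wk2 l r (cv x) \<star> \<one>\<^sub>2 (pth n (p2 @ ?s2 @ p3)))"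
      "sv n (p1 @ ?s1 @ p2 @ ?t2 @ p3) (length p1, l, x, r) = \<one>\<^sub>2 (pth ?c1 p1) \<star> (wk2 l r (cv x) \<star> \<one>\<^sub>2 (pth n (p2 @ ?t2 @ p3)))"
      by (rule sv_eq)+
    have G: "\<one>\<^sub>2 (pth ?c2 (p1 @ shift l r z @ p2)) \<star> (wk2 l2 r2 (cv y) \<star> \<one>\<^sub>2 (pth n p3)) =
        \<one>\<^sub>2 (pth ?c1 p1) \<star> (\<one>\<^sub>2 (pth ?d1 (shift l r z)) \<star> ?G)"
      if z: "wf_path ?d1 (shift l r z)" "cd ?d1 (shift l r z) = ?c1" for z
    proof -
      have hz: "pth ?d1 (shift l r z) \<in> hom1 B (P ?d1) (P ?c1)" using pth_hom[OF z(1)] z(2) by simp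
      have "pth ?c2 (p1 @ shift l r z @ p2) = pth ?c1 p1 \<odot> (pth ?d1 (shift l r z) \<odot> pth ?c2 p2)"
        using assms z by (simp add: pth_append wf_append)
      then have "\<one>\<^sub>2 (pth ?c2 (p1 @ shift l r z @ p2)) = \<one>\<^sub>2 (pth ?c1 p1) \<star> (\<one>\<^sub>2 (pth ?d1 (shift l r z)) \<star> \<one>\<^sub>2 (pth ?c2 p2))"
        using id_ctx[OF h1 h2 hz] by simp
      then show ?thesis
        using h_assoc[OF iG0 in2_hcomp[OF in2_id[OF h2] in2_id[OF hz]] in2_id[OF h1]] h_assoc[OF iG0 in2_id[OF h2] in2_id[OF hz]]
        by simp
    qed
    have v2: "sv n (p1 @ ?t1 @ p2 @ ?s2 @ p3) (length p1 + length (ctrg x) + length p2, l2, y, r2) = \<one>\<^sub>2 (pth ?c1 p1) \<star> (\<one>\<^sub>2 (pth ?d1 ?t1) \<star> ?G)"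
      "sv n (p1 @ ?s1 @ p2 @ ?s2 @ p3) (length p1 + length (csrc x) + length p2, l2, y, r2) = \<one>\<^sub>2 (pth ?c1 p1) \<star> (\<one>\<^sub>2 (pth ?d1 ?s1) \<star> ?G)"
      using G[OF ws(1,3)] G[OF ws(2,4)] sv_eq[of n "p1 @ ?t1 @ p2" l2 r2 y p3] sv_eq[of n "p1 @ ?s1 @ p2" l2 r2 y p3]
      by (simp_all add: add.assoc del: sv.simps)
    have lift: "\<one>\<^sub>2 (pth ?c1 p1) \<star> (\<beta> \<cdot> \<alpha>) = (\<one>\<^sub>2 (pth ?c1 p1) \<star> \<beta>) \<cdot> (\<one>\<^sub>2 (pth ?c1 p1) \<star> \<alpha>)"
      if "in2 \<alpha> a b (P n) (P ?c1)" "in2 \<beta> b c (P n) (P ?c1)" for \<alpha> \<beta> a b c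
      using vh_interchange[OF that in2_id[OF h1] in2_id[OF h1]] v_id(1)[OF in2_id[OF h1]] by simp
    have "sem n (p1 @ ?s1 @ p2 @ ?s2 @ p3) [(length p1, l, x, r), (length p1 + length (ctrg x) + length p2, l2, y, r2)] =
        (\<one>\<^sub>2 (pth ?c1 p1) \<star> (\<one>\<^sub>2 (pth ?d1 ?t1) \<star> ?G)) \<cdot> (\<one>\<^sub>2 (pth ?c1 p1) \<star> (wk2 l r (cv x) \<star> \<one>\<^sub>2 (pth n (p2 @ ?s2 @ p3))))"
      using a1 a2 v1 v2 v_id(1)[OF sv_in2[OF a2(1) app_wf(1)[OF a1(1) wf] adm(2)]]
      by (simp del: app.simps sv.simps)
    \<comment> \<open>The common value of both orders: the two cells composed horizontally in one
      go.\<close>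
    also have "\<dots> = \<one>\<^sub>2 (pth ?c1 p1) \<star> (wk2 l r (cv x) \<star> ?G)"
      using hcomp_split(2)[OF iG i1] lift[OF in2_hcomp[OF in2_id[OF in2D(2)[OF iG]] i1] in2_hcomp[OF iG in2_id[OF ht]]] by simp
    also have "\<dots> = (\<one>\<^sub>2 (pth ?c1 p1) \<star> (wk2 l r (cv x) \<star> \<one>\<^sub>2 (pth n (p2 @ ?t2 @ p3)))) \<cdot> (\<one>\<^sub>2 (pth ?c1 p1) \<star> (\<one>\<^sub>2 (pth ?d1 ?s1) \<star> ?G))"
      using hcomp_split(1)[OF iG i1] lift[OF in2_hcomp[OF iG in2_id[OF hs]] in2_hcomp[OF in2_id[OF in2D(3)[OF iG]] i1]] by simp
    also have "\<dots> = sem n (p1 @ ?s1 @ p2 @ ?s2 @ p3) [(length p1 + length (csrc x) + length p2, l2, y, r2), (length p1, l, x, r)]"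
      using a1 a2 v1 v2 v_id(1)[OF sv_in2[OF a1(2) app_wf(1)[OF a2(2) wf] adm(1)]]
      by (simp del: app.simps sv.simps)
    finally show ?thesis .
  qed
  show ?thesis unfolding sound.simps using wf r s by auto
qed

lemma sound_exchange:
  assumes "wf_path n p" "run n p [(i, l, x, r), (j, l2, y, r2)] = Some q" "i + length (ctrg x) \<le> j"
  shows "sound (n, p, [(i, l, x, r), (j, l2, y, r2)], [(j - length (ctrg x) + length (csrc x), l2, y, r2), (i, l, x, r)])"
proof -
  from assms(2) obtain p' where a: "app n p (i, l, x, r) = Some p'" "app n p' (j, l2, y, r2) = Some q"
    by (auto split: option.splits simp del: app.simps)
  from a(1) assms(1) obtain p1 p2 where b: "p = p1 @ shift l r (csrc x) @ p2" "p' = p1 @ shift l r (ctrg x) @ p2" "i = length p1"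
    "cd n p2 = l + cdom x + r" "wf_path n p2" "wf_path (l + ccod x + r) p1" by (rule appE)
  from a(2) app_wf(1)[OF a(1) assms(1)] obtain p3 p4 where c: "p' = p3 @ shift l2 r2 (csrc y) @ p4" "j = length p3"
    "cd n p4 = l2 + cdom y + r2" "wf_path n p4" "wf_path (l2 + ccod y + r2) p3" by (rule appE)
  \<comment> \<open>The layers between the two redexes; the inequality of positions ensures that
    this segment exists, though it may be empty.\<close>
  define p0 where "p0 = drop (length p1 + length (ctrg x)) p3"
  have "take (length p1 + length (ctrg x)) p' = take (length p1 + length (ctrg x)) p3"
    using assms(3) c(1,2) b(3) by simp
  then have "take (length p1 + length (ctrg x)) p3 = p1 @ shift l r (ctrg x)" unfolding b(2) by simp
  then have p3: "p3 = p1 @ shift l r (ctrg x) @ p0"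
    using append_take_drop_id[of "length p1 + length (ctrg x)" p3] unfolding p0_def by simp
  have p2: "p2 = p0 @ shift l2 r2 (csrc y) @ p4" using b(2) c(1) p3 by simp
  have d: "wf_path (l2 + ccod y + r2) p0" "cd (l2 + ccod y + r2) p0 = l + cdom x + r"
    using c(3,4,5) b(4) p2 p3 by (auto simp: wf_append cell_wf)
  show ?thesis using sound_exchange_aux[OF c(4,3) d b(6)] unfolding b(1) p2 b(3) c(2) p3 by (simp add: ac_simps)
qed

lemma sound_exchange':
  assumes "wf_path n p" "run n p [(i, l, x, r), (j, l2, y, r2)] = Some q" "j + length (csrc y) \<le> i"
  shows "sound (n, p, [(i, l, x, r), (j, l2, y, r2)], [(j, l2, y, r2), (i - length (csrc y) + length (ctrg y), l, x, r)])"
proof -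
  from assms(2) obtain p' where a: "app n p (i, l, x, r) = Some p'" "app n p' (j, l2, y, r2) = Some q"
    by (auto split: option.splits simp del: app.simps)
  from a(1) assms(1) obtain p1 p2 where b: "p = p1 @ shift l r (csrc x) @ p2" "p' = p1 @ shift l r (ctrg x) @ p2" "i = length p1"
    "cd n p2 = l + cdom x + r" "wf_path n p2" "wf_path (l + ccod x + r) p1" by (rule appE)
  from a(2) app_wf(1)[OF a(1) assms(1)] obtain p3 p4 where c: "p' = p3 @ shift l2 r2 (csrc y) @ p4" "j = length p3"
    "cd n p4 = l2 + cdom y + r2" "wf_path n p4" "wf_path (l2 + ccod y + r2) p3" by (rule appE)
  define p0 where "p0 = drop (length p3 + length (csrc y)) p1"
  have "take (length p3 + length (csrc y)) p' = take (length p3 + length (csrc y)) p1"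
    using assms(3) c(2) b(2,3) by simp
  then have "take (length p3 + length (csrc y)) p1 = p3 @ shift l2 r2 (csrc y)" unfolding c(1) by simp
  then have p1: "p1 = p3 @ shift l2 r2 (csrc y) @ p0"
    using append_take_drop_id[of "length p3 + length (csrc y)" p1] unfolding p0_def by simp
  have p4: "p4 = p0 @ shift l r (ctrg x) @ p2" using b(2) c(1) p1 by simp
  have d: "wf_path (l + ccod x + r) p0" "cd (l + ccod x + r) p0 = l2 + cdom y + r2"
    using c(3,4) b(4-6) p1 p4 by (auto simp: wf_append cell_wf)
  show ?thesis using sound_sym[OF sound_exchange_aux[OF b(5,4) d c(5)]] unfolding b(1) p1 b(3) c(2) by (simp add: ac_simps)
qed

end

section \<open>Rewriting certificates\<close>

text \<open>In \<open>NatR f k x\<close> the 2-cell \<open>x\<close> sits \<open>k\<close> strands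
  to the right of the layer \<open>f\<close>, in \<open>NatL f k x\<close> to its left, and it moves
  through the crossings with \<open>f\<close>; the variants ending in \<open>I\<close> use inverse
  interchangers. \<open>Cancel x\<close> is a crossing followed by its inverse.\<close>

datatype ref = Given nat | NatR gen1 nat cell | NatL gen1 nat cell | NatRI gen1 nat cell | NatLI gen1 nat cell | Cancel cell

fun is_swap :: "cell \<Rightarrow> bool" where
  "is_swap (Gen h) = False" | "is_swap (Sw f k g) = True" | "is_swap (Si f k g) = True"

fun rule_of :: "rule list \<Rightarrow> ref \<Rightarrow> rule option" where
  "rule_of rs (Given i) = (if i < length rs then Some (rs ! i) else None)"
| "rule_of rs (NatR f k x) = Some (dom_g f + k + cdom x, (0, f, k + ccod x) # shift (dom_g f + k) 0 (csrc x),
    (1, dom_g f + k, x, 0) # swaps [(0, f, 0)] (shift k 0 (ctrg x)),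
    swaps [(0, f, 0)] (shift k 0 (csrc x)) @ [(0, cod_g f + k, x, 0)])"
| "rule_of rs (NatL f k x) = Some (cdom x + k + dom_g f, shift 0 (k + cod_g f) (csrc x) @ [(cdom x + k, f, 0)],
    (0, 0, x, k + cod_g f) # swaps (ctrg x) [(k, f, 0)],
    swaps (csrc x) [(k, f, 0)] @ [(1, 0, x, k + dom_g f)])"
| "rule_of rs (NatRI f k x) = Some (dom_g f + k + cdom x, shift (cod_g f + k) 0 (csrc x) @ [(0, f, k + cdom x)],
    (0, cod_g f + k, x, 0) # invs (swaps [(0, f, 0)] (shift k 0 (ctrg x))),
    invs (swaps [(0, f, 0)] (shift k 0 (csrc x))) @ [(1, dom_g f + k, x, 0)])"
| "rule_of rs (NatLI f k x) = Some (cdom x + k + dom_g f, (ccod x + k, f, 0) # shift 0 (k + dom_g f) (csrc x),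
    (1, 0, x, k + dom_g f) # invs (swaps (ctrg x) [(k, f, 0)]),
    invs (swaps (csrc x) [(k, f, 0)]) @ [(0, 0, x, k + cod_g f)])"
| "rule_of rs (Cancel x) = (if is_swap x then Some (cdom x, csrc x, [(0, 0, x, 0), (0, 0, cinv x, 0)], []) else None)"

text \<open>In \<open>Use ref b j k l r\<close> the rule is read backwards if \<open>b\<close>
  holds; it starts at slice \<open>j\<close> and acts from layer \<open>k\<close> on, between
  \<open>l\<close> and \<open>r\<close> idle strands.\<close>

datatype step = Ex bool nat | Use ref bool nat nat nat nat

text \<open>The side conditions of the soundness proof are tested here, so nothing has to be trusted
  about the way in which a certificate was found.\<close>

fun exec1 :: "rule list \<Rightarrow> nat \<Rightarrow> path \<Rightarrow> slice list \<Rightarrow> step \<Rightarrow> slice list option" where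
  "exec1 rs n p S (Ex d j) = (case drop j S of
      (i, l, x, r) # (i', l', y, r') # V \<Rightarrow>
        if d \<and> i + length (ctrg x) \<le> i' then
          Some (take j S @ (i' - length (ctrg x) + length (csrc x), l', y, r') # (i, l, x, r) # V)
        else if \<not> d \<and> i' + length (csrc y) \<le> i then
          Some (take j S @ (i', l', y, r') # (i - length (csrc y) + length (ctrg y), l, x, r) # V)
        else None
    | _ \<Rightarrow> None)"
| "exec1 rs n p S (Use ref b j k l r) = (case rule_of rs ref of None \<Rightarrow> None | Some (n0, p0, A0, B0) \<Rightarrow>
    (case run n p (take j S) of None \<Rightarrow> None | Some q \<Rightarrow>
      (let A = (if b then B0 else A0); B = (if b then A0 else B0) in
        if take (length A) (drop j S) = shs k l r A \<and> k \<le> length q \<and> take (length p0) (drop k q) = shift l r p0 \<and>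
          cd n (drop (length p0) (drop k q)) = l + n0 + r
        then Some (take j S @ shs k l r B @ drop (length A) (drop j S)) else None)))"

context diagrams
begin

text \<open>This is \<open>interchanger_natural\<close> with an identity as its first 2-cell.
  \<open>T\<close> may have many slices because the crossings with a whole path denote a single
  interchanger.\<close>

lemma sound_nat_right:
  assumes p: "wf_path a p" and q: "wf_path b q" and T: "run b q T = Some q'"
  shows "sound (a + b, shift 0 (cd b q) p @ shift a 0 q, shs (length p) a 0 T @ swaps p q',
    swaps p q @ shs 0 (cd a p) 0 T)"
proof -
  note q' = run_wf[OF T q]
  let ?c = "cd b q" and ?d = "cd a p"
  have wq: "wf_path (a + b) (shift a 0 q)" "wf_path (a + b) (shift a 0 q')" "cd (a + b) (shift a 0 q) = a + ?c"
    using wf_shift[OF q, of a 0] wf_shift[OF q'(1), of a 0] cd_shift[of a b 0 q] by (simp_all del: cd_shift)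
  have wp: "wf_path (a + ?c) (shift 0 ?c p)" "wf_path (a + b) (shift 0 b p)" "cd (a + b) (shift 0 b p) = ?d + b"
    using wf_shift[OF p, of 0] cd_shift[of 0 a b p] by (simp_all del: cd_shift)
  note w1 = whisker[of b q T q' "a + b" "[]" a 0 "shift 0 ?c p", OF T q _ _ , simplified, OF wp(1)]
  note w2 = whisker[of b q T q' "a + b" "shift 0 b p" ?d 0 "[]", OF T q wp(2), simplified, OF wp(3)]
  note s1 = swaps_sem[OF p q] and s2 = swaps_sem[OF p q'(1), unfolded q'(2)]
  have wf: "wf_path (a + b) (shift 0 ?c p @ shift a 0 q)" using wq wp by (simp add: wf_append)
  have runs: "run (a + b) (shift 0 ?c p @ shift a 0 q) (shs (length p) a 0 T @ swaps p q') = Some (shift ?d 0 q' @ shift 0 b p)"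
    "run (a + b) (shift 0 ?c p @ shift a 0 q) (swaps p q @ shs 0 ?d 0 T) = Some (shift ?d 0 q' @ shift 0 b p)"
    using w1(1) w2(1) s1 s2 by (simp_all add: run_append)
  have "sem (a + b) (shift 0 ?c p @ shift a 0 q) (shs (length p) a 0 T @ swaps p q') =
    sem (a + b) (shift 0 ?c p @ shift a 0 q) (swaps p q @ shs 0 ?d 0 T)" if ad: "adms T"
  proof -
    note i = sem_in2[OF T q ad]
    note hp = pth_hom[OF p] and hq = pth_hom[OF q]
    note iT = in2_ltens[OF P_obj i, of a] in2_ltens[OF P_obj i, of ?d]
    have hp1: "pth a p \<rtimes>\<^sub>1 P ?c \<in> hom1 B (P a \<otimes>\<^sub>0 P ?c) (P ?d \<otimes>\<^sub>0 P ?c)"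
      and hp2: "pth a p \<rtimes>\<^sub>1 P b \<in> hom1 B (P a \<otimes>\<^sub>0 P b) (P ?d \<otimes>\<^sub>0 P b)" using rtens1_hom[OF P_obj hp] by auto
    have e1: "pth (a + ?c) (shift 0 ?c p) = pth a p \<rtimes>\<^sub>1 P ?c" "pth (a + b) (shift 0 b p) = pth a p \<rtimes>\<^sub>1 P b"
      using pth_shift[OF p, of 0] wk1_right[OF hp] by simp_all
    have 1: "sem (a + b) (shift 0 ?c p @ shift a 0 q) (shs (length p) a 0 T) = \<one>\<^sub>2 (pth a p \<rtimes>\<^sub>1 P ?c) \<star> (P a \<ltimes>\<^sub>2 sem b q T)"
      using w1(2)[OF ad] h_id(2)[OF iT(1)] by (simp add: e1 wk2_left[OF i] P_add)
    have 2: "sem (a + b) (shift ?d 0 q @ shift 0 b p) (shs 0 ?d 0 T) = (P ?d \<ltimes>\<^sub>2 sem b q T) \<star> \<one>\<^sub>2 (pth a p \<rtimes>\<^sub>1 P b)"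
      using w2(2)[OF ad] h_id(1)[OF in2_hcomp[OF in2_id[OF hp2] iT(2)]] by (simp add: e1 wk2_left[OF i] P_add)
    have "sem (a + b) (shift 0 ?c p @ shift a 0 q) (shs (length p) a 0 T @ swaps p q') =
        \<Sigma> (pth a p) (pth b q') \<cdot> (\<one>\<^sub>2 (pth a p \<rtimes>\<^sub>1 P ?c) \<star> (P a \<ltimes>\<^sub>2 sem b q T))"
      using sem_append[OF w1(1) s2[THEN conjunct1] wf _ adms_swaps] ad 1 s2 by simp
    also have "\<dots> = ((P ?d \<ltimes>\<^sub>2 sem b q T) \<star> \<one>\<^sub>2 (pth a p \<rtimes>\<^sub>1 P b)) \<cdot> \<Sigma> (pth a p) (pth b q)"
      using interchanger_natural[OF hp hq in2D(1)[OF in2_id[OF hp]] in2D(1)[OF i]]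
      by (simp add: tens2_id hom1_cells0[OF hp])
    also have "\<dots> = sem (a + b) (shift 0 ?c p @ shift a 0 q) (swaps p q @ shs 0 ?d 0 T)"
      using sem_append[OF s1[THEN conjunct1] w2(1) wf adms_swaps] ad 2 s1 by simp
    finally show ?thesis .
  qed
  then show ?thesis using wf runs by (simp add: adms_swaps)
qed

lemma sound_nat_left:
  assumes p: "wf_path a p" and q: "wf_path b q" and S: "run a p S = Some p'"
  shows "sound (a + b, shift 0 (cd b q) p @ shift a 0 q, shs 0 0 (cd b q) S @ swaps p' q,
    swaps p q @ shs (length q) 0 b S)"
proof -
  note p' = run_wf[OF S p]
  let ?c = "cd b q" and ?d = "cd a p"
  have wq: "wf_path (a + b) (shift a 0 q)" "cd (a + b) (shift a 0 q) = a + ?c" "wf_path (?d + b) (shift ?d 0 q)"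
    using wf_shift[OF q, of a 0] wf_shift[OF q, of ?d 0] cd_shift[of a b 0 q] by (simp_all del: cd_shift)
  have wp: "wf_path (a + ?c) (shift 0 ?c p)" "wf_path (a + b) (shift 0 b p)" "cd (a + b) (shift 0 b p) = ?d + b"
    using wf_shift[OF p, of 0] cd_shift[of 0 a b p] by (simp_all del: cd_shift)
  note w1 = whisker[of a p S p' "a + b" "shift a 0 q" 0 ?c "[]", OF S p wq(1), simplified, OF wq(2)]
  note w2 = whisker[of a p S p' "a + b" "[]" 0 b "shift ?d 0 q", OF S p _ _ , simplified, OF wq(3)]
  note s1 = swaps_sem[OF p q] and s2 = swaps_sem[OF p'(1) q, unfolded p'(2)]
  have wf: "wf_path (a + b) (shift 0 ?c p @ shift a 0 q)" using wq wp by (simp add: wf_append)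
  have runs: "run (a + b) (shift 0 ?c p @ shift a 0 q) (shs 0 0 ?c S @ swaps p' q) = Some (shift ?d 0 q @ shift 0 b p')"
    "run (a + b) (shift 0 ?c p @ shift a 0 q) (swaps p q @ shs (length q) 0 b S) = Some (shift ?d 0 q @ shift 0 b p')"
    using w1(1) w2(1) s1 s2 by (simp_all add: run_append)
  have "sem (a + b) (shift 0 ?c p @ shift a 0 q) (shs 0 0 ?c S @ swaps p' q) =
    sem (a + b) (shift 0 ?c p @ shift a 0 q) (swaps p q @ shs (length q) 0 b S)" if ad: "adms S"
  proof -
    note i = sem_in2[OF S p ad]
    note hp = pth_hom[OF p] and hq = pth_hom[OF q]
    note iS = in2_rtens[OF P_obj i, of b] in2_rtens[OF P_obj i, of ?c]
    have hq1: "P a \<ltimes>\<^sub>1 pth b q \<in> hom1 B (P a \<otimes>\<^sub>0 P b) (P a \<otimes>\<^sub>0 P ?c)" using ltens1_hom[OF P_obj hq] by auto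
    have e1: "pth (a + b) (shift a 0 q) = P a \<ltimes>\<^sub>1 pth b q" "pth (?d + b) (shift ?d 0 q) = P ?d \<ltimes>\<^sub>1 pth b q"
      using pth_shift[OF q, of _ 0] wk1_left[OF hq] by simp_all
    have 1: "sem (a + b) (shift 0 ?c p @ shift a 0 q) (shs 0 0 ?c S) = (sem a p S \<rtimes>\<^sub>2 P ?c) \<star> \<one>\<^sub>2 (P a \<ltimes>\<^sub>1 pth b q)"
      using w1(2)[OF ad] h_id(1)[OF in2_hcomp[OF in2_id[OF hq1] iS(2)]] by (simp add: e1 wk2_right[OF i] P_add)
    have 2: "sem (a + b) (shift ?d 0 q @ shift 0 b p) (shs (length q) 0 b S) = \<one>\<^sub>2 (P ?d \<ltimes>\<^sub>1 pth b q) \<star> (sem a p S \<rtimes>\<^sub>2 P b)"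
      using w2(2)[OF ad] h_id(2)[OF iS(1)] by (simp add: e1 wk2_right[OF i] P_add)
    have "sem (a + b) (shift 0 ?c p @ shift a 0 q) (shs 0 0 ?c S @ swaps p' q) =
        \<Sigma> (pth a p') (pth b q) \<cdot> ((sem a p S \<rtimes>\<^sub>2 P ?c) \<star> \<one>\<^sub>2 (P a \<ltimes>\<^sub>1 pth b q))"
      using sem_append[OF w1(1) s2[THEN conjunct1] wf _ adms_swaps] ad 1 s2 by simp
    also have "\<dots> = (\<one>\<^sub>2 (P ?d \<ltimes>\<^sub>1 pth b q) \<star> (sem a p S \<rtimes>\<^sub>2 P b)) \<cdot> \<Sigma> (pth a p) (pth b q)"
      using interchanger_natural[OF hp hq in2D(1)[OF i] in2D(1)[OF in2_id[OF hq]]]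
      by (simp add: tens2_id hom1_cells0[OF hq])
    also have "\<dots> = sem (a + b) (shift 0 ?c p @ shift a 0 q) (swaps p q @ shs (length q) 0 b S)"
      using sem_append[OF s1[THEN conjunct1] w2(1) wf adms_swaps] ad 2 s1 by simp
    finally show ?thesis .
  qed
  then show ?thesis using wf runs by (simp add: adms_swaps)
qed

lemma sound_cancel:
  assumes "is_swap x"
  shows "sound (cdom x, csrc x, [(0, 0, x, 0), (0, 0, cinv x, 0)], [])"
proof -
  have x: "csrc (cinv x) = ctrg x" "ctrg (cinv x) = csrc x" "cdom (cinv x) = cdom x" "ccod (cinv x) = ccod x" "adm x" "adm (cinv x)"
    using assms by (cases x; simp)+
  have c: "cv (cinv x) \<cdot> cv x = \<one>\<^sub>2 (pth (cdom x) (csrc x))"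
    using assms Si_inverse by (cases x) auto
  note i1 = cell_in2[OF x(5)] and i2 = cell_in2[OF x(6), unfolded x]
  have a: "app (cdom x) (csrc x) (0, 0, x, 0) = Some (ctrg x)" "app (cdom x) (ctrg x) (0, 0, cinv x, 0) = Some (csrc x)"
    using cell_wf[of x] x by auto
  have v: "sv (cdom x) (csrc x) (0, 0, x, 0) = cv x"
    "sv (cdom x) (ctrg x) (0, 0, cinv x, 0) = cv (cinv x)"
    using x h_id(1)[OF i1] h_id(2)[OF i1] h_id(1)[OF i2] h_id(2)[OF i2] wk2_0[OF i1] wk2_0[OF i2] by simp_all
  have r: "run (cdom x) (csrc x) [(0, 0, x, 0), (0, 0, cinv x, 0)] = Some (csrc x)" using a by (simp del: app.simps)
  have s: "sem (cdom x) (csrc x) [(0, 0, x, 0), (0, 0, cinv x, 0)] = \<one>\<^sub>2 (pth (cdom x) (csrc x))"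
    using a v c v_id(1)[OF i2] by (simp del: app.simps sv.simps)
  show ?thesis unfolding sound.simps r s using x cell_wf(1)[of x] by simp
qed

lemma invs_Nil [simp]: "invs [] = []"
  by (simp add: invs_def)

lemma invs_Cons: "invs ((i, l, x, r) # S) = invs S @ [(i, l, cinv x, r)]"
  by (simp add: invs_def)

lemma adms_invs [simp]: "list_all (\<lambda>(i, l, x, r). is_swap x) S \<Longrightarrow> adms (invs S)"
proof (induction S)
  case (Cons s S)
  obtain i l x r where "s = (i, l, x, r)" by (cases s)
  then show ?case using Cons by (cases x) (auto simp: invs_Cons)
qed simp

lemma invs_sound:
  assumes "run n p S = Some q" "wf_path n p" "list_all (\<lambda>(i, l, x, r). is_swap x) S"
  shows "run n q (invs S) = Some p \<and> sound (n, p, S @ invs S, [])"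
  using assms
proof (induction S arbitrary: p)
  case (Cons s S)
  obtain i l x r where s: "s = (i, l, x, r)" by (cases s)
  from Cons.prems obtain p' where p': "app n p s = Some p'" "run n p' S = Some q" by (auto split: option.splits)
  note w = app_wf[OF p'(1) Cons.prems(2)]
  have x: "is_swap x" "list_all (\<lambda>(i, l, x, r). is_swap x) S" using Cons.prems s by auto
  note IH = Cons.IH[OF p'(2) w(1) x(2)]
  from p'(1)[unfolded s] Cons.prems(2) obtain p1 p2 where b: "p = p1 @ shift l r (csrc x) @ p2" "p' = p1 @ shift l r (ctrg x) @ p2" "i = length p1"
    "cd n p2 = l + cdom x + r" "wf_path n p2" "wf_path (l + ccod x + r) p1" by (rule appE)
  have c: "sound (n, p, [(i, l, x, r), (i, l, cinv x, r)], [])"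
    using sound_whisker[OF sound_cancel[OF x(1)] b(5,4), of p1] b cell_wf[of x] by simp
  then have a: "app n p' (i, l, cinv x, r) = Some p" using p'(1) s by (auto split: option.splits simp del: app.simps sv.simps)
  have 1: "sound (n, p', (S @ invs S) @ [(i, l, cinv x, r)], [] @ [(i, l, cinv x, r)])"
    using sound_append[of n p' "S @ invs S" "[]" p' "[(i, l, cinv x, r)]" p] IH p'(2) a
    by (simp add: run_append del: app.simps sound.simps)
  have "sound (n, p, [(i, l, x, r)] @ ((S @ invs S) @ [(i, l, cinv x, r)]), [(i, l, x, r)] @ ([] @ [(i, l, cinv x, r)]))"
    using sound_prepend[OF 1, of p "[(i, l, x, r)]"] p' s Cons.prems by (simp del: app.simps sound.simps)
  then have "sound (n, p, s # S @ invs (s # S), [])" using sound_trans[OF _ c] by (simp add: s invs_Cons del: sound.simps)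
  then show ?case using IH p' a by (simp add: s invs_Cons run_append del: app.simps sound.simps)
qed simp

lemma invs_invs: "list_all (\<lambda>(i, l, x, r). is_swap x) S \<Longrightarrow> invs (invs S) = S"
proof (induction S)
  case (Cons s S)
  obtain i l x r where "s = (i, l, x, r)" by (cases s)
  moreover have "invs (A @ [(i, l, x, r)]) = (i, l, cinv x, r) # invs A" for A i l x r by (simp add: invs_def)
  ultimately show ?case using Cons by (cases x) (auto simp: invs_Cons)
qed simp

lemma swap_list_invs: "list_all (\<lambda>(i, l, x, r). is_swap x) S \<Longrightarrow> list_all (\<lambda>(i, l, x, r). is_swap x) (invs S)"
proof (induction S)
  case (Cons s S)
  obtain i l x r where "s = (i, l, x, r)" by (cases s)
  then show ?case using Cons by (cases x) (auto simp: invs_Cons)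
qed simp

text \<open>Cancelling the crossings on both sides of a naturality square leaves the square for the
  inverse crossings; it yields \<open>NatRI\<close> and \<open>NatLI\<close> from
  \<open>NatR\<close> and \<open>NatL\<close>.\<close>

lemma sound_conjugate:
  assumes "sound (n, p, A @ S', S @ A')"
    and S: "run n p S = Some p2" "list_all (\<lambda>(i, l, x, r). is_swap x) S"
    and S': "run n p A = Some p1" "list_all (\<lambda>(i, l, x, r). is_swap x) S'"
  shows "sound (n, p2, A' @ invs S', invs S @ A)"
proof -
  from assms(1) obtain q where q: "run n p (A @ S') = Some q" "run n p (S @ A') = Some q" and w: "wf_path n p" by auto
  have r: "run n p1 S' = Some q" "run n p2 A' = Some q" using q S S' by (auto simp: run_append)
  have w1: "wf_path n p1" and w2: "wf_path n p2" and wq: "wf_path n q" using run_wf[OF S'(1) w] run_wf[OF S(1) w] run_wf[OF q(1) w] by auto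
  note i = invs_sound[OF S(1) w S(2)] and i' = invs_sound[OF r(1) w1 S'(2)]
  have j: "sound (n, p2, invs S @ S, [])"
    using invs_sound[OF i[THEN conjunct1] w2 swap_list_invs[OF S(2)]] invs_invs[OF S(2)] by simp
  have "sound (n, p2, invs S @ (A @ (S' @ invs S')), invs S @ (A @ []))"
    by (rule sound_prepend[OF sound_prepend[OF i'[THEN conjunct2] S'(1) w] i[THEN conjunct1] w2])
  moreover have "sound (n, p2, invs S @ ((A @ S') @ invs S'), invs S @ ((S @ A') @ invs S'))"
    by (rule sound_prepend[OF sound_append[OF assms(1) q(1) i'[THEN conjunct1]] i[THEN conjunct1] w2])
  moreover have "sound (n, p2, (invs S @ S) @ (A' @ invs S'), [] @ (A' @ invs S'))"
    using sound_append[OF j, of p2 "A' @ invs S'" p1] i S(1) r(2) i' by (simp add: run_append)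
  ultimately show ?thesis
    using sound_trans sound_sym append.assoc append_Nil append_Nil2 by metis
qed

lemma swap_list_swaps: "list_all (\<lambda>(i, l, x, r). is_swap x) (swaps p q)"
proof -
  have s: "list_all (\<lambda>(i, l, x, r). is_swap x) (shs j l r S) = list_all (\<lambda>(i, l, x, r). is_swap x) S" for j l r S
    by (induction S) auto
  have "list_all (\<lambda>(i, l, x, r). is_swap x) (swaps1 x q)" for x
    by (cases x) (induction q; auto simp: s split: prod.splits)
  then show ?thesis by (induction p) (auto simp: s)
qed

lemma sound_prefix: "sound (n, p, A @ V, T) \<Longrightarrow> \<exists>q. run n p A = Some q"
  by (auto simp: run_append split: option.splits)

lemma sound_rule_of:
  assumes "rule_of rs ref = Some R" "\<And>r. r \<in> set rs \<Longrightarrow> sound r"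
  shows "sound R"
proof -
  have cell: "run (l + cdom x + r) (shift l r (csrc x)) [(0, l, x, r)] = Some (shift l r (ctrg x))" for l x r
    using cell_wf(3)[of x] by (auto simp: cd_shift)
  have cell0: "run (cdom x) (csrc x) [(0, 0, x, 0)] = Some (ctrg x)" for x
    using cell[of 0 x 0] by simp
  have R: "sound (dom_g f + k + cdom x, (0, f, k + ccod x) # shift (dom_g f + k) 0 (csrc x),
    [(1, dom_g f + k, x, 0)] @ swaps [(0, f, 0)] (shift k 0 (ctrg x)),
    swaps [(0, f, 0)] (shift k 0 (csrc x)) @ [(0, cod_g f + k, x, 0)])" for f k x
  proof -
    have "wf_path (k + cdom x) (shift k 0 (csrc x))" "cd (k + cdom x) (shift k 0 (csrc x)) = k + ccod x"
      using wf_shift[OF cell_wf(1)[of x], of k 0] cd_shift[of k "cdom x" 0 "csrc x"] cell_wf(3)[of x] by (simp_all del: cd_shift)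
    then show ?thesis
      using sound_nat_right[of "dom_g f" "[(0, f, 0)]" "k + cdom x" "shift k 0 (csrc x)" "[(0, k, x, 0)]"] cell[of k x 0]
      by (simp add: add.assoc del: sound.simps run.simps swaps.simps)
  qed
  have L: "sound (cdom x + k + dom_g f, shift 0 (k + cod_g f) (csrc x) @ [(cdom x + k, f, 0)],
    [(0, 0, x, k + cod_g f)] @ swaps (ctrg x) [(k, f, 0)],
    swaps (csrc x) [(k, f, 0)] @ [(1, 0, x, k + dom_g f)])" for f k x
    using sound_nat_left[OF cell_wf(1)[of x], of "k + dom_g f" "[(k, f, 0)]" "[(0, 0, x, 0)]"] cell0[of x]
    by (simp add: add.assoc del: sound.simps run.simps swaps.simps)
  show ?thesis
  proof (cases ref)
    case (Given i)
    then have "R \<in> set rs" using assms(1) by (auto split: if_splits)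
    then show ?thesis by (rule assms(2))
  next
    case (NatR f k x)
    show ?thesis using R[of f k x] assms(1)[unfolded NatR rule_of.simps option.inject, symmetric] by (simp only: append_Cons append_Nil)
  next
    case (NatL f k x)
    show ?thesis using L[of x k f] assms(1)[unfolded NatL rule_of.simps option.inject, symmetric] by (simp only: append_Cons append_Nil)
  next
    case (NatRI f k x)
    have w: "wf_path (k + cdom x) (shift k 0 (csrc x))" "cd (k + cdom x) (shift k 0 (csrc x)) = k + ccod x"
      using wf_shift[OF cell_wf(1)[of x], of k 0] cd_shift[of k "cdom x" 0 "csrc x"] cell_wf(3)[of x] by (simp_all del: cd_shift)
    have r: "run (dom_g f + k + cdom x) ((0, f, k + ccod x) # shift (dom_g f + k) 0 (csrc x)) (swaps [(0, f, 0)] (shift k 0 (csrc x))) =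
        Some (shift (cod_g f + k) 0 (csrc x) @ [(0, f, k + cdom x)])"
      using swaps_sem[of "dom_g f" "[(0, f, 0)]", OF _ w(1)] w(2) by (simp add: add.assoc del: swaps.simps)
    obtain p1 where
      "run (dom_g f + k + cdom x) ((0, f, k + ccod x) # shift (dom_g f + k) 0 (csrc x)) [(1, dom_g f + k, x, 0)] = Some p1"
      using sound_prefix[OF R[of f k x]] by blast
    from sound_conjugate[OF R[of f k x] r swap_list_swaps this swap_list_swaps]
    show ?thesis using assms(1)[unfolded NatRI rule_of.simps option.inject, symmetric] by (simp only: append_Cons append_Nil)
  next
    case (NatLI f k x)
    have r: "run (cdom x + k + dom_g f) (shift 0 (k + cod_g f) (csrc x) @ [(cdom x + k, f, 0)]) (swaps (csrc x) [(k, f, 0)]) =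
        Some ((ccod x + k, f, 0) # shift 0 (k + dom_g f) (csrc x))"
      using swaps_sem[OF cell_wf(1)[of x], of "k + dom_g f" "[(k, f, 0)]"] cell_wf(3)[of x] by (simp add: add.assoc del: swaps.simps)
    obtain p1 where
      "run (cdom x + k + dom_g f) (shift 0 (k + cod_g f) (csrc x) @ [(cdom x + k, f, 0)]) [(0, 0, x, k + cod_g f)] = Some p1"
      using sound_prefix[OF L[of x k f]] by blast
    from sound_conjugate[OF L[of x k f] r swap_list_swaps this swap_list_swaps]
    show ?thesis using assms(1)[unfolded NatLI rule_of.simps option.inject, symmetric] by (simp only: append_Cons append_Nil)
  next
    case (Cancel x)
    then show ?thesis using assms(1) sound_cancel[of x] by (auto simp del: sound.simps split: if_splits)
  qed
qed

lemma sound_replace: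
  assumes "run n p S = Some q'" "wf_path n p" "S = U @ A @ V" "run n p U = Some q" "sound (n, q, A, A')"
  shows "sound (n, p, S, U @ A' @ V)"
proof -
  have wq: "wf_path n q" using run_wf[OF assms(4,2)] by simp
  obtain q1 where q1: "run n q A = Some q1" using assms(5) by auto
  have "run n q1 V = Some q'" using assms(1,3,4) q1 by (auto simp: run_append)
  from sound_prepend[OF sound_append[OF assms(5) q1 this] assms(4,2)] show ?thesis unfolding assms(3) by (simp only: append_assoc)
qed

lemma exec1_sound:
  assumes "exec1 rs n p S c = Some T" "\<And>r. r \<in> set rs \<Longrightarrow> sound r" "run n p S = Some q'" "wf_path n p"
  shows "sound (n, p, S, T)"
proof (cases c)
  case (Ex d j)
  from assms(1)[unfolded Ex] obtain i l x r i' l' y r' V where d: "drop j S = (i, l, x, r) # (i', l', y, r') # V"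
    by (auto split: list.splits)
  have S: "S = take j S @ [(i, l, x, r), (i', l', y, r')] @ V" using append_take_drop_id[of j S] d by simp
  obtain q where q: "run n p (take j S) = Some q" and rq: "run n q [(i, l, x, r), (i', l', y, r')] \<noteq> None"
  proof -
    have "run n p (take j S @ [(i, l, x, r), (i', l', y, r')] @ V) = Some q'" using assms(3) S by simp
    then show thesis using that unfolding run_append by (auto split: option.splits simp del: run.simps)
  qed
  have wq: "wf_path n q" using run_wf[OF q assms(4)] by simp
  obtain q2 where q2: "run n q [(i, l, x, r), (i', l', y, r')] = Some q2" using rq by auto
  show ?thesis
  proof (cases d)
    case True
    then have T: "i + length (ctrg x) \<le> i'" "T = take j S @ [(i' - length (ctrg x) + length (csrc x), l', y, r'), (i, l, x, r)] @ V"
      using assms(1) Ex d by (auto split: if_splits)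
    show ?thesis unfolding T(2) by (rule sound_replace[OF assms(3,4) S q sound_exchange[OF wq q2 T(1)]])
  next
    case False
    then have T: "i' + length (csrc y) \<le> i" "T = take j S @ [(i', l', y, r'), (i - length (csrc y) + length (ctrg y), l, x, r)] @ V"
      using assms(1) Ex d by (auto split: if_splits)
    show ?thesis unfolding T(2) by (rule sound_replace[OF assms(3,4) S q sound_exchange'[OF wq q2 T(1)]])
  qed
next
  case (Use ref b j k l r)
  from assms(1)[unfolded Use] obtain n0 p0 A0 B0 q where R: "rule_of rs ref = Some (n0, p0, A0, B0)" and q: "run n p (take j S) = Some q"
    by (auto split: option.splits)
  define A B0' where "A = (if b then B0 else A0)" and "B0' = (if b then A0 else B0)"
  have s: "sound (n0, p0, A, B0')" using sound_rule_of[OF R assms(2)] sound_sym unfolding A_def B0'_def by auto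
  have c: "take (length A) (drop j S) = shs k l r A" "k \<le> length q" "take (length p0) (drop k q) = shift l r p0"
    "cd n (drop (length p0) (drop k q)) = l + n0 + r" and T: "T = take j S @ shs k l r B0' @ drop (length A) (drop j S)"
    using assms(1) Use R q unfolding A_def B0'_def by (auto simp: Let_def split: if_splits simp del: drop_drop)
  have S: "S = take j S @ shs k l r A @ drop (length A) (drop j S)"
    using append_take_drop_id[of j S] append_take_drop_id[of "length A" "drop j S"] c(1) by simp
  have wq: "wf_path n q" using run_wf[OF q assms(4)] by simp
  let ?p1 = "take k q" and ?p2 = "drop (length p0) (drop k q)"
  have qq: "q = ?p1 @ shift l r p0 @ ?p2"
    using append_take_drop_id[of k q] append_take_drop_id[of "length p0" "drop k q"] c(3) by simp
  have w0: "wf_path n0 p0" using s by simp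
  have w2: "wf_path n ?p2" and w3: "wf_path (cd n (shift l r p0 @ ?p2)) ?p1"
    using wq qq by (metis wf_append)+
  have "cd n (shift l r p0 @ ?p2) = l + cd n0 p0 + r" using c(4) by simp
  then have "sound (n, ?p1 @ shift l r p0 @ ?p2, shs (length ?p1) l r A, shs (length ?p1) l r B0')"
    using sound_whisker[OF s w2 c(4), of ?p1] w3 by simp
  then have "sound (n, q, shs k l r A, shs k l r B0')" using qq c(2) by (simp del: sound.simps drop_drop)
  from sound_replace[OF assms(3,4) S q this] show ?thesis unfolding T .
qed

end

text \<open>
  Reversing both composition of 1-cells and the tensor product is a symmetry of the theory of Hopf
  monoids; it exchanges \<open>m\<close> with \<open>m\<^sup>r\<close> and, for instance, \<open>lun\<close> with the inverse of \<open>co_run\<close>.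
\<close>

fun mgen1 :: "gen1 \<Rightarrow> gen1" where
  "mgen1 ga = ga" | "mgen1 gm = gn" | "mgen1 gn = gm" | "mgen1 gu = gv" | "mgen1 gv = gu"

fun mgen2 :: "gen2 \<Rightarrow> gen2" where
  "mgen2 Asc = Cas" | "mgen2 AscI = CasI" | "mgen2 Cas = Asc" | "mgen2 CasI = AscI"
| "mgen2 Lun = CrI" | "mgen2 LunI = Cr" | "mgen2 Run = ClI" | "mgen2 RunI = Cl"
| "mgen2 Cl = RunI" | "mgen2 ClI = Run" | "mgen2 Cr = LunI" | "mgen2 CrI = Lun"
| "mgen2 Theta = RTheta" | "mgen2 RTheta = Theta" | "mgen2 h = h"

fun mcell :: "cell \<Rightarrow> cell" where
  "mcell (Gen h) = Gen (mgen2 h)" | "mcell (Sw f k g) = Sw (mgen1 g) k (mgen1 f)" | "mcell (Si f k g) = Si (mgen1 g) k (mgen1 f)"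

definition mpath :: "path \<Rightarrow> path" where
  "mpath p = rev (map (\<lambda>(l, g, r). (r, mgen1 g, l)) p)"

text \<open>Positions are counted from the other end of the path, so the length of the path met by
  each slice is needed and the diagram is run alongside. The order of the slices is kept: vertical
  composition is not reversed.\<close>

fun mslices :: "nat \<Rightarrow> path \<Rightarrow> slice list \<Rightarrow> slice list" where
  "mslices n p [] = []"
| "mslices n p ((i, l, x, r) # S) = (length p - i - length (csrc x), r, mcell x, l) #
    (case app n p (i, l, x, r) of None \<Rightarrow> [] | Some q \<Rightarrow> mslices n q S)"

fun mrule :: "rule \<Rightarrow> rule" where
  "mrule (n, p, S, T) = (cd n p, mpath p, mslices n p S, mslices n p T)"

fun mref :: "ref \<Rightarrow> ref" where
  "mref (Given i) = Given i"
| "mref (NatR f k x) = NatL (mgen1 f) k (mcell x)" | "mref (NatL f k x) = NatR (mgen1 f) k (mcell x)"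
| "mref (NatRI f k x) = NatLI (mgen1 f) k (mcell x)" | "mref (NatLI f k x) = NatRI (mgen1 f) k (mcell x)"
| "mref (Cancel x) = Cancel (mcell x)"

text \<open>\<open>Ex\<close> changes direction because the two ends of the path are exchanged. The
  place of a rule is measured from the far end of the current path, which is why the diagram is an
  argument.\<close>

fun mstep :: "rule list \<Rightarrow> nat \<Rightarrow> path \<Rightarrow> slice list \<Rightarrow> step \<Rightarrow> step" where
  "mstep rs n p S (Ex d j) = Ex (\<not> d) j"
| "mstep rs n p S (Use ref b j k l r) = Use (mref ref) b j
    (length (the (run n p (take j S))) - k - length (fst (snd (the (rule_of rs ref))))) r l"

text \<open>
  \<open>Dn j\<close> and \<open>Up j\<close> exchange slice \<open>j\<close> with the next one, \<open>Nt\<close> is naturality of interchangers, \<open>Cn\<close> and \<open>Ins\<close>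
  cancel and insert an interchanger and its inverse, and \<open>Fw k j\<close> and \<open>Bw k j\<close> rewrite at slice \<open>j\<close> with the
  \<open>k\<close>-th rule from left to right and from right to left. The left-hand side of the rule must not be
  empty there, since its first slice locates the redex; \<open>At\<close> gives the position explicitly.
\<close>

datatype cstep = Dn nat | Up nat | Nt nat bool nat | Cn nat | Ins cell nat nat nat nat | Fw nat nat | Bw nat nat | At nat bool nat nat nat nat

text \<open>Truncated subtraction is harmless here: \<open>exec1\<close> compares the whole redex
  before it rewrites.\<close>

definition match_head :: "nat \<Rightarrow> bool \<Rightarrow> nat \<Rightarrow> slice \<Rightarrow> slice \<Rightarrow> step" where
  "match_head k b j s t = (case (s, t) of ((i, l, x, r), (i', l', x', r')) \<Rightarrow> Use (Given k) b j (i - i') (l - l') (r - r'))"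

text \<open>In the \<open>Nt\<close> case slice \<open>j\<close> is the one that carries the 2-cell
  \<open>x\<close>, and \<open>f\<close> is the layer next to the source of \<open>x\<close> in the
  path, on the side selected by \<open>above\<close>. Read backwards, the rule begins with the
  \<open>c\<close> crossings of \<open>f\<close> with the source of \<open>x\<close>, hence the
  start \<open>j - c\<close>.\<close>

fun expand :: "rule list \<Rightarrow> nat \<Rightarrow> path \<Rightarrow> slice list \<Rightarrow> cstep \<Rightarrow> step" where
  "expand rs n p S (Dn j) = Ex True j"
| "expand rs n p S (Up j) = Ex False j"
| "expand rs n p S (Cn j) = (case S ! j of (i, l, x, r) \<Rightarrow> Use (Cancel x) False j i l r)"
| "expand rs n p S (Ins x j k l r) = Use (Cancel x) True j k l r"
| "expand rs n p S (Fw k j) = match_head k False j (S ! j) (hd (fst (snd (snd (rs ! k)))))"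
| "expand rs n p S (Bw k j) = match_head k True j (S ! j) (hd (snd (snd (snd (rs ! k)))))"
| "expand rs n p S (At k b j i l r) = Use (Given k) b j i l r"
| "expand rs n p S (Nt k b j) = (case S ! j of (i, l, x, r) \<Rightarrow>
    (let q = the (run n p (take j S)); c = length (csrc x);
         above = (b = (k = 1 \<or> k = 2));
         i' = (if above then i - 1 else i); (L, f, R) = (if above then q ! (i - 1) else q ! (i + c));
         j' = (if b then j - c else j)
     in if k = 0 then Use (NatR f (l - L - (if b then cod_g f else dom_g f)) x) b j' i' L r
        else if k = 1 then Use (NatL f (L - l - (if b then ccod x else cdom x)) x) b j' i' l R
        else if k = 2 then Use (NatRI f (l - L - (if b then dom_g f else cod_g f)) x) b j' i' L r
        else Use (NatLI f (L - l - (if b then cdom x else ccod x)) x) b j' i' l R))"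

fun follow :: "rule list \<Rightarrow> nat \<Rightarrow> path \<Rightarrow> slice list \<Rightarrow> cstep list \<Rightarrow> slice list option" where
  "follow rs n p S [] = Some S"
| "follow rs n p S (c # cs) = (case exec1 rs n p S (expand rs n p S c) of None \<Rightarrow> None | Some T \<Rightarrow> follow rs n p T cs)"

text \<open>The two runs advance together because the reflection of a step depends on the diagram to
  which the original step is applied.\<close>

fun follow2 :: "rule list \<Rightarrow> rule list \<Rightarrow> nat \<Rightarrow> path \<Rightarrow> slice list \<Rightarrow> nat \<Rightarrow> path \<Rightarrow> slice list \<Rightarrow> cstep list \<Rightarrow> (slice list \<times> slice list) option" where
  "follow2 rs ms n p S n' p' S' [] = Some (S, S')"
| "follow2 rs ms n p S n' p' S' (c # cs) = (let s = expand rs n p S c in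
    case exec1 rs n p S s of None \<Rightarrow> None | Some T \<Rightarrow>
    case exec1 ms n' p' S' (mstep rs n p S s) of None \<Rightarrow> None | Some T' \<Rightarrow> follow2 rs ms n p T n' p' T' cs)"

fun proves :: "rule list \<Rightarrow> cstep list \<Rightarrow> rule \<Rightarrow> bool" where
  "proves rs cs (n, p, S, T) \<longleftrightarrow> wf_path n p \<and> run n p S \<noteq> None \<and> follow rs n p S cs = Some T"

text \<open>That the reflection of a derivation is again a derivation is not a theorem here; it is evaluated
  together with the derivation.\<close>

fun proves2 :: "rule list \<Rightarrow> cstep list \<Rightarrow> rule \<Rightarrow> bool" where
  "proves2 rs cs (n, p, S, T) \<longleftrightarrow> wf_path n p \<and> run n p S \<noteq> None \<and>
    (case mrule (n, p, S, T) of (n', p', S', T') \<Rightarrow> wf_path n' p' \<and> run n' p' S' \<noteq> None \<and>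
      follow2 rs (map mrule rs) n p S n' p' S' cs = Some (T, T'))"

context diagrams
begin

lemma follow_sound:
  assumes "follow rs n p S cs = Some T" "\<And>r. r \<in> set rs \<Longrightarrow> sound r" "run n p S = Some q" "wf_path n p"
  shows "sound (n, p, S, T)"
  using assms
proof (induction cs arbitrary: S)
  case Nil
  then show ?case by simp
next
  case (Cons c cs)
  from Cons.prems(1) obtain U where U: "exec1 rs n p S (expand rs n p S c) = Some U" "follow rs n p U cs = Some T"
    by (auto split: option.splits)
  note s = exec1_sound[OF U(1) Cons.prems(2-4)]
  then have "run n p U = Some q" using Cons.prems(3) by auto
  from sound_trans[OF s Cons.IH[OF U(2) Cons.prems(2) this Cons.prems(4)]] show ?case .
qed

lemma follow2_derive: "follow2 rs ms n p S n' p' S' cs = Some (T, T') \<Longrightarrow> follow rs n p S cs = Some T"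
  by (induction cs arbitrary: S S') (auto split: option.splits simp: Let_def)

lemma follow2_sound:
  assumes "follow2 rs ms n p S n' p' S' cs = Some (T, T')" "\<And>r. r \<in> set ms \<Longrightarrow> sound r" "run n' p' S' = Some q'" "wf_path n' p'"
  shows "sound (n', p', S', T')"
  using assms
proof (induction cs arbitrary: S S')
  case Nil
  then show ?case by simp
next
  case (Cons c cs)
  from Cons.prems(1) obtain U U' where U: "exec1 ms n' p' S' (mstep rs n p S (expand rs n p S c)) = Some U'"
      "follow2 rs ms n p U n' p' U' cs = Some (T, T')"
    by (auto split: option.splits simp: Let_def)
  note s = exec1_sound[OF U(1) Cons.prems(2-4)]
  then have "run n' p' U' = Some q'" using Cons.prems(3) by auto
  from sound_trans[OF s Cons.IH[OF U(2) Cons.prems(2) this Cons.prems(4)]] show ?case .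
qed

lemma proves_sound: "proves rs cs R \<Longrightarrow> list_all sound rs \<Longrightarrow> sound R"
  by (cases R) (auto simp del: sound.simps simp: list_all_iff intro: follow_sound)

lemma proves2_proves: "proves2 rs cs R \<Longrightarrow> proves rs cs R"
  by (cases R) (auto simp: Let_def dest: follow2_derive split: prod.splits)

lemmas proves2_sound = proves_sound[OF proves2_proves]

text \<open>Soundness of the reflected rules in the given interpretation is a premise, and this is
  what replaces a dual Gray monoid. For the axioms the premise is met by separate
  certificates.\<close>

lemma proves2_sound_mirror:
  assumes "proves2 rs cs R" "list_all (\<lambda>r. sound (mrule r)) rs"
  shows "sound (mrule R)"
proof -
  obtain n p S T where R: "R = (n, p, S, T)" by (cases R)
  obtain n' p' S' T' where M: "mrule R = (n', p', S', T')" by (cases "mrule R")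
  have 1: "wf_path n' p'" "run n' p' S' \<noteq> None"
    "follow2 rs (map mrule rs) n p S n' p' S' cs = Some (T, T')"
    using assms(1) M[unfolded R] unfolding R proves2.simps by (auto simp del: mrule.simps)
  have 2: "\<And>r. r \<in> set (map mrule rs) \<Longrightarrow> sound r"
    using assms(2) by (auto simp: list_all_iff simp del: sound.simps mrule.simps)
  obtain q' where "run n' p' S' = Some q'" using 1(2) by blast
  then have "sound (n', p', S', T')" by (intro follow2_sound[OF 1(3)] 1(1) 2)
  then show ?thesis unfolding M[unfolded R] R .
qed

end

section \<open>Diagrams that represent given cells\<close>

context diagrams
begin

definition rep1 :: "nat \<Rightarrow> path \<Rightarrow> 'a \<Rightarrow> bool" where
  "rep1 n p f \<longleftrightarrow> wf_path n p \<and> pth n p = f"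

text \<open>The bridge between terms and diagrams. Because \<open>run\<close> and
  \<open>adms\<close> are included, every representation also proves that the represented term is
  well typed.\<close>

definition rep :: "nat \<Rightarrow> path \<Rightarrow> slice list \<Rightarrow> path \<Rightarrow> 'c \<Rightarrow> bool" where
  "rep n p S q \<alpha> \<longleftrightarrow> wf_path n p \<and> run n p S = Some q \<and> adms S \<and> sem n p S = \<alpha>"

lemma rep1_hom: "rep1 n p f \<Longrightarrow> f \<in> hom1 B (P n) (P (cd n p))"
  using pth_hom by (auto simp: rep1_def)

lemma rep_in2: "rep n p S q \<alpha> \<Longrightarrow> in2 \<alpha> (pth n p) (pth n q) (P n) (P (cd n p))"
  using sem_in2 by (auto simp: rep_def)

lemma rep_hom2: "rep n p S q \<alpha> \<Longrightarrow> rep1 n p f \<Longrightarrow> rep1 n q g \<Longrightarrow> \<alpha> \<in> hom2 B f g"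
  using in2D(1)[OF rep_in2] by (auto simp: rep1_def)

lemma rep_wf: "rep n p S q \<alpha> \<Longrightarrow> wf_path n p" "rep n p S q \<alpha> \<Longrightarrow> wf_path n q" "rep n p S q \<alpha> \<Longrightarrow> cd n q = cd n p"
  using run_wf by (auto simp: rep_def)

lemma rep_cong: "rep n p S q \<alpha> \<Longrightarrow> n = n' \<Longrightarrow> p = p' \<Longrightarrow> S = S' \<Longrightarrow> q = q' \<Longrightarrow> rep n' p' S' q' \<alpha>"
  by simp

lemma rep1_cong: "rep1 n p f \<Longrightarrow> n = n' \<Longrightarrow> p = p' \<Longrightarrow> rep1 n' p' f"
  by simp

lemma rep_sound:
  assumes "rep n p S q \<alpha>" "rep n p T q \<alpha>"
  shows "sound (n, p, S, T)"
  using assms by (auto simp: rep_def)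

lemma sound_rep:
  assumes "sound (n, p, S, T)" "rep n p S q \<alpha>"
  shows "rep n p T q \<alpha>"
  using assms by (auto simp: rep_def)

lemma rep_det: "rep n p S q \<alpha> \<Longrightarrow> rep n p S q' \<beta> \<Longrightarrow> \<alpha> = \<beta>"
  by (auto simp: rep_def)

lemma rep1_gen: "rep1 (dom_g g) [(0, g, 0)] (v1 g)"
  using pth_single[of "dom_g g" 0 g 0] wk1_0[OF v1_hom] by (simp add: rep1_def)

lemma rep1_id: "rep1 n [] (\<one>\<^sub>1 (P n))"
  by (simp add: rep1_def)

lemma rep1_comp: "rep1 n p f \<Longrightarrow> rep1 k q g \<Longrightarrow> k = cd n p \<Longrightarrow> rep1 n (q @ p) (g \<odot> f)"
  by (auto simp: rep1_def wf_append pth_append)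

lemma rep1_left: "rep1 n p f \<Longrightarrow> rep1 (k + n) (shift k 0 p) (P k \<ltimes>\<^sub>1 f)"
  using pth_shift[of n p k 0] wf_shift[of n p k 0] wk1_left[OF rep1_hom[of n p f]] by (auto simp: rep1_def)

lemma rep1_right: "rep1 n p f \<Longrightarrow> rep1 (n + k) (shift 0 k p) (f \<rtimes>\<^sub>1 P k)"
  using pth_shift[of n p 0 k] wf_shift[of n p 0 k] wk1_right[OF rep1_hom[of n p f]] by (auto simp: rep1_def)

lemma rep1_tens: "rep1 n p f \<Longrightarrow> rep1 k q g \<Longrightarrow> rep1 (n + k) (shift 0 (cd k q) p @ shift n 0 q) (f \<otimes>\<^sub>1 g)"
proof -
  assume f: "rep1 n p f" and g: "rep1 k q g"
  have "cd (n + k) (shift n 0 q) = n + cd k q" using cd_shift[of n k 0 q] by (simp del: cd_shift)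
  then show ?thesis unfolding tens1_def
    using rep1_comp[OF rep1_left[OF g, of n] rep1_right[OF f, of "cd k q"]] hom1_cells0[OF rep1_hom[OF f]] hom1_cells0[OF rep1_hom[OF g]]
    by simp
qed

lemma rep_id: "rep1 n p f \<Longrightarrow> rep n p [] p (\<one>\<^sub>2 f)"
  by (auto simp: rep_def rep1_def)

lemma rep_gen:
  assumes "adm (Gen h)"
  shows "rep (gdom h) (gsrc h) [(0, 0, Gen h, 0)] (gtrg h) (v2 h)"
proof -
  note i = cell_in2[OF assms]
  have a: "app (gdom h) (gsrc h) (0, 0, Gen h, 0) = Some (gtrg h)" using cell_wf(3)[of "Gen h"] by simp
  have v: "sv (gdom h) (gsrc h) (0, 0, Gen h, 0) = v2 h"
    using h_id(1)[OF i] h_id(2)[OF i] wk2_0[OF i] by simp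
  show ?thesis using assms a v v_id(1)[OF i] cell_wf(1)[of "Gen h"] unfolding rep_def by (simp del: app.simps sv.simps)
qed

lemma rep_vcomp: "rep n p S q \<alpha> \<Longrightarrow> rep n' q' T r \<beta> \<Longrightarrow> n' = n \<Longrightarrow> q' = q \<Longrightarrow> rep n p (S @ T) r (\<beta> \<cdot> \<alpha>)"
  by (auto simp: rep_def run_append sem_append)

lemma rep_hcomp:
  assumes "rep n p S q \<alpha>" "rep k p' T q' \<beta>" "k = cd n p"
  shows "rep n (p' @ p) (T @ shs (length q') 0 0 S) (q' @ q) (\<beta> \<star> \<alpha>)"
proof -
  have w: "wf_path n p" "wf_path n q" "cd n q = cd n p" "wf_path k p'" "wf_path k q'" "cd k q' = cd k p'"
    using rep_wf[OF assms(1)] rep_wf[OF assms(2)] by auto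
  have r: "run n p S = Some q" "run k p' T = Some q'" "adms S" "adms T" "sem n p S = \<alpha>" "sem k p' T = \<beta>"
    using assms(1,2) by (auto simp: rep_def)
  note i1 = rep_in2[OF assms(1)] and i2 = rep_in2[OF assms(2)]
  note w1 = whisker[of k p' T q' n p 0 0 "[]", OF r(2) w(4) w(1), simplified, OF assms(3)[symmetric]]
  note w2 = whisker[of n p S q n "[]" 0 0 q', OF r(1) w(1), simplified, OF w(5)[unfolded assms(3)]]
  have 1: "sem n (p' @ p) T = \<beta> \<star> \<one>\<^sub>2 (pth n p)"
    using w1(2)[OF r(4)] r(6) wk2_0[OF i2] h_id(1)[OF in2_hcomp[OF in2_id[OF pth_hom[OF w(1)]] i2[unfolded assms(3)]]] by (simp add: assms(3))
  have 2: "sem n (q' @ p) (shs (length q') 0 0 S) = \<one>\<^sub>2 (pth (cd n p) q') \<star> \<alpha>"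
    using w2(2)[OF r(3)] r(5) wk2_0[OF i1] h_id(2)[OF i1] by simp
  have wf: "wf_path n (p' @ p)" using w assms(3) by (simp add: wf_append)
  have "sem n (p' @ p) (T @ shs (length q') 0 0 S) = \<beta> \<star> \<alpha>"
    using sem_append[OF w1(1) w2(1) wf r(4)] r(3) 1 2 hcomp_split(2)[OF i1 i2[unfolded assms(3)]] by simp
  then show ?thesis using wf w1(1) w2(1) r by (simp add: rep_def run_append)
qed

lemma rep_left: "rep n p S q \<alpha> \<Longrightarrow> rep (k + n) (shift k 0 p) (shs 0 k 0 S) (shift k 0 q) (P k \<ltimes>\<^sub>2 \<alpha>)"
proof -
  assume a: "rep n p S q \<alpha>"
  then have r: "run n p S = Some q" "wf_path n p" "adms S" "sem n p S = \<alpha>" by (auto simp: rep_def)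
  note w = whisker[of n p S q "k + n" "[]" k 0 "[]", OF r(1,2), simplified]
  note i = in2_ltens[OF P_obj rep_in2[OF a], of k]
  show ?thesis using w r wf_shift[OF r(2), of k 0] h_id(1)[OF i] h_id(2)[OF i]
    by (simp add: rep_def wk2_left[OF rep_in2[OF a]] P_add)
qed

lemma rep_right: "rep n p S q \<alpha> \<Longrightarrow> rep (n + k) (shift 0 k p) (shs 0 0 k S) (shift 0 k q) (\<alpha> \<rtimes>\<^sub>2 P k)"
proof -
  assume a: "rep n p S q \<alpha>"
  then have r: "run n p S = Some q" "wf_path n p" "adms S" "sem n p S = \<alpha>" by (auto simp: rep_def)
  note w = whisker[of n p S q "n + k" "[]" 0 k "[]", OF r(1,2), simplified]
  note i = in2_rtens[OF P_obj rep_in2[OF a], of k]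
  show ?thesis using w r wf_shift[OF r(2), of 0 k] h_id(1)[OF i] h_id(2)[OF i]
    by (simp add: rep_def wk2_right[OF rep_in2[OF a]] P_add)
qed

lemma rep_interchanger:
  assumes "rep1 a p f" "rep1 b q g"
  shows "rep (a + b) (shift 0 (cd b q) p @ shift a 0 q) (swaps p q) (shift (cd a p) 0 q @ shift 0 b p) (\<Sigma> f g)"
    "rep (a + b) (shift (cd a p) 0 q @ shift 0 b p) (invs (swaps p q)) (shift 0 (cd b q) p @ shift a 0 q) (inv2 B (\<Sigma> f g))"
proof -
  have w: "wf_path a p" "wf_path b q" "pth a p = f" "pth b q = g" using assms by (auto simp: rep1_def)
  have ws: "wf_path (a + b) (shift 0 (cd b q) p @ shift a 0 q)"
    using wf_shift[OF w(2), of a 0] wf_shift[OF w(1), of 0 "cd b q"] cd_shift[of a b 0 q] by (simp add: wf_append del: cd_shift)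
  note s = swaps_sem[OF w(1,2), unfolded w(3,4)]
  show r: "rep (a + b) (shift 0 (cd b q) p @ shift a 0 q) (swaps p q) (shift (cd a p) 0 q @ shift 0 b p) (\<Sigma> f g)"
    using s ws by (simp add: rep_def adms_swaps)
  let ?S = "swaps p q" and ?p = "shift 0 (cd b q) p @ shift a 0 q" and ?q = "shift (cd a p) 0 q @ shift 0 b p"
  note wq = rep_wf(2)[OF r]
  note i = invs_sound[OF s[THEN conjunct1] ws swap_list_swaps]
  note j = invs_sound[OF i[THEN conjunct1] wq swap_list_invs[OF swap_list_swaps], unfolded invs_invs[OF swap_list_swaps]]
  have ad: "adms (invs ?S)" by (rule adms_invs[OF swap_list_swaps])
  have k: "rep (a + b) ?q (invs ?S) ?p (sem (a + b) ?q (invs ?S))" using i wq ad by (simp add: rep_def)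
  have "sem (a + b) ?q (invs ?S) \<cdot> \<Sigma> f g = \<one>\<^sub>2 (pth (a + b) ?p)"
    using i[THEN conjunct2] sem_append[OF s[THEN conjunct1] i[THEN conjunct1] ws adms_swaps ad] s ad by (simp add: adms_swaps)
  moreover have "\<Sigma> f g \<cdot> sem (a + b) ?q (invs ?S) = \<one>\<^sub>2 (pth (a + b) ?q)"
    using j[THEN conjunct2] sem_append[OF i[THEN conjunct1] s[THEN conjunct1] wq ad adms_swaps] s ad by (simp add: adms_swaps)
  ultimately have "inv2 B (\<Sigma> f g) = sem (a + b) ?q (invs ?S)"
    using inv2_eqI[OF rep_in2[OF r], of "sem (a + b) ?q (invs ?S)"] rep_in2[OF k] rep_wf(3)[OF r] by simp
  then show "rep (a + b) ?q (invs ?S) ?p (inv2 B (\<Sigma> f g))" using k by simp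
qed

text \<open>Two cancellation equations between diagrams suffice to compute \<open>inv2\<close>. The
  structure cells defined as mates obtain their inverses in this way.\<close>

lemma rep_inv2:
  assumes "rep n p S q \<alpha>" "sound (n, p, S @ T, [])" "sound (n, q, T @ S, [])" "adms T"
  shows "rep n q T p (inv2 B \<alpha>)" "inverse2 B \<alpha> (inv2 B \<alpha>)"
proof -
  have r: "run n p S = Some q" "wf_path n p" "adms S" "sem n p S = \<alpha>" using assms(1) by (auto simp: rep_def)
  have t: "run n q T = Some p" using assms(2) r by (auto simp: run_append)
  note wq = rep_wf(2)[OF assms(1)]
  have k: "rep n q T p (sem n q T)" using t wq assms(4) by (simp add: rep_def)
  have e1: "sem n q T \<cdot> \<alpha> = \<one>\<^sub>2 (pth n p)" using sem_append[OF r(1) t r(2,3) assms(4)] assms(2,4) r by simp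
  have e2: "\<alpha> \<cdot> sem n q T = \<one>\<^sub>2 (pth n q)" using sem_append[OF t r(1) wq assms(4) r(3)] assms(3,4) r by simp
  have i2: "in2 (sem n q T) (pth n q) (pth n p) (P n) (P (cd n p))" using rep_in2[OF k] rep_wf(3)[OF assms(1)] by simp
  note i1 = rep_in2[OF assms(1)]
  have e: "inv2 B \<alpha> = sem n q T" by (rule inv2_eqI[OF i1 i2 e1 e2])
  then show "rep n q T p (inv2 B \<alpha>)" using k by simp
  show "inverse2 B \<alpha> (inv2 B \<alpha>)" unfolding e inverse2_def
    using in2_cells[OF i1] in2_cells[OF i2] in2D(1)[OF i2] e1 e2 by simp
qed

end

section \<open>Diagrammatic equations of Hopf monoids\<close>

text \<open>\<open>beta_d\<close> and \<open>alpha_d\<close> are the 2-cells \<open>\<beta>\<close> and \<open>\<alpha>\<close> in the definition of \<open>\<phi>\<close> and \<open>\<psi>\<close>, and \<open>kappa_d\<close> and \<open>tau_d\<close> are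
  the transposes \<open>u\<^sup>r \<Rightarrow> u\<^sup>r.a\<close> of \<open>\<eta>\<close> and \<open>u\<^sup>r.a \<Rightarrow> u\<^sup>r\<close> of \<open>\<theta>\<close>. In the notation of Hopf algebras, \<open>prod_d\<close> is
  \<open>x \<otimes> y \<mapsto> x y\<close>, \<open>quot_d\<close> is \<open>x \<otimes> y \<mapsto> x S(y)\<close> and \<open>retraction_d\<close> is \<open>x \<otimes> y \<mapsto> \<tau> (x S(y\<^sub>1)) y\<^sub>2\<close>.\<close>

definition beta_d :: "slice list" where
  "beta_d = [(0,0,Gen EtaM,0), (1,0,Gen Run,0)]"

definition alpha_d :: "slice list" where
  "alpha_d = [(1,0,Gen EtaM,0), (0,0,Gen ClI,0)]"

definition kappa_d :: "slice list" where
  "kappa_d = [(0,0,Gen EtaU,0), (1,0,Gen One,0)]"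

definition tau_d :: "slice list" where
  "tau_d = [(0,0,Gen EtaU,0), (1,0,Gen Theta,0), (1,0,Gen EpsU,0)]"

definition prod_d :: "slice list" where
  "prod_d = [(0,0,Si gv 0 ga,0), (1,0,Si ga 0 ga,0)] @ alpha_d @ [(0,0,Gen Mul,0)]"

definition quot_d :: "slice list" where
  "quot_d = [(0,0,Gen Sig,0), (4,0,Si ga 0 gu,0), (3,0,Si ga 0 gn,0), (2,0,Si ga 0
  ga,1)] @ shs 5 0 0 beta_d @ [(4,0,Gen Cas,0), (1,0,Gen Mul,1)]"

definition retraction_d :: "slice list" where
  "retraction_d = [(0,0,Gen Del,0)] @ shs 1 0 0 quot_d @ shs 1 0 1 tau_d @ [(1,0,Gen ClI,0)]"

section \<open>The axioms as rewriting rules\<close>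

definition cas_def_r :: rule where
  "cas_def_r = (1, [(1,gn,0), (0,gn,0)],
    [(0,0,Gen Cas,0)],
    [(0,0,Gen EtaM,1), (1,0,Gen EtaM,0), (2,0,Gen Asc,0), (3,1,Gen EpsM,0), (2,0,Gen EpsM,0)])"

definition tri_m1_r :: rule where
  "tri_m1_r = (2, [(0,gm,0)],
    [(1,0,Gen EtaM,0), (0,0,Gen EpsM,0)],
    [])"

definition asc_ci_r :: rule where
  "asc_ci_r = (3, [(0,gm,0), (1,gm,0)],
    [(0,0,Gen AscI,0), (0,0,Gen Asc,0)],
    [])"

definition tri_m2_r :: rule where
  "tri_m2_r = (1, [(0,gn,0)],
    [(0,0,Gen EtaM,0), (1,0,Gen EpsM,0)],
    [])"

definition asc_c_r :: rule where
  "asc_c_r = (3, [(0,gm,0), (0,gm,1)],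
    [(0,0,Gen Asc,0), (0,0,Gen AscI,0)],
    [])"

definition cl_def_r :: rule where
  "cl_def_r = (1, [],
    [(0,0,Gen Cl,0)],
    [(0,0,Gen EtaU,1), (1,0,Gen EtaM,0), (2,0,Gen Lun,0)])"

definition tri_u1_r :: rule where
  "tri_u1_r = (0, [(0,gu,0)],
    [(1,0,Gen EtaU,0), (0,0,Gen EpsU,0)],
    [])"

definition lun_ci_r :: rule where
  "lun_ci_r = (1, [],
    [(0,0,Gen LunI,0), (0,0,Gen Lun,0)],
    [])"

definition lun_c_r :: rule where
  "lun_c_r = (1, [(0,gm,0), (0,gu,1)],
    [(0,0,Gen Lun,0), (0,0,Gen LunI,0)],
    [])"

definition tri_u2_r :: rule where
  "tri_u2_r = (1, [(0,gv,0)],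
    [(0,0,Gen EtaU,0), (1,0,Gen EpsU,0)],
    [])"

definition cr_def_r :: rule where
  "cr_def_r = (1, [],
    [(0,0,Gen Cr,0)],
    [(0,1,Gen EtaU,0)] @ shs 1 0 0 beta_d)"

definition run_ci_r :: rule where
  "run_ci_r = (1, [],
    [(0,0,Gen RunI,0), (0,0,Gen Run,0)],
    [])"

definition run_c_r :: rule where
  "run_c_r = (1, [(0,gm,0), (1,gu,0)],
    [(0,0,Gen Run,0), (0,0,Gen RunI,0)],
    [])"

definition cl_c_r :: rule where
  "cl_c_r = (1, [],
    [(0,0,Gen Cl,0), (0,0,Gen ClI,0)],
    [])"

definition triangle_r :: rule where
  "triangle_r = (2, [(0,gm,0), (0,gm,1), (1,gu,1)],
    [(0,0,Gen Asc,0), (1,1,Gen Lun,0)],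
    [(1,0,Gen Run,1)])"

definition pentagon_r :: rule where
  "pentagon_r = (4, [(0,gm,0), (0,gm,1), (0,gm,2)],
    [(0,0,Gen Asc,0), (1,0,Si gm 0 gm,0), (0,0,Gen Asc,0)],
    [(1,0,Gen Asc,1), (0,0,Gen Asc,0), (1,1,Gen Asc,0)])"

text \<open>The first antipode axiom with \<open>phi\<close> expanded. The target
  \<open>(a \<circ> j) \<bullet> i\<close> contains \<open>m.(u 1)\<close>, so both sides contain
  the inverse of \<open>lun\<close>, a common factor that \<open>hopf1_r\<close> removes.\<close>

definition hopf1_raw_r :: rule where
  "hopf1_raw_r = (1, [(0,ga,0)],
    [(0,0,Gen Del,0), (0,0,Gen Sig,0), (4,0,Si ga 0 gu,0), (3,0,Si ga 0 gn,0), (2,0,Si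
    ga 0 ga,1)] @ shs 5 0 0 beta_d @ [(4,0,Gen Cas,0), (0,0,Gen LunI,0), (3,0,Gen Mul,1)],
    [(0,0,Gen Eps,0), (0,0,Gen Cl,0), (0,0,Gen LunI,0)] @ shs 2 0 1 kappa_d)"

definition cr_c_r :: rule where
  "cr_c_r = (1, [],
    [(0,0,Gen Cr,0), (0,0,Gen CrI,0)],
    [])"

definition hopf2_raw_r :: rule where
  "hopf2_raw_r = (1, [(0,ga,0)],
    [(0,0,Gen Del,0), (1,0,Gen Sig,0), (0,0,Si gv 0 ga,0), (1,0,Si gm 0 ga,0), (2,1,Si
    ga 0 ga,0)] @ alpha_d @ [(0,0,Gen Asc,0), (6,0,Gen Cr,0), (1,1,Gen Mul,0)],
    [(0,0,Gen Eps,0), (0,0,Gen Cr,0), (0,0,Gen RunI,0), (2,1,Gen EtaU,0), (1,1,Gen One,0)])"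

definition cas_c_r :: rule where
  "cas_c_r = (1, [(1,gn,0), (0,gn,0)],
    [(0,0,Gen Cas,0), (0,0,Gen CasI,0)],
    [])"

text \<open>The crossings come from the choice \<open>f g = (f 1).(1 g)\<close> for the product of
  1-cells: \<open>b_assoc\<close> has to move \<open>m\<close> and \<open>m^r\<close> past a
  neighbouring factor.\<close>

definition assoc_r :: rule where
  "assoc_r = (1, [(0,gm,0), (0,gm,1), (0,ga,2), (1,ga,1), (0,gn,1),
  (1,ga,0), (0,gn,0)],
    [(1,0,Gen Mul,1), (0,0,Gen Mul,0)],
    [(4,0,Sw gn 0 ga,0), (0,0,Gen Asc,0), (5,0,Gen CasI,0), (1,0,Si ga 0 gm,0), (2,1,Gen
    Mul,0), (0,0,Gen Mul,0)])"

definition runit_r :: rule where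
  "runit_r = (1, [(0,gm,0), (0,ga,1), (1,gu,0), (1,gv,0), (0,gn,0)],
    [(2,1,Gen One,0), (0,0,Gen Mul,0)],
    [(1,0,Sw ga 0 gu,0), (0,0,Gen Run,0), (1,0,Gen CrI,0)])"

definition lunit_r :: rule where
  "lunit_r = (1, [(0,gm,0), (0,gu,1), (0,gv,1), (1,ga,0), (0,gn,0)],
    [(1,0,Gen One,1), (0,0,Gen Mul,0)],
    [(2,0,Sw gv 0 ga,0), (0,0,Gen Lun,0), (1,0,Gen ClI,0)])"

definition del_mul_r :: rule where
  "del_mul_r = (1, [(0,gm,0), (0,ga,1), (1,ga,0), (0,gn,0)],
    [(0,0,Gen Mul,0), (0,0,Gen Del,0)],
    [(1,0,Gen Del,1), (3,1,Gen Del,0), (2,0,Sw ga 0 ga,0), (3,0,Gen EtaM,0), (0,0,Gen Mul,0), (1,0,Gen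
    Mul,0)])"

definition coassoc_r :: rule where
  "coassoc_r = (1, [(0,ga,0)],
    [(0,0,Gen Del,0), (0,0,Gen Del,0)],
    [(0,0,Gen Del,0), (1,0,Gen Del,0)])"

definition counit0_r :: rule where
  "counit0_r = (1, [(0,ga,0)],
    [(0,0,Gen Del,0), (0,0,Gen Eps,0)],
    [])"

definition cointegral_normal_r :: rule where
  "cointegral_normal_r = (1, [(0,gu,0), (0,gv,0)],
    shs 1 0 0 kappa_d @ [(0,0,Gen Theta,0)],
    [])"

definition cl_ci_r :: rule where
  "cl_ci_r = (1, [(0,gv,1), (0,gn,0)],
    [(0,0,Gen ClI,0), (0,0,Gen Cl,0)],
    [])"

definition cointegral_a_r :: rule where
  "cointegral_a_r = (1, [(0,gu,0), (0,gv,0), (0,ga,0)],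
    [(2,0,Gen Del,0), (0,0,Gen Theta,0)],
    [(0,0,Gen Theta,0)] @ shs 1 0 0 kappa_d)"

definition cointegral_j_r :: rule where
  "cointegral_j_r = (1, [(0,gu,0), (0,gv,0), (0,ga,0)],
    [(1,0,Gen EtaU,0), (2,0,Gen Theta,0)],
    [(0,0,Gen Theta,0), (1,0,Gen EtaU,0)])"

definition counit1_r :: rule where
  "counit1_r = (1, [(0,ga,0)],
    [(0,0,Gen Del,0), (1,0,Gen Eps,0)],
    [])"

section \<open>Inverses of the mates\<close>

definition cas_inv1_r :: rule where
  "cas_inv1_r = (1, [(1,gn,0), (0,gn,0)],
    [(0,0,Gen Cas,0), (0,1,Gen EtaM,0), (1,0,Gen EtaM,0), (2,0,Gen AscI,0), (3,0,Gen EpsM,1), (2,0,Gen EpsM,0)],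
    [])"

text \<open>Taking mates reverses vertical composition and preserves identities, so the inverse of
  the mate of \<open>asc\<close> is the mate of its inverse. The certificate brings units next to
  counits and cancels them by triangle identities.\<close>

lemma cas_inv1_cert:
  "proves [cas_def_r, tri_m1_r, asc_ci_r, tri_m2_r] [Fw 0 0, Up 4, Up 3, Up 5, Up 2, Up 1, Up 4, Up 6, Up 3, Up 2, Up
  5, Up 4, Up 3, Up 7, Up 6, Up 5, Up 0, Up 1, Up 2, Up 4, Fw 1 3, Up 6, Up 5, Up 4, Fw 1 3, Fw 2 2, Dn 1, Fw 3 0, Fw
  3 0] cas_inv1_r"
  by code_simp

definition cas_inv2_r :: rule where
  "cas_inv2_r = (1, [(0,gn,1), (0,gn,0)],
    [(0,1,Gen EtaM,0), (1,0,Gen EtaM,0), (2,0,Gen AscI,0), (3,0,Gen EpsM,1), (2,0,Gen EpsM,0), (0,0,Gen Cas,0)],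
    [])"

lemma cas_inv2_cert:
  "proves [cas_def_r, tri_m1_r, asc_c_r, tri_m2_r] [Fw 0 5, Up 4, Up 3, Up 5, Up 2, Up 1, Up 4, Up 6, Up 3, Up 2, Up
  5, Up 4, Up 3, Up 7, Up 6, Up 5, Up 0, Up 1, Up 2, Up 4, Fw 1 3, Up 6, Up 5, Up 4, Fw 1 3, Fw 2 2, Dn 1, Fw 3 0, Fw
  3 0] cas_inv2_r"
  by code_simp

definition cl_inv1_r :: rule where
  "cl_inv1_r = (1, [],
    [(0,0,Gen Cl,0), (0,0,Gen LunI,0), (1,0,Gen EpsU,1), (0,0,Gen EpsM,0)],
    [])"

lemma cl_inv1_cert:
  "proves [cl_def_r, tri_u1_r, tri_m1_r, lun_ci_r] [Fw 0 0, Up 2, Up 3, Up 1, Up 0, Up 2, Fw 1 1, Up 2, Fw 2 1, Fw 3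
  0] cl_inv1_r"
  by code_simp

definition cl_inv2_r :: rule where
  "cl_inv2_r = (1, [(0,gv,1), (0,gn,0)],
    [(0,0,Gen LunI,0), (1,0,Gen EpsU,1), (0,0,Gen EpsM,0), (0,0,Gen Cl,0)],
    [])"

lemma cl_inv2_cert:
  "proves [cl_def_r, lun_c_r, tri_u2_r, tri_m2_r] [Fw 0 3, Up 2, Up 1, Up 0, Up 3, Up 2, Up 1, Up 4, Up 3, Up 2, Fw 1
  2, Dn 1, Fw 2 0, Fw 3 0] cl_inv2_r"
  by code_simp

definition cr_inv1_r :: rule where
  "cr_inv1_r = (1, [],
    [(0,0,Gen Cr,0), (0,0,Gen RunI,0), (1,1,Gen EpsU,0), (0,0,Gen EpsM,0)],
    [])"

lemma cr_inv1_cert: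
  "proves [cr_def_r, tri_u1_r, tri_m1_r, run_ci_r] [Fw 0 0, Up 2, Up 3, Up 1, Up 0, Up 2, Fw 1 1, Up 2, Fw 2 1, Fw 3
  0] cr_inv1_r"
  by code_simp

definition cr_inv2_r :: rule where
  "cr_inv2_r = (1, [(1,gv,0), (0,gn,0)],
    [(0,0,Gen RunI,0), (1,1,Gen EpsU,0), (0,0,Gen EpsM,0), (0,0,Gen Cr,0)],
    [])"

lemma cr_inv2_cert:
  "proves [cr_def_r, run_c_r, tri_u2_r, tri_m2_r] [Fw 0 3, Up 2, Up 1, Up 0, Up 3, Up 2, Up 1, Up 4, Up 3, Up 2, Fw 1
  2, Dn 1, Fw 2 0, Fw 3 0] cr_inv2_r"
  by code_simp

text \<open>A second form of \<open>\<alpha>\<close>: insert \<open>m.(u 1)\<close> by the inverse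
  of \<open>lun\<close>, then cancel \<open>u\<close> against its right adjoint. It does not mention
  \<open>co_lun\<close>, and so it fits the unit laws of the monoidale.\<close>

definition alpha2_r :: rule where
  "alpha2_r = (2, [(0,gv,1)],
    [(0,0,Gen LunI,0), (1,0,Gen EpsU,1)],
    alpha_d)"

lemma alpha2_cert:
  "proves [cl_c_r, cl_def_r, lun_c_r, tri_u2_r] [At 0 True 2 0 0 0, Fw 1 2, Up 1, Up 0, Up 2, Up 1, Up 3, Up 2, Fw 2
  2, Dn 1, Fw 3 0] alpha2_r"
  by code_simp

definition cotriangle_r :: rule where
  "cotriangle_r = (1, [(0,gn,0)],
    [(0,1,Gen Cl,0), (1,0,Gen Cas,0)],
    [(0,0,Gen Cr,1)])"

lemma cotriangle_cert:
  "proves [cl_def_r, cas_def_r, tri_m1_r, triangle_r, tri_m2_r, cr_def_r] [Fw 0 0, Fw 1 3, Up 2, Up 3, Up 4, Up 5, Up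
  1, Up 2, Up 3, Fw 2 4, Fw 3 3, Dn 2, Fw 4 3, Bw 5 0] cotriangle_r"
  by code_simp

section \<open>Unit laws that follow from pentagon and triangle\<close>

definition kelly_r1_r :: rule where
  "kelly_r1_r = (3, [(0,gm,0), (0,gm,1), (0,gm,2), (2,gu,1)],
    [(1,0,Gen Asc,1), (2,1,Gen Run,1)],
    [(2,0,Sw gm 0 gu,1), (1,0,Gen Run,1)])"

text \<open>Kelly's argument: the law is shown first with one more factor on the right, where
  pentagon and triangle apply; \<open>kelly_r_cert\<close> then puts a unit into that factor and
  cancels it.\<close>

lemma kelly_r1_cert:
  "proves [asc_c_r, triangle_r, pentagon_r] [At 0 True 2 0 0 0, Up 1, Bw 1 2, Bw 2 0, Dn 2, Nt 0 False 2, Cn 1, Dn 0,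
  Fw 1 1, Fw 0 2] kelly_r1_r"
  by code_simp

definition kelly_r_r :: rule where
  "kelly_r_r = (2, [(0,gm,0), (0,gm,1), (2,gu,0)],
    [(0,0,Gen Asc,0), (1,1,Gen Run,0)],
    [(1,0,Sw gm 0 gu,0), (0,0,Gen Run,0)])"

lemma kelly_r_cert:
  "proves [run_ci_r, kelly_r1_r] [At 0 True 0 0 0 0, Ins (Si gm 0 gu) 1 1 0 0, Ins (Si gm 1
  gu) 2 2 0 0, Ins (Si gu 0 gu) 3 3 2 0, Dn 7, Dn 8, Nt 1 True 7, Dn 7, Up 4, Nt 1 True 7, Fw 1
  4, Nt 3 True 4, Up 4, Cn 5, Dn 1, Nt 3 True 4, Dn 0, Dn 1, Fw 0 2] kelly_r_r"
  by code_simp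

definition pentagon_i_r :: rule where
  "pentagon_i_r = (4, [(0,gm,0), (1,gm,0), (2,gm,0)],
    [(1,1,Gen AscI,0), (0,0,Gen AscI,0), (1,0,Gen AscI,1)],
    [(0,0,Gen AscI,0), (1,0,Sw gm 0 gm,0), (0,0,Gen AscI,0)])"

lemma pentagon_i_cert:
  "proves [asc_ci_r, pentagon_r, asc_c_r] [At 0 True 0 0 0 0, Ins (Sw gm 0 gm) 1 1 0 0, At 0 True 2 0 0
  0, Fw 1 3, Fw 2 5, Fw 2 4, Fw 2 3] pentagon_i_r"
  by code_simp

definition kelly_l1_r :: rule where
  "kelly_l1_r = (3, [(0,gm,0), (1,gm,0), (2,gm,0), (1,gu,2)],
    [(1,1,Gen AscI,0), (2,1,Gen Lun,1)],
    [(2,1,Si gu 0 gm,0), (1,1,Gen Lun,0)])"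

lemma kelly_l1_cert:
  "proves [asc_ci_r, triangle_r, pentagon_i_r] [At 0 True 2 0 0 0, Up 1, At 0 True 2 1 0 1, Fw 1 3, Fw 2 0, Dn 2, Fw
  0 3, Nt 3 False 2, Cn 1, Bw 1 2, Up 1, Fw 0 0] kelly_l1_r"
  by code_simp

definition kelly_l_r :: rule where
  "kelly_l_r = (2, [(0,gm,0), (1,gm,0), (0,gu,2)],
    [(0,0,Gen AscI,0), (1,0,Gen Lun,1)],
    [(1,0,Si gu 0 gm,0), (0,0,Gen Lun,0)])"

lemma kelly_l_cert:
  "proves [lun_ci_r, kelly_l1_r] [At 0 True 0 0 0 0, Ins (Sw gu 0 gm) 1 1 0 0, Ins (Sw gu 1
  gm) 2 2 0 0, Ins (Sw gu 0 gu) 3 3 0 2, Dn 7, Dn 8, Nt 2 True 7, Dn 7, Up 4, Nt 2 True 7, Fw 1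
  4, Nt 0 True 4, Up 4, Cn 5, Dn 1, Nt 0 True 4, Dn 0, Dn 1, Fw 0 2] kelly_l_r"
  by code_simp

definition kelly_l_i_r :: rule where
  "kelly_l_i_r = (2, [(0,gm,0)],
    [(1,0,Gen LunI,1), (0,0,Gen Asc,0)],
    [(0,0,Gen LunI,0), (1,0,Sw gu 0 gm,0)])"

lemma kelly_l_i_cert:
  "proves [lun_ci_r, kelly_l_r, lun_c_r, asc_ci_r] [At 0 True 0 0 0 0, Ins (Sw gu 0 gm) 1 1 0 0, Bw 1
  2, Fw 2 3, Fw 3 2] kelly_l_i_r"
  by code_simp

definition kelly_u1_r :: rule where
  "kelly_u1_r = (1, [(0,gm,0), (0,gm,1), (0,gu,2), (0,gu,1)],
    [(1,0,Gen Lun,1)],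
    [(2,0,Sw gu 0 gu,1), (1,0,Gen Run,1)])"

lemma kelly_u1_cert:
  "proves [asc_c_r, kelly_l_r, lun_c_r, triangle_r] [At 0 True 0 0 0 0, Fw 1 1, At 2 True 3 0 0 0, Dn 2, Nt 0 False
  2, Cn 1, Dn 0, Fw 2 3, Fw 3 1] kelly_u1_r"
  by code_simp

text \<open>The left and the right unitor agree at the unit. As \<open>u\<close> meets itself, one
  side carries a crossing.\<close>

definition kelly_u_r :: rule where
  "kelly_u_r = (0, [(0,gm,0), (0,gu,1), (0,gu,0)],
    [(0,0,Gen Lun,0)],
    [(1,0,Sw gu 0 gu,0), (0,0,Gen Run,0)])"

lemma kelly_u_cert:
  "proves [run_ci_r, kelly_u1_r] [At 0 True 0 0 0 0, Ins (Si gm 0 gu) 1 1 0 0, Ins (Si gu 1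
  gu) 2 2 0 0, Ins (Si gu 0 gu) 3 3 0 0, Dn 7, Nt 1 True 7, Up 4, Fw 1 4, Nt 3 True 4, Up 4, Cn
  5, Dn 1, Nt 3 True 4, Dn 0, Dn 1, Fw 0 2] kelly_u_r"
  by code_simp

text \<open>At the unit, \<open>\<alpha>\<close> becomes the counit of the adjunction of
  \<open>u\<close>, because the two unitors agree there. It is needed to simplify a product whose
  right factor is \<open>1\<close>.\<close>

definition unit_counit_r :: rule where
  "unit_counit_r = (1, [(0,gu,0), (0,gv,0)],
    [(0,0,Si gv 0 gu,0)] @ alpha_d @ [(0,0,Gen Run,0)],
    [(0,0,Gen EpsU,0)])"

lemma unit_counit_cert:
  "proves [alpha2_r, kelly_u_r, lun_ci_r] [Bw 0 1, Up 0, Nt 1 False 2, Cn 1, Up 2, Bw 1 1, Fw 2 0] unit_counit_r"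
  by code_simp

text \<open>Compatibility of \<open>\<beta>\<close> with coassociativity, a transpose of
  \<open>kelly_r_r\<close>. Its reflection is \<open>alpha_asc_r\<close>, a transpose of the
  corresponding left law.\<close>

definition beta_cas_r :: rule where
  "beta_cas_r = (1, [(2,gu,0), (0,gn,0)],
    shs 0 1 0 beta_d @ [(0,0,Gen Cas,0)],
    [(0,0,Si gn 0 gu,0)] @ shs 1 0 0 beta_d)"

lemma beta_cas_cert:
  "proves [cas_def_r, tri_m1_r, kelly_r_r, tri_m2_r] [Fw 0 2, Up 1, Up 2, Up 3, Up 4, Up 0, Up 1, Up 2, Fw 1 3, Fw 2
  2, Nt 3 True 0, Up 2, Cn 3, Dn 3, Dn 2, Nt 3 False 2, Nt 3 False 0, Dn 0, Fw 3 1] beta_cas_r"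
  by code_simp

definition alpha_asc_r :: rule where
  "alpha_asc_r = (3, [(0,gm,0), (0,gv,2)],
    shs 1 0 1 alpha_d @ [(0,0,Gen Asc,0)],
    [(0,0,Si gv 0 gm,0)] @ alpha_d)"

lemma alpha_asc_cert:
  "proves [alpha2_r, kelly_l_i_r] [Bw 0 0, Up 1, Fw 1 0, Nt 3 False 2, Cn 1, Dn 0, Fw 0 1] alpha_asc_r"
  by code_simp

definition cas_counit_r :: rule where
  "cas_counit_r = (1, [(0,gm,0), (0,gm,1), (1,gn,0), (0,gn,0)],
    [(2,0,Gen Cas,0), (1,0,Gen EpsM,1), (0,0,Gen EpsM,0)],
    [(0,0,Gen Asc,0), (1,1,Gen EpsM,0), (0,0,Gen EpsM,0)])"

lemma cas_counit_cert:
  "proves [cas_def_r, tri_m1_r] [Fw 0 0, Up 4, Up 3, Up 2, Up 1, Fw 1 0, Up 3, Up 2, Up 1, Fw 1 0] cas_counit_r"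
  by code_simp

text \<open>The pentagon of the pseudo-comonoid. In front of counits, \<open>cas_counit_r\<close>
  trades \<open>Cas\<close> for \<open>Asc\<close>, and then \<open>pentagon_r\<close>
  applies.\<close>

definition copentagon_r :: rule where
  "copentagon_r = (1, [(2,gn,0), (1,gn,0), (0,gn,0)],
    [(0,1,Gen Cas,0), (1,0,Gen Cas,0), (0,0,Gen Cas,1)],
    [(1,0,Gen Cas,0), (0,0,Si gn 0 gn,0), (1,0,Gen Cas,0)])"

lemma copentagon_cert:
  "proves [tri_m2_r, cas_counit_r, pentagon_r] [At 0 True 3 2 0 0, At 0 True 3 1 0 1, At 0 True 3 0 0 2, Up 2, Up 4,
  Up 3, Fw 1 4, Up 1, Up 2, Up 3, Up 4, Up 6, Up 5, Fw 1 6, Up 0, Up 1, Up 2, Up 4, Up 3, Up 5, Up 4, Fw 1 5, Up 2,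
  Bw 2 3, Nt 3 True 0, Up 2, Up 3, Up 4, Dn 7, Nt 2 True 7, Bw 1 6, Dn 5, Dn 6, Nt 3 False 6, Up 5, Dn 4, Dn 3, Dn 2,
  Nt 3 False 0, Dn 3, Dn 4, Dn 5, Dn 2, Dn 3, Dn 4, Dn 1, Dn 2, Dn 3, Dn 3, Dn 0, Dn 1, Bw 1 6, Dn 5, Dn 6, Dn 4, Dn
  3, Up 4, Dn 2, Fw 0 3, Fw 0 3, Fw 0 3] copentagon_r"
  by code_simp

text \<open>In elements, \<open>y1 S(y2) = \<epsilon>(y) 1\<close>.\<close>

definition hopf1_r :: rule where
  "hopf1_r = (1, [(0,ga,0)],
    [(0,0,Gen Del,0)] @ quot_d,
    [(0,0,Gen Eps,0), (0,0,Gen Cl,0)] @ shs 0 0 1 kappa_d)"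

lemma hopf1_cert:
  "proves [lun_ci_r, hopf1_raw_r] [At 0 True 9 0 0 0, Up 8, Fw 1 0, Dn 2, Dn 3, Fw 0 4] hopf1_r"
  by code_simp

text \<open>In elements, \<open>S(y1) y2 = \<epsilon>(y) 1\<close>.\<close>

definition hopf2_r :: rule where
  "hopf2_r = (1, [(0,ga,0)],
    [(0,0,Gen Del,0), (1,0,Gen Sig,0), (0,0,Si gv 0 ga,0), (1,0,Si gm 0 ga,0), (2,1,Si
    ga 0 ga,0)] @ alpha_d @ [(0,0,Gen Asc,0), (1,1,Gen Mul,0)],
    [(0,0,Gen Eps,0), (0,0,Gen RunI,0), (2,1,Gen EtaU,0), (1,1,Gen One,0)])"

lemma hopf2_cert:
  "proves [cr_c_r, hopf2_raw_r] [At 0 True 9 3 0 0, Dn 8, Fw 1 0, Up 1, Up 2, Up 3, Fw 0 4] hopf2_r"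
  by code_simp

section \<open>Reflections of the axioms\<close>

lemma mirror_cl_def_cert:
  "proves [cr_c_r, cr_def_r, run_c_r] [At 0 True 1 0 0 0, Up 0, Fw 1 0, Fw 2 2] (mrule cl_def_r)"
  by code_simp

text \<open>Reflection turns the mate formula for \<open>co_run\<close> into one for the inverse of
  \<open>lun\<close>: the units of the adjunctions of \<open>u\<close> and \<open>m\<close>,
  followed by the inverse of \<open>co_lun\<close>.\<close>

lemma mirror_cr_def_cert:
  "proves [cl_c_r, cl_def_r, lun_c_r] [At 0 True 1 0 0 0, Up 0, Fw 1 0, Fw 2 2] (mrule cr_def_r)"
  by code_simp

lemma mirror_cotriangle_cert:
  "proves [lun_c_r, triangle_r, run_ci_r] [At 0 True 2 1 1 0, Fw 1 1, Fw 2 0] (mrule cotriangle_r)"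
  by code_simp

lemma mirror_unit_counit_cert:
  "proves [unit_counit_r] [Up 2, Fw 0 0] (mrule unit_counit_r)"
  by code_simp

text \<open>The reflected law has its crossings and associators on the opposite side of the
  equation, so it arises from the given law by composing with their inverses.\<close>

lemma mirror_assoc_cert:
  "proves [cas_c_r, asc_ci_r, assoc_r] [Ins (Sw ga 0 gm) 0 1 0 0, At 0 True 1 5 0 0, At 1 True 2 0 0 0,
  Ins (Si gn 0 ga) 3 4 0 0, Bw 2 4] (mrule assoc_r)"
  by code_simp

lemma mirror_lunit_cert:
  "proves [runit_r] [Fw 0 0, Dn 1] (mrule lunit_r)"
  by code_simp

lemma mirror_runit_cert:
  "proves [lunit_r] [Fw 0 0, Dn 1] (mrule runit_r)"
  by code_simp

lemma mirror_del_mul_cert: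
  "proves [del_mul_r] [Fw 0 0, Dn 0, Dn 4] (mrule del_mul_r)"
  by code_simp

lemma mirror_run_ci_cert:
  "proves [cl_c_r] [Fw 0 0] (mrule run_ci_r)"
  by code_simp

lemma mirror_cas_c_cert:
  "proves [asc_c_r] [Fw 0 0] (mrule cas_c_r)"
  by code_simp

lemma mirror_cl_c_cert:
  "proves [run_ci_r] [Fw 0 0] (mrule cl_c_r)"
  by code_simp

lemma mirror_cl_ci_cert:
  "proves [run_c_r] [Fw 0 0] (mrule cl_ci_r)"
  by code_simp

lemma mirror_cr_c_cert:
  "proves [lun_ci_r] [Fw 0 0] (mrule cr_c_r)"
  by code_simp

lemma mirror_tri_u2_cert:
  "proves [tri_u1_r] [Fw 0 0] (mrule tri_u2_r)"
  by code_simp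

lemma mirror_beta_cas_cert:
  "proves [alpha_asc_r] [Fw 0 0] (mrule beta_cas_r)"
  by code_simp

lemma mirror_alpha_asc_cert:
  "proves [beta_cas_r] [Fw 0 0] (mrule alpha_asc_r)"
  by code_simp

lemma mirror_copentagon_cert:
  "proves [pentagon_r] [Bw 0 0] (mrule copentagon_r)"
  by code_simp

lemma mirror_coassoc_cert:
  "proves [coassoc_r] [Bw 0 0] (mrule coassoc_r)"
  by code_simp

lemma mirror_counit1_cert:
  "proves [counit0_r] [Fw 0 0] (mrule counit1_r)"
  by code_simp

text \<open>Once freed from the unit isomorphisms, the two antipode axioms are reflections of one
  another.\<close>

lemma mirror_hopf1_cert:
  "proves [hopf2_r] [Fw 0 0] (mrule hopf1_r)"
  by code_simp

lemma mirror_hopf2_cert: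
  "proves [hopf1_r] [Fw 0 0] (mrule hopf2_r)"
  by code_simp

section \<open>Hopf algebra identities\<close>

definition tau_norm_r :: rule where
  "tau_norm_r = (1, [(0,gv,0)],
    kappa_d @ tau_d,
    [])"

lemma tau_norm_cert:
  "proves2 [cointegral_normal_r, tri_u2_r] [Up 1, Up 0, Fw 0 1, Fw 1 0] tau_norm_r"
  by code_simp

text \<open>In elements, \<open>(x S(y1)) y2 = \<epsilon>(y) x\<close>. The target of
  \<open>quot_d\<close> is exactly the 1-cell that \<open>prod_d\<close> accepts as its left
  factor.\<close>

definition prod_quot_r :: rule where
  "prod_quot_r = (1, [(0,ga,0), (0,ga,0)],
    [(0,0,Gen Del,0)] @ shs 1 0 0 quot_d @ prod_d,
    [(0,0,Gen Eps,0)])"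

lemma prod_quot_cert:
  "proves2 [assoc_r, cas_c_r, hopf2_r, runit_r, cr_def_r, cr_c_r, run_ci_r] [Up 8, Dn 12, Nt 3 False 9, Up 13, Fw 0
  14, Up 7, Up 8, Up 9, Up 10, Dn 15, Up 12, Cn 13, Up 11, Fw 1 12, Up 15, Up 14, Up 13, Up 12, Up 6, Up 7, Up 8, Up
  9, Up 10, Up 11, Up 12, Up 13, Up 14, Up 5, Up 6, Up 7, Up 8, Up 9, Up 10, Up 11, Up 12, Up 13, Up 4, Up 3, Up 5,
  Up 4, Nt 3 False 6, Up 5, Up 8, Up 7, Up 6, Up 9, Up 8, Up 7, Up 10, Up 9, Up 8, Nt 2 True 13, Up 2, Up 3, Up 4, Up
  5, Up 6, Up 7, Up 8, Fw 2 0, Dn 3, Up 7, Nt 2 False 4, Dn 6, Fw 3 7, Nt 2 False 2, Up 2, Up 4, Up 3, Cn 2, Dn 5, Dn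
  4, Bw 4 2, Up 2, Fw 5 3, Fw 6 1] prod_quot_r"
  by code_simp

text \<open>In elements, \<open>x (y z) = (x y) z\<close>, where \<open>y z\<close> is formed by
  \<open>\<mu>\<close>. The left factor \<open>x\<close> carries a leg of \<open>m^r\<close>, so
  \<open>Cas\<close> and crossings join the associativity of \<open>\<mu>\<close>.\<close>

definition mul_assoc_g_r :: rule where
  "mul_assoc_g_r = (1, [(0,gm,0), (0,ga,1), (1,ga,0), (0,gn,0), (0,gv,1),
  (0,ga,1), (0,gn,0)],
    [(0,0,Gen Mul,0)] @ prod_d,
    [(3,0,Si gv 0 gn,0), (4,0,Si ga 0 gn,0), (5,0,Gen Cas,0), (2,0,Si gv 1
    ga,0), (3,0,Si ga 1 ga,0), (4,0,Si gn 0 ga,0)] @ shs 1 0 1 prod_d @ [(0,0,Gen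
    Mul,0)])"

lemma mul_assoc_g_cert:
  "proves2 [cas_c_r, alpha_asc_r, assoc_r] [Nt 2 False 0, Nt 2 False 4, Dn 3, Dn 2, Dn 1, Dn 4, Dn 3, Dn 5, Up 8, Up
  7, Up 9, Up 8, At 0 True 9 5 0 0, Dn 8, Ins (Si gn 0 ga) 10 4 0 0, Dn 9, Dn 7, Dn 8, Dn 6, Dn 7, Dn
  5, Dn 6, Dn 4, Dn 5, Dn 3, Dn 2, Bw 1 8, Dn 10, Bw 2 10] mul_assoc_g_r"
  by code_simp

section \<open>Sliding \<open>\<beta>\<close> and products past crossings\<close>

definition beta_v_r :: rule where
  "beta_v_r = (2, [(1,gu,0), (0,gv,1)],
    beta_d @ [(0,0,Si gv 0 gn,0)],
    [(0,0,Si gv 1 gu,0)] @ shs 1 1 0 beta_d)"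

lemma beta_v_cert:
  "proves2 [] [Nt 2 False 1, Dn 0, Nt 0 True 1, Cn 3, Dn 2, Cn 3] beta_v_r"
  by code_simp

definition beta_a_r :: rule where
  "beta_a_r = (2, [(2,gu,0), (0,ga,1)],
    shs 0 1 0 beta_d @ [(0,0,Si ga 0 gn,0)],
    [(0,0,Si ga 1 gu,0)] @ shs 1 1 0 beta_d)"

lemma beta_a_cert:
  "proves2 [] [Nt 2 False 1, Dn 0, Nt 0 True 1, Cn 3, Dn 2, Cn 3] beta_a_r"
  by code_simp

definition g_past_u_r :: rule where
  "g_past_u_r = (1, [(1,gu,0), (0,ga,0), (0,gv,1), (0,ga,1), (0,gn,0)],
    shs 1 0 0 prod_d @ [(0,0,Si ga 0 gu,0)],
    [(0,0,Si ga 0 gu,0), (1,0,Si gv 1 gu,0), (2,0,Si ga 1 gu,0), (3,0,Si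
    gn 0 gu,0)] @ shs 0 0 1 prod_d)"

lemma g_past_u_cert:
  "proves2 [] [Nt 3 False 4, Up 1, Up 2, Up 3, Nt 3 False 4, Nt 3 False 2, Dn 4, Dn 5, Up 1, Nt 3 False 2, Dn 2, Nt 3
  False 0, Dn 4, Dn 3, Dn 2, Dn 6, Dn 5, Dn 4, Dn 3, Dn 6, Dn 5] g_past_u_r"
  by code_simp

definition g_past_n_r :: rule where
  "g_past_n_r = (2, [(1,gn,0), (0,ga,1), (0,gv,2), (0,ga,2), (0,gn,1)],
    shs 1 0 1 prod_d @ [(0,0,Si ga 0 gn,0)],
    [(0,0,Si ga 0 gn,0), (1,0,Si gv 1 gn,0), (2,0,Si ga 1 gn,0), (3,0,Si
    gn 0 gn,0)] @ shs 0 0 2 prod_d)"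

lemma g_past_n_cert:
  "proves2 [] [Nt 3 False 4, Up 1, Up 2, Up 3, Nt 3 False 4, Nt 3 False 2, Dn 4, Dn 5, Up 1, Nt 3 False 2, Dn 2, Nt 3
  False 0, Dn 4, Dn 3, Dn 2, Dn 6, Dn 5, Dn 4, Dn 3, Dn 6, Dn 5] g_past_n_r"
  by code_simp

definition g_past_a_r :: rule where
  "g_past_a_r = (2, [(1,ga,0), (0,ga,1), (0,gv,2), (0,ga,2), (0,gn,1)],
    shs 1 0 1 prod_d @ [(0,0,Si ga 0 ga,0)],
    [(0,0,Si ga 0 ga,0), (1,0,Si gv 1 ga,0), (2,0,Si ga 1 ga,0), (3,0,Si
    gn 0 ga,0)] @ shs 0 0 1 prod_d)"

lemma g_past_a_cert:
  "proves2 [] [Nt 3 False 3, Up 2, Nt 3 False 6, Dn 5, Nt 3 False 3, Dn 4, Dn 3, Dn 5, Dn 4, Up 1, Nt 3 False 2, Nt 3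
  False 0, Dn 2, Dn 6, Dn 5, Dn 4, Dn 3] g_past_a_r"
  by code_simp

text \<open>In elements, \<open>(x y) S(z) = x (y S(z))\<close>. The antipode is spread over the
  five layers of \<open>a^-\<close>, and the product has to slide past \<open>u\<close>,
  \<open>m^r\<close> and \<open>a\<close> among them before associativity can be used.\<close>

definition quot_prod_r :: rule where
  "quot_prod_r = (1, [(0,ga,0), (0,ga,0), (0,gv,1), (0,ga,1), (0,gn,0)],
    shs 1 0 0 prod_d @ quot_d,
    quot_d @ [(2,0,Si gv 0 gn,0), (3,0,Si ga 0 gn,0), (4,0,Gen Cas,0)] @ shs 1 0 1
    prod_d)"

lemma quot_prod_cert:
  "proves2 [g_past_u_r, g_past_n_r, g_past_a_r, beta_cas_r, beta_a_r, beta_v_r, copentagon_r, mul_assoc_g_r] [Up 4,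
  Up 3, Up 2, Up 1, Up 0, Fw 0 1, Fw 1 5, Fw 2 9, Up 4, Up 3, Up 2, Up 8, Up 7, Up 6, Up 5, Up 4, Up 3, Up 14, Up 12,
  Up 13, Up 11, Up 12, Up 9, Up 10, Up 11, Up 8, Up 9, Up 10, Dn 17, Dn 16, Dn 15, Dn 14, Dn 13, Dn 12, Dn 11, Dn 10,
  Dn 9, Dn 8, Dn 7, Dn 18, Dn 17, Dn 16, Dn 15, Dn 14, Dn 13, Dn 12, Dn 11, Dn 10, Dn 9, Dn 8, Dn 12, Dn 11, Dn 10,
  Dn 13, Dn 12, Dn 11, Dn 19, Dn 18, Dn 17, Dn 16, Dn 15, Dn 14, Dn 13, Dn 12, Dn 15, Dn 14, Dn 16, Dn 15, Dn 17, Bw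
  3 6, Up 8, Up 9, Bw 4 5, Up 7, Bw 5 4, Bw 6 10, Nt 2 True 10, Dn 10, Nt 2 True 8, Dn 8, Dn 9, Bw 7 10, Up 9, Up 8,
  Up 7] quot_prod_r"
  by code_simp

definition prod_one_r :: rule where
  "prod_one_r = (1, [(0,gv,0), (0,gv,1), (0,ga,1), (0,gn,0)],
    kappa_d @ shs 1 0 0 prod_d,
    [(0,0,Si gv 0 gv,0), (1,0,Si ga 0 gv,0), (2,0,Gen CrI,0)])"

lemma prod_one_cert:
  "proves2 [runit_r, unit_counit_r, tri_u2_r] [Dn 5, Nt 2 False 1, Nt 2 False 3, Up 5, Fw 0 6, Up 4, Cn 5, Dn 5, Up
  6, Dn 4, Dn 2, Dn 3, Fw 1 4, Dn 0, Dn 1, Dn 2, Fw 2 3] prod_one_r"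
  by code_simp

text \<open>In elements, \<open>(x y1) S(y2) = \<epsilon>(y) x\<close>, by reassociation and
  \<open>hopf1_r\<close>; the companion of \<open>prod_quot_r\<close>.\<close>

definition quot_prod_counit_r :: rule where
  "quot_prod_counit_r = (1, [(0,ga,0), (0,gv,1), (0,ga,1), (0,gn,0)],
    [(0,0,Gen Del,0)] @ shs 1 0 0 prod_d @ quot_d,
    [(0,0,Gen Eps,0)])"

lemma quot_prod_counit_cert:
  "proves2 [quot_prod_r, hopf1_r, prod_one_r, cotriangle_r, cr_c_r] [Fw 0 1, Fw 1 0, Dn 3, Dn 2, Dn 4, Dn 3, Dn 5, Dn
  4, Fw 2 5, Up 4, Up 3, Nt 2 False 1, Up 3, Nt 2 False 1, Fw 3 1, Fw 4 1] quot_prod_counit_r"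
  by code_simp

definition prod_del_r :: rule where
  "prod_del_r = (1, [(0,ga,0), (0,gv,1), (0,ga,1), (0,gn,0)],
    prod_d @ [(0,0,Gen Del,0)],
    [(0,0,Gen Del,0), (3,0,Gen Del,1), (1,0,Si gv 0 ga,0), (2,0,Si ga 0 ga,0), (3,0,Si
    ga 0 ga,0), (3,0,Gen EtaM,0), (4,0,Gen Mul,0)] @ prod_d)"

lemma prod_del_cert:
  "proves2 [del_mul_r] [Fw 0 4, Dn 3, Dn 2, Nt 3 True 2, Dn 0, Up 3, Up 4, Nt 2 True 6, Dn 4, Dn 3, Nt 2 True 3, Cn
  8, Nt 2 True 2, Up 0, Dn 3, Dn 7, Dn 6, Dn 5, Dn 4, Up 6, Dn 8, Dn 7, Dn 6, Dn 5, Dn 9, Dn 10, Dn 9, Dn 8, Dn 7, Dn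
  6, Dn 8, Up 10] prod_del_r"
  by code_simp

definition one_prod_r :: rule where
  "one_prod_r = (1, [(0,ga,0)],
    [(1,0,Gen Cl,0)] @ shs 1 0 1 kappa_d @ prod_d,
    [])"

lemma one_prod_cert:
  "proves2 [lunit_r, cl_def_r, cl_c_r] [Up 2, Dn 6, Nt 3 False 3, Up 5, Fw 0 6, Nt 3 False 1, Dn 1, Up 4, Bw 1 2, Dn
  2, Cn 1, Up 0, Fw 2 1, Fw 2 0] one_prod_r"
  by code_simp

definition kappa_prod_r :: rule where
  "kappa_prod_r = (1, [(0,ga,0), (0,gv,1), (0,gn,0)],
    shs 1 0 1 kappa_d @ prod_d,
    [(1,0,Gen ClI,0)])"

lemma kappa_prod_cert:
  "proves2 [cl_ci_r, one_prod_r] [At 0 True 0 1 0 0, Fw 1 1] kappa_prod_r"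
  by code_simp

text \<open>In elements, \<open>x1 \<tau>(x2) = \<tau>(x) 1\<close>. Transposing
  \<open>\<theta>\<close> creates an additional unit \<open>\<eta>\<^sub>u\<close>; colinearity over
  \<open>j\<close> moves it through \<open>\<theta>\<close>, where a triangle identity removes
  it.\<close>

definition tau_a_r :: rule where
  "tau_a_r = (1, [(0,gv,0), (0,ga,0)],
    [(1,0,Gen Del,0)] @ tau_d,
    tau_d @ kappa_d)"

lemma tau_a_cert:
  "proves2 [cointegral_a_r, cointegral_j_r, tri_u2_r] [Up 0, Fw 0 1, Bw 1 1, Up 3, Up 2, Dn 0, Fw 2 1, At 2 True 2 2
  0 0, Bw 1 1, Dn 0, Dn 1, Dn 2] tau_a_r"
  by code_simp

definition tau_past_r :: rule where
  "tau_past_r = (2, [(0,ga,0), (0,gv,1), (0,ga,1)],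
    [(0,0,Si gv 0 ga,0), (1,0,Si ga 0 ga,0)] @ shs 0 0 1 tau_d,
    shs 1 0 1 tau_d @ [(0,0,Si gv 0 ga,0)])"

lemma tau_past_cert:
  "proves2 [] [Up 1, Up 0, Nt 3 True 0, Nt 3 True 5, Dn 1, Nt 3 True 5, Dn 2] tau_past_r"
  by code_simp

definition kap_past_r :: rule where
  "kap_past_r = (2, [(0,ga,0), (0,gv,1)],
    [(0,0,Si gv 0 ga,0)] @ shs 0 0 1 kappa_d,
    shs 1 0 1 kappa_d @ [(0,0,Si gv 0 ga,0), (1,0,Si ga 0 ga,0)])"

lemma kap_past_cert:
  "proves2 [] [Up 0, Nt 3 True 0, Nt 3 True 4, Dn 1] kap_past_r"
  by code_simp

section \<open>The colinear retraction of the comultiplication\<close>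

definition retraction_section_r :: rule where
  "retraction_section_r = (1, [(0,ga,0)],
    [(0,0,Gen Del,0)] @ retraction_d,
    [])"

lemma retraction_section_cert:
  "proves2 [coassoc_r, hopf1_r, tau_norm_r, cl_c_r, counit1_r] [Fw 0 0, Fw 1 1, Fw 2 3, Fw 3 2, Fw 4 0]
  retraction_section_r"
  by code_simp

definition retraction_right_r :: rule where
  "retraction_right_r = (1, [(0,ga,0), (0,ga,0)],
    retraction_d @ [(0,0,Gen Del,0)],
    [(0,0,Gen Del,0)] @ shs 1 0 0 retraction_d)"

lemma retraction_right_cert:
  "proves2 [coassoc_r] [Up 12, Up 11, Up 10, Up 9, Up 8, Up 7, Up 6, Up 5, Up 4, Up 3, Up 2, Up 1, Fw 0 0]
  retraction_right_r"
  by code_simp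

definition gamma_chi_r :: rule where
  "gamma_chi_r = (1, [(0,ga,0), (0,ga,0)],
    [(0,0,Gen Del,0)] @ shs 1 0 0 quot_d @ [(0,0,Gen Del,0)] @ shs 1 0 0 prod_d,
    [])"

lemma gamma_chi_cert:
  "proves2 [coassoc_r, prod_quot_r, counit1_r] [Up 8, Up 7, Up 6, Up 5, Up 4, Up 3, Up 2, Up 1, Fw 0 0, Fw 1 1, Fw 2
  0] gamma_chi_r"
  by code_simp

text \<open>By coassociativity the antipode meets the very factor that \<open>\<gamma>\<close> has
  just multiplied on, and \<open>quot_prod_counit_r\<close> cancels the two.\<close>

definition rho_gamma_r :: rule where
  "rho_gamma_r = (1, [(0,ga,0), (0,gv,1), (0,ga,1), (0,gn,0)],
    [(0,0,Gen Del,0)] @ shs 1 0 0 prod_d @ retraction_d,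
    shs 1 0 1 tau_d @ [(1,0,Gen ClI,0)])"

lemma rho_gamma_cert:
  "proves2 [coassoc_r, quot_prod_counit_r, counit1_r] [Up 5, Up 4, Up 3, Up 2, Up 1, Fw 0 0, Fw 1 1, Fw 2 0]
  rho_gamma_r"
  by code_simp

text \<open>After \<open>\<gamma>\<close>, the first side is \<open>x1 y1 \<otimes> \<rho>(x2 y2
  \<otimes> y3) = x1 y1 \<otimes> \<tau>(x2) y2\<close>, which \<open>tau_a_r\<close> turns into
  \<open>\<tau>(x) y1 \<otimes> y2\<close>. The certificate starts by inserting
  \<open>gamma_chi_r\<close> backwards and ends by removing it.\<close>

definition retraction_left_r :: rule where
  "retraction_left_r = (1, [(0,ga,0), (0,ga,0)],
    [(1,0,Gen Del,0)] @ retraction_d,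
    retraction_d @ [(0,0,Gen Del,0)])"

lemma retraction_left_cert:
  "proves2 [gamma_chi_r, prod_del_r, coassoc_r, rho_gamma_r, tau_a_r, tau_past_r, kap_past_r, kappa_prod_r] [At 0
  True 0 0 0 0, Fw 1 10, Bw 2 9, Dn 10, Dn 11, Dn 12, Dn 13, Dn 14, Dn 15, Fw 3 16, Up 10, Nt 3 False 11, Up 14, Up
  15, Up 16, Up 13, Up 14, Up 15, Fw 4 12, Fw 5 10, Fw 6 13, Up 18, Fw 7 13, Dn 9, Dn 10, Dn 11, Dn 12, Bw 3 9, Fw 0
  0] retraction_left_r"
  by code_simp

section \<open>Interpretation in a Hopf monoid\<close>

locale hopf_setting = map_monoidale B for B :: "('o, 'a, 'c, 'x) map_mon_scheme" (structure) +
  fixes a :: 'a and \<mu> \<eta> \<delta> \<epsilon> \<sigma> \<theta> :: 'c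
  assumes hopf: "hopf_monoid B a \<mu> \<eta> \<delta> \<epsilon> \<sigma>"
begin

fun val1 :: "gen1 \<Rightarrow> 'a" where
  "val1 ga = a" | "val1 gm = \<m>" | "val1 gu = \<u>" | "val1 gn = \<m>\<^sup>r" | "val1 gv = \<u>\<^sup>r"

fun val2 :: "gen2 \<Rightarrow> 'c" where
  "val2 Asc = asc B" | "val2 AscI = inv2 B (asc B)" | "val2 Lun = lun B" | "val2 LunI = inv2 B (lun B)"
| "val2 Run = map_mon.run B" | "val2 RunI = inv2 B (map_mon.run B)" | "val2 Cas = co_asc B" | "val2 CasI = inv2 B (co_asc B)"
| "val2 Cl = co_lun B" | "val2 ClI = inv2 B (co_lun B)" | "val2 Cr = co_run B" | "val2 CrI = inv2 B (co_run B)"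
| "val2 EtaM = \<eta>\<^sub>m" | "val2 EpsM = \<epsilon>\<^sub>m" | "val2 EtaU = \<eta>\<^sub>u" | "val2 EpsU = \<epsilon>\<^sub>u"
| "val2 Mul = \<mu>" | "val2 One = \<eta>" | "val2 Del = \<delta>" | "val2 Eps = \<epsilon>" | "val2 Sig = \<sigma>"
| "val2 Theta = \<theta>" | "val2 RTheta = \<theta>"

lemma bimon: "bimonoid B a \<mu> \<eta> \<delta> \<epsilon>" and sigma_hom: "\<sigma> \<in> hom2 B a (antipode_target B a)"
  using hopf by (auto simp: hopf_monoid_def)

lemma b_mon: "b_monoid B a \<mu> \<eta>" and c_comon: "c_comonoid B a \<delta> \<epsilon>"
  using bimon by (auto simp: bimonoid_def)

lemma a_hom: "a \<in> hom1 B \<M> \<M>" and mu_hom: "\<mu> \<in> hom2 B (bprod1 B a a) a" and one_hom: "\<eta> \<in> hom2 B (bunit B) a"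
  using b_mon by (auto simp: b_monoid_def)

lemma adj_homs:
  "\<m>\<^sup>r \<in> hom1 B \<M> (\<M> \<otimes>\<^sub>0 \<M>)" "\<eta>\<^sub>m \<in> hom2 B (\<one>\<^sub>1 (\<M> \<otimes>\<^sub>0 \<M>)) (\<m>\<^sup>r \<odot> \<m>)" "\<epsilon>\<^sub>m \<in> hom2 B (\<m> \<odot> \<m>\<^sup>r) (\<one>\<^sub>1 \<M>)"
  "\<u>\<^sup>r \<in> hom1 B \<M> \<I>" "\<eta>\<^sub>u \<in> hom2 B (\<one>\<^sub>1 \<I>) (\<u>\<^sup>r \<odot> \<u>)" "\<epsilon>\<^sub>u \<in> hom2 B (\<u> \<odot> \<u>\<^sup>r) (\<one>\<^sub>1 \<M>)"
  using mul_adjunction unt_adjunction hom1_cells0[OF mul_hom] hom1_cells0[OF unt_hom] by (auto simp: adjunction_def)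

sublocale diagrams B \<M> val1 val2
proof
  show "\<M> \<in> cells0 B" by (rule carr_obj)
  show "val1 g \<in> hom1 B (tpow B \<M> (dom_g g)) (tpow B \<M> (cod_g g))" for g
    using a_hom mul_hom unt_hom adj_homs carr_obj by (cases g) (auto simp: numeral_2_eq_2 tens0_unit)
qed

lemma P_simps: "P 0 = \<I>" "P 1 = \<M>" "P 2 = \<M> \<otimes>\<^sub>0 \<M>" "P (Suc 0) = \<M>"
  using carr_obj by (auto simp: numeral_2_eq_2 tens0_unit)

lemma rep1_consts:
  "rep1 1 [(0, ga, 0)] a" "rep1 2 [(0, gm, 0)] \<m>" "rep1 0 [(0, gu, 0)] \<u>" "rep1 1 [(0, gn, 0)] \<m>\<^sup>r" "rep1 1 [(0, gv, 0)] \<u>\<^sup>r"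
  "rep1 1 [] (\<one>\<^sub>1 \<M>)" "rep1 0 [] (\<one>\<^sub>1 \<I>)" "rep1 2 [] (\<one>\<^sub>1 (\<M> \<otimes>\<^sub>0 \<M>))"
  using rep1_gen[of ga] rep1_gen[of gm] rep1_gen[of gu] rep1_gen[of gn] rep1_gen[of gv] rep1_id[of 1] rep1_id[of 0] rep1_id[of 2] P_simps
  by simp_all

lemma rep1_M:
  "rep1 n p f \<Longrightarrow> rep1 (1 + n) (shift 1 0 p) (\<M> \<ltimes>\<^sub>1 f)" "rep1 n p f \<Longrightarrow> rep1 (n + 1) (shift 0 1 p) (f \<rtimes>\<^sub>1 \<M>)"
  using rep1_left[of n p f 1] rep1_right[of n p f 1] P_simps by simp_all

lemma rep_M:
  "rep n p S q \<alpha> \<Longrightarrow> rep (1 + n) (shift 1 0 p) (shs 0 1 0 S) (shift 1 0 q) (\<M> \<ltimes>\<^sub>2 \<alpha>)"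
  "rep n p S q \<alpha> \<Longrightarrow> rep (n + 1) (shift 0 1 p) (shs 0 0 1 S) (shift 0 1 q) (\<alpha> \<rtimes>\<^sub>2 \<M>)"
  using rep_left[of n p S q \<alpha> 1] rep_right[of n p S q \<alpha> 1] P_simps by simp_all

lemma rep_tens:
  assumes "rep n p S q \<alpha>" "rep k p' T q' \<beta>"
  shows "rep (n + k) (shift 0 (cd k p') p @ shift n 0 p') (shs 0 0 (cd k p') S @ shs (length q) n 0 T)
    (shift 0 (cd k p') q @ shift n 0 q') (\<alpha> \<otimes>\<^sub>2 \<beta>)"
proof -
  have "cd (n + k) (shift n 0 p') = n + cd k p'" using cd_shift[of n k 0 p'] by (simp del: cd_shift)
  then show ?thesis
    using rep_hcomp[OF rep_left[OF assms(2), of n] rep_right[OF assms(1), of "cd k p'"]]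
      in2_cells[OF rep_in2[OF assms(1)]] in2_cells[OF rep_in2[OF assms(2)]]
      hom1_cells0[OF pth_hom[OF rep_wf(1)[OF assms(1)]]] hom1_cells0[OF pth_hom[OF rep_wf(1)[OF assms(2)]]]
    by (simp add: tens2_def)
qed

lemmas rep1_intros = rep1_consts rep1_M rep1_tens rep1_comp

lemma rep_genI:
  assumes "\<alpha> \<in> hom2 B f g" "rep1 n p f" "rep1 n p' g" "val2 h = \<alpha>" "gdom h = n" "gsrc h = p" "gtrg h = p'"
  shows "rep n p [(0, 0, Gen h, 0)] p' \<alpha>"
proof -
  have "adm (Gen h)" using assms(1-3) unfolding assms(4)[symmetric] assms(5)[symmetric] assms(6)[symmetric] assms(7)[symmetric] rep1_def by simp
  from rep_gen[OF this] show ?thesis unfolding assms(4-7) .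
qed

text \<open>The boundaries and slices of the two representations are left open: the introduction
  rules compute them while descending the terms, and only the last premises compare the outcome with
  the stated rule.\<close>

lemma rep_eq_sound:
  "\<alpha> = \<beta> \<Longrightarrow> rep n1 p1 S1 q1 \<alpha> \<Longrightarrow> rep n2 p2 S2 q2 \<beta> \<Longrightarrow> q2 = q1 \<Longrightarrow> (n1, p1, S1) = (n, p, S) \<Longrightarrow> (n2, p2, S2) = (n, p, T) \<Longrightarrow> sound (n, p, S, T)"
  by (auto intro: rep_sound simp del: sound.simps)

lemma inv2_hom2:
  assumes "invertible2 B \<alpha>" "\<alpha> \<in> hom2 B f g"
  shows "inv2 B \<alpha> \<in> hom2 B g f"
proof -
  have "f \<in> cells1 B" using cells2_ends[of \<alpha>] assms(2) by (auto simp: hom2_def)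
  then have "in2 \<alpha> f g (src1 B f) (trg1 B f)" by (intro in2I[OF assms(2)]) (simp add: hom1_def)
  from in2D(1)[OF inv2_inverse(1)[OF assms(1) this]] show ?thesis .
qed

lemma rep1_MM:
  "rep1 3 [(0,gm,0),(0,gm,1)] (\<m> \<odot> (\<m> \<rtimes>\<^sub>1 \<M>))" "rep1 3 [(0,gm,0),(1,gm,0)] (\<m> \<odot> (\<M> \<ltimes>\<^sub>1 \<m>))"
  "rep1 1 [(0,gm,0),(0,gu,1)] (\<m> \<odot> (\<u> \<rtimes>\<^sub>1 \<M>))" "rep1 1 [(0,gm,0),(1,gu,0)] (\<m> \<odot> (\<M> \<ltimes>\<^sub>1 \<u>))"
  "rep1 2 [(0,gn,0),(0,gm,0)] (\<m>\<^sup>r \<odot> \<m>)" "rep1 1 [(0,gm,0),(0,gn,0)] (\<m> \<odot> \<m>\<^sup>r)"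
  "rep1 0 [(0,gv,0),(0,gu,0)] (\<u>\<^sup>r \<odot> \<u>)" "rep1 1 [(0,gu,0),(0,gv,0)] (\<u> \<odot> \<u>\<^sup>r)"
  by ((rule rep1_cong, (rule rep1_intros | (simp; fail))+)[1])+

lemma rep_asc:
  "rep 3 [(0,gm,0),(0,gm,1)] [(0,0,Gen Asc,0)] [(0,gm,0),(1,gm,0)] (asc B)"
  "rep 3 [(0,gm,0),(1,gm,0)] [(0,0,Gen AscI,0)] [(0,gm,0),(0,gm,1)] (inv2 B (asc B))"
proof -
  show "rep 3 [(0,gm,0),(0,gm,1)] [(0,0,Gen Asc,0)] [(0,gm,0),(1,gm,0)] (asc B)" by (rule rep_genI[OF asc_hom rep1_MM(1,2)]) simp_all
  show "rep 3 [(0,gm,0),(1,gm,0)] [(0,0,Gen AscI,0)] [(0,gm,0),(0,gm,1)] (inv2 B (asc B))" by (rule rep_genI[OF inv2_hom2[OF asc_invertible asc_hom] rep1_MM(2,1)]) simp_all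
qed

lemma rep_lun:
  "rep 1 [(0,gm,0),(0,gu,1)] [(0,0,Gen Lun,0)] [] (lun B)"
  "rep 1 [] [(0,0,Gen LunI,0)] [(0,gm,0),(0,gu,1)] (inv2 B (lun B))"
proof -
  show "rep 1 [(0,gm,0),(0,gu,1)] [(0,0,Gen Lun,0)] [] (lun B)" by (rule rep_genI[OF lun_hom rep1_MM(3) rep1_consts(6)]) simp_all
  show "rep 1 [] [(0,0,Gen LunI,0)] [(0,gm,0),(0,gu,1)] (inv2 B (lun B))" by (rule rep_genI[OF inv2_hom2[OF lun_invertible lun_hom] rep1_consts(6) rep1_MM(3)]) simp_all
qed

lemma rep_run:
  "rep 1 [(0,gm,0),(1,gu,0)] [(0,0,Gen Run,0)] [] (map_mon.run B)"
  "rep 1 [] [(0,0,Gen RunI,0)] [(0,gm,0),(1,gu,0)] (inv2 B (map_mon.run B))"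
proof -
  show "rep 1 [(0,gm,0),(1,gu,0)] [(0,0,Gen Run,0)] [] (map_mon.run B)" by (rule rep_genI[OF run_hom rep1_MM(4) rep1_consts(6)]) simp_all
  show "rep 1 [] [(0,0,Gen RunI,0)] [(0,gm,0),(1,gu,0)] (inv2 B (map_mon.run B))" by (rule rep_genI[OF inv2_hom2[OF run_invertible run_hom] rep1_consts(6) rep1_MM(4)]) simp_all
qed

lemma rep_adj:
  "rep 2 [] [(0,0,Gen EtaM,0)] [(0,gn,0),(0,gm,0)] \<eta>\<^sub>m"
  "rep 1 [(0,gm,0),(0,gn,0)] [(0,0,Gen EpsM,0)] [] \<epsilon>\<^sub>m"
  "rep 0 [] [(0,0,Gen EtaU,0)] [(0,gv,0),(0,gu,0)] \<eta>\<^sub>u"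
  "rep 1 [(0,gu,0),(0,gv,0)] [(0,0,Gen EpsU,0)] [] \<epsilon>\<^sub>u"
proof -
  show "rep 2 [] [(0,0,Gen EtaM,0)] [(0,gn,0),(0,gm,0)] \<eta>\<^sub>m" by (rule rep_genI[OF adj_homs(2) rep1_consts(8) rep1_MM(5)]) simp_all
  show "rep 1 [(0,gm,0),(0,gn,0)] [(0,0,Gen EpsM,0)] [] \<epsilon>\<^sub>m" by (rule rep_genI[OF adj_homs(3) rep1_MM(6) rep1_consts(6)]) simp_all
  show "rep 0 [] [(0,0,Gen EtaU,0)] [(0,gv,0),(0,gu,0)] \<eta>\<^sub>u" by (rule rep_genI[OF adj_homs(5) rep1_consts(7) rep1_MM(7)]) simp_all
  show "rep 1 [(0,gu,0),(0,gv,0)] [(0,0,Gen EpsU,0)] [] \<epsilon>\<^sub>u" by (rule rep_genI[OF adj_homs(6) rep1_MM(8) rep1_consts(6)]) simp_all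
qed

lemmas base_intros = rep1_intros rep_asc rep_lun rep_run rep_adj rep_M rep_tens rep_interchanger(2) rep_vcomp rep_hcomp rep_id

lemma inverse_sounds:
  assumes "rep n p [(0, 0, Gen g, 0)] q \<alpha>" "rep n q [(0, 0, Gen h, 0)] p (inv2 B \<alpha>)" "invertible2 B \<alpha>"
  shows "sound (n, p, [(0, 0, Gen g, 0), (0, 0, Gen h, 0)], [])" "sound (n, q, [(0, 0, Gen h, 0), (0, 0, Gen g, 0)], [])"
proof -
  note i = inv2_inverse[OF assms(3) rep_in2[OF assms(1)]]
  have r: "rep1 n p (pth n p)" "rep1 n q (pth n q)" using rep_wf[OF assms(1)] by (auto simp: rep1_def)
  have "rep n p ([(0, 0, Gen g, 0)] @ [(0, 0, Gen h, 0)]) p (\<one>\<^sub>2 (pth n p))" "rep n q ([(0, 0, Gen h, 0)] @ [(0, 0, Gen g, 0)]) q (\<one>\<^sub>2 (pth n q))"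
    using rep_vcomp[OF assms(1,2) refl refl] rep_vcomp[OF assms(2,1) refl refl] i(2,3) by simp_all
  from rep_sound[OF this(1) rep_id[OF r(1)]] rep_sound[OF this(2) rep_id[OF r(2)]]
  show "sound (n, p, [(0, 0, Gen g, 0), (0, 0, Gen h, 0)], [])" "sound (n, q, [(0, 0, Gen h, 0), (0, 0, Gen g, 0)], [])"
    by (simp_all del: sound.simps)
qed

lemma unit_sounds:
  "sound asc_c_r" "sound asc_ci_r" "sound lun_c_r" "sound lun_ci_r" "sound run_c_r" "sound run_ci_r"
  unfolding asc_c_r_def asc_ci_r_def lun_c_r_def lun_ci_r_def run_c_r_def run_ci_r_def
  by (rule inverse_sounds[OF rep_asc asc_invertible] inverse_sounds[OF rep_lun lun_invertible] inverse_sounds[OF rep_run run_invertible])+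

lemma adj_eqs:
  "(\<epsilon>\<^sub>m \<lhd> \<m>) \<cdot> (\<m> \<rhd> \<eta>\<^sub>m) = \<one>\<^sub>2 \<m>" "(\<m>\<^sup>r \<rhd> \<epsilon>\<^sub>m) \<cdot> (\<eta>\<^sub>m \<lhd> \<m>\<^sup>r) = \<one>\<^sub>2 \<m>\<^sup>r"
  "(\<epsilon>\<^sub>u \<lhd> \<u>) \<cdot> (\<u> \<rhd> \<eta>\<^sub>u) = \<one>\<^sub>2 \<u>" "(\<u>\<^sup>r \<rhd> \<epsilon>\<^sub>u) \<cdot> (\<eta>\<^sub>u \<lhd> \<u>\<^sup>r) = \<one>\<^sub>2 \<u>\<^sup>r"
  using mul_adjunction unt_adjunction by (auto simp: adjunction_def)

lemmas whisker_defs = whisker_left_def whisker_right_def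

lemma tri_m1: "sound tri_m1_r"
  unfolding tri_m1_r_def
  by (rule rep_eq_sound[OF adj_eqs(1)[unfolded whisker_defs]], (rule base_intros | (simp; fail))+)

lemma tri_m2: "sound tri_m2_r"
  unfolding tri_m2_r_def
  by (rule rep_eq_sound[OF adj_eqs(2)[unfolded whisker_defs]], (rule base_intros | (simp; fail))+)

lemma tri_u1: "sound tri_u1_r"
  unfolding tri_u1_r_def
  by (rule rep_eq_sound[OF adj_eqs(3)[unfolded whisker_defs]], (rule base_intros | (simp; fail))+)

lemma tri_u2: "sound tri_u2_r"
  unfolding tri_u2_r_def
  by (rule rep_eq_sound[OF adj_eqs(4)[unfolded whisker_defs]], (rule base_intros | (simp; fail))+)

lemma monoidale_sounds: "sound pentagon_r" "sound triangle_r"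
proof -
  show "sound pentagon_r" unfolding pentagon_r_def
    by (rule rep_eq_sound[OF pentagon[unfolded whisker_left_def whisker_right_def]], ((rule base_intros) | (simp add: invs_def; fail))+)
  show "sound triangle_r" unfolding triangle_r_def
    by (rule rep_eq_sound[OF triangle[unfolded whisker_left_def whisker_right_def]], ((rule base_intros) | (simp; fail))+)
qed

end

section \<open>Mates and unitors in the interpretation\<close>

definition cr_ci_r :: rule where
  "cr_ci_r = (1, [(1,gv,0),(0,gn,0)], [(0,0,Gen CrI,0), (0,0,Gen Cr,0)], [])"

lemma counitor_certs:
  "proves [cl_ci_r, lun_c_r] [Fw 0 1, Fw 1 0] (1, [(0,gm,0),(0,gu,1),(0,gv,1),(0,gn,0)], [(0,0,Gen Lun,0), (0,0,Gen ClI,0)] @ [(0,0,Gen Cl,0), (0,0,Gen LunI,0)], [])"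
  "proves [lun_ci_r, cl_c_r] [Fw 0 1, Fw 1 0] (1, [], [(0,0,Gen Cl,0), (0,0,Gen LunI,0)] @ [(0,0,Gen Lun,0), (0,0,Gen ClI,0)], [])"
  "proves [cr_ci_r, run_c_r] [Fw 0 1, Fw 1 0] (1, [(0,gm,0),(1,gu,0),(1,gv,0),(0,gn,0)], [(0,0,Gen Run,0), (0,0,Gen CrI,0)] @ [(0,0,Gen Cr,0), (0,0,Gen RunI,0)], [])"
  "proves [run_ci_r, cr_c_r] [Fw 0 1, Fw 1 0] (1, [], [(0,0,Gen Cr,0), (0,0,Gen RunI,0)] @ [(0,0,Gen Run,0), (0,0,Gen CrI,0)], [])"
  by code_simp+

abbreviation cas_inverse_d :: "slice list" where
  "cas_inverse_d \<equiv> [(0,1,Gen EtaM,0),(1,0,Gen EtaM,0),(2,0,Gen AscI,0),(3,0,Gen EpsM,1),(2,0,Gen EpsM,0)]"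

abbreviation cl_inverse_d :: "slice list" where
  "cl_inverse_d \<equiv> [(0,0,Gen LunI,0),(1,0,Gen EpsU,1),(0,0,Gen EpsM,0)]"

abbreviation cr_inverse_d :: "slice list" where
  "cr_inverse_d \<equiv> [(0,0,Gen RunI,0),(1,1,Gen EpsU,0),(0,0,Gen EpsM,0)]"

context hopf_setting
begin

text \<open>A representation of a cell as a composite also types it, so the cell can be represented
  by its own generator as well. Comparing both representations gives rules such as
  \<open>cas_def_r\<close>.\<close>

lemma rep_genI':
  assumes "rep n p S q \<alpha>" "val2 h = \<alpha>" "gdom h = n" "gsrc h = p" "gtrg h = q"
  shows "rep n p [(0, 0, Gen h, 0)] q \<alpha>"
  by (rule rep_genI[OF in2D(1)[OF rep_in2[OF assms(1)]] _ _ assms(2-5)])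
    (use rep_wf[OF assms(1)] in \<open>simp_all add: rep1_def\<close>)

lemmas gray_intros = base_intros rep_interchanger(1)

lemma rep_co_asc: "rep 1 [(1,gn,0),(0,gn,0)] [(0,0,Gen EtaM,1),(1,0,Gen EtaM,0),(2,0,Gen Asc,0),(3,1,Gen EpsM,0),(2,0,Gen EpsM,0)] [(0,gn,1),(0,gn,0)] (co_asc B)"
  unfolding co_asc_def mate_def comp_unit_def comp_counit_def whisker_defs
  by (rule rep_cong, (rule gray_intros | (simp; fail))+)

lemma rep_cas: "rep 1 [(1,gn,0),(0,gn,0)] [(0,0,Gen Cas,0)] [(0,gn,1),(0,gn,0)] (co_asc B)"
  by (rule rep_genI'[OF rep_co_asc]) simp_all

lemma cas_mate: "sound cas_def_r"
  using rep_sound[OF rep_cas rep_co_asc] by (simp add: cas_def_r_def beta_d_def del: sound.simps)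

lemma rep_co_lun: "rep 1 [] [(0,0,Gen EtaU,1),(1,0,Gen EtaM,0),(2,0,Gen Lun,0)] [(0,gv,1),(0,gn,0)] (co_lun B)"
  unfolding co_lun_def mate_def comp_unit_def comp_counit_def whisker_defs
  by (rule rep_cong, (rule gray_intros | (simp; fail))+)

lemma rep_cl: "rep 1 [] [(0,0,Gen Cl,0)] [(0,gv,1),(0,gn,0)] (co_lun B)"
  by (rule rep_genI'[OF rep_co_lun]) simp_all

lemma cl_mate: "sound cl_def_r"
  using rep_sound[OF rep_cl rep_co_lun] by (simp add: cl_def_r_def beta_d_def del: sound.simps)

lemma rep_co_run: "rep 1 [] [(0,1,Gen EtaU,0),(1,0,Gen EtaM,0),(2,0,Gen Run,0)] [(1,gv,0),(0,gn,0)] (co_run B)"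
  unfolding co_run_def mate_def comp_unit_def comp_counit_def whisker_defs
  by (rule rep_cong, (rule gray_intros | (simp; fail))+)

lemma rep_cr: "rep 1 [] [(0,0,Gen Cr,0)] [(1,gv,0),(0,gn,0)] (co_run B)"
  by (rule rep_genI'[OF rep_co_run]) simp_all

lemma cr_mate: "sound cr_def_r"
  using rep_sound[OF rep_cr rep_co_run] by (simp add: cr_def_r_def beta_d_def numeral_2_eq_2 del: sound.simps)

lemma cas_inv1: "sound cas_inv1_r"
  by (rule proves_sound[OF cas_inv1_cert]) (simp add: cas_mate tri_m1 unit_sounds(2) tri_m2)

lemma cas_inv2: "sound cas_inv2_r"
  by (rule proves_sound[OF cas_inv2_cert]) (simp add: cas_mate tri_m1 unit_sounds(1) tri_m2)

text \<open>The coassociator is defined as a mate, so its invertibility has to be proved before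
  \<open>inv2\<close> says anything about it.\<close>

lemma inverse_cas:
  "rep 1 [(0,gn,1),(0,gn,0)] cas_inverse_d [(1,gn,0),(0,gn,0)] (inv2 B (co_asc B))" "invertible2 B (co_asc B)"
proof -
  have a: "sound (1, [(1,gn,0),(0,gn,0)], [(0,0,Gen Cas,0)] @ cas_inverse_d, [])" "sound (1, [(0,gn,1),(0,gn,0)], cas_inverse_d @ [(0,0,Gen Cas,0)], [])"
    using cas_inv1 cas_inv2 by (simp_all add: cas_inv1_r_def cas_inv2_r_def del: sound.simps)
  have b: "adms cas_inverse_d" using rep_asc rep_lun rep_run rep_adj by (auto simp: rep_def)
  show "rep 1 [(0,gn,1),(0,gn,0)] cas_inverse_d [(1,gn,0),(0,gn,0)] (inv2 B (co_asc B))" by (rule rep_inv2(1)[OF rep_cas a b])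
  show "invertible2 B (co_asc B)" using rep_inv2(2)[OF rep_cas a b] unfolding invertible2_def by blast
qed

lemma rep_casI: "rep 1 [(0,gn,1),(0,gn,0)] [(0,0,Gen CasI,0)] [(1,gn,0),(0,gn,0)] (inv2 B (co_asc B))"
  by (rule rep_genI'[OF inverse_cas(1)]) simp_all

lemma cl_inv1: "sound cl_inv1_r"
  by (rule proves_sound[OF cl_inv1_cert]) (simp add: cl_mate tri_u1 tri_m1 unit_sounds(4))

lemma cl_inv2: "sound cl_inv2_r"
  by (rule proves_sound[OF cl_inv2_cert]) (simp add: cl_mate unit_sounds(3) tri_u2 tri_m2)

lemma inverse_cl:
  "rep 1 [(0,gv,1),(0,gn,0)] cl_inverse_d [] (inv2 B (co_lun B))" "invertible2 B (co_lun B)"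
proof -
  have a: "sound (1, [], [(0,0,Gen Cl,0)] @ cl_inverse_d, [])" "sound (1, [(0,gv,1),(0,gn,0)], cl_inverse_d @ [(0,0,Gen Cl,0)], [])"
    using cl_inv1 cl_inv2 by (simp_all add: cl_inv1_r_def cl_inv2_r_def del: sound.simps)
  have b: "adms cl_inverse_d" using rep_asc rep_lun rep_run rep_adj by (auto simp: rep_def)
  show "rep 1 [(0,gv,1),(0,gn,0)] cl_inverse_d [] (inv2 B (co_lun B))" by (rule rep_inv2(1)[OF rep_cl a b])
  show "invertible2 B (co_lun B)" using rep_inv2(2)[OF rep_cl a b] unfolding invertible2_def by blast
qed

lemma rep_clI: "rep 1 [(0,gv,1),(0,gn,0)] [(0,0,Gen ClI,0)] [] (inv2 B (co_lun B))"
  by (rule rep_genI'[OF inverse_cl(1)]) simp_all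

lemma cr_inv1: "sound cr_inv1_r"
  by (rule proves_sound[OF cr_inv1_cert]) (simp add: cr_mate tri_u1 tri_m1 unit_sounds(6))

lemma cr_inv2: "sound cr_inv2_r"
  by (rule proves_sound[OF cr_inv2_cert]) (simp add: cr_mate unit_sounds(5) tri_u2 tri_m2)

lemma inverse_cr:
  "rep 1 [(1,gv,0),(0,gn,0)] cr_inverse_d [] (inv2 B (co_run B))" "invertible2 B (co_run B)"
proof -
  have a: "sound (1, [], [(0,0,Gen Cr,0)] @ cr_inverse_d, [])" "sound (1, [(1,gv,0),(0,gn,0)], cr_inverse_d @ [(0,0,Gen Cr,0)], [])"
    using cr_inv1 cr_inv2 by (simp_all add: cr_inv1_r_def cr_inv2_r_def del: sound.simps)
  have b: "adms cr_inverse_d" using rep_asc rep_lun rep_run rep_adj by (auto simp: rep_def)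
  show "rep 1 [(1,gv,0),(0,gn,0)] cr_inverse_d [] (inv2 B (co_run B))" by (rule rep_inv2(1)[OF rep_cr a b])
  show "invertible2 B (co_run B)" using rep_inv2(2)[OF rep_cr a b] unfolding invertible2_def by blast
qed

lemma rep_crI: "rep 1 [(1,gv,0),(0,gn,0)] [(0,0,Gen CrI,0)] [] (inv2 B (co_run B))"
  by (rule rep_genI'[OF inverse_cr(1)]) simp_all

lemma co_unit_sounds: "sound cas_c_r" "sound cl_c_r" "sound cl_ci_r" "sound cr_c_r" "sound cr_ci_r"
  unfolding cas_c_r_def cl_c_r_def cl_ci_r_def cr_c_r_def cr_ci_r_def
  by (rule inverse_sounds[OF rep_cas rep_casI inverse_cas(2)] inverse_sounds[OF rep_cl rep_clI inverse_cl(2)]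
    inverse_sounds[OF rep_cr rep_crI inverse_cr(2)])+

lemmas prod_defs = bprod1_def bprod2_def cprod1_def cprod2_def cunit_def bunit_def whisker_defs

lemma rep1_hopf:
  "rep1 1 [(0,gm,0),(0,ga,1),(1,ga,0),(0,gn,0)] (bprod1 B a a)" "rep1 1 [(0,gu,0),(0,gv,0)] (bunit B)" "rep1 1 [(0,ga,0),(0,ga,0)] (cprod1 B a a)" "rep1 1 [] (cunit B)"
  "rep1 1 [(0,gv,1),(0,gm,1),(1,ga,1),(1,gn,0),(1,gu,0)] (antipode_target B a)"
  unfolding prod_defs antipode_target_def
  by ((rule rep1_cong, (rule rep1_intros | (simp; fail))+)[1])+

lemma c_comonoid_eqs:
  "\<delta> \<in> hom2 B a (cprod1 B a a)" "\<epsilon> \<in> hom2 B a (cunit B)"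
  "cprod2 B \<delta> (\<one>\<^sub>2 a) \<cdot> \<delta> = cprod2 B (\<one>\<^sub>2 a) \<delta> \<cdot> \<delta>"
  "cprod2 B \<epsilon> (\<one>\<^sub>2 a) \<cdot> \<delta> = \<one>\<^sub>2 a" "cprod2 B (\<one>\<^sub>2 a) \<epsilon> \<cdot> \<delta> = \<one>\<^sub>2 a"
  using c_comon by (simp_all add: c_comonoid_def)

lemma b_monoid_eqs:
  "\<mu> \<cdot> bprod2 B \<mu> (\<one>\<^sub>2 a) = \<mu> \<cdot> bprod2 B (\<one>\<^sub>2 a) \<mu> \<cdot> b_assoc B a a a"
  "\<mu> \<cdot> bprod2 B \<eta> (\<one>\<^sub>2 a) = b_lunit B a" "\<mu> \<cdot> bprod2 B (\<one>\<^sub>2 a) \<eta> = b_runit B a"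
  using b_mon by (simp_all add: b_monoid_def)

lemma bimonoid_eqs:
  "\<delta> \<cdot> \<mu> = cprod2 B \<mu> \<mu> \<cdot> xi B a a a a \<cdot> bprod2 B \<delta> \<delta>"
  "\<delta> \<cdot> \<eta> = cprod2 B \<eta> \<eta> \<cdot> xi_comul B" "\<epsilon> \<cdot> \<eta> = xi_counit B"
  using bimon by (simp_all add: bimonoid_def)

lemma rep_mul: "rep 1 [(0,gm,0),(0,ga,1),(1,ga,0),(0,gn,0)] [(0,0,Gen Mul,0)] [(0,ga,0)] \<mu>"
  by (rule rep_genI[OF mu_hom rep1_hopf(1) rep1_consts(1)]) simp_all

lemma rep_one: "rep 1 [(0,gu,0),(0,gv,0)] [(0,0,Gen One,0)] [(0,ga,0)] \<eta>"
  by (rule rep_genI[OF one_hom rep1_hopf(2) rep1_consts(1)]) simp_all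

lemma rep_del: "rep 1 [(0,ga,0)] [(0,0,Gen Del,0)] [(0,ga,0),(0,ga,0)] \<delta>"
  by (rule rep_genI[OF c_comonoid_eqs(1) rep1_consts(1) rep1_hopf(3)]) simp_all

lemma rep_eps: "rep 1 [(0,ga,0)] [(0,0,Gen Eps,0)] [] \<epsilon>"
  by (rule rep_genI[OF c_comonoid_eqs(2) rep1_consts(1) rep1_hopf(4)]) simp_all

lemma rep_sig: "rep 1 [(0,ga,0)] [(0,0,Gen Sig,0)] [(0,gv,1),(0,gm,1),(1,ga,1),(1,gn,0),(1,gu,0)] \<sigma>"
  by (rule rep_genI[OF sigma_hom rep1_consts(1) rep1_hopf(5)]) simp_all

lemmas hopf_intros = gray_intros rep_cas rep_casI rep_cl rep_clI rep_cr rep_crI rep_mul rep_one rep_del rep_eps rep_sig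

lemmas diagram_defs = retraction_d_def quot_d_def prod_d_def tau_d_def kappa_d_def alpha_d_def beta_d_def invs_def

lemma assoc: "sound assoc_r"
  unfolding assoc_r_def
  by (rule rep_eq_sound[OF b_monoid_eqs(1)[unfolded prod_defs b_assoc_def]], (rule hopf_intros | (simp add: diagram_defs; fail))+)

lemma lunit: "sound lunit_r"
  unfolding lunit_r_def
  by (rule rep_eq_sound[OF b_monoid_eqs(2)[unfolded prod_defs b_lunit_def]], (rule hopf_intros | (simp add: diagram_defs; fail))+)

lemma runit: "sound runit_r"
  unfolding runit_r_def
  by (rule rep_eq_sound[OF b_monoid_eqs(3)[unfolded prod_defs b_runit_def]], (rule hopf_intros | (simp add: diagram_defs; fail))+)

lemma del_mul: "sound del_mul_r"
  unfolding del_mul_r_def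
  by (rule rep_eq_sound[OF bimonoid_eqs(1)[unfolded prod_defs xi_def]], (rule hopf_intros | (simp add: diagram_defs; fail))+)

lemma coassoc: "sound coassoc_r"
  unfolding coassoc_r_def
  by (rule rep_eq_sound[OF c_comonoid_eqs(3)[symmetric, unfolded prod_defs]], (rule hopf_intros | (simp add: diagram_defs; fail))+)

lemma counit1: "sound counit1_r"
  unfolding counit1_r_def
  by (rule rep_eq_sound[OF c_comonoid_eqs(4)[unfolded prod_defs ]], (rule hopf_intros | (simp add: diagram_defs; fail))+)

lemma counit0: "sound counit0_r"
  unfolding counit0_r_def
  by (rule rep_eq_sound[OF c_comonoid_eqs(5)[unfolded prod_defs ]], (rule hopf_intros | (simp add: diagram_defs; fail))+)

text \<open>At \<open>i\<close> the crossings inside the unitors are with an empty path and vanish,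
  which leaves two structure cells to be inverted.\<close>

lemma rep_unitors:
  "rep 1 [(0,gm,0),(0,gu,1),(0,gv,1),(0,gn,0)] [(0,0,Gen Lun,0), (0,0,Gen ClI,0)] [] (b_lunit B (cunit B))"
  "rep 1 [(0,gm,0),(1,gu,0),(1,gv,0),(0,gn,0)] [(0,0,Gen Run,0), (0,0,Gen CrI,0)] [] (b_runit B (cunit B))"
  unfolding b_lunit_def b_runit_def prod_defs
  by ((rule rep_cong, (rule hopf_intros | (simp; fail))+)[1])+

lemma rep_unitors_inverse:
  "rep 1 [] [(0,0,Gen Cl,0), (0,0,Gen LunI,0)] [(0,gm,0),(0,gu,1),(0,gv,1),(0,gn,0)] (inv2 B (b_lunit B (cunit B)))"
  "rep 1 [] [(0,0,Gen Cr,0), (0,0,Gen RunI,0)] [(0,gm,0),(1,gu,0),(1,gv,0),(0,gn,0)] (inv2 B (b_runit B (cunit B)))"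
proof -
  have ad: "adms [(0,0,Gen Cl,0), (0,0,Gen LunI,0)]" "adms [(0,0,Gen Cr,0), (0,0,Gen RunI,0)]"
    using rep_cl rep_cr rep_lun rep_run by (auto simp: rep_def)
  note s = counitor_certs[THEN proves_sound]
  show "rep 1 [] [(0,0,Gen Cl,0), (0,0,Gen LunI,0)] [(0,gm,0),(0,gu,1),(0,gv,1),(0,gn,0)] (inv2 B (b_lunit B (cunit B)))"
    by (rule rep_inv2(1)[OF rep_unitors(1) s(1) s(2) ad(1)]) (simp_all add: co_unit_sounds unit_sounds)
  show "rep 1 [] [(0,0,Gen Cr,0), (0,0,Gen RunI,0)] [(0,gm,0),(1,gu,0),(1,gv,0),(0,gn,0)] (inv2 B (b_runit B (cunit B)))"
    by (rule rep_inv2(1)[OF rep_unitors(2) s(3) s(4) ad(2)]) (simp_all add: co_unit_sounds unit_sounds)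
qed

lemmas rep_unitors_inverse' = rep_unitors_inverse[unfolded cunit_def]

lemma antipode_eqs:
  "bprod2 B (cprod2 B \<mu> (\<one>\<^sub>2 (bunit B))) (\<one>\<^sub>2 (cunit B)) \<cdot> phi B a a \<cdot> cprod2 B (\<one>\<^sub>2 a) \<sigma> \<cdot> \<delta>
    = bprod2 B (cprod2 B \<eta> (\<one>\<^sub>2 (bunit B)) \<cdot> xi_comul B) (\<one>\<^sub>2 (cunit B)) \<cdot> inv2 B (b_lunit B (cunit B)) \<cdot> \<epsilon>"
  "bprod2 B (\<one>\<^sub>2 (cunit B)) (cprod2 B (\<one>\<^sub>2 (bunit B)) \<mu>) \<cdot> psi B a a \<cdot> cprod2 B \<sigma> (\<one>\<^sub>2 a) \<cdot> \<delta>
    = bprod2 B (\<one>\<^sub>2 (cunit B)) (cprod2 B (\<one>\<^sub>2 (bunit B)) \<eta> \<cdot> xi_comul B) \<cdot> inv2 B (b_runit B (cunit B)) \<cdot> \<epsilon>"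
  using hopf by (simp_all add: hopf_monoid_def)

lemma hopf1_raw: "sound hopf1_raw_r"
  unfolding hopf1_raw_r_def
  by (rule rep_eq_sound[OF antipode_eqs(1)[unfolded prod_defs phi_def unit_to_comul_def xi_comul_def]],
    (rule rep_unitors_inverse' hopf_intros | (simp add: diagram_defs; fail))+)

lemma hopf2_raw: "sound hopf2_raw_r"
  unfolding hopf2_raw_r_def
  by (rule rep_eq_sound[OF antipode_eqs(2)[unfolded prod_defs psi_def unit_to_mul_def xi_comul_def]],
    (rule rep_unitors_inverse' hopf_intros | (simp add: diagram_defs; fail))+)

end

section \<open>Coseparable comonoids in a strict monoidal category\<close>

text \<open>\<open>ar \<alpha> x y\<close> means \<open>\<alpha> : x \<rightarrow> y\<close>; it is also the only way to say that \<open>x\<close> and \<open>y\<close> are objects.\<close>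

locale strict_monoidal =
  fixes ar :: "'c \<Rightarrow> 'a \<Rightarrow> 'a \<Rightarrow> bool" and idn :: "'a \<Rightarrow> 'c" and cmp :: "'c \<Rightarrow> 'c \<Rightarrow> 'c" (infixr "\<bullet>" 65)
    and t1 :: "'a \<Rightarrow> 'a \<Rightarrow> 'a" (infixr "\<otimes>" 75) and t2 :: "'c \<Rightarrow> 'c \<Rightarrow> 'c" (infixr "\<boxtimes>" 74) and unit :: 'a
  assumes ar_id: "ar \<alpha> x y \<Longrightarrow> ar (idn x) x x \<and> ar (idn y) y y"
    and ar_cmp: "ar \<alpha> x y \<Longrightarrow> ar \<beta> y z \<Longrightarrow> ar (\<beta> \<bullet> \<alpha>) x z"
    and assoc: "ar \<alpha> x y \<Longrightarrow> ar \<beta> y z \<Longrightarrow> ar \<gamma> z w \<Longrightarrow> (\<gamma> \<bullet> \<beta>) \<bullet> \<alpha> = \<gamma> \<bullet> (\<beta> \<bullet> \<alpha>)"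
    and id_left: "ar \<alpha> x y \<Longrightarrow> idn y \<bullet> \<alpha> = \<alpha>" and id_right: "ar \<alpha> x y \<Longrightarrow> \<alpha> \<bullet> idn x = \<alpha>"
    and ar_t2: "ar \<alpha> x y \<Longrightarrow> ar \<beta> x' y' \<Longrightarrow> ar (\<alpha> \<boxtimes> \<beta>) (x \<otimes> x') (y \<otimes> y')"
    and t2_cmp: "ar \<alpha> x y \<Longrightarrow> ar \<beta> y z \<Longrightarrow> ar \<alpha>' x' y' \<Longrightarrow> ar \<beta>' y' z' \<Longrightarrow>
      (\<beta> \<boxtimes> \<beta>') \<bullet> (\<alpha> \<boxtimes> \<alpha>') = (\<beta> \<bullet> \<alpha>) \<boxtimes> (\<beta>' \<bullet> \<alpha>')"
    and t2_id: "ar \<alpha> x x' \<Longrightarrow> ar \<beta> y y' \<Longrightarrow> idn x \<boxtimes> idn y = idn (x \<otimes> y)"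
    and t1_assoc: "ar \<alpha> x x' \<Longrightarrow> ar \<beta> y y' \<Longrightarrow> ar \<gamma> z z' \<Longrightarrow> (x \<otimes> y) \<otimes> z = x \<otimes> (y \<otimes> z)"
    and t2_assoc: "ar \<alpha> x x' \<Longrightarrow> ar \<beta> y y' \<Longrightarrow> ar \<gamma> z z' \<Longrightarrow> (\<alpha> \<boxtimes> \<beta>) \<boxtimes> \<gamma> = \<alpha> \<boxtimes> (\<beta> \<boxtimes> \<gamma>)"
    and t1_unit: "ar \<alpha> x y \<Longrightarrow> unit \<otimes> x = x \<and> x \<otimes> unit = x"
    and t2_unit: "ar \<alpha> x y \<Longrightarrow> idn unit \<boxtimes> \<alpha> = \<alpha> \<and> \<alpha> \<boxtimes> idn unit = \<alpha>"
begin

text \<open>Composites are kept nested to the right; this rewrites the two leading factors of such a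
  chain without reassociating by hand.\<close>

lemma rewrite_tail:
  "\<beta> \<bullet> \<alpha> = \<beta>' \<bullet> \<alpha>' \<Longrightarrow> ar \<alpha> x y \<Longrightarrow> ar \<beta> y z \<Longrightarrow> ar \<alpha>' x y' \<Longrightarrow> ar \<beta>' y' z \<Longrightarrow> ar \<kappa> w x \<Longrightarrow>
    \<beta> \<bullet> (\<alpha> \<bullet> \<kappa>) = \<beta>' \<bullet> (\<alpha>' \<bullet> \<kappa>)"
  using assoc[of \<kappa> w x \<alpha> y \<beta> z] assoc[of \<kappa> w x \<alpha>' y' \<beta>' z] by simp

lemma exchange:
  assumes "ar \<alpha> x x'" "ar \<beta> y y'"
  shows "(\<alpha> \<boxtimes> idn y') \<bullet> (idn x \<boxtimes> \<beta>) = (idn x' \<boxtimes> \<beta>) \<bullet> (\<alpha> \<boxtimes> idn y)"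
  using t2_cmp[of "idn x" x x \<alpha> x' \<beta> y y' "idn y'" y'] t2_cmp[of \<alpha> x x' "idn x'" x' "idn y" y y \<beta> y'] assms ar_id[OF assms(1)] ar_id[OF assms(2)]
  by (simp add: id_left[OF assms(1)] id_right[OF assms(1)] id_left[OF assms(2)] id_right[OF assms(2)])

lemma left_cmp:
  assumes "ar \<gamma> c c'" "ar \<alpha> x y" "ar \<beta> y z"
  shows "idn c \<boxtimes> (\<beta> \<bullet> \<alpha>) = (idn c \<boxtimes> \<beta>) \<bullet> (idn c \<boxtimes> \<alpha>)"
  using t2_cmp[of "idn c" c c "idn c" c \<alpha> x y \<beta> z] assms ar_id[OF assms(1)] id_left[of "idn c" c c] by simp

lemma right_cmp:
  assumes "ar \<gamma> c c'" "ar \<alpha> x y" "ar \<beta> y z"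
  shows "(\<beta> \<bullet> \<alpha>) \<boxtimes> idn c = (\<beta> \<boxtimes> idn c) \<bullet> (\<alpha> \<boxtimes> idn c)"
  using t2_cmp[of \<alpha> x y \<beta> z "idn c" c c "idn c" c] assms ar_id[OF assms(1)] id_left[of "idn c" c c] by simp

lemma coaction_map_id:
  assumes "ar \<gamma> c c'" "ar l x (c \<otimes> x)"
  shows "(idn c \<boxtimes> idn x) \<bullet> l = l \<bullet> idn x"
  using t2_id[OF assms(1,2)] id_left[OF assms(2)] id_right[OF assms(2)] by simp

lemma coaction_map_comp:
  assumes c: "ar \<gamma> c c'" and l: "ar l x (c \<otimes> x)" and l': "ar l' y (c \<otimes> y)" and l'': "ar l'' z (c \<otimes> z)"
    and f: "ar f x y" and g: "ar g y z" and "(idn c \<boxtimes> f) \<bullet> l = l' \<bullet> f" "(idn c \<boxtimes> g) \<bullet> l' = l'' \<bullet> g"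
  shows "(idn c \<boxtimes> (g \<bullet> f)) \<bullet> l = l'' \<bullet> (g \<bullet> f)"
proof -
  have i: "ar (idn c) c c" using ar_id[OF c] by simp
  note F = ar_t2[OF i f] and G = ar_t2[OF i g]
  show ?thesis using left_cmp[OF c f g] assoc[OF l F G] assoc[OF f l' G] assoc[OF f g l''] assms(7,8) by simp
qed

end

text \<open>The setting is abstract so that it can be used twice, for the product
  \<open>\<circ>\<close> and for the reversed one.\<close>

locale coseparability = strict_monoidal ar idn cmp t1 t2 unit
  for ar :: "'c \<Rightarrow> 'a \<Rightarrow> 'a \<Rightarrow> bool" and idn :: "'a \<Rightarrow> 'c" and cmp :: "'c \<Rightarrow> 'c \<Rightarrow> 'c" (infixr "\<bullet>" 65)
    and t1 :: "'a \<Rightarrow> 'a \<Rightarrow> 'a" (infixr "\<otimes>" 75) and t2 :: "'c \<Rightarrow> 'c \<Rightarrow> 'c" (infixr "\<boxtimes>" 74) and unit :: 'a +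
  fixes c :: 'a and d e \<rho> :: 'c
  assumes d: "ar d c (c \<otimes> c)" and e: "ar e c unit" and \<rho>: "ar \<rho> (c \<otimes> c) c"
    and counit: "(e \<boxtimes> idn c) \<bullet> d = idn c" "(idn c \<boxtimes> e) \<bullet> d = idn c"
    and \<rho>_left: "(idn c \<boxtimes> \<rho>) \<bullet> (d \<boxtimes> idn c) = d \<bullet> \<rho>"
    and \<rho>_right: "(\<rho> \<boxtimes> idn c) \<bullet> (idn c \<boxtimes> d) = d \<bullet> \<rho>"
    and \<rho>_section: "\<rho> \<bullet> d = idn c"
begin

definition left_com :: "'a \<Rightarrow> 'c \<Rightarrow> bool" where
  "left_com x l \<longleftrightarrow> ar l x (c \<otimes> x) \<and> (d \<boxtimes> idn x) \<bullet> l = (idn c \<boxtimes> l) \<bullet> l \<and> (e \<boxtimes> idn x) \<bullet> l = idn x"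

text \<open>The form on \<open>c\<close> that corresponds to the retraction, dual to the Casimir
  element of a separable algebra.\<close>

definition \<pi> :: 'c where "\<pi> = e \<bullet> \<rho>"

text \<open>In elements, with coactions written \<open>x' \<otimes> x0\<close>: \<open>x\<close>
  goes to \<open>\<pi>(x' \<otimes> y') y0\<close>, where \<open>y = h(x0)\<close>. This is dual to
  averaging a linear map with a separability idempotent.\<close>

definition average :: "'a \<Rightarrow> 'c \<Rightarrow> 'c \<Rightarrow> 'c \<Rightarrow> 'c" where
  "average y l' h l = (\<pi> \<boxtimes> idn y) \<bullet> ((idn c \<boxtimes> l') \<bullet> ((idn c \<boxtimes> h) \<bullet> l))"

lemma c: "ar (idn c) c c" "ar (idn (c \<otimes> c)) (c \<otimes> c) (c \<otimes> c)"
  using ar_id[OF d] by auto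

lemma \<pi>: "ar \<pi> (c \<otimes> c) unit"
  unfolding \<pi>_def by (rule ar_cmp[OF \<rho> e])

lemma \<pi>_d: "\<pi> \<bullet> d = e"
  unfolding \<pi>_def using assoc[OF d \<rho> e] \<rho>_section id_right[OF e] by simp

lemma ccc: "(c \<otimes> c) \<otimes> c = c \<otimes> (c \<otimes> c)"
  by (rule t1_assoc[OF c(1) c(1) c(1)])

lemma cu: "c \<otimes> unit = c" "unit \<otimes> c = c"
  using t1_unit[OF c(1)] by auto

text \<open>The counit axiom recovers \<open>\<rho>\<close> from the form, here by comultiplying its
  first argument. Together with \<open>\<pi>_right\<close> this says that the form is
  balanced.\<close>

lemma \<pi>_left: "(idn c \<boxtimes> \<pi>) \<bullet> (d \<boxtimes> idn c) = \<rho>"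
proof -
  have i: "ar (d \<boxtimes> idn c) (c \<otimes> c) (c \<otimes> (c \<otimes> c))" using ar_t2[OF d c(1)] ccc by simp
  have j: "ar (idn c \<boxtimes> e) (c \<otimes> c) c" using ar_t2[OF c(1) e] cu by simp
  have "(idn c \<boxtimes> \<pi>) \<bullet> (d \<boxtimes> idn c) = (idn c \<boxtimes> e) \<bullet> ((idn c \<boxtimes> \<rho>) \<bullet> (d \<boxtimes> idn c))"
    unfolding \<pi>_def left_cmp[OF c(1) \<rho> e] by (rule assoc[OF i ar_t2[OF c(1) \<rho>] j])
  also have "\<dots> = ((idn c \<boxtimes> e) \<bullet> d) \<bullet> \<rho>" unfolding \<rho>_left by (rule assoc[OF \<rho> d j, symmetric])
  finally show ?thesis using counit id_left[OF \<rho>] by simp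
qed

lemma \<pi>_right: "(\<pi> \<boxtimes> idn c) \<bullet> (idn c \<boxtimes> d) = \<rho>"
proof -
  have i: "ar (idn c \<boxtimes> d) (c \<otimes> c) ((c \<otimes> c) \<otimes> c)" using ar_t2[OF c(1) d] ccc by simp
  have j: "ar (e \<boxtimes> idn c) (c \<otimes> c) c" using ar_t2[OF e c(1)] cu by simp
  have "(\<pi> \<boxtimes> idn c) \<bullet> (idn c \<boxtimes> d) = (e \<boxtimes> idn c) \<bullet> ((\<rho> \<boxtimes> idn c) \<bullet> (idn c \<boxtimes> d))"
    unfolding \<pi>_def right_cmp[OF c(1) \<rho> e] by (rule assoc[OF i ar_t2[OF \<rho> c(1)] j])
  also have "\<dots> = ((e \<boxtimes> idn c) \<bullet> d) \<bullet> \<rho>" unfolding \<rho>_right by (rule assoc[OF \<rho> d j, symmetric])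
  finally show ?thesis using counit id_left[OF \<rho>] by simp
qed

context
  fixes x y l l'
  assumes l: "left_com x l" and l': "left_com y l'"
begin

lemma coactions: "ar l x (c \<otimes> x)" "ar l' y (c \<otimes> y)"
  using l l' by (auto simp: left_com_def)

lemma ids: "ar (idn x) x x" "ar (idn y) y y"
  using ar_id[OF coactions(1)] ar_id[OF coactions(2)] by auto

lemma \<pi>_y: "ar (\<pi> \<boxtimes> idn y) (c \<otimes> (c \<otimes> y)) y"
  using ar_t2[OF \<pi> ids(2)] t1_unit[OF ids(2)] t1_assoc[OF c(1) c(1) ids(2)] by simp

lemma factors:
  assumes "ar h x y"
  shows "ar ((idn c \<boxtimes> h) \<bullet> l) x (c \<otimes> y)" "ar ((idn c \<boxtimes> l') \<bullet> ((idn c \<boxtimes> h) \<bullet> l)) x (c \<otimes> (c \<otimes> y))"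
    "ar (average y l' h l) x y"
proof -
  show 1: "ar ((idn c \<boxtimes> h) \<bullet> l) x (c \<otimes> y)" by (rule ar_cmp[OF coactions(1) ar_t2[OF c(1) assms]])
  show 2: "ar ((idn c \<boxtimes> l') \<bullet> ((idn c \<boxtimes> h) \<bullet> l)) x (c \<otimes> (c \<otimes> y))" by (rule ar_cmp[OF 1 ar_t2[OF c(1) coactions(2)]])
  show "ar (average y l' h l) x y" unfolding average_def by (rule ar_cmp[OF 2 \<pi>_y])
qed

lemma \<pi>_natural:
  assumes "ar g y z"
  shows "(\<pi> \<boxtimes> idn z) \<bullet> (idn c \<boxtimes> (idn c \<boxtimes> g)) = g \<bullet> (\<pi> \<boxtimes> idn y)"
proof -
  have "idn c \<boxtimes> (idn c \<boxtimes> g) = idn (c \<otimes> c) \<boxtimes> g" using t2_assoc[OF c(1) c(1) assms] t2_id[OF c(1) c(1)] by simp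
  then show ?thesis using exchange[OF \<pi> assms] t2_unit[OF assms] by simp
qed

lemma coassoc_y: "(idn c \<boxtimes> l') \<bullet> l' = (d \<boxtimes> idn y) \<bullet> l'"
  using l' by (simp add: left_com_def)

lemma average_map:
  assumes f: "ar f x y" and "(idn c \<boxtimes> f) \<bullet> l = l' \<bullet> f"
  shows "average y l' f l = f"
proof -
  have dy: "ar (d \<boxtimes> idn y) (c \<otimes> y) (c \<otimes> (c \<otimes> y))" using ar_t2[OF d ids(2)] t1_assoc[OF c(1) c(1) ids(2)] by simp
  have ey: "ar (e \<boxtimes> idn y) (c \<otimes> y) y" using ar_t2[OF e ids(2)] t1_unit[OF ids(2)] by simp
  have lf: "ar (l' \<bullet> f) x (c \<otimes> y)" by (rule ar_cmp[OF f coactions(2)])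
  have "average y l' f l = (\<pi> \<boxtimes> idn y) \<bullet> ((d \<boxtimes> idn y) \<bullet> (l' \<bullet> f))"
    unfolding average_def assms(2) using rewrite_tail[OF coassoc_y coactions(2) ar_t2[OF c(1) coactions(2)] coactions(2) dy f] by simp
  also have "\<dots> = (e \<boxtimes> idn y) \<bullet> (l' \<bullet> f)"
    using assoc[OF lf dy \<pi>_y] right_cmp[OF ids(2) d \<pi>] \<pi>_d by simp
  also have "\<dots> = f" using assoc[OF f coactions(2) ey] l' id_left[OF f] by (simp add: left_com_def)
  finally show ?thesis .
qed

text \<open>Both sides equal \<open>\<rho> \<boxtimes> idn y\<close> applied to the same composite:
  expanding \<open>\<rho>\<close> by \<open>\<pi>_left\<close> produces one side, expanding it by
  \<open>\<pi>_right\<close> the other.\<close>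

lemma average_left:
  assumes h: "ar h x y"
  shows "(idn c \<boxtimes> average y l' h l) \<bullet> l = l' \<bullet> average y l' h l"
proof -
  let ?A = "idn c \<boxtimes> h" and ?B = "idn c \<boxtimes> l'" and ?K = "(idn c \<boxtimes> l') \<bullet> ((idn c \<boxtimes> h) \<bullet> l)"
  note A = ar_t2[OF c(1) h] and B = ar_t2[OF c(1) coactions(2)] and L = coactions(1)
  note F = factors[OF h]
  have dx: "ar (d \<boxtimes> idn x) (c \<otimes> x) (c \<otimes> (c \<otimes> x))" using ar_t2[OF d ids(1)] t1_assoc[OF c(1) c(1) ids(1)] by simp
  have dy: "ar (d \<boxtimes> idn y) (c \<otimes> y) (c \<otimes> (c \<otimes> y))" using ar_t2[OF d ids(2)] t1_assoc[OF c(1) c(1) ids(2)] by simp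
  have cy: "ar (idn (c \<otimes> y)) (c \<otimes> y) (c \<otimes> y)" using ar_id[OF coactions(2)] by simp
  have cycy: "idn c \<boxtimes> idn y = idn (c \<otimes> y)" by (rule t2_id[OF c(1) ids(2)])
  have dcy: "ar (d \<boxtimes> idn (c \<otimes> y)) (c \<otimes> (c \<otimes> y)) (c \<otimes> (c \<otimes> (c \<otimes> y)))"
    using ar_t2[OF d cy] t1_assoc[OF c(1) c(1) cy] by simp
  have cc: "idn (c \<otimes> c) \<boxtimes> \<alpha> = idn c \<boxtimes> (idn c \<boxtimes> \<alpha>)" if "ar \<alpha> z w" for \<alpha> z w
    using t2_assoc[OF c(1) c(1) that] t2_id[OF c(1) c(1)] by simp
  have e1: "(idn c \<boxtimes> ?A) \<bullet> (d \<boxtimes> idn x) = (d \<boxtimes> idn y) \<bullet> ?A" using exchange[OF d h] cc[OF h] by simp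
  have e2: "(idn c \<boxtimes> ?B) \<bullet> (d \<boxtimes> idn y) = (d \<boxtimes> idn (c \<otimes> y)) \<bullet> ?B" using exchange[OF d coactions(2)] cc[OF coactions(2)] by simp
  have e3: "(idn c \<boxtimes> (\<pi> \<boxtimes> idn y)) \<bullet> (d \<boxtimes> idn (c \<otimes> y)) = \<rho> \<boxtimes> idn y"
  proof -
    have "idn c \<boxtimes> (\<pi> \<boxtimes> idn y) = (idn c \<boxtimes> \<pi>) \<boxtimes> idn y" by (rule t2_assoc[OF c(1) \<pi> ids(2), symmetric])
    moreover have "d \<boxtimes> idn (c \<otimes> y) = (d \<boxtimes> idn c) \<boxtimes> idn y" using t2_assoc[OF d c(1) ids(2)] cycy by simp
    moreover have "ar (idn c \<boxtimes> \<pi>) ((c \<otimes> c) \<otimes> c) c" using ar_t2[OF c(1) \<pi>] cu ccc by simp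
    ultimately show ?thesis using right_cmp[OF ids(2) ar_t2[OF d c(1)], of "idn c \<boxtimes> \<pi>" c] \<pi>_left by simp
  qed
  have e4: "(\<pi> \<boxtimes> idn (c \<otimes> y)) \<bullet> (idn c \<boxtimes> (d \<boxtimes> idn y)) = \<rho> \<boxtimes> idn y"
  proof -
    have "idn c \<boxtimes> (d \<boxtimes> idn y) = (idn c \<boxtimes> d) \<boxtimes> idn y" by (rule t2_assoc[OF c(1) d ids(2), symmetric])
    moreover have "\<pi> \<boxtimes> idn (c \<otimes> y) = (\<pi> \<boxtimes> idn c) \<boxtimes> idn y" using t2_assoc[OF \<pi> c(1) ids(2)] cycy by simp
    moreover have "ar (\<pi> \<boxtimes> idn c) (c \<otimes> (c \<otimes> c)) c" using ar_t2[OF \<pi> c(1)] cu ccc by simp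
    ultimately show ?thesis using right_cmp[OF ids(2) ar_t2[OF c(1) d], of "\<pi> \<boxtimes> idn c" c] \<pi>_right by simp
  qed
  have e5: "(idn c \<boxtimes> (d \<boxtimes> idn y)) \<bullet> ?B = (idn c \<boxtimes> ?B) \<bullet> ?B"
    using left_cmp[OF c(1) coactions(2) dy] left_cmp[OF c(1) coactions(2) B] coassoc_y by simp
  have \<pi>c: "ar (\<pi> \<boxtimes> idn (c \<otimes> y)) (c \<otimes> (c \<otimes> (c \<otimes> y))) (c \<otimes> y)"
    using ar_t2[OF \<pi> cy] t1_unit[OF cy] t1_assoc[OF c(1) c(1) cy] by simp
  have "idn c \<boxtimes> average y l' h l = (idn c \<boxtimes> (\<pi> \<boxtimes> idn y)) \<bullet> ((idn c \<boxtimes> ?B) \<bullet> ((idn c \<boxtimes> ?A) \<bullet> (idn c \<boxtimes> l)))"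
    unfolding average_def left_cmp[OF c(1) F(2) \<pi>_y] left_cmp[OF c(1) F(1) B] left_cmp[OF c(1) L A] ..
  then have "(idn c \<boxtimes> average y l' h l) \<bullet> l =
      (idn c \<boxtimes> (\<pi> \<boxtimes> idn y)) \<bullet> ((idn c \<boxtimes> ?B) \<bullet> ((idn c \<boxtimes> ?A) \<bullet> ((idn c \<boxtimes> l) \<bullet> l)))"
    using assoc[OF L ar_t2[OF c(1) F(2)] ar_t2[OF c(1) \<pi>_y]] assoc[OF L ar_t2[OF c(1) F(1)] ar_t2[OF c(1) B]]
      assoc[OF L ar_t2[OF c(1) L] ar_t2[OF c(1) A]] left_cmp[OF c(1) F(1) B] left_cmp[OF c(1) L A] by simp
  also have "\<dots> = (idn c \<boxtimes> (\<pi> \<boxtimes> idn y)) \<bullet> ((idn c \<boxtimes> ?B) \<bullet> ((d \<boxtimes> idn y) \<bullet> (?A \<bullet> l)))"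
    using l rewrite_tail[OF e1 dx ar_t2[OF c(1) A] A dy L] by (simp add: left_com_def)
  also have "\<dots> = (idn c \<boxtimes> (\<pi> \<boxtimes> idn y)) \<bullet> ((d \<boxtimes> idn (c \<otimes> y)) \<bullet> ?K)"
    using rewrite_tail[OF e2 dy ar_t2[OF c(1) B] B dcy F(1)] by simp
  also have "\<dots> = (\<rho> \<boxtimes> idn y) \<bullet> ?K" using assoc[OF F(2) dcy ar_t2[OF c(1) \<pi>_y]] e3 by simp
  \<comment> \<open>The second expansion of \<open>\<rho>\<close>: the remaining factor
    \<open>c\<close> now comes from the coaction of \<open>y\<close> and no longer from that of
    \<open>x\<close>.\<close>
  also have "\<dots> = (\<pi> \<boxtimes> idn (c \<otimes> y)) \<bullet> ((idn c \<boxtimes> (d \<boxtimes> idn y)) \<bullet> ?K)"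
    using assoc[OF F(2) ar_t2[OF c(1) dy] \<pi>c] e4 by simp
  also have "(idn c \<boxtimes> (d \<boxtimes> idn y)) \<bullet> ?K = (idn c \<boxtimes> ?B) \<bullet> ?K"
    by (rule rewrite_tail[OF e5 B ar_t2[OF c(1) dy] B ar_t2[OF c(1) B] F(1)])
  also have "(\<pi> \<boxtimes> idn (c \<otimes> y)) \<bullet> ((idn c \<boxtimes> ?B) \<bullet> ?K) = l' \<bullet> ((\<pi> \<boxtimes> idn y) \<bullet> ?K)"
    using rewrite_tail[OF \<pi>_natural[OF coactions(2)] ar_t2[OF c(1) B] \<pi>c \<pi>_y coactions(2) F(2)] .
  finally show ?thesis unfolding average_def .
qed

text \<open>The commuting coactions and the colinearity of \<open>h\<close> carry \<open>r\<close>
  through \<open>l\<close>, \<open>h\<close> and \<open>l'\<close> in turn; finally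
  \<open>\<pi>\<close> acts on other factors than \<open>r'\<close> and passes it.\<close>

lemma average_right:
  assumes h: "ar h x y" and k: "ar (idn k) k k" and r: "ar r x (x \<otimes> k)" and r': "ar r' y (y \<otimes> k)"
    and lr: "(l \<boxtimes> idn k) \<bullet> r = (idn c \<boxtimes> r) \<bullet> l" and lr': "(l' \<boxtimes> idn k) \<bullet> r' = (idn c \<boxtimes> r') \<bullet> l'"
    and hr: "(h \<boxtimes> idn k) \<bullet> r = r' \<bullet> h"
  shows "(average y l' h l \<boxtimes> idn k) \<bullet> r = r' \<bullet> average y l' h l"
proof -
  let ?A = "idn c \<boxtimes> h" and ?B = "idn c \<boxtimes> l'" and ?K = "(idn c \<boxtimes> l') \<bullet> ((idn c \<boxtimes> h) \<bullet> l)"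
  note A = ar_t2[OF c(1) h] and B = ar_t2[OF c(1) coactions(2)] and L = coactions(1)
  note F = factors[OF h]
  have yk: "ar (idn (y \<otimes> k)) (y \<otimes> k) (y \<otimes> k)" using ar_id[OF r'] by simp
  have ass: "(c \<otimes> x) \<otimes> k = c \<otimes> (x \<otimes> k)" "(c \<otimes> y) \<otimes> k = c \<otimes> (y \<otimes> k)"
    "(c \<otimes> (c \<otimes> y)) \<otimes> k = c \<otimes> (c \<otimes> (y \<otimes> k))"
    using t1_assoc[OF c(1) ids(1) k] t1_assoc[OF c(1) ids(2) k] t1_assoc[OF c(1) ar_id[OF coactions(2), THEN conjunct2] k] by auto
  have L1: "ar (l \<boxtimes> idn k) (x \<otimes> k) (c \<otimes> (x \<otimes> k))" using ar_t2[OF L k] ass by simp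
  have A1: "ar (?A \<boxtimes> idn k) (c \<otimes> (x \<otimes> k)) (c \<otimes> (y \<otimes> k))" using ar_t2[OF A k] ass by simp
  have B1: "ar (?B \<boxtimes> idn k) (c \<otimes> (y \<otimes> k)) (c \<otimes> (c \<otimes> (y \<otimes> k)))" using ar_t2[OF B k] ass by simp
  have P1: "ar ((\<pi> \<boxtimes> idn y) \<boxtimes> idn k) (c \<otimes> (c \<otimes> (y \<otimes> k))) (y \<otimes> k)" using ar_t2[OF \<pi>_y k] ass by simp
  note R = ar_t2[OF c(1) r] and R' = ar_t2[OF c(1) r'] and R'' = ar_t2[OF c(1) ar_t2[OF c(1) r']]
  have e1: "(?A \<boxtimes> idn k) \<bullet> (idn c \<boxtimes> r) = (idn c \<boxtimes> r') \<bullet> ?A"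
    using t2_assoc[OF c(1) h k] left_cmp[OF c(1) r ar_t2[OF h k]] left_cmp[OF c(1) h r'] hr by simp
  have l1: "ar (l' \<boxtimes> idn k) (y \<otimes> k) (c \<otimes> (y \<otimes> k))" using ar_t2[OF coactions(2) k] ass by simp
  have e2: "(?B \<boxtimes> idn k) \<bullet> (idn c \<boxtimes> r') = (idn c \<boxtimes> (idn c \<boxtimes> r')) \<bullet> ?B"
    using t2_assoc[OF c(1) coactions(2) k] left_cmp[OF c(1) r' l1] left_cmp[OF c(1) coactions(2) R'] lr' by simp
  have e3: "((\<pi> \<boxtimes> idn y) \<boxtimes> idn k) \<bullet> (idn c \<boxtimes> (idn c \<boxtimes> r')) = r' \<bullet> (\<pi> \<boxtimes> idn y)"
    using \<pi>_natural[OF r'] t2_assoc[OF \<pi> ids(2) k] t2_id[OF ids(2) k] by simp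
  have "average y l' h l \<boxtimes> idn k = ((\<pi> \<boxtimes> idn y) \<boxtimes> idn k) \<bullet> ((?B \<boxtimes> idn k) \<bullet> ((?A \<boxtimes> idn k) \<bullet> (l \<boxtimes> idn k)))"
    unfolding average_def right_cmp[OF k F(2) \<pi>_y] right_cmp[OF k F(1) B] right_cmp[OF k L A] ..
  then have "(average y l' h l \<boxtimes> idn k) \<bullet> r = ((\<pi> \<boxtimes> idn y) \<boxtimes> idn k) \<bullet> ((?B \<boxtimes> idn k) \<bullet> ((?A \<boxtimes> idn k) \<bullet> ((l \<boxtimes> idn k) \<bullet> r)))"
    using assoc[OF r ar_cmp[OF ar_cmp[OF L1 A1] B1] P1] assoc[OF r ar_cmp[OF L1 A1] B1] assoc[OF r L1 A1] by simp
  also have "\<dots> = ((\<pi> \<boxtimes> idn y) \<boxtimes> idn k) \<bullet> ((?B \<boxtimes> idn k) \<bullet> ((idn c \<boxtimes> r') \<bullet> (?A \<bullet> l)))"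
    using lr rewrite_tail[OF e1 R A1 A R' L] by simp
  also have "\<dots> = ((\<pi> \<boxtimes> idn y) \<boxtimes> idn k) \<bullet> ((idn c \<boxtimes> (idn c \<boxtimes> r')) \<bullet> ?K)"
    using rewrite_tail[OF e2 R' B1 B R'' F(1)] by simp
  also have "\<dots> = r' \<bullet> ((\<pi> \<boxtimes> idn y) \<bullet> ?K)"
    by (rule rewrite_tail[OF e3 R'' P1 \<pi>_y r' F(2)])
  finally show ?thesis unfolding average_def .
qed

lemma average_natural:
  assumes h: "ar h x y" and f: "ar f x0 x" "left_com x0 l0" "(idn c \<boxtimes> f) \<bullet> l0 = l \<bullet> f"
    and g: "ar g y y0" "left_com y0 l1" "(idn c \<boxtimes> g) \<bullet> l' = l1 \<bullet> g"
  shows "average y0 l1 (g \<bullet> (h \<bullet> f)) l0 = g \<bullet> (average y l' h l \<bullet> f)"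
proof -
  let ?A = "idn c \<boxtimes> h" and ?B = "idn c \<boxtimes> l'" and ?K = "(idn c \<boxtimes> l') \<bullet> ((idn c \<boxtimes> h) \<bullet> l)"
  note A = ar_t2[OF c(1) h] and B = ar_t2[OF c(1) coactions(2)] and L = coactions(1)
  note F = factors[OF h]
  have L0: "ar l0 x0 (c \<otimes> x0)" and L1: "ar l1 y0 (c \<otimes> y0)" using f(2) g(2) by (auto simp: left_com_def)
  note f1 = ar_t2[OF c(1) f(1)] and g1 = ar_t2[OF c(1) g(1)]
  note hf = ar_cmp[OF f(1) h]
  have y0: "ar (idn y0) y0 y0" using ar_id[OF g(1)] by simp
  have P0: "ar (\<pi> \<boxtimes> idn y0) (c \<otimes> (c \<otimes> y0)) y0"
    using ar_t2[OF \<pi> y0] t1_unit[OF y0] t1_assoc[OF c(1) c(1) y0] by simp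
  note Af = ar_cmp[OF f(1) F(1)]
  have e: "(idn c \<boxtimes> l1) \<bullet> (idn c \<boxtimes> g) = (idn c \<boxtimes> (idn c \<boxtimes> g)) \<bullet> ?B"
    using left_cmp[OF c(1) g(1) L1] left_cmp[OF c(1) coactions(2) g1] g(3) by simp
  have "(idn c \<boxtimes> (g \<bullet> (h \<bullet> f))) \<bullet> l0 = (idn c \<boxtimes> g) \<bullet> (?A \<bullet> ((idn c \<boxtimes> f) \<bullet> l0))"
    using left_cmp[OF c(1) hf g(1)] left_cmp[OF c(1) f(1) h] assoc[OF L0 ar_cmp[OF f1 A] g1] assoc[OF L0 f1 A] by simp
  also have "\<dots> = (idn c \<boxtimes> g) \<bullet> ((?A \<bullet> l) \<bullet> f)" unfolding f(3) using assoc[OF f(1) L A] by simp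
  finally have "average y0 l1 (g \<bullet> (h \<bullet> f)) l0 = (\<pi> \<boxtimes> idn y0) \<bullet> ((idn c \<boxtimes> l1) \<bullet> ((idn c \<boxtimes> g) \<bullet> ((?A \<bullet> l) \<bullet> f)))"
    unfolding average_def by simp
  also have "\<dots> = (\<pi> \<boxtimes> idn y0) \<bullet> ((idn c \<boxtimes> (idn c \<boxtimes> g)) \<bullet> (?K \<bullet> f))"
    using rewrite_tail[OF e g1 ar_t2[OF c(1) L1] B ar_t2[OF c(1) g1] Af] assoc[OF f(1) F(1) B] by simp
  also have "\<dots> = g \<bullet> ((\<pi> \<boxtimes> idn y) \<bullet> (?K \<bullet> f))"
    by (rule rewrite_tail[OF \<pi>_natural[OF g(1)] ar_t2[OF c(1) g1] P0 \<pi>_y g(1) ar_cmp[OF f(1) F(2)]])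
  also have "\<dots> = g \<bullet> (average y l' h l \<bullet> f)" unfolding average_def using assoc[OF f(1) F(2) \<pi>_y] by simp
  finally show ?thesis .
qed

end

end

section \<open>Coseparability from cointegrals\<close>

context hopf_setting
begin

section \<open>Soundness of the derived rules\<close>

lemma alpha2: "sound alpha2_r"
  by (rule proves_sound[OF alpha2_cert]) (simp add: co_unit_sounds(2) cl_mate unit_sounds(3) tri_u2 del: sound.simps mrule.simps)

lemma cotriangle: "sound cotriangle_r"
  by (rule proves_sound[OF cotriangle_cert]) (simp add: cl_mate cas_mate tri_m1 monoidale_sounds(2) tri_m2 cr_mate del: sound.simps mrule.simps)

lemma kelly_r1: "sound kelly_r1_r"
  by (rule proves_sound[OF kelly_r1_cert]) (simp add: unit_sounds(1) monoidale_sounds(2) monoidale_sounds(1) del: sound.simps mrule.simps)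

lemma kelly_r: "sound kelly_r_r"
  by (rule proves_sound[OF kelly_r_cert]) (simp add: unit_sounds(6) kelly_r1 del: sound.simps mrule.simps)

lemma pentagon_i: "sound pentagon_i_r"
  by (rule proves_sound[OF pentagon_i_cert]) (simp add: unit_sounds(2) monoidale_sounds(1) unit_sounds(1) del: sound.simps mrule.simps)

lemma kelly_l1: "sound kelly_l1_r"
  by (rule proves_sound[OF kelly_l1_cert]) (simp add: unit_sounds(2) monoidale_sounds(2) pentagon_i del: sound.simps mrule.simps)

lemma kelly_l: "sound kelly_l_r"
  by (rule proves_sound[OF kelly_l_cert]) (simp add: unit_sounds(4) kelly_l1 del: sound.simps mrule.simps)

lemma kelly_l_i: "sound kelly_l_i_r"
  by (rule proves_sound[OF kelly_l_i_cert]) (simp add: unit_sounds(4) kelly_l unit_sounds(3) unit_sounds(2) del: sound.simps mrule.simps)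

lemma kelly_u1: "sound kelly_u1_r"
  by (rule proves_sound[OF kelly_u1_cert]) (simp add: unit_sounds(1) kelly_l unit_sounds(3) monoidale_sounds(2) del: sound.simps mrule.simps)

lemma kelly_u: "sound kelly_u_r"
  by (rule proves_sound[OF kelly_u_cert]) (simp add: unit_sounds(6) kelly_u1 del: sound.simps mrule.simps)

lemma unit_counit: "sound unit_counit_r"
  by (rule proves_sound[OF unit_counit_cert]) (simp add: alpha2 kelly_u unit_sounds(4) del: sound.simps mrule.simps)

lemma beta_cas: "sound beta_cas_r"
  by (rule proves_sound[OF beta_cas_cert]) (simp add: cas_mate tri_m1 kelly_r tri_m2 del: sound.simps mrule.simps)

lemma alpha_asc: "sound alpha_asc_r"
  by (rule proves_sound[OF alpha_asc_cert]) (simp add: alpha2 kelly_l_i del: sound.simps mrule.simps)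

lemma cas_counit: "sound cas_counit_r"
  by (rule proves_sound[OF cas_counit_cert]) (simp add: cas_mate tri_m1 del: sound.simps mrule.simps)

lemma copentagon: "sound copentagon_r"
  by (rule proves_sound[OF copentagon_cert]) (simp add: tri_m2 cas_counit monoidale_sounds(1) del: sound.simps mrule.simps)

lemma hopf1: "sound hopf1_r"
  by (rule proves_sound[OF hopf1_cert]) (simp add: unit_sounds(4) hopf1_raw del: sound.simps mrule.simps)

lemma hopf2: "sound hopf2_r"
  by (rule proves_sound[OF hopf2_cert]) (simp add: co_unit_sounds(4) hopf2_raw del: sound.simps mrule.simps)

section \<open>Soundness of the reflected axioms\<close>

lemma mirror_cl_def: "sound (mrule cl_def_r)"
  by (rule proves_sound[OF mirror_cl_def_cert]) (simp add: co_unit_sounds(4) cr_mate unit_sounds(5) del: sound.simps mrule.simps)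

lemma mirror_cr_def: "sound (mrule cr_def_r)"
  by (rule proves_sound[OF mirror_cr_def_cert]) (simp add: co_unit_sounds(2) cl_mate unit_sounds(3) del: sound.simps mrule.simps)

lemma mirror_cotriangle: "sound (mrule cotriangle_r)"
  by (rule proves_sound[OF mirror_cotriangle_cert]) (simp add: unit_sounds(3) monoidale_sounds(2) unit_sounds(6) del: sound.simps mrule.simps)

lemma mirror_unit_counit: "sound (mrule unit_counit_r)"
  by (rule proves_sound[OF mirror_unit_counit_cert]) (simp add: unit_counit del: sound.simps mrule.simps)

lemma mirror_assoc: "sound (mrule assoc_r)"
  by (rule proves_sound[OF mirror_assoc_cert]) (simp add: co_unit_sounds(1) unit_sounds(2) assoc del: sound.simps mrule.simps)

lemma mirror_lunit: "sound (mrule lunit_r)"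
  by (rule proves_sound[OF mirror_lunit_cert]) (simp add: runit del: sound.simps mrule.simps)

lemma mirror_runit: "sound (mrule runit_r)"
  by (rule proves_sound[OF mirror_runit_cert]) (simp add: lunit del: sound.simps mrule.simps)

lemma mirror_del_mul: "sound (mrule del_mul_r)"
  by (rule proves_sound[OF mirror_del_mul_cert]) (simp add: del_mul del: sound.simps mrule.simps)

lemma mirror_run_ci: "sound (mrule run_ci_r)"
  by (rule proves_sound[OF mirror_run_ci_cert]) (simp add: co_unit_sounds(2) del: sound.simps mrule.simps)

lemma mirror_cas_c: "sound (mrule cas_c_r)"
  by (rule proves_sound[OF mirror_cas_c_cert]) (simp add: unit_sounds(1) del: sound.simps mrule.simps)

lemma mirror_cl_c: "sound (mrule cl_c_r)"
  by (rule proves_sound[OF mirror_cl_c_cert]) (simp add: unit_sounds(6) del: sound.simps mrule.simps)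

lemma mirror_cl_ci: "sound (mrule cl_ci_r)"
  by (rule proves_sound[OF mirror_cl_ci_cert]) (simp add: unit_sounds(5) del: sound.simps mrule.simps)

lemma mirror_cr_c: "sound (mrule cr_c_r)"
  by (rule proves_sound[OF mirror_cr_c_cert]) (simp add: unit_sounds(4) del: sound.simps mrule.simps)

lemma mirror_tri_u2: "sound (mrule tri_u2_r)"
  by (rule proves_sound[OF mirror_tri_u2_cert]) (simp add: tri_u1 del: sound.simps mrule.simps)

lemma mirror_beta_cas: "sound (mrule beta_cas_r)"
  by (rule proves_sound[OF mirror_beta_cas_cert]) (simp add: alpha_asc del: sound.simps mrule.simps)

lemma mirror_alpha_asc: "sound (mrule alpha_asc_r)"
  by (rule proves_sound[OF mirror_alpha_asc_cert]) (simp add: beta_cas del: sound.simps mrule.simps)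

lemma mirror_copentagon: "sound (mrule copentagon_r)"
  by (rule proves_sound[OF mirror_copentagon_cert]) (simp add: monoidale_sounds(1) del: sound.simps mrule.simps)

lemma mirror_coassoc: "sound (mrule coassoc_r)"
  by (rule proves_sound[OF mirror_coassoc_cert]) (simp add: coassoc del: sound.simps mrule.simps)

lemma mirror_counit1: "sound (mrule counit1_r)"
  by (rule proves_sound[OF mirror_counit1_cert]) (simp add: counit0 del: sound.simps mrule.simps)

lemma mirror_hopf1: "sound (mrule hopf1_r)"
  by (rule proves_sound[OF mirror_hopf1_cert]) (simp add: hopf2 del: sound.simps mrule.simps)

lemma mirror_hopf2: "sound (mrule hopf2_r)"
  by (rule proves_sound[OF mirror_hopf2_cert]) (simp add: hopf1 del: sound.simps mrule.simps)

section \<open>Soundness of the Hopf algebra identities and their reflections\<close>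

lemma tau_norm:
  assumes "sound cointegral_normal_r"
  shows "sound tau_norm_r"
  by (rule proves2_sound[OF tau_norm_cert]) (simp add: assms tri_u2 del: sound.simps mrule.simps)

lemma mirror_tau_norm:
  assumes "sound (mrule cointegral_normal_r)"
  shows "sound (mrule tau_norm_r)"
  by (rule proves2_sound_mirror[OF tau_norm_cert]) (simp add: assms mirror_tri_u2 del: sound.simps mrule.simps)

lemma prod_quot: "sound prod_quot_r"
  by (rule proves2_sound[OF prod_quot_cert]) (simp add: assoc co_unit_sounds(1) hopf2 runit cr_mate co_unit_sounds(4) unit_sounds(6) del: sound.simps mrule.simps)

lemma mirror_prod_quot: "sound (mrule prod_quot_r)"
  by (rule proves2_sound_mirror[OF prod_quot_cert]) (simp add: mirror_assoc mirror_cas_c mirror_hopf2 mirror_runit mirror_cr_def mirror_cr_c mirror_run_ci del: sound.simps mrule.simps)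

lemma mul_assoc_g: "sound mul_assoc_g_r"
  by (rule proves2_sound[OF mul_assoc_g_cert]) (simp add: co_unit_sounds(1) alpha_asc assoc del: sound.simps mrule.simps)

lemma mirror_mul_assoc_g: "sound (mrule mul_assoc_g_r)"
  by (rule proves2_sound_mirror[OF mul_assoc_g_cert]) (simp add: mirror_cas_c mirror_alpha_asc mirror_assoc del: sound.simps mrule.simps)

lemma beta_v: "sound beta_v_r"
  by (rule proves2_sound[OF beta_v_cert]) (simp del: sound.simps mrule.simps)

lemma mirror_beta_v: "sound (mrule beta_v_r)"
  by (rule proves2_sound_mirror[OF beta_v_cert]) (simp del: sound.simps mrule.simps)

lemma beta_a: "sound beta_a_r"
  by (rule proves2_sound[OF beta_a_cert]) (simp del: sound.simps mrule.simps)

lemma mirror_beta_a: "sound (mrule beta_a_r)"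
  by (rule proves2_sound_mirror[OF beta_a_cert]) (simp del: sound.simps mrule.simps)

lemma g_past_u: "sound g_past_u_r"
  by (rule proves2_sound[OF g_past_u_cert]) (simp del: sound.simps mrule.simps)

lemma mirror_g_past_u: "sound (mrule g_past_u_r)"
  by (rule proves2_sound_mirror[OF g_past_u_cert]) (simp del: sound.simps mrule.simps)

lemma g_past_n: "sound g_past_n_r"
  by (rule proves2_sound[OF g_past_n_cert]) (simp del: sound.simps mrule.simps)

lemma mirror_g_past_n: "sound (mrule g_past_n_r)"
  by (rule proves2_sound_mirror[OF g_past_n_cert]) (simp del: sound.simps mrule.simps)

lemma g_past_a: "sound g_past_a_r"
  by (rule proves2_sound[OF g_past_a_cert]) (simp del: sound.simps mrule.simps)

lemma mirror_g_past_a: "sound (mrule g_past_a_r)"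
  by (rule proves2_sound_mirror[OF g_past_a_cert]) (simp del: sound.simps mrule.simps)

lemma quot_prod: "sound quot_prod_r"
  by (rule proves2_sound[OF quot_prod_cert]) (simp add: g_past_u g_past_n g_past_a beta_cas beta_a beta_v copentagon mul_assoc_g del: sound.simps mrule.simps)

lemma mirror_quot_prod: "sound (mrule quot_prod_r)"
  by (rule proves2_sound_mirror[OF quot_prod_cert]) (simp add: mirror_g_past_u mirror_g_past_n mirror_g_past_a mirror_beta_cas mirror_beta_a mirror_beta_v mirror_copentagon mirror_mul_assoc_g del: sound.simps mrule.simps)

lemma prod_one: "sound prod_one_r"
  by (rule proves2_sound[OF prod_one_cert]) (simp add: runit unit_counit tri_u2 del: sound.simps mrule.simps)

lemma mirror_prod_one: "sound (mrule prod_one_r)"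
  by (rule proves2_sound_mirror[OF prod_one_cert]) (simp add: mirror_runit mirror_unit_counit mirror_tri_u2 del: sound.simps mrule.simps)

lemma quot_prod_counit: "sound quot_prod_counit_r"
  by (rule proves2_sound[OF quot_prod_counit_cert]) (simp add: quot_prod hopf1 prod_one cotriangle co_unit_sounds(4) del: sound.simps mrule.simps)

lemma mirror_quot_prod_counit: "sound (mrule quot_prod_counit_r)"
  by (rule proves2_sound_mirror[OF quot_prod_counit_cert]) (simp add: mirror_quot_prod mirror_hopf1 mirror_prod_one mirror_cotriangle mirror_cr_c del: sound.simps mrule.simps)

lemma prod_del: "sound prod_del_r"
  by (rule proves2_sound[OF prod_del_cert]) (simp add: del_mul del: sound.simps mrule.simps)

lemma mirror_prod_del: "sound (mrule prod_del_r)"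
  by (rule proves2_sound_mirror[OF prod_del_cert]) (simp add: mirror_del_mul del: sound.simps mrule.simps)

lemma one_prod: "sound one_prod_r"
  by (rule proves2_sound[OF one_prod_cert]) (simp add: lunit cl_mate co_unit_sounds(2) del: sound.simps mrule.simps)

lemma mirror_one_prod: "sound (mrule one_prod_r)"
  by (rule proves2_sound_mirror[OF one_prod_cert]) (simp add: mirror_lunit mirror_cl_def mirror_cl_c del: sound.simps mrule.simps)

lemma kappa_prod: "sound kappa_prod_r"
  by (rule proves2_sound[OF kappa_prod_cert]) (simp add: co_unit_sounds(3) one_prod del: sound.simps mrule.simps)

lemma mirror_kappa_prod: "sound (mrule kappa_prod_r)"
  by (rule proves2_sound_mirror[OF kappa_prod_cert]) (simp add: mirror_cl_ci mirror_one_prod del: sound.simps mrule.simps)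

lemma tau_a:
  assumes "sound cointegral_a_r" "sound cointegral_j_r"
  shows "sound tau_a_r"
  by (rule proves2_sound[OF tau_a_cert]) (simp add: assms tri_u2 del: sound.simps mrule.simps)

lemma mirror_tau_a:
  assumes "sound (mrule cointegral_a_r)" "sound (mrule cointegral_j_r)"
  shows "sound (mrule tau_a_r)"
  by (rule proves2_sound_mirror[OF tau_a_cert]) (simp add: assms mirror_tri_u2 del: sound.simps mrule.simps)

lemma tau_past: "sound tau_past_r"
  by (rule proves2_sound[OF tau_past_cert]) (simp del: sound.simps mrule.simps)

lemma mirror_tau_past: "sound (mrule tau_past_r)"
  by (rule proves2_sound_mirror[OF tau_past_cert]) (simp del: sound.simps mrule.simps)

lemma kap_past: "sound kap_past_r"
  by (rule proves2_sound[OF kap_past_cert]) (simp del: sound.simps mrule.simps)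

lemma mirror_kap_past: "sound (mrule kap_past_r)"
  by (rule proves2_sound_mirror[OF kap_past_cert]) (simp del: sound.simps mrule.simps)

lemma retraction_section:
  assumes "sound cointegral_normal_r"
  shows "sound retraction_section_r"
  by (rule proves2_sound[OF retraction_section_cert]) (simp add: assms coassoc hopf1 tau_norm[OF assms(1)] co_unit_sounds(2) counit1 del: sound.simps mrule.simps)

lemma mirror_retraction_section:
  assumes "sound (mrule cointegral_normal_r)"
  shows "sound (mrule retraction_section_r)"
  by (rule proves2_sound_mirror[OF retraction_section_cert]) (simp add: assms mirror_coassoc mirror_hopf1 mirror_tau_norm[OF assms(1)] mirror_cl_c mirror_counit1 del: sound.simps mrule.simps)

lemma retraction_right: "sound retraction_right_r"
  by (rule proves2_sound[OF retraction_right_cert]) (simp add: coassoc del: sound.simps mrule.simps)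

lemma mirror_retraction_right: "sound (mrule retraction_right_r)"
  by (rule proves2_sound_mirror[OF retraction_right_cert]) (simp add: mirror_coassoc del: sound.simps mrule.simps)

lemma gamma_chi: "sound gamma_chi_r"
  by (rule proves2_sound[OF gamma_chi_cert]) (simp add: coassoc prod_quot counit1 del: sound.simps mrule.simps)

lemma mirror_gamma_chi: "sound (mrule gamma_chi_r)"
  by (rule proves2_sound_mirror[OF gamma_chi_cert]) (simp add: mirror_coassoc mirror_prod_quot mirror_counit1 del: sound.simps mrule.simps)

lemma rho_gamma: "sound rho_gamma_r"
  by (rule proves2_sound[OF rho_gamma_cert]) (simp add: coassoc quot_prod_counit counit1 del: sound.simps mrule.simps)

lemma mirror_rho_gamma: "sound (mrule rho_gamma_r)"
  by (rule proves2_sound_mirror[OF rho_gamma_cert]) (simp add: mirror_coassoc mirror_quot_prod_counit mirror_counit1 del: sound.simps mrule.simps)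

text \<open>The cointegral equations enter as premises on diagrams because \<open>\<theta>\<close>
  is an arbitrary 2-cell here. A left cointegral meets these premises, a right one those of the
  reflected lemma.\<close>

lemma retraction_left:
  assumes "sound cointegral_a_r" "sound cointegral_j_r"
  shows "sound retraction_left_r"
  by (rule proves2_sound[OF retraction_left_cert]) (simp add: assms gamma_chi prod_del coassoc rho_gamma tau_a[OF assms(1) assms(2)] tau_past kap_past kappa_prod del: sound.simps mrule.simps)

lemma mirror_retraction_left:
  assumes "sound (mrule cointegral_a_r)" "sound (mrule cointegral_j_r)"
  shows "sound (mrule retraction_left_r)"
  by (rule proves2_sound_mirror[OF retraction_left_cert]) (simp add: assms mirror_gamma_chi mirror_prod_del mirror_coassoc mirror_rho_gamma mirror_tau_a[OF assms(1) assms(2)] mirror_tau_past mirror_kap_past mirror_kappa_prod del: sound.simps mrule.simps)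

end

section \<open>From cointegrals to coseparability\<close>

abbreviation aj_path :: "path" where
  "aj_path \<equiv> [(0,gu,0),(0,gv,0),(0,ga,0)]"

abbreviation ja_path :: "path" where
  "ja_path \<equiv> [(0,ga,0),(0,gu,0),(0,gv,0)]"

abbreviation aa_path :: "path" where
  "aa_path \<equiv> [(0,ga,0),(0,ga,0)]"

abbreviation j_path :: "path" where
  "j_path \<equiv> [(0,gu,0),(0,gv,0)]"

text \<open>In elements, \<open>x \<otimes> y\<close> goes to \<open>x1 \<tau>(S(x2) y)\<close>,
  with \<open>\<tau>\<close> the transpose of a right cointegral.\<close>

abbreviation mirror_retraction_d :: "slice list" where
  "mirror_retraction_d \<equiv> mslices 1 aa_path retraction_d"

lemma mrule_retraction_section:
  "mrule retraction_section_r = (1, [(0,ga,0)], [(0,0,Gen Del,0)] @ mirror_retraction_d, [])"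
  by code_simp

text \<open>Reflection exchanges the two sides: left colinearity of the retraction becomes right
  colinearity of its reflection.\<close>

lemma mrule_retraction_left:
  "mrule retraction_left_r = (1, aa_path,
    [(0,0,Gen Del,0)] @ shs 1 0 0 mirror_retraction_d, mirror_retraction_d @ [(0,0,Gen Del,0)])"
  by code_simp

lemma mrule_retraction_right:
  "mrule retraction_right_r = (1, aa_path,
    mirror_retraction_d @ [(0,0,Gen Del,0)], [(1,0,Gen Del,0)] @ mirror_retraction_d)"
  by code_simp

text \<open>Since \<open>Theta\<close> becomes \<open>RTheta\<close>, these are the equations of a
  normalized right cointegral.\<close>

lemma mrule_cointegrals:
  "mrule cointegral_a_r = (1, ja_path,
    [(0,0,Gen Del,0), (1,0,Gen RTheta,0)], [(0,0,Gen RTheta,0), (1,0,Gen EtaU,0), (0,0,Gen One,0)])"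
  "mrule cointegral_j_r = (1, ja_path,
    [(2,0,Gen EtaU,0), (0,0,Gen RTheta,0)], [(0,0,Gen RTheta,0), (1,0,Gen EtaU,0)])"
  "mrule cointegral_normal_r = (1, j_path,
    [(1,0,Gen EtaU,0), (0,0,Gen One,0), (0,0,Gen RTheta,0)], [])"
  by code_simp+

lemma run_retraction:
  "run 1 aa_path retraction_d = Some [(0,ga,0)]"
  "run 1 aa_path mirror_retraction_d = Some [(0,ga,0)]"
  by code_simp+

text \<open>\<open>\<theta>\<close> is known to have the type of only one of \<open>Theta\<close>
  and \<open>RTheta\<close>, so typing must be reduced to the generators that actually occur in a
  diagram.\<close>

definition uses_only :: "gen2 list \<Rightarrow> slice list \<Rightarrow> bool" where
  "uses_only hs S \<longleftrightarrow> list_all (\<lambda>(i, l, x, r). case x of Gen h \<Rightarrow> h \<in> set hs | _ \<Rightarrow> True) S"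

lemma retraction_uses:
  "uses_only [Del, Sig, EtaM, Run, ClI, Cas, Asc, Mul, EtaU, EpsU, Theta] retraction_d"
  "uses_only [Del, Sig, EtaM, Run, ClI, Cas, Asc, Mul, EtaU, EpsU, RTheta] mirror_retraction_d"
  by code_simp+

context hopf_setting
begin

lemma rep_eq: "sound (n, p, S, T) \<Longrightarrow> rep n p S q \<alpha> \<Longrightarrow> rep n p T q' \<beta> \<Longrightarrow> \<alpha> = \<beta>"
  using rep_det[OF sound_rep] .

lemma adms_uses_only:
  assumes "uses_only hs S" "\<And>h. h \<in> set hs \<Longrightarrow> adm (Gen h)"
  shows "adms S"
  using assms unfolding uses_only_def adms_def
  by (induction S) (auto split: cell.splits)

lemma rep_adm: "rep n p [(i, l, x, r)] q \<alpha> \<Longrightarrow> adm x"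
  by (simp add: rep_def)

lemmas adm_gens = rep_del[THEN rep_adm] rep_sig[THEN rep_adm] rep_adj(1)[THEN rep_adm] rep_run(1)[THEN rep_adm]
  rep_clI[THEN rep_adm] rep_cas[THEN rep_adm] rep_asc(1)[THEN rep_adm] rep_mul[THEN rep_adm] rep_adj(3,4)[THEN rep_adm]

text \<open>The diagram \<open>D\<close> is left open so that one argument covers the retraction and
  its reflection.\<close>

lemma coseparableI:
  assumes r: "rep 1 aa_path D [(0,ga,0)] \<rho>"
    and s: "sound (1, [(0,ga,0)], [(0,0,Gen Del,0)] @ D, [])"
    and right: "sound (1, aa_path, D @ [(0,0,Gen Del,0)], [(0,0,Gen Del,0)] @ shs 1 0 0 D)"
    and left: "sound (1, aa_path, D @ [(0,0,Gen Del,0)], [(1,0,Gen Del,0)] @ D)"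
  shows "coseparable B a \<delta>"
proof -
  have "\<rho> \<cdot> \<delta> = \<one>\<^sub>2 a"
    by (rule rep_eq[OF s]; (rule rep_cong, (rule r hopf_intros | (simp; fail))+))
  moreover have "\<delta> \<cdot> \<rho> = cprod2 B \<rho> (\<one>\<^sub>2 a) \<cdot> cprod2 B (\<one>\<^sub>2 a) \<delta>"
    unfolding prod_defs by (rule rep_eq[OF right]; (rule rep_cong, (rule r hopf_intros | (simp; fail))+))
  moreover have "\<delta> \<cdot> \<rho> = cprod2 B (\<one>\<^sub>2 a) \<rho> \<cdot> cprod2 B \<delta> (\<one>\<^sub>2 a)"
    unfolding prod_defs by (rule rep_eq[OF left]; (rule rep_cong, (rule r hopf_intros | (simp; fail))+))
  moreover have "\<rho> \<in> hom2 B (cprod1 B a a) a" by (rule rep_hom2[OF r rep1_hopf(3) rep1_consts(1)])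
  ultimately show ?thesis unfolding coseparable_def left_comodule_map_def right_comodule_map_def by auto
qed

lemma coseparable_of_left_cointegral:
  assumes "normalized_left_cointegral B a \<eta> \<delta> \<theta>"
  shows "coseparable B a \<delta>"
proof -
  have h: "\<theta> \<in> hom2 B (cprod1 B a (bunit B)) (bunit B)"
    and e: "cprod2 B (\<one>\<^sub>2 a) \<theta> \<cdot> cprod2 B \<delta> (\<one>\<^sub>2 (bunit B)) = (cprod2 B \<eta> (\<one>\<^sub>2 (bunit B)) \<cdot> xi_comul B) \<cdot> \<theta>"
      "cprod2 B \<theta> (\<one>\<^sub>2 (bunit B)) \<cdot> cprod2 B (\<one>\<^sub>2 a) (xi_comul B) = xi_comul B \<cdot> \<theta>"
      "\<theta> \<cdot> cprod2 B \<eta> (\<one>\<^sub>2 (bunit B)) \<cdot> xi_comul B = \<one>\<^sub>2 (bunit B)"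
    using assms by (auto simp: normalized_left_cointegral_def left_cointegral_def left_comodule_map_def right_comodule_map_def)
  have p: "rep1 1 aj_path (cprod1 B a (bunit B))"
    unfolding prod_defs by (rule rep1_cong, (rule rep1_intros | (simp; fail))+)
  have t: "rep 1 aj_path [(0,0,Gen Theta,0)] j_path \<theta>"
    by (rule rep_genI[OF h p rep1_hopf(2)]) simp_all
  have "sound cointegral_a_r" unfolding cointegral_a_r_def
    by (rule rep_eq_sound[OF e(1)[unfolded prod_defs xi_comul_def]], (rule t hopf_intros | (simp add: diagram_defs; fail))+)
  moreover have "sound cointegral_j_r" unfolding cointegral_j_r_def
    by (rule rep_eq_sound[OF e(2)[unfolded prod_defs xi_comul_def]], (rule t hopf_intros | (simp add: diagram_defs; fail))+)
  moreover have "sound cointegral_normal_r" unfolding cointegral_normal_r_def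
    by (rule rep_eq_sound[OF e(3)[unfolded prod_defs xi_comul_def]], (rule t hopf_intros | (simp add: diagram_defs; fail))+)
  ultimately have s: "sound retraction_section_r" "sound retraction_left_r" "sound retraction_right_r"
    using retraction_section retraction_left retraction_right by blast+
  have "adms retraction_d"
    by (rule adms_uses_only[OF retraction_uses(1)]) (use adm_gens rep_adm[OF t] in \<open>auto simp del: adm.simps\<close>)
  then have "rep 1 aa_path retraction_d [(0,ga,0)] (sem 1 aa_path retraction_d)"
    using run_retraction by (simp add: rep_def)
  then show ?thesis
    by (rule coseparableI) (rule s[unfolded retraction_section_r_def retraction_left_r_def retraction_right_r_def] sound_sym)+
qed

lemma coseparable_of_right_cointegral:
  assumes "normalized_right_cointegral B a \<eta> \<delta> \<theta>"
  shows "coseparable B a \<delta>"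
proof -
  have h: "\<theta> \<in> hom2 B (cprod1 B (bunit B) a) (bunit B)"
    and e: "cprod2 B \<theta> (\<one>\<^sub>2 a) \<cdot> cprod2 B (\<one>\<^sub>2 (bunit B)) \<delta> = (cprod2 B (\<one>\<^sub>2 (bunit B)) \<eta> \<cdot> xi_comul B) \<cdot> \<theta>"
      "cprod2 B (\<one>\<^sub>2 (bunit B)) \<theta> \<cdot> cprod2 B (xi_comul B) (\<one>\<^sub>2 a) = xi_comul B \<cdot> \<theta>"
      "\<theta> \<cdot> cprod2 B (\<one>\<^sub>2 (bunit B)) \<eta> \<cdot> xi_comul B = \<one>\<^sub>2 (bunit B)"
    using assms by (auto simp: normalized_right_cointegral_def right_cointegral_def left_comodule_map_def right_comodule_map_def)
  have p: "rep1 1 ja_path (cprod1 B (bunit B) a)"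
    unfolding prod_defs by (rule rep1_cong, (rule rep1_intros | (simp; fail))+)
  have t: "rep 1 ja_path [(0,0,Gen RTheta,0)] j_path \<theta>"
    by (rule rep_genI[OF h p rep1_hopf(2)]) simp_all
  have "sound (mrule cointegral_a_r)" unfolding mrule_cointegrals
    by (rule rep_eq_sound[OF e(1)[unfolded prod_defs xi_comul_def]], (rule t hopf_intros | (simp add: diagram_defs; fail))+)
  moreover have "sound (mrule cointegral_j_r)" unfolding mrule_cointegrals
    by (rule rep_eq_sound[OF e(2)[unfolded prod_defs xi_comul_def]], (rule t hopf_intros | (simp add: diagram_defs; fail))+)
  moreover have "sound (mrule cointegral_normal_r)" unfolding mrule_cointegrals
    by (rule rep_eq_sound[OF e(3)[unfolded prod_defs xi_comul_def]], (rule t hopf_intros | (simp add: diagram_defs; fail))+)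
  ultimately have s: "sound (mrule retraction_section_r)" "sound (mrule retraction_left_r)" "sound (mrule retraction_right_r)"
    using mirror_retraction_section mirror_retraction_left mirror_retraction_right by blast+
  have "adms mirror_retraction_d"
    by (rule adms_uses_only[OF retraction_uses(2)]) (use adm_gens rep_adm[OF t] in \<open>auto simp del: adm.simps\<close>)
  then have "rep 1 aa_path mirror_retraction_d [(0,ga,0)]
      (sem 1 aa_path mirror_retraction_d)"
    using run_retraction by (simp add: rep_def)
  then show ?thesis
    by (rule coseparableI) (rule s[unfolded mrule_retraction_section mrule_retraction_left mrule_retraction_right] sound_sym)+
qed

end

section \<open>The bicomodules \<open>j\<close>, \<open>a \<circ> j\<close> and \<open>j \<circ> a\<close>\<close>

definition one_del_r :: rule where
  "one_del_r = (1, j_path, [(0,0,Gen One,0),(0,0,Gen Del,0)], [(1,0,Gen EtaU,0),(0,0,Gen One,0),(1,0,Gen One,0)])"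

definition one_eps_r :: rule where
  "one_eps_r = (1, j_path, [(0,0,Gen One,0),(0,0,Gen Eps,0)], [(0,0,Gen EpsU,0)])"

lemma unit_comonoid_certs:
  "proves [] [Up 0] (1, j_path, [(1,0,Gen EtaU,0),(1,0,Gen EtaU,0)], [(1,0,Gen EtaU,0),(3,0,Gen EtaU,0)])"
  "proves [tri_u1_r] [Fw 0 0] (1, j_path, [(1,0,Gen EtaU,0),(0,0,Gen EpsU,0)], [])"
  "proves [tri_u2_r] [Fw 0 0] (1, j_path, [(1,0,Gen EtaU,0),(2,0,Gen EpsU,0)], [])"
  by code_simp+

lemma left_unit_certs:
  "proves [one_del_r] [Fw 0 1, Dn 0, Dn 2, Dn 1] (1, j_path,
    [(1,0,Gen EtaU,0),(2,0,Gen One,0),(2,0,Gen Del,0)], [(1,0,Gen EtaU,0),(2,0,Gen One,0),(1,0,Gen EtaU,0),(2,0,Gen One,0)])"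
  "proves [one_eps_r, tri_u2_r] [Fw 0 1, Fw 1 0] (1, j_path,
    [(1,0,Gen EtaU,0),(2,0,Gen One,0),(2,0,Gen Eps,0)], [])"
  "proves [] [Dn 0, Dn 1] (1, j_path,
    [(1,0,Gen EtaU,0),(3,0,Gen EtaU,0),(4,0,Gen One,0)], [(1,0,Gen EtaU,0),(2,0,Gen One,0),(1,0,Gen EtaU,0)])"
  by code_simp+

lemma left_cofree_certs:
  "proves [coassoc_r] [Bw 0 0] (1, aj_path,
    [(2,0,Gen Del,0),(3,0,Gen Del,0)], [(2,0,Gen Del,0),(2,0,Gen Del,0)])"
  "proves [counit1_r] [Fw 0 0] (1, aj_path, [(2,0,Gen Del,0),(3,0,Gen Eps,0)], [])"
  "proves [] [Up 0] (1, aj_path,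
    [(1,0,Gen EtaU,0),(1,0,Gen EtaU,0)], [(1,0,Gen EtaU,0),(3,0,Gen EtaU,0)])"
  "proves [tri_u1_r] [Fw 0 0] (1, aj_path, [(1,0,Gen EtaU,0),(0,0,Gen EpsU,0)], [])"
  "proves [] [Dn 0] (1, aj_path,
    [(1,0,Gen EtaU,0),(4,0,Gen Del,0)], [(2,0,Gen Del,0),(1,0,Gen EtaU,0)])"
  "proves [] [Dn 0] (1, aj_path,
    [(1,0,Gen EtaU,0),(4,0,Gen Eps,0)], [(2,0,Gen Eps,0),(1,0,Gen EtaU,0)])"
  by code_simp+

lemma right_unit_certs:
  "proves [one_del_r] [Fw 0 1, Up 0, Up 1] (1, j_path,
    [(1,0,Gen EtaU,0),(0,0,Gen One,0),(0,0,Gen Del,0)], [(1,0,Gen EtaU,0),(0,0,Gen One,0),(2,0,Gen EtaU,0),(1,0,Gen One,0)])"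
  "proves [one_eps_r, tri_u1_r] [Fw 0 1, Fw 1 0] (1, j_path,
    [(1,0,Gen EtaU,0),(0,0,Gen One,0),(0,0,Gen Eps,0)], [])"
  "proves [] [Dn 1, Dn 0] (1, j_path,
    [(1,0,Gen EtaU,0),(0,0,Gen One,0),(2,0,Gen EtaU,0)], [(1,0,Gen EtaU,0),(1,0,Gen EtaU,0),(0,0,Gen One,0)])"
  by code_simp+

lemma right_cofree_certs:
  "proves [coassoc_r] [Fw 0 0] (1, ja_path,
    [(0,0,Gen Del,0),(0,0,Gen Del,0)], [(0,0,Gen Del,0),(1,0,Gen Del,0)])"
  "proves [counit0_r] [Fw 0 0] (1, ja_path, [(0,0,Gen Del,0),(0,0,Gen Eps,0)], [])"
  "proves [] [Dn 0] (1, ja_path,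
    [(2,0,Gen EtaU,0),(4,0,Gen EtaU,0)], [(2,0,Gen EtaU,0),(2,0,Gen EtaU,0)])"
  "proves [tri_u2_r] [Fw 0 0] (1, ja_path, [(2,0,Gen EtaU,0),(3,0,Gen EpsU,0)], [])"
  "proves [] [Dn 0] (1, ja_path,
    [(0,0,Gen Del,0),(3,0,Gen EtaU,0)], [(2,0,Gen EtaU,0),(0,0,Gen Del,0)])"
  "proves [] [Up 0] (1, ja_path,
    [(2,0,Gen EtaU,0),(0,0,Gen Eps,0)], [(0,0,Gen Eps,0),(1,0,Gen EtaU,0)])"
  by code_simp+

context hopf_setting
begin

abbreviation bicomodule_aj :: "'a \<Rightarrow> 'c \<Rightarrow> 'c \<Rightarrow> bool" where
  "bicomodule_aj \<equiv> bicomodule B a \<delta> \<epsilon> (bunit B) (xi_comul B) (xi_counit B)"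

abbreviation bicomodule_ja :: "'a \<Rightarrow> 'c \<Rightarrow> 'c \<Rightarrow> bool" where
  "bicomodule_ja \<equiv> bicomodule B (bunit B) (xi_comul B) (xi_counit B) a \<delta> \<epsilon>"

abbreviation j_left :: "'c" where
  "j_left \<equiv> cprod2 B \<eta> (\<one>\<^sub>2 (bunit B)) \<cdot> xi_comul B"

abbreviation j_right :: "'c" where
  "j_right \<equiv> cprod2 B (\<one>\<^sub>2 (bunit B)) \<eta> \<cdot> xi_comul B"

abbreviation aj_left :: "'c" where
  "aj_left \<equiv> cprod2 B \<delta> (\<one>\<^sub>2 (bunit B))"

abbreviation aj_right :: "'c" where
  "aj_right \<equiv> cprod2 B (\<one>\<^sub>2 a) (xi_comul B)"

abbreviation ja_left :: "'c" where
  "ja_left \<equiv> cprod2 B (xi_comul B) (\<one>\<^sub>2 a)"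

abbreviation ja_right :: "'c" where
  "ja_right \<equiv> cprod2 B (\<one>\<^sub>2 (bunit B)) \<delta>"

abbreviation aj :: "'a" where
  "aj \<equiv> cprod1 B a (bunit B)"

abbreviation ja :: "'a" where
  "ja \<equiv> cprod1 B (bunit B) a"

lemma one_del: "sound one_del_r"
  unfolding one_del_r_def
  by (rule rep_eq_sound[OF bimonoid_eqs(2)[unfolded prod_defs xi_comul_def]], (rule hopf_intros | (simp; fail))+)

lemma one_eps: "sound one_eps_r"
  unfolding one_eps_r_def
  by (rule rep_eq_sound[OF bimonoid_eqs(3)[unfolded xi_counit_def]], (rule hopf_intros | (simp; fail))+)

lemma comonoid_lists:
  "list_all sound []" "list_all sound [tri_u1_r]" "list_all sound [tri_u2_r]" "list_all sound [one_del_r]" "list_all sound [one_eps_r, tri_u2_r]" "list_all sound [one_eps_r, tri_u1_r]" "list_all sound [coassoc_r]" "list_all sound [counit1_r]" "list_all sound [counit0_r]"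
  by (simp_all add: one_del one_eps coassoc counit1 counit0 tri_u1 tri_u2 del: sound.simps)

lemma rep1_cofree:
  "rep1 1 aj_path aj"
  "rep1 1 ja_path ja"
  unfolding prod_defs by ((rule rep1_cong, (rule rep1_intros | (simp; fail))+)[1])+

lemma j_hom: "bunit B \<in> hom1 B \<M> \<M>" "aj \<in> hom1 B \<M> \<M>" "ja \<in> hom1 B \<M> \<M>"
  using rep1_hom[OF rep1_hopf(2)] rep1_hom[OF rep1_cofree(1)] rep1_hom[OF rep1_cofree(2)] P_simps by simp_all

lemma rep_xi: "rep 1 j_path [(1,0,Gen EtaU,0)] [(0,gu,0),(0,gv,0),(0,gu,0),(0,gv,0)] (xi_comul B)"
  unfolding prod_defs xi_comul_def by (rule rep_cong, (rule hopf_intros | (simp; fail))+)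

lemma xi_hom: "xi_comul B \<in> hom2 B (bunit B) (cprod1 B (bunit B) (bunit B))"
  by (rule rep_hom2[OF rep_xi rep1_hopf(2)], unfold prod_defs, rule rep1_cong, (rule rep1_intros | (simp; fail))+)

lemma unit_comonoid:
  "cprod2 B (xi_comul B) (\<one>\<^sub>2 (bunit B)) \<cdot> xi_comul B = cprod2 B (\<one>\<^sub>2 (bunit B)) (xi_comul B) \<cdot> xi_comul B"
  "cprod2 B (\<one>\<^sub>2 (bunit B)) (xi_counit B) \<cdot> xi_comul B = \<one>\<^sub>2 (bunit B)"
  "cprod2 B (xi_counit B) (\<one>\<^sub>2 (bunit B)) \<cdot> xi_comul B = \<one>\<^sub>2 (bunit B)"
proof -
  show "cprod2 B (xi_comul B) (\<one>\<^sub>2 (bunit B)) \<cdot> xi_comul B = cprod2 B (\<one>\<^sub>2 (bunit B)) (xi_comul B) \<cdot> xi_comul B"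
    unfolding prod_defs xi_comul_def xi_counit_def
    by (rule rep_eq[OF unit_comonoid_certs(1)[THEN proves_sound, OF comonoid_lists(1)], symmetric]; (rule rep_cong, (rule hopf_intros | (simp; fail))+))
  show "cprod2 B (\<one>\<^sub>2 (bunit B)) (xi_counit B) \<cdot> xi_comul B = \<one>\<^sub>2 (bunit B)"
    unfolding prod_defs xi_comul_def xi_counit_def
    by (rule rep_eq[OF unit_comonoid_certs(2)[THEN proves_sound, OF comonoid_lists(2)]]; (rule rep_cong, (rule hopf_intros | (simp; fail))+))
  show "cprod2 B (xi_counit B) (\<one>\<^sub>2 (bunit B)) \<cdot> xi_comul B = \<one>\<^sub>2 (bunit B)"
    unfolding prod_defs xi_comul_def xi_counit_def
    by (rule rep_eq[OF unit_comonoid_certs(3)[THEN proves_sound, OF comonoid_lists(3)]]; (rule rep_cong, (rule hopf_intros | (simp; fail))+))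
qed

text \<open>The first equation serves twice: as coassociativity of the coaction
  \<open>j_left\<close> on \<open>j\<close>, and as left colinearity of the same 2-cell seen as a
  map from \<open>j\<close> to \<open>a \<circ> j\<close>. The third is likewise both compatibility
  of the two coactions and right colinearity.\<close>

lemma left_unit:
  "aj_left \<cdot> j_left = cprod2 B (\<one>\<^sub>2 a) j_left \<cdot> j_left"
  "cprod2 B \<epsilon> (\<one>\<^sub>2 (bunit B)) \<cdot> j_left = \<one>\<^sub>2 (bunit B)"
  "cprod2 B j_left (\<one>\<^sub>2 (bunit B)) \<cdot> xi_comul B = aj_right \<cdot> j_left"
proof -
  show "aj_left \<cdot> j_left = cprod2 B (\<one>\<^sub>2 a) j_left \<cdot> j_left"
    unfolding prod_defs xi_comul_def xi_counit_def
    by (rule rep_eq[OF left_unit_certs(1)[THEN proves_sound, OF comonoid_lists(4)]]; (rule rep_cong, (rule hopf_intros | (simp; fail))+))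
  show "cprod2 B \<epsilon> (\<one>\<^sub>2 (bunit B)) \<cdot> j_left = \<one>\<^sub>2 (bunit B)"
    unfolding prod_defs xi_comul_def xi_counit_def
    by (rule rep_eq[OF left_unit_certs(2)[THEN proves_sound, OF comonoid_lists(5)]]; (rule rep_cong, (rule hopf_intros | (simp; fail))+))
  show "cprod2 B j_left (\<one>\<^sub>2 (bunit B)) \<cdot> xi_comul B = aj_right \<cdot> j_left"
    unfolding prod_defs xi_comul_def xi_counit_def
    by (rule rep_eq[OF left_unit_certs(3)[THEN proves_sound, OF comonoid_lists(1)]]; (rule rep_cong, (rule hopf_intros | (simp; fail))+))
qed

text \<open>The first five equations belong to the bicomodule \<open>a \<circ> j\<close>, cofree on
  \<open>j\<close> as a left comodule. The last makes \<open>\<epsilon> \<circ> 1\<close> a morphism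
  of right \<open>j\<close>-comodules, as the splitting over \<open>j\<close> requires.\<close>

lemma left_cofree:
  "cprod2 B \<delta> (\<one>\<^sub>2 aj) \<cdot> aj_left = cprod2 B (\<one>\<^sub>2 a) aj_left \<cdot> aj_left"
  "cprod2 B \<epsilon> (\<one>\<^sub>2 aj) \<cdot> aj_left = \<one>\<^sub>2 aj"
  "cprod2 B (\<one>\<^sub>2 aj) (xi_comul B) \<cdot> aj_right = cprod2 B aj_right (\<one>\<^sub>2 (bunit B)) \<cdot> aj_right"
  "cprod2 B (\<one>\<^sub>2 aj) (xi_counit B) \<cdot> aj_right = \<one>\<^sub>2 aj"
  "cprod2 B aj_left (\<one>\<^sub>2 (bunit B)) \<cdot> aj_right = cprod2 B (\<one>\<^sub>2 a) aj_right \<cdot> aj_left"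
  "cprod2 B (cprod2 B \<epsilon> (\<one>\<^sub>2 (bunit B))) (\<one>\<^sub>2 (bunit B)) \<cdot> aj_right = xi_comul B \<cdot> cprod2 B \<epsilon> (\<one>\<^sub>2 (bunit B))"
proof -
  show "cprod2 B \<delta> (\<one>\<^sub>2 aj) \<cdot> aj_left = cprod2 B (\<one>\<^sub>2 a) aj_left \<cdot> aj_left"
    unfolding prod_defs xi_comul_def xi_counit_def
    by (rule rep_eq[OF left_cofree_certs(1)[THEN proves_sound, OF comonoid_lists(7)]]; (rule rep_cong, (rule hopf_intros | (simp; fail))+))
  show "cprod2 B \<epsilon> (\<one>\<^sub>2 aj) \<cdot> aj_left = \<one>\<^sub>2 aj"
    unfolding prod_defs xi_comul_def xi_counit_def
    by (rule rep_eq[OF left_cofree_certs(2)[THEN proves_sound, OF comonoid_lists(8)]]; (rule rep_cong, (rule hopf_intros | (simp; fail))+))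
  show "cprod2 B (\<one>\<^sub>2 aj) (xi_comul B) \<cdot> aj_right = cprod2 B aj_right (\<one>\<^sub>2 (bunit B)) \<cdot> aj_right"
    unfolding prod_defs xi_comul_def xi_counit_def
    by (rule rep_eq[OF left_cofree_certs(3)[THEN proves_sound, OF comonoid_lists(1)]]; (rule rep_cong, (rule hopf_intros | (simp; fail))+))
  show "cprod2 B (\<one>\<^sub>2 aj) (xi_counit B) \<cdot> aj_right = \<one>\<^sub>2 aj"
    unfolding prod_defs xi_comul_def xi_counit_def
    by (rule rep_eq[OF left_cofree_certs(4)[THEN proves_sound, OF comonoid_lists(2)]]; (rule rep_cong, (rule hopf_intros | (simp; fail))+))
  show "cprod2 B aj_left (\<one>\<^sub>2 (bunit B)) \<cdot> aj_right = cprod2 B (\<one>\<^sub>2 a) aj_right \<cdot> aj_left"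
    unfolding prod_defs xi_comul_def xi_counit_def
    by (rule rep_eq[OF left_cofree_certs(5)[THEN proves_sound, OF comonoid_lists(1)]]; (rule rep_cong, (rule hopf_intros | (simp; fail))+))
  show "cprod2 B (cprod2 B \<epsilon> (\<one>\<^sub>2 (bunit B))) (\<one>\<^sub>2 (bunit B)) \<cdot> aj_right = xi_comul B \<cdot> cprod2 B \<epsilon> (\<one>\<^sub>2 (bunit B))"
    unfolding prod_defs xi_comul_def xi_counit_def
    by (rule rep_eq[OF left_cofree_certs(6)[THEN proves_sound, OF comonoid_lists(1)]]; (rule rep_cong, (rule hopf_intros | (simp; fail))+))
qed

lemma right_unit:
  "ja_right \<cdot> j_right = cprod2 B j_right (\<one>\<^sub>2 a) \<cdot> j_right"
  "cprod2 B (\<one>\<^sub>2 (bunit B)) \<epsilon> \<cdot> j_right = \<one>\<^sub>2 (bunit B)"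
  "ja_left \<cdot> j_right = cprod2 B (\<one>\<^sub>2 (bunit B)) j_right \<cdot> xi_comul B"
proof -
  show "ja_right \<cdot> j_right = cprod2 B j_right (\<one>\<^sub>2 a) \<cdot> j_right"
    unfolding prod_defs xi_comul_def xi_counit_def
    by (rule rep_eq[OF right_unit_certs(1)[THEN proves_sound, OF comonoid_lists(4)]]; (rule rep_cong, (rule hopf_intros | (simp; fail))+))
  show "cprod2 B (\<one>\<^sub>2 (bunit B)) \<epsilon> \<cdot> j_right = \<one>\<^sub>2 (bunit B)"
    unfolding prod_defs xi_comul_def xi_counit_def
    by (rule rep_eq[OF right_unit_certs(2)[THEN proves_sound, OF comonoid_lists(6)]]; (rule rep_cong, (rule hopf_intros | (simp; fail))+))
  show "ja_left \<cdot> j_right = cprod2 B (\<one>\<^sub>2 (bunit B)) j_right \<cdot> xi_comul B"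
    unfolding prod_defs xi_comul_def xi_counit_def
    by (rule rep_eq[OF right_unit_certs(3)[THEN proves_sound, OF comonoid_lists(1)]]; (rule rep_cong, (rule hopf_intros | (simp; fail))+))
qed

lemma right_cofree:
  "cprod2 B (\<one>\<^sub>2 ja) \<delta> \<cdot> ja_right = cprod2 B ja_right (\<one>\<^sub>2 a) \<cdot> ja_right"
  "cprod2 B (\<one>\<^sub>2 ja) \<epsilon> \<cdot> ja_right = \<one>\<^sub>2 ja"
  "cprod2 B (xi_comul B) (\<one>\<^sub>2 ja) \<cdot> ja_left = cprod2 B (\<one>\<^sub>2 (bunit B)) ja_left \<cdot> ja_left"
  "cprod2 B (xi_counit B) (\<one>\<^sub>2 ja) \<cdot> ja_left = \<one>\<^sub>2 ja"
  "cprod2 B ja_left (\<one>\<^sub>2 a) \<cdot> ja_right = cprod2 B (\<one>\<^sub>2 (bunit B)) ja_right \<cdot> ja_left"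
  "cprod2 B (\<one>\<^sub>2 (bunit B)) (cprod2 B (\<one>\<^sub>2 (bunit B)) \<epsilon>) \<cdot> ja_left = xi_comul B \<cdot> cprod2 B (\<one>\<^sub>2 (bunit B)) \<epsilon>"
proof -
  show "cprod2 B (\<one>\<^sub>2 ja) \<delta> \<cdot> ja_right = cprod2 B ja_right (\<one>\<^sub>2 a) \<cdot> ja_right"
    unfolding prod_defs xi_comul_def xi_counit_def
    by (rule rep_eq[OF right_cofree_certs(1)[THEN proves_sound, OF comonoid_lists(7)]]; (rule rep_cong, (rule hopf_intros | (simp; fail))+))
  show "cprod2 B (\<one>\<^sub>2 ja) \<epsilon> \<cdot> ja_right = \<one>\<^sub>2 ja"
    unfolding prod_defs xi_comul_def xi_counit_def
    by (rule rep_eq[OF right_cofree_certs(2)[THEN proves_sound, OF comonoid_lists(9)]]; (rule rep_cong, (rule hopf_intros | (simp; fail))+))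
  show "cprod2 B (xi_comul B) (\<one>\<^sub>2 ja) \<cdot> ja_left = cprod2 B (\<one>\<^sub>2 (bunit B)) ja_left \<cdot> ja_left"
    unfolding prod_defs xi_comul_def xi_counit_def
    by (rule rep_eq[OF right_cofree_certs(3)[THEN proves_sound, OF comonoid_lists(1)]]; (rule rep_cong, (rule hopf_intros | (simp; fail))+))
  show "cprod2 B (xi_counit B) (\<one>\<^sub>2 ja) \<cdot> ja_left = \<one>\<^sub>2 ja"
    unfolding prod_defs xi_comul_def xi_counit_def
    by (rule rep_eq[OF right_cofree_certs(4)[THEN proves_sound, OF comonoid_lists(3)]]; (rule rep_cong, (rule hopf_intros | (simp; fail))+))
  show "cprod2 B ja_left (\<one>\<^sub>2 a) \<cdot> ja_right = cprod2 B (\<one>\<^sub>2 (bunit B)) ja_right \<cdot> ja_left"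
    unfolding prod_defs xi_comul_def xi_counit_def
    by (rule rep_eq[OF right_cofree_certs(5)[THEN proves_sound, OF comonoid_lists(1)]]; (rule rep_cong, (rule hopf_intros | (simp; fail))+))
  show "cprod2 B (\<one>\<^sub>2 (bunit B)) (cprod2 B (\<one>\<^sub>2 (bunit B)) \<epsilon>) \<cdot> ja_left = xi_comul B \<cdot> cprod2 B (\<one>\<^sub>2 (bunit B)) \<epsilon>"
    unfolding prod_defs xi_comul_def xi_counit_def
    by (rule rep_eq[OF right_cofree_certs(6)[THEN proves_sound, OF comonoid_lists(1)]]; (rule rep_cong, (rule hopf_intros | (simp; fail))+))
qed

end

section \<open>Separability of the forgetful functors\<close>

text \<open>The natural retraction carries a splitting of the image to a splitting. The record
  \<open>cat\<close> and the pair \<open>F\<close>, \<open>F'\<close> carry no laws, hence the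
  premises on identities and composites.\<close>

lemma separable_functor_reflects_split_monos:
  assumes "separable_functor C D F F'"
    and ident: "\<And>x. x \<in> obs C \<Longrightarrow> ident C x \<in> arrs C x x"
    and ident_F: "\<And>x. x \<in> obs C \<Longrightarrow> compose D (F' (ident C x)) (ident D (F x)) = F' (ident C x)"
    and left_id: "\<And>x y f. x \<in> obs C \<Longrightarrow> y \<in> obs C \<Longrightarrow> f \<in> arrs C x y \<Longrightarrow> compose C (ident C y) f = f"
    and comp: "\<And>x y z f g. x \<in> obs C \<Longrightarrow> y \<in> obs C \<Longrightarrow> z \<in> obs C \<Longrightarrow>
      f \<in> arrs C x y \<Longrightarrow> g \<in> arrs C y z \<Longrightarrow> compose C g f \<in> arrs C x z"
  shows "reflects_split_monos C D F F'"
  unfolding reflects_split_monos_def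
proof (intro ballI impI)
  fix x y f
  assume x: "x \<in> obs C" and y: "y \<in> obs C" and f: "f \<in> arrs C x y" and "split_mono D (F x) (F y) (F' f)"
  then obtain g where g: "g \<in> arrs D (F y) (F x)" "compose D g (F' f) = ident D (F x)"
    by (auto simp: split_mono_def)
  obtain P where P: "\<forall>x \<in> obs C. \<forall>y \<in> obs C. \<forall>h \<in> arrs D (F x) (F y). P x y h \<in> arrs C x y"
    and nat: "\<forall>x \<in> obs C. \<forall>y \<in> obs C. \<forall>x' \<in> obs C. \<forall>y' \<in> obs C.
      \<forall>f \<in> arrs C x' x. \<forall>h \<in> arrs D (F x) (F y). \<forall>g \<in> arrs C y y'.
        P x' y' (compose D (F' g) (compose D h (F' f))) = compose C g (compose C (P x y h) f)"
    and retr: "\<forall>x \<in> obs C. \<forall>y \<in> obs C. \<forall>f \<in> arrs C x y. P x y (F' f) = f"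
    using assms(1) unfolding separable_functor_def by (elim exE conjE) (rule that)
  note p = P[rule_format, OF y x g(1)]
  \<comment> \<open>Naturality is stated for composites on both sides, so an identity is put on the
    outer one.\<close>
  have "compose C (P y x g) f = compose C (ident C x) (compose C (P y x g) f)"
    by (rule left_id[OF x x comp[OF x y x f p], symmetric])
  also have "\<dots> = P x x (compose D (F' (ident C x)) (compose D g (F' f)))"
    by (rule nat[rule_format, OF y x x x f g(1) ident[OF x], symmetric])
  also have "\<dots> = ident C x" using retr[rule_format, OF x x ident[OF x]] ident_F[OF x] g(2) by simp
  finally show "split_mono C x y f" using f p by (auto simp: split_mono_def)
qed

section \<open>The product of endo-1-cells and the category laws for comodules\<close>

context map_monoidale
begin

lemma c_monoidal:
  "strict_monoidal (\<lambda>\<alpha> x y. in2 \<alpha> x y \<M> \<M>) \<one>\<^sub>2 (\<cdot>) (cprod1 B) (cprod2 B) (cunit B)"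
  unfolding cprod1_def cprod2_def cunit_def
proof (unfold_locales, goal_cases)
  case 1 then show ?case by (auto intro: in2_id dest: in2D)
next
  case 2 then show ?case by (rule in2_vcomp)
next
  case 3 then show ?case by (rule v_assoc)
next
  case 4 then show ?case by (rule v_id)
next
  case 5 then show ?case by (rule v_id)
next
  case 6 then show ?case by (intro in2_hcomp)
next
  case 7 then show ?case by (intro vh_interchange)
next
  case 8 then show ?case by (intro hcomp_id2) (auto dest: in2D)
next
  case 9 then show ?case by (intro comp1_assoc[symmetric]) (auto dest: in2D)
next
  case 10 then show ?case by (intro h_assoc[symmetric])
next
  case 11 then show ?case by (auto dest: in2D intro: comp1_id_left comp1_id_right)
next
  case 12 then show ?case using h_id by blast
qed

text \<open>For the reversed product a right comodule is a left one, so everything proved for left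
  coactions applies to right coactions.\<close>

lemma c_monoidal_reversed:
  "strict_monoidal (\<lambda>\<alpha> x y. in2 \<alpha> x y \<M> \<M>) \<one>\<^sub>2 (\<cdot>) (\<odot>) (\<star>) (cunit B)"
  unfolding cunit_def
proof (unfold_locales, goal_cases)
  case 1 then show ?case by (auto intro: in2_id dest: in2D)
next
  case 2 then show ?case by (rule in2_vcomp)
next
  case 3 then show ?case by (rule v_assoc)
next
  case 4 then show ?case by (rule v_id)
next
  case 5 then show ?case by (rule v_id)
next
  case 6 then show ?case by (intro in2_hcomp)
next
  case 7 then show ?case by (intro vh_interchange)
next
  case 8 then show ?case by (intro hcomp_id2) (auto dest: in2D)
next
  case 9 then show ?case by (intro comp1_assoc) (auto dest: in2D)
next
  case 10 then show ?case by (intro h_assoc)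
next
  case 11 then show ?case by (auto dest: in2D intro: comp1_id_left comp1_id_right)
next
  case 12 then show ?case using h_id by blast
qed

lemma left_comodule_map_id:
  assumes "c \<in> hom1 B \<M> \<M>" "left_comodule B c d e x l"
  shows "left_comodule_map B c x l x l (\<one>\<^sub>2 x)"
proof -
  interpret S: strict_monoidal "\<lambda>\<alpha> x y. in2 \<alpha> x y \<M> \<M>" "\<one>\<^sub>2" "(\<cdot>)" "cprod1 B" "cprod2 B" "cunit B" by (rule c_monoidal)
  have x: "x \<in> hom1 B \<M> \<M>" and l: "in2 l x (cprod1 B c x) \<M> \<M>" using assms(2) by (auto simp: left_comodule_def intro: in2I)
  show ?thesis using S.coaction_map_id[OF in2_id[OF assms(1)] l] in2D(1)[OF in2_id[OF x]] by (simp add: left_comodule_map_def)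
qed

lemma right_comodule_map_id:
  assumes "c \<in> hom1 B \<M> \<M>" "right_comodule B c d e x r"
  shows "right_comodule_map B c x r x r (\<one>\<^sub>2 x)"
proof -
  interpret S: strict_monoidal "\<lambda>\<alpha> x y. in2 \<alpha> x y \<M> \<M>" "\<one>\<^sub>2" "(\<cdot>)" "(\<odot>)" "(\<star>)" "cunit B" by (rule c_monoidal_reversed)
  have x: "x \<in> hom1 B \<M> \<M>" and r: "in2 r x (c \<odot> x) \<M> \<M>" using assms(2) by (auto simp: right_comodule_def cprod1_def intro: in2I)
  show ?thesis using S.coaction_map_id[OF in2_id[OF assms(1)] r] in2D(1)[OF in2_id[OF x]] by (simp add: right_comodule_map_def cprod2_def)
qed

lemma left_comodule_map_comp:
  assumes "c \<in> hom1 B \<M> \<M>" "left_comodule B c d e x l" "left_comodule B c d e y l'" "left_comodule B c d e z l''"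
    "left_comodule_map B c x l y l' f" "left_comodule_map B c y l' z l'' g"
  shows "left_comodule_map B c x l z l'' (g \<cdot> f)"
proof -
  interpret S: strict_monoidal "\<lambda>\<alpha> x y. in2 \<alpha> x y \<M> \<M>" "\<one>\<^sub>2" "(\<cdot>)" "cprod1 B" "cprod2 B" "cunit B" by (rule c_monoidal)
  have m: "in2 l x (cprod1 B c x) \<M> \<M>" "in2 l' y (cprod1 B c y) \<M> \<M>" "in2 l'' z (cprod1 B c z) \<M> \<M>"
    "in2 f x y \<M> \<M>" "in2 g y z \<M> \<M>"
    using assms by (auto simp: left_comodule_def left_comodule_map_def intro: in2I)
  show ?thesis using S.coaction_map_comp[OF in2_id[OF assms(1)] m] assms(5,6) in2D(1)[OF in2_vcomp[OF m(4,5)]]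
    by (simp add: left_comodule_map_def)
qed

lemma right_comodule_map_comp:
  assumes "c \<in> hom1 B \<M> \<M>" "right_comodule B c d e x r" "right_comodule B c d e y r'" "right_comodule B c d e z r''"
    "right_comodule_map B c x r y r' f" "right_comodule_map B c y r' z r'' g"
  shows "right_comodule_map B c x r z r'' (g \<cdot> f)"
proof -
  interpret S: strict_monoidal "\<lambda>\<alpha> x y. in2 \<alpha> x y \<M> \<M>" "\<one>\<^sub>2" "(\<cdot>)" "(\<odot>)" "(\<star>)" "cunit B" by (rule c_monoidal_reversed)
  have m: "in2 r x (c \<odot> x) \<M> \<M>" "in2 r' y (c \<odot> y) \<M> \<M>" "in2 r'' z (c \<odot> z) \<M> \<M>"
    "in2 f x y \<M> \<M>" "in2 g y z \<M> \<M>"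
    using assms by (auto simp: right_comodule_def right_comodule_map_def cprod1_def intro: in2I)
  show ?thesis using S.coaction_map_comp[OF in2_id[OF assms(1)] m] assms(5,6) in2D(1)[OF in2_vcomp[OF m(4,5)]]
    by (simp add: right_comodule_map_def cprod2_def)
qed

lemma bicomodule_cat_laws:
  fixes c c' d d' e e'
  assumes c: "c \<in> hom1 B \<M> \<M>" "c' \<in> hom1 B \<M> \<M>"
  defines "C \<equiv> bicomodule_cat B c d e c' d' e'"
  shows "X \<in> obs C \<Longrightarrow> ident C X \<in> arrs C X X"
    and "(x, l, r) \<in> obs C \<Longrightarrow> \<one>\<^sub>2 x \<cdot> \<one>\<^sub>2 x = \<one>\<^sub>2 x"
    and "Y \<in> obs C \<Longrightarrow> f \<in> arrs C X Y \<Longrightarrow> compose C (ident C Y) f = f"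
    and "X \<in> obs C \<Longrightarrow> Y \<in> obs C \<Longrightarrow> Z \<in> obs C \<Longrightarrow> f \<in> arrs C X Y \<Longrightarrow> g \<in> arrs C Y Z \<Longrightarrow> compose C g f \<in> arrs C X Z"
proof -
  show "ident C X \<in> arrs C X X" if "X \<in> obs C"
    using that unfolding C_def bicomodule_cat_def bicomodule_def
    by clarsimp (intro conjI left_comodule_map_id[OF c(1)] right_comodule_map_id[OF c(2)])
  show "\<one>\<^sub>2 x \<cdot> \<one>\<^sub>2 x = \<one>\<^sub>2 x" if "(x, l, r) \<in> obs C"
  proof -
    have "x \<in> cells1 B" using that by (auto simp: C_def bicomodule_cat_def bicomodule_def left_comodule_def hom1_def)
    then show ?thesis by (rule vcomp_id_left[OF id2_hom])
  qed
  show "compose C (ident C Y) f = f" if "Y \<in> obs C" "f \<in> arrs C X Y"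
    using that unfolding C_def bicomodule_cat_def left_comodule_map_def by (cases X) (clarsimp simp: vcomp_id_left)
  show "compose C g f \<in> arrs C X Z" if "X \<in> obs C" "Y \<in> obs C" "Z \<in> obs C" "f \<in> arrs C X Y" "g \<in> arrs C Y Z"
    using that unfolding C_def bicomodule_cat_def bicomodule_def
    by (cases X; cases Y; cases Z) (clarsimp, intro conjI left_comodule_map_comp[OF c(1)] right_comodule_map_comp[OF c(2)])
qed

end

context hopf_setting
begin

lemmas category_defs = aj_bicomodules_def ja_bicomodules_def right_j_comodules_def left_j_comodules_def
  bicomodule_cat_def right_comodule_cat_def left_comodule_cat_def

lemma delta_in2: "in2 \<delta> a (cprod1 B a a) \<M> \<M>" "in2 \<epsilon> a (cunit B) \<M> \<M>"
  using c_comonoid_eqs a_hom by (auto intro: in2I)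

lemma coseparable_imp_separable_left:
  assumes "coseparable B a \<delta>"
  shows "separable_functor (aj_bicomodules B a \<delta> \<epsilon>) (right_j_comodules B) forget_left id"
proof -
  obtain \<rho> where \<rho>: "left_comodule_map B a (cprod1 B a a) (cprod2 B \<delta> (\<one>\<^sub>2 a)) a \<delta> \<rho>"
    "right_comodule_map B a (cprod1 B a a) (cprod2 B (\<one>\<^sub>2 a) \<delta>) a \<delta> \<rho>" "\<rho> \<cdot> \<delta> = \<one>\<^sub>2 a"
    using assms by (auto simp: coseparable_def)
  have \<rho>2: "in2 \<rho> (cprod1 B a a) a \<M> \<M>"
    using \<rho>(1) in2D(3)[OF delta_in2(1)] by (auto simp: left_comodule_map_def intro: in2I)
  interpret S: coseparability "\<lambda>\<alpha> x y. in2 \<alpha> x y \<M> \<M>" "\<one>\<^sub>2" "(\<cdot>)" "cprod1 B" "cprod2 B" "cunit B" a \<delta> \<epsilon> \<rho>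
    by (intro coseparability.intro c_monoidal coseparability_axioms.intro)
      (use \<rho> \<rho>2 delta_in2 c_comonoid_eqs in \<open>auto simp: left_comodule_map_def right_comodule_map_def\<close>)
  have com: "S.left_com x l" if "left_comodule B a \<delta> \<epsilon> x l" for x l
    using that by (auto simp: S.left_com_def left_comodule_def intro: in2I)
  have j: "in2 (\<one>\<^sub>2 (bunit B)) (bunit B) (bunit B) \<M> \<M>" by (rule in2_id[OF j_hom(1)])
  \<comment> \<open>The retraction on hom sets: averaging makes a \<open>j\<close>-colinear 2-cell
    colinear over \<open>a\<close> as well.\<close>
  define Q where "Q = (\<lambda>(x :: 'a, l, r :: 'c) (y, l', r' :: 'c) h. S.average y l' h l)"
  have arrs: "left_comodule_map B a x l y l' (S.average y l' h l) \<and>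
      right_comodule_map B (bunit B) x r y r' (S.average y l' h l)"
    if x: "bicomodule_aj x l r"
      and y: "bicomodule_aj y l' r'"
      and h: "right_comodule_map B (bunit B) x r y r' h" for x l r y l' r' h
  proof -
    have l: "S.left_com x l" "S.left_com y l'" using x y com by (auto simp: bicomodule_def)
    have r: "in2 r x (cprod1 B x (bunit B)) \<M> \<M>" "in2 r' y (cprod1 B y (bunit B)) \<M> \<M>" "in2 h x y \<M> \<M>"
      using x y h by (auto simp: bicomodule_def right_comodule_def right_comodule_map_def intro: in2I)
    have "cprod2 B (S.average y l' h l) (\<one>\<^sub>2 (bunit B)) \<cdot> r = r' \<cdot> S.average y l' h l"
      by (rule S.average_right[OF l r(3) j r(1,2)]) (use x y h in \<open>auto simp: bicomodule_def right_comodule_map_def\<close>)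
    then show ?thesis using S.average_left[OF l r(3)] in2D(1)[OF S.factors(3)[OF l r(3)]]
      by (simp add: left_comodule_map_def right_comodule_map_def)
  qed
  have nat: "S.average y0 l1 (g \<cdot> (h \<cdot> f)) l0 = g \<cdot> (S.average y l' h l \<cdot> f)"
    if "bicomodule_aj x l r"
      and "bicomodule_aj y l' r'"
      and "bicomodule_aj x0 l0 r0"
      and "bicomodule_aj y0 l1 r1"
      and "left_comodule_map B a x0 l0 x l f" "right_comodule_map B (bunit B) x r y r' h" "left_comodule_map B a y l' y0 l1 g"
    for x l r y l' r' x0 l0 r0 y0 l1 r1 f g h
  proof -
    have "in2 f x0 x \<M> \<M>" "in2 h x y \<M> \<M>" "in2 g y y0 \<M> \<M>"
      using that by (auto simp: bicomodule_def left_comodule_def left_comodule_map_def right_comodule_map_def intro: in2I)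
    then show ?thesis using that
      by (intro S.average_natural[of x l y l' h f x0 l0 g y0 l1] com) (auto simp: bicomodule_def left_comodule_map_def)
  qed
  have retr: "S.average y l' f l = f"
    if "bicomodule_aj x l r"
      and "bicomodule_aj y l' r'" and "left_comodule_map B a x l y l' f"
    for x l r y l' r' f
  proof -
    have "in2 f x y \<M> \<M>" using that by (auto simp: bicomodule_def left_comodule_def left_comodule_map_def intro: in2I)
    then show ?thesis using that
      by (intro S.average_map[of x l y l' f] com) (auto simp: bicomodule_def left_comodule_map_def)
  qed
  show ?thesis unfolding separable_functor_def
  proof (rule exI[of _ Q], intro conjI ballI)
    fix X Y h
    assume "X \<in> obs (aj_bicomodules B a \<delta> \<epsilon>)" "Y \<in> obs (aj_bicomodules B a \<delta> \<epsilon>)"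
      "h \<in> arrs (right_j_comodules B) (forget_left X) (forget_left Y)"
    then show "Q X Y h \<in> arrs (aj_bicomodules B a \<delta> \<epsilon>) X Y"
      by (clarsimp simp: category_defs forget_left_def Q_def) (rule arrs)
  next
    fix X Y X' Y' f h g
    assume "X \<in> obs (aj_bicomodules B a \<delta> \<epsilon>)" "Y \<in> obs (aj_bicomodules B a \<delta> \<epsilon>)"
      "X' \<in> obs (aj_bicomodules B a \<delta> \<epsilon>)" "Y' \<in> obs (aj_bicomodules B a \<delta> \<epsilon>)"
      "f \<in> arrs (aj_bicomodules B a \<delta> \<epsilon>) X' X" "h \<in> arrs (right_j_comodules B) (forget_left X) (forget_left Y)"
      "g \<in> arrs (aj_bicomodules B a \<delta> \<epsilon>) Y Y'"
    then show "Q X' Y' (compose (right_j_comodules B) (id g) (compose (right_j_comodules B) h (id f))) =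
        compose (aj_bicomodules B a \<delta> \<epsilon>) g (compose (aj_bicomodules B a \<delta> \<epsilon>) (Q X Y h) f)"
      by (clarsimp simp: category_defs forget_left_def Q_def) (rule nat)
  next
    fix X Y f
    assume "X \<in> obs (aj_bicomodules B a \<delta> \<epsilon>)" "Y \<in> obs (aj_bicomodules B a \<delta> \<epsilon>)"
      "f \<in> arrs (aj_bicomodules B a \<delta> \<epsilon>) X Y"
    then show "Q X Y (id f) = f"
      by (clarsimp simp: category_defs Q_def) (rule retr)
  qed
qed

lemma coseparable_imp_separable_right:
  assumes "coseparable B a \<delta>"
  shows "separable_functor (ja_bicomodules B a \<delta> \<epsilon>) (left_j_comodules B) forget_right id"
proof -
  obtain \<rho> where \<rho>: "left_comodule_map B a (cprod1 B a a) (cprod2 B \<delta> (\<one>\<^sub>2 a)) a \<delta> \<rho>"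
    "right_comodule_map B a (cprod1 B a a) (cprod2 B (\<one>\<^sub>2 a) \<delta>) a \<delta> \<rho>" "\<rho> \<cdot> \<delta> = \<one>\<^sub>2 a"
    using assms by (auto simp: coseparable_def)
  have \<rho>2: "in2 \<rho> (cprod1 B a a) a \<M> \<M>"
    using \<rho>(1) in2D(3)[OF delta_in2(1)] by (auto simp: left_comodule_map_def intro: in2I)
  \<comment> \<open>With the reversed product, the right coactions of \<open>a\<close> are the left
    coactions of the abstract setting, and the left coactions of \<open>j\<close> are the second
    ones in \<open>average_right\<close>.\<close>
  interpret S: coseparability "\<lambda>\<alpha> x y. in2 \<alpha> x y \<M> \<M>" "\<one>\<^sub>2" "(\<cdot>)" "(\<odot>)" "(\<star>)" "cunit B" a \<delta> \<epsilon> \<rho>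
    by (intro coseparability.intro c_monoidal_reversed coseparability_axioms.intro)
      (use \<rho> \<rho>2 delta_in2 c_comonoid_eqs in \<open>auto simp: left_comodule_map_def right_comodule_map_def cprod1_def cprod2_def\<close>)
  have com: "S.left_com x r" if "right_comodule B a \<delta> \<epsilon> x r" for x r
    using that by (auto simp: S.left_com_def right_comodule_def cprod1_def cprod2_def intro: in2I)
  have j: "in2 (\<one>\<^sub>2 (bunit B)) (bunit B) (bunit B) \<M> \<M>" by (rule in2_id[OF j_hom(1)])
  define Q where "Q = (\<lambda>(x :: 'a, l :: 'c, r) (y, l' :: 'c, r') h. S.average y r' h r)"
  have arrs: "left_comodule_map B (bunit B) x l y l' (S.average y r' h r) \<and>
      right_comodule_map B a x r y r' (S.average y r' h r)"
    if x: "bicomodule_ja x l r"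
      and y: "bicomodule_ja y l' r'"
      and h: "left_comodule_map B (bunit B) x l y l' h" for x l r y l' r' h
  proof -
    have r: "S.left_com x r" "S.left_com y r'" using x y com by (auto simp: bicomodule_def)
    have l: "in2 l x (x \<odot> bunit B) \<M> \<M>" "in2 l' y (y \<odot> bunit B) \<M> \<M>" "in2 h x y \<M> \<M>"
      using x y h by (auto simp: bicomodule_def left_comodule_def left_comodule_map_def cprod1_def intro: in2I)
    have "(S.average y r' h r \<star> \<one>\<^sub>2 (bunit B)) \<cdot> l = l' \<cdot> S.average y r' h r"
      by (rule S.average_right[OF r l(3) j l(1,2)])
        (use x y h in \<open>auto simp: bicomodule_def left_comodule_map_def cprod2_def\<close>)
    then show ?thesis using S.average_left[OF r l(3)] in2D(1)[OF S.factors(3)[OF r l(3)]]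
      by (simp add: left_comodule_map_def right_comodule_map_def cprod2_def)
  qed
  have nat: "S.average y0 r1 (g \<cdot> (h \<cdot> f)) r0 = g \<cdot> (S.average y r' h r \<cdot> f)"
    if "bicomodule_ja x l r"
      and "bicomodule_ja y l' r'"
      and "bicomodule_ja x0 l0 r0"
      and "bicomodule_ja y0 l1 r1"
      and "right_comodule_map B a x0 r0 x r f" "left_comodule_map B (bunit B) x l y l' h" "right_comodule_map B a y r' y0 r1 g"
    for x l r y l' r' x0 l0 r0 y0 l1 r1 f g h
  proof -
    have "in2 f x0 x \<M> \<M>" "in2 h x y \<M> \<M>" "in2 g y y0 \<M> \<M>"
      using that by (auto simp: bicomodule_def left_comodule_def left_comodule_map_def right_comodule_map_def intro: in2I)
    then show ?thesis using that
      by (intro S.average_natural[of x r y r' h f x0 r0 g y0 r1] com) (auto simp: bicomodule_def right_comodule_map_def cprod2_def)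
  qed
  have retr: "S.average y r' f r = f"
    if "bicomodule_ja x l r"
      and "bicomodule_ja y l' r'" and "right_comodule_map B a x r y r' f"
    for x l r y l' r' f
  proof -
    have "in2 f x y \<M> \<M>" using that by (auto simp: bicomodule_def left_comodule_def right_comodule_map_def intro: in2I)
    then show ?thesis using that
      by (intro S.average_map[of x r y r' f] com) (auto simp: bicomodule_def right_comodule_map_def cprod2_def)
  qed
  show ?thesis unfolding separable_functor_def
  proof (rule exI[of _ Q], intro conjI ballI)
    fix X Y h
    assume "X \<in> obs (ja_bicomodules B a \<delta> \<epsilon>)" "Y \<in> obs (ja_bicomodules B a \<delta> \<epsilon>)"
      "h \<in> arrs (left_j_comodules B) (forget_right X) (forget_right Y)"
    then show "Q X Y h \<in> arrs (ja_bicomodules B a \<delta> \<epsilon>) X Y"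
      by (clarsimp simp: category_defs forget_right_def Q_def) (rule arrs)
  next
    fix X Y X' Y' f h g
    assume "X \<in> obs (ja_bicomodules B a \<delta> \<epsilon>)" "Y \<in> obs (ja_bicomodules B a \<delta> \<epsilon>)"
      "X' \<in> obs (ja_bicomodules B a \<delta> \<epsilon>)" "Y' \<in> obs (ja_bicomodules B a \<delta> \<epsilon>)"
      "f \<in> arrs (ja_bicomodules B a \<delta> \<epsilon>) X' X" "h \<in> arrs (left_j_comodules B) (forget_right X) (forget_right Y)"
      "g \<in> arrs (ja_bicomodules B a \<delta> \<epsilon>) Y Y'"
    then show "Q X' Y' (compose (left_j_comodules B) (id g) (compose (left_j_comodules B) h (id f))) =
        compose (ja_bicomodules B a \<delta> \<epsilon>) g (compose (ja_bicomodules B a \<delta> \<epsilon>) (Q X Y h) f)"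
      by (clarsimp simp: category_defs forget_right_def Q_def) (rule nat)
  next
    fix X Y f
    assume "X \<in> obs (ja_bicomodules B a \<delta> \<epsilon>)" "Y \<in> obs (ja_bicomodules B a \<delta> \<epsilon>)"
      "f \<in> arrs (ja_bicomodules B a \<delta> \<epsilon>) X Y"
    then show "Q X Y (id f) = f"
      by (clarsimp simp: category_defs Q_def) (rule retr)
  qed
qed

lemma separable_imp_reflects:
  "separable_functor (aj_bicomodules B a \<delta> \<epsilon>) (right_j_comodules B) forget_left id \<Longrightarrow>
    reflects_split_monos (aj_bicomodules B a \<delta> \<epsilon>) (right_j_comodules B) forget_left id"
  "separable_functor (ja_bicomodules B a \<delta> \<epsilon>) (left_j_comodules B) forget_right id \<Longrightarrow>
    reflects_split_monos (ja_bicomodules B a \<delta> \<epsilon>) (left_j_comodules B) forget_right id"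
proof -
  note C = bicomodule_cat_laws[OF a_hom j_hom(1)] and C' = bicomodule_cat_laws[OF j_hom(1) a_hom]
  show "reflects_split_monos (aj_bicomodules B a \<delta> \<epsilon>) (right_j_comodules B) forget_left id"
    if "separable_functor (aj_bicomodules B a \<delta> \<epsilon>) (right_j_comodules B) forget_left id"
  proof (rule separable_functor_reflects_split_monos[OF that], unfold aj_bicomodules_def, goal_cases)
    case (2 X)
    then show ?case using C(2) by (cases X) (auto simp: category_defs forget_left_def)
  qed (rule C, assumption+)+
  show "reflects_split_monos (ja_bicomodules B a \<delta> \<epsilon>) (left_j_comodules B) forget_right id"
    if "separable_functor (ja_bicomodules B a \<delta> \<epsilon>) (left_j_comodules B) forget_right id"
  proof (rule separable_functor_reflects_split_monos[OF that], unfold ja_bicomodules_def, goal_cases)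
    case (2 X)
    then show ?case using C'(2) by (cases X) (auto simp: category_defs forget_right_def)
  qed (rule C', assumption+)+
qed

lemma rep_hom2I:
  "rep n p S q \<alpha> \<Longrightarrow> rep1 n' p' f \<Longrightarrow> rep1 n'' q' g \<Longrightarrow> n' = n \<Longrightarrow> p' = p \<Longrightarrow> n'' = n \<Longrightarrow> q' = q \<Longrightarrow> \<alpha> \<in> hom2 B f g"
  using rep_hom2 by blast

lemma left_homs:
  "j_left \<in> hom2 B (bunit B) aj"
  "aj_left \<in> hom2 B aj (cprod1 B a aj)"
  "aj_right \<in> hom2 B aj (cprod1 B aj (bunit B))"
  "cprod2 B \<epsilon> (\<one>\<^sub>2 (bunit B)) \<in> hom2 B aj (bunit B)"
  unfolding prod_defs xi_comul_def by ((rule rep_hom2I, (rule hopf_intros | (simp; fail))+)[1])+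

lemma right_homs:
  "j_right \<in> hom2 B (bunit B) ja"
  "ja_right \<in> hom2 B ja (cprod1 B ja a)"
  "ja_left \<in> hom2 B ja (cprod1 B (bunit B) ja)"
  "cprod2 B (\<one>\<^sub>2 (bunit B)) \<epsilon> \<in> hom2 B ja (bunit B)"
  unfolding prod_defs xi_comul_def by ((rule rep_hom2I, (rule hopf_intros | (simp; fail))+)[1])+

lemma left_bicomodules:
  "bicomodule_aj (bunit B) j_left (xi_comul B)"
  "bicomodule_aj aj
    aj_left aj_right"
  using left_homs left_unit left_cofree unit_comonoid j_hom xi_hom
  by (simp_all add: bicomodule_def left_comodule_def right_comodule_def)

lemma right_bicomodules:
  "bicomodule_ja (bunit B) (xi_comul B) j_right"
  "bicomodule_ja ja
    ja_left ja_right"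
  using right_homs right_unit right_cofree unit_comonoid j_hom xi_hom
  by (simp_all add: bicomodule_def left_comodule_def right_comodule_def)

lemma reflects_imp_left_cointegral:
  assumes "reflects_split_monos (aj_bicomodules B a \<delta> \<epsilon>) (right_j_comodules B) forget_left id"
  shows "\<exists>\<theta>. normalized_left_cointegral B a \<eta> \<delta> \<theta>"
proof -
  let ?l = "j_left" and ?e = "cprod2 B \<epsilon> (\<one>\<^sub>2 (bunit B))"
  let ?J = "(bunit B, ?l, xi_comul B)"
    and ?A = "(aj, aj_left, aj_right)"
  have "?J \<in> obs (aj_bicomodules B a \<delta> \<epsilon>)" "?A \<in> obs (aj_bicomodules B a \<delta> \<epsilon>)"
    "?l \<in> arrs (aj_bicomodules B a \<delta> \<epsilon>) ?J ?A"
    using left_bicomodules left_homs left_unit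
    by (auto simp: category_defs left_comodule_map_def right_comodule_map_def)
  moreover have "split_mono (right_j_comodules B) (forget_left ?J) (forget_left ?A) (id ?l)"
    unfolding split_mono_def using left_homs left_unit left_cofree
    by (auto simp: category_defs forget_left_def right_comodule_map_def intro!: bexI[of _ ?e])
  ultimately have "split_mono (aj_bicomodules B a \<delta> \<epsilon>) ?J ?A ?l"
    using assms by (auto simp: reflects_split_monos_def)
  \<comment> \<open>A retraction of \<open>j_left\<close> among bicomodules satisfies, word for
    word, the conditions on a normalized left cointegral.\<close>
  then show ?thesis
    by (auto simp: split_mono_def category_defs normalized_left_cointegral_def left_cointegral_def)
qed

lemma reflects_imp_right_cointegral:
  assumes "reflects_split_monos (ja_bicomodules B a \<delta> \<epsilon>) (left_j_comodules B) forget_right id"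
  shows "\<exists>\<theta>. normalized_right_cointegral B a \<eta> \<delta> \<theta>"
proof -
  let ?r = "j_right" and ?e = "cprod2 B (\<one>\<^sub>2 (bunit B)) \<epsilon>"
  let ?J = "(bunit B, xi_comul B, ?r)"
    and ?A = "(ja, ja_left, ja_right)"
  have "?J \<in> obs (ja_bicomodules B a \<delta> \<epsilon>)" "?A \<in> obs (ja_bicomodules B a \<delta> \<epsilon>)"
    "?r \<in> arrs (ja_bicomodules B a \<delta> \<epsilon>) ?J ?A"
    using right_bicomodules right_homs right_unit
    by (auto simp: category_defs left_comodule_map_def right_comodule_map_def)
  moreover have "split_mono (left_j_comodules B) (forget_right ?J) (forget_right ?A) (id ?r)"
    unfolding split_mono_def using right_homs right_unit right_cofree
    by (auto simp: category_defs forget_right_def left_comodule_map_def intro!: bexI[of _ ?e])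
  ultimately have "split_mono (ja_bicomodules B a \<delta> \<epsilon>) ?J ?A ?r"
    using assms by (auto simp: reflects_split_monos_def)
  then show ?thesis
    by (auto simp: split_mono_def category_defs normalized_right_cointegral_def right_cointegral_def)
qed

end

theorem theorem3p4:
  fixes B :: "('o, 'a, 'c) map_mon"
    and a :: 'a
    and \<mu> \<eta> \<delta> \<epsilon> \<sigma> :: 'c
  assumes "map_monoidale B"
    and "naturally_frobenius B"
    and "hopf_monoid B a \<mu> \<eta> \<delta> \<epsilon> \<sigma>"
  shows "(coseparable B a \<delta> \<longleftrightarrow> (\<exists>\<theta>. normalized_left_cointegral B a \<eta> \<delta> \<theta>)) \<and>
    (coseparable B a \<delta> \<longleftrightarrow> (\<exists>\<theta>. normalized_right_cointegral B a \<eta> \<delta> \<theta>)) \<and>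
    (coseparable B a \<delta> \<longleftrightarrow>
      separable_functor (aj_bicomodules B a \<delta> \<epsilon>) (right_j_comodules B) forget_left id) \<and>
    (coseparable B a \<delta> \<longleftrightarrow>
      separable_functor (ja_bicomodules B a \<delta> \<epsilon>) (left_j_comodules B) forget_right id) \<and>
    (coseparable B a \<delta> \<longleftrightarrow>
      reflects_split_monos (aj_bicomodules B a \<delta> \<epsilon>) (right_j_comodules B) forget_left id) \<and>
    (coseparable B a \<delta> \<longleftrightarrow>
      reflects_split_monos (ja_bicomodules B a \<delta> \<epsilon>) (left_j_comodules B) forget_right id)"
proof -
  \<comment> \<open>\<open>\<theta>\<close> does not occur in the locale assumptions, so the lemmas
    obtained from \<open>H\<close> hold for every 2-cell \<open>\<theta>\<close>.\<close>
  have H: "hopf_setting B a \<mu> \<eta> \<delta> \<epsilon> \<sigma>" using assms by (intro hopf_setting.intro hopf_setting_axioms.intro)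
  note left = hopf_setting.coseparable_imp_separable_left[OF H] hopf_setting.separable_imp_reflects(1)[OF H]
    hopf_setting.reflects_imp_left_cointegral[OF H] hopf_setting.coseparable_of_left_cointegral[OF H]
  note right = hopf_setting.coseparable_imp_separable_right[OF H] hopf_setting.separable_imp_reflects(2)[OF H]
    hopf_setting.reflects_imp_right_cointegral[OF H] hopf_setting.coseparable_of_right_cointegral[OF H]
  \<comment> \<open>Two cycles of implications meet in coseparability, one through left and one
    through right cointegrals.\<close>
  from left right show ?thesis by blast
qed

end
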